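(* Let $(X,\mathsf d,\mathfrak m)$ be a metric measure space with $\mathfrak m(X)<\infty$ and assume that the cotangent module $L^2(T^*X)$ is reflexive. Then there exists a unique couple $(\mathrm D,\mathcal V)$, where $\mathcal V$ is a normed $C_b(X)$-module and $\mathrm D:W^{1,2}(X)\to\mathcal M_{\mathcal V}$ is linear, such that: (i) $|\mathrm Df|=|\mathrm df|\,\mathfrak m$ as measures, for every $f\in W^{1,2}(X)$; (ii) for every $v\in\mathcal V$ one has $\|v\|=\sup\mathsf N(X)(v)$, where the supremum is taken among all local vector measures $\mathsf N$ belonging to the $C_b(X)$-module generated by the image of $\mathrm D$ with $|\mathsf N|(X)\le1$; (iii) if $\{v_k\}_k\subseteq\mathcal V$ is bounded and such that for every Borel $A\subseteq X$ and $f\in W^{1,2}(X)$ the sequence $\mathrm Df(A)(v_k)$ has a finite limit, then there exists $v\in\mathcal V$ such that $\mathrm Df(A)(v_k)\to\mathrm Df(A)(v)$ for every such $A$ and $f$. Uniqueness is intended up to unique isomorphism in the following sense: whenever $(\tilde{\mathrm D},\tilde{\mathcal V})$ is another such couple, there exists a unique couple $(\Phi,\Psi)$ of $C_b(X)$-linear bijective isometries $\Phi:\mathcal M_{\mathcal V}\to\mathcal M_{\tilde{\mathcal V}}$, $\Psi:\mathcal V\to\tilde{\mathcal V}$ such that $\Phi\circ\mathrm D=\tilde{\mathrm D}$ and $\Psi(v)\cdot\Phi(\mathsf N)=v\cdot\mathsf N$ for all $v\in\mathcal V$, $\mathsf N\in\mathcal M_{\mathcal V}$. Finally, the definitions $$\mathcal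 V:=\{v\in L^2(TX):|v|\in L^\infty(\mathfrak m)\}=L^\infty(TX)\quad\text{and}\quad\mathrm Df(A)(\cdot):=\int_A\mathrm df(\cdot)\,\mathrm d\mathfrak m$$ provide a realization of such unique couple.
   Context: **Local vector measures.** A normed $C_b(X)$-module is a normed space $(\mathcal V,\|\cdot\|)$ that is algebraically a module over $C_b(X)$ (bounded continuous functions) with $\|\sum_if_iv_i\|\le\max_i\|f_i\|_\infty\max_i\|v_i\|$ for finitely many $v_i\in\mathcal V$ and $f_i\in C_b(X)$ with pairwise disjoint supports. For $A$ open, $\|v\|_{|A}:=\sup\{\|fv\|:f\in C_b(X),\operatorname{supp}f\subseteq A,\|f\|_\infty\le1\}$. A local vector measure on $\mathcal V$ is a map $\mathsf N$ from the Borel sets of $X$ to the dual $(\mathcal V',\|\cdot\|')$, $\sigma$-additive with respect to norm convergence, with $\mathsf N(A)(v)=0$ whenever $A$ is open and $\|v\|_{|A}=0$. Its total variation is $|\mathsf N|(E):=\sup_\pi\sum_{A\in\pi}\|\mathsf N(A)\|'$, over finite Borel partitions $\pi$ of $E$. $\mathcal M_{\mathcal V}$ is the space of local vector measures on $\mathcal V$ with the norm $|\mathsf N|(X)$. $v\cdot\mathsf N$ is the signed measure $B\mapsto\mathsf N(B)(v)$. For $g$ bounded Borel, $g\mathsf N$ is the local vector measure $g\mathsf N(A):=\int_Ag\,\mathrm d\mathsf N$ (Bartle integral: $\sum_ic_i\mathsf N(A\cap A_i)$ for $g=\sum_ic_i\chi_{A_i}$ simple, extended by uniform limits); equivalently $g\mathsf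 N(A)(v)=\int_Ag\,\mathrm d(v\cdot\mathsf N)$. This gives $\mathcal M_{\mathcal V}$ its $C_b(X)$-module structure; the $C_b(X)$-module generated by the image of $\mathrm D$ consists of finite sums $\sum_ig_i\mathrm Df_i$, $g_i\in C_b(X)$, $f_i\in W^{1,2}(X)$. **Metric measure spaces and Sobolev functions.** A metric measure space is a triple $(X,\mathsf d,\mathfrak m)$ with $(X,\mathsf d)$ complete separable and $\mathfrak m$ a nonnegative Borel measure finite on balls with full support. With $\mathrm{lip}(f)(x):=\limsup_{y\to x}|f(y)-f(x)|/\mathsf d(y,x)$ (0 at isolated points), the Cheeger energy of $f\in L^2(\mathfrak m)$ is $\mathrm{Ch}(f):=\frac12\inf\{\liminf_k\int\mathrm{lip}(f_k)^2\mathrm d\mathfrak m:f_k\in\mathrm{LIP}_b(X)\cap L^2(\mathfrak m),f_k\to f\text{ in }L^2(\mathfrak m)\}$; $W^{1,2}(X):=\{\mathrm{Ch}<\infty\}$, with norm $\|f\|^2=\|f\|_{L^2}^2+2\mathrm{Ch}(f)$. For $f\in W^{1,2}(X)$, $|\mathrm df|\in L^2(\mathfrak m)$ is the minimal relaxed slope, for which $\mathrm{Ch}(f)=\frac12\int|\mathrm df|^2\mathrm d\mathfrak m$. **(Co)tangent modules** (Gigli). An $L^2$-normed $L^\infty$-module is a Banach space that is a module over $L^\infty(\mathfrak m)$ with a pointwise norm $|\cdot|$ valued in nonnegative $L^2(\mathfrak m)$ functions, $\|v\|=\||v|\|_{L^2}$, $|fv|=|f||v|$. There is a unique (up to unique isomorphism)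 couple $(L^2(T^*X),\mathrm d)$ with $L^2(T^*X)$ an $L^2$-normed $L^\infty$-module and $\mathrm d:W^{1,2}(X)\to L^2(T^*X)$ linear such that the pointwise norm of $\mathrm df$ is the minimal relaxed slope $\mathfrak m$-a.e. and $L^\infty$-linear combinations of differentials are dense in $L^2(T^*X)$. The tangent module $L^2(TX)$ is the module dual of $L^2(T^*X)$, i.e. the space of $L^\infty(\mathfrak m)$-linear continuous maps $L^2(T^*X)\to L^1(\mathfrak m)$ with the dual pointwise norm; the pairing is written $\mathrm df(v)$. $L^\infty(TX)$ is the set of $v$ in the $L^0$-completion of $L^2(TX)$ with $|v|\in L^\infty(\mathfrak m)$, with norm $\||v|\|_{L^\infty(\mathfrak m)}$ and the inherited product by $C_b(X)$ functions. *)

theory Defs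
  imports "HOL-Analysis.Analysis" "HOL-Algebra.Module"
begin

section \<open>Metric measure spaces and Sobolev functions\<close>

text \<open>The metric space is a type of class \<open>polish_space\<close> (a complete metric on a second countable,
  i.e. separable, space). Elements of \<open>L\<^sup>p\<close>-spaces are represented by Borel functions; equality
  in these spaces is equality almost everywhere, and everything below is stable under it.\<close>

definition metric_measure_space :: "'x::polish_space measure \<Rightarrow> bool" where
  "metric_measure_space m \<longleftrightarrow> sets m = sets borel
    \<and> (\<forall>x r. emeasure m (ball x r) < \<infinity>)
    \<and> (\<forall>U. open U \<longrightarrow> U \<noteq> {} \<longrightarrow> emeasure m U > 0)"

definition L2 :: "'x measure \<Rightarrow> ('x \<Rightarrow> real) set" where
  "L2 m = {f \<in> borel_measurable m. integrable m (\<lambda>x. (f x)\<^sup>2)}"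

definition Linf :: "'x measure \<Rightarrow> ('x \<Rightarrow> real) set" where
  "Linf m = {f \<in> borel_measurable m. \<exists>C. AE x in m. \<bar>f x\<bar> \<le> C}"

definition Linf_norm :: "'x measure \<Rightarrow> ('x \<Rightarrow> real) \<Rightarrow> real" where
  "Linf_norm m f = Inf {C. 0 \<le> C \<and> (AE x in m. \<bar>f x\<bar> \<le> C)}"

text \<open>At an isolated point \<open>at x\<close> is the trivial filter and \<open>Limsup\<close> is \<open>bot = 0\<close>, as it should be.\<close>

definition lip :: "('x::metric_space \<Rightarrow> real) \<Rightarrow> 'x \<Rightarrow> ennreal" where
  "lip f x = Limsup (at x) (\<lambda>y. ennreal (\<bar>f y - f x\<bar> / dist y x))"

definition LIPb :: "('x::metric_space \<Rightarrow> real) set" where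
  "LIPb = {f. bounded (range f) \<and> (\<exists>L. L-lipschitz_on UNIV f)}"

definition tendsto_L2 :: "'x measure \<Rightarrow> (nat \<Rightarrow> 'x \<Rightarrow> real) \<Rightarrow> ('x \<Rightarrow> real) \<Rightarrow> bool" where
  "tendsto_L2 m F f \<longleftrightarrow> (\<lambda>k. \<integral>\<^sup>+ x. ennreal ((F k x - f x)\<^sup>2) \<partial>m) \<longlonglongrightarrow> 0"

definition Ch :: "'x::polish_space measure \<Rightarrow> ('x \<Rightarrow> real) \<Rightarrow> ennreal" where
  "Ch m f = (INF F \<in> {F. (\<forall>k. F k \<in> LIPb \<inter> L2 m) \<and> tendsto_L2 m F f}.
               liminf (\<lambda>k. \<integral>\<^sup>+ x. (lip (F k) x)\<^sup>2 \<partial>m)) / 2"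

definition W12 :: "'x::polish_space measure \<Rightarrow> ('x \<Rightarrow> real) set" where
  "W12 m = {f \<in> L2 m. Ch m f < \<infinity>}"

text \<open>The (minimal) relaxed slope of Ambrosio, Gigli and Savare: a relaxed slope of \<open>f\<close> is an \<open>L\<^sup>2\<close>
  function bounding from above a weak \<open>L\<^sup>2\<close>-limit of \<open>lip (F k)\<close>, for some \<open>F k \<rightarrow> f\<close> in \<open>L\<^sup>2\<close>; the minimal
  one is the one with least \<open>L\<^sup>2\<close>-norm. The pointwise Lipschitz constant of an element of \<open>LIPb\<close> is
  finite, so \<open>enn2real\<close> is harmless.\<close>

definition relaxed_slope :: "'x::polish_space measure \<Rightarrow> ('x \<Rightarrow> real) \<Rightarrow> ('x \<Rightarrow> real) \<Rightarrow> bool" where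
  "relaxed_slope m f G \<longleftrightarrow> G \<in> L2 m \<and>
    (\<exists>F H. (\<forall>k. F k \<in> LIPb \<inter> L2 m \<and> (\<lambda>x. enn2real (lip (F k) x)) \<in> L2 m) \<and> tendsto_L2 m F f
      \<and> H \<in> L2 m
      \<and> (\<forall>h \<in> L2 m. (\<lambda>k. \<integral>x. enn2real (lip (F k) x) * h x \<partial>m) \<longlonglongrightarrow> (\<integral>x. H x * h x \<partial>m))
      \<and> (AE x in m. H x \<le> G x))"

definition minimal_relaxed_slope ::
    "'x::polish_space measure \<Rightarrow> ('x \<Rightarrow> real) \<Rightarrow> ('x \<Rightarrow> real) \<Rightarrow> bool" where
  "minimal_relaxed_slope m f G \<longleftrightarrow> relaxed_slope m f G \<and>
    (\<forall>H. relaxed_slope m f H \<longrightarrow> (\<integral>x. (G x)\<^sup>2 \<partial>m) \<le> (\<integral>x. (H x)\<^sup>2 \<partial>m))"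


section \<open>The cotangent module\<close>

text \<open>\<open>act\<close> is the product by (representatives of) \<open>L\<^sup>\<infinity>\<close> functions, \<open>pn v\<close> a representative of the
  pointwise norm of \<open>v\<close>.\<close>

definition L2_normed_module ::
    "'x measure \<Rightarrow> (('x \<Rightarrow> real) \<Rightarrow> 'c::banach \<Rightarrow> 'c) \<Rightarrow> ('c \<Rightarrow> 'x \<Rightarrow> real) \<Rightarrow> bool" where
  "L2_normed_module m act pn \<longleftrightarrow>
    (\<forall>f\<in>Linf m. \<forall>g\<in>Linf m. \<forall>v. (AE x in m. f x = g x) \<longrightarrow> act f v = act g v)
    \<and> (\<forall>f\<in>Linf m. \<forall>v w. act f (v + w) = act f v + act f w)
    \<and> (\<forall>f\<in>Linf m. \<forall>g\<in>Linf m. \<forall>v. act (\<lambda>x. f x + g x) v = act f v + act g v)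
    \<and> (\<forall>f\<in>Linf m. \<forall>g\<in>Linf m. \<forall>v. act (\<lambda>x. f x * g x) v = act f (act g v))
    \<and> (\<forall>c v. act (\<lambda>_. c) v = c *\<^sub>R v)
    \<and> (\<forall>v. pn v \<in> L2 m \<and> (AE x in m. 0 \<le> pn v x))
    \<and> (\<forall>v. norm v = sqrt (\<integral>x. (pn v x)\<^sup>2 \<partial>m))
    \<and> (\<forall>f\<in>Linf m. \<forall>v. AE x in m. pn (act f v) x = \<bar>f x\<bar> * pn v x)"

definition cotangent_module ::
    "'x::polish_space measure \<Rightarrow> (('x \<Rightarrow> real) \<Rightarrow> 'c::banach \<Rightarrow> 'c) \<Rightarrow> ('c \<Rightarrow> 'x \<Rightarrow> real)
      \<Rightarrow> (('x \<Rightarrow> real) \<Rightarrow> 'c) \<Rightarrow> bool" where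
  "cotangent_module m act pn d \<longleftrightarrow> L2_normed_module m act pn
    \<and> (\<forall>f\<in>W12 m. \<forall>g\<in>W12 m. (AE x in m. f x = g x) \<longrightarrow> d f = d g)
    \<and> (\<forall>f\<in>W12 m. \<forall>g\<in>W12 m. d (\<lambda>x. f x + g x) = d f + d g)
    \<and> (\<forall>c. \<forall>f\<in>W12 m. d (\<lambda>x. c * f x) = c *\<^sub>R d f)
    \<and> (\<forall>f\<in>W12 m. minimal_relaxed_slope m f (pn (d f)))
    \<and> closure {\<Sum>i<n. act (g i) (d (f i)) | (n::nat) g f.
                 \<forall>i<n. g i \<in> Linf m \<and> f i \<in> W12 m} = UNIV"

definition reflexive_space :: "'c::real_normed_vector itself \<Rightarrow> bool" where
  "reflexive_space _ \<longleftrightarrow>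
    (\<forall>F :: ('c \<Rightarrow>\<^sub>L real) \<Rightarrow>\<^sub>L real. \<exists>v::'c. \<forall>\<phi>. blinfun_apply F \<phi> = blinfun_apply \<phi> v)"


section \<open>Normed \<open>C\<^sub>b\<close>-modules\<close>

abbreviation cb_mult ::
    "('x::topological_space \<Rightarrow>\<^sub>C real) \<Rightarrow> ('x \<Rightarrow>\<^sub>C real) \<Rightarrow> ('x \<Rightarrow>\<^sub>C real)" where
  "cb_mult f g \<equiv> Bcontfun (\<lambda>x. apply_bcontfun f x * apply_bcontfun g x)"

definition Cb :: "('x::topological_space \<Rightarrow>\<^sub>C real) ring" where
  "Cb = \<lparr>carrier = UNIV, monoid.mult = cb_mult, one = const_bcontfun 1, zero = 0, add = (+)\<rparr>"

definition supp :: "('x::topological_space \<Rightarrow>\<^sub>C real) \<Rightarrow> 'x set" where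
  "supp f = closure {x. apply_bcontfun f x \<noteq> 0}"

text \<open>The real scalar multiplication of the normed space is the product by constant functions.
  The fields \<open>mult\<close> and \<open>one\<close> that module records inherit from ring records are irrelevant.\<close>

record ('x, 'v) normed_cb_module = "('x::topological_space \<Rightarrow>\<^sub>C real, 'v) module" +
  vnorm :: "'v \<Rightarrow> real"

abbreviation vscale :: "('x::topological_space, 'v, 'more) normed_cb_module_scheme \<Rightarrow> real \<Rightarrow> 'v \<Rightarrow> 'v" where
  "vscale V c v \<equiv> const_bcontfun c \<odot>\<^bsub>V\<^esub> v"

definition is_normed_cb_module :: "('x::topological_space, 'v) normed_cb_module \<Rightarrow> bool" where
  "is_normed_cb_module V \<longleftrightarrow> Module.module Cb V
    \<and> (\<forall>v\<in>carrier V. 0 \<le> vnorm V v \<and> (vnorm V v = 0 \<longleftrightarrow> v = \<zero>\<^bsub>V\<^esub>))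
    \<and> (\<forall>v\<in>carrier V. \<forall>w\<in>carrier V. vnorm V (v \<oplus>\<^bsub>V\<^esub> w) \<le> vnorm V v + vnorm V w)
    \<and> (\<forall>c. \<forall>v\<in>carrier V. vnorm V (vscale V c v) = \<bar>c\<bar> * vnorm V v)
    \<and> (\<forall>(n::nat) f v. 0 < n \<and> (\<forall>i<n. v i \<in> carrier V)
          \<and> disjoint_family_on (\<lambda>i. supp (f i)) {..<n}
        \<longrightarrow> vnorm V (finsum V (\<lambda>i. f i \<odot>\<^bsub>V\<^esub> v i) {..<n})
              \<le> (MAX i\<in>{..<n}. norm (f i)) * (MAX i\<in>{..<n}. vnorm V (v i)))"

definition vnorm_on :: "('x::topological_space, 'v) normed_cb_module \<Rightarrow> 'x set \<Rightarrow> 'v \<Rightarrow> real" where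
  "vnorm_on V A v = Sup {vnorm V (f \<odot>\<^bsub>V\<^esub> v) | f. supp f \<subseteq> A \<and> norm f \<le> 1}"

text \<open>Functionals are extended by \<open>0\<close> outside the carrier, so that they are equal as elements of the
  dual iff they are equal as HOL functions; the vector operations of the dual are pointwise.\<close>

definition vdual :: "('x::topological_space, 'v) normed_cb_module \<Rightarrow> ('v \<Rightarrow> real) set" where
  "vdual V = {\<phi>. (\<forall>v\<in>carrier V. \<forall>w\<in>carrier V. \<phi> (v \<oplus>\<^bsub>V\<^esub> w) = \<phi> v + \<phi> w)
    \<and> (\<forall>c. \<forall>v\<in>carrier V. \<phi> (vscale V c v) = c * \<phi> v)
    \<and> (\<exists>C. \<forall>v\<in>carrier V. \<bar>\<phi> v\<bar> \<le> C * vnorm V v)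
    \<and> (\<forall>v. v \<notin> carrier V \<longrightarrow> \<phi> v = 0)}"

definition dnorm :: "('x::topological_space, 'v) normed_cb_module \<Rightarrow> ('v \<Rightarrow> real) \<Rightarrow> real" where
  "dnorm V \<phi> = Sup {\<bar>\<phi> v\<bar> | v. v \<in> carrier V \<and> vnorm V v \<le> 1}"


section \<open>Local vector measures\<close>

text \<open>Vector measures are likewise extended by \<open>0\<close> to sets that are not Borel.\<close>

definition local_vector_measure ::
    "('x::topological_space, 'v) normed_cb_module \<Rightarrow> ('x set \<Rightarrow> 'v \<Rightarrow> real) \<Rightarrow> bool" where
  "local_vector_measure V N \<longleftrightarrow>
    (\<forall>A\<in>sets borel. N A \<in> vdual V) \<and> (\<forall>A. A \<notin> sets borel \<longrightarrow> N A = (\<lambda>_. 0))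
    \<and> (\<forall>A :: nat \<Rightarrow> 'x set. range A \<subseteq> sets borel \<and> disjoint_family A \<longrightarrow>
          (\<lambda>n. dnorm V (\<lambda>v. (\<Sum>i<n. N (A i) v) - N (\<Union>i. A i) v)) \<longlonglongrightarrow> 0)
    \<and> (\<forall>A. \<forall>v\<in>carrier V. open A \<and> vnorm_on V A v = 0 \<longrightarrow> N A v = 0)"

definition total_variation ::
    "('x::topological_space, 'v) normed_cb_module \<Rightarrow> ('x set \<Rightarrow> 'v \<Rightarrow> real) \<Rightarrow> 'x set \<Rightarrow> ennreal" where
  "total_variation V N E =
    (SUP P \<in> {P. finite P \<and> partition_on E P \<and> P \<subseteq> sets borel}. \<Sum>A\<in>P. ennreal (dnorm V (N A)))"

definition simple_bartle ::
    "('x set \<Rightarrow> 'v \<Rightarrow> real) \<Rightarrow> ('x \<Rightarrow> real) \<Rightarrow> 'x set \<Rightarrow> 'v \<Rightarrow> real" where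
  "simple_bartle N s A = (\<lambda>v. \<Sum>c\<in>range s. c * N (A \<inter> s -` {c}) v)"

text \<open>\<open>bartle V N g A\<close> is the Bartle integral of the bounded Borel function \<open>g\<close> over \<open>A\<close>: the limit, in the
  norm of the dual, of the integrals of any simple functions converging uniformly to \<open>g\<close>.\<close>

definition bartle :: "('x::topological_space, 'v) normed_cb_module \<Rightarrow> ('x set \<Rightarrow> 'v \<Rightarrow> real)
    \<Rightarrow> ('x \<Rightarrow> real) \<Rightarrow> 'x set \<Rightarrow> 'v \<Rightarrow> real" where
  "bartle V N g A = (if A \<in> sets borel then
      (THE \<phi>. \<phi> \<in> vdual V \<and>
        (\<forall>s. (\<forall>n. simple_function borel (s n)) \<and> uniform_limit UNIV s g sequentially \<longrightarrow>
          (\<lambda>n. dnorm V (\<lambda>v. simple_bartle N (s n) A v - \<phi> v)) \<longlonglongrightarrow> 0))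
    else (\<lambda>_. 0))"

text \<open>The space \<open>\<M>\<^sub>V\<close> of local vector measures; the finite total variation is a consequence of locality,
  so \<open>enn2real\<close> loses nothing.\<close>

definition lvm_space ::
    "('x::topological_space, 'v) normed_cb_module \<Rightarrow> ('x, 'x set \<Rightarrow> 'v \<Rightarrow> real) normed_cb_module" where
  "lvm_space V = \<lparr>carrier = {N. local_vector_measure V N}, monoid.mult = undefined, one = undefined,
    zero = (\<lambda>_ _. 0), add = (\<lambda>N N' A v. N A v + N' A v),
    smult = (\<lambda>g N. bartle V N (apply_bcontfun g)),
    vnorm = (\<lambda>N. enn2real (total_variation V N UNIV))\<rparr>"

definition cb_isometry ::
    "('x::topological_space, 'v) normed_cb_module \<Rightarrow> ('x, 'w) normed_cb_module \<Rightarrow> ('v \<Rightarrow> 'w) \<Rightarrow> bool" where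
  "cb_isometry V W \<Phi> \<longleftrightarrow> \<Phi> \<in> extensional (carrier V) \<and> bij_betw \<Phi> (carrier V) (carrier W)
    \<and> (\<forall>v\<in>carrier V. \<forall>w\<in>carrier V. \<Phi> (v \<oplus>\<^bsub>V\<^esub> w) = \<Phi> v \<oplus>\<^bsub>W\<^esub> \<Phi> w)
    \<and> (\<forall>f. \<forall>v\<in>carrier V. \<Phi> (f \<odot>\<^bsub>V\<^esub> v) = f \<odot>\<^bsub>W\<^esub> \<Phi> v)
    \<and> (\<forall>v\<in>carrier V. vnorm W (\<Phi> v) = vnorm V v)"


section \<open>The characterizing couples\<close>

definition linear_into_lvm :: "'x::polish_space measure \<Rightarrow> ('x, 'v) normed_cb_module
    \<Rightarrow> (('x \<Rightarrow> real) \<Rightarrow> 'x set \<Rightarrow> 'v \<Rightarrow> real) \<Rightarrow> bool" where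
  "linear_into_lvm m V D \<longleftrightarrow> (\<forall>f\<in>W12 m. local_vector_measure V (D f))
    \<and> (\<forall>f\<in>W12 m. \<forall>g\<in>W12 m. (AE x in m. f x = g x) \<longrightarrow> D f = D g)
    \<and> (\<forall>f\<in>W12 m. \<forall>g\<in>W12 m. D (\<lambda>x. f x + g x) = (\<lambda>A v. D f A v + D g A v))
    \<and> (\<forall>c. \<forall>f\<in>W12 m. D (\<lambda>x. c * f x) = (\<lambda>A v. c * D f A v))"

definition generated_module :: "'x::polish_space measure \<Rightarrow> ('x, 'v) normed_cb_module
    \<Rightarrow> (('x \<Rightarrow> real) \<Rightarrow> 'x set \<Rightarrow> 'v \<Rightarrow> real) \<Rightarrow> ('x set \<Rightarrow> 'v \<Rightarrow> real) set" where
  "generated_module m V D =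
    {\<lambda>A v. \<Sum>i<n. bartle V (D (f i)) (apply_bcontfun (g i)) A v | (n::nat) g f. \<forall>i<n. f i \<in> W12 m}"

definition differential_couple :: "'x::polish_space measure \<Rightarrow> ('x, 'v) normed_cb_module
    \<Rightarrow> (('x \<Rightarrow> real) \<Rightarrow> 'x set \<Rightarrow> 'v \<Rightarrow> real) \<Rightarrow> bool" where
  "differential_couple m V D \<longleftrightarrow> is_normed_cb_module V \<and> linear_into_lvm m V D
    \<and> (\<forall>f\<in>W12 m. \<exists>G. minimal_relaxed_slope m f G \<and>
          (\<forall>E\<in>sets borel. total_variation V (D f) E = (\<integral>\<^sup>+ x\<in>E. ennreal (G x) \<partial>m)))
    \<and> (\<forall>v\<in>carrier V. vnorm V v =
          (SUP N \<in> {N \<in> generated_module m V D. total_variation V N UNIV \<le> 1}. N UNIV v))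
    \<and> (\<forall>v :: nat \<Rightarrow> 'v. (\<forall>k. v k \<in> carrier V) \<and> (\<exists>C. \<forall>k. vnorm V (v k) \<le> C)
          \<and> (\<forall>A\<in>sets borel. \<forall>f\<in>W12 m. convergent (\<lambda>k. D f A (v k)))
        \<longrightarrow> (\<exists>w\<in>carrier V. \<forall>A\<in>sets borel. \<forall>f\<in>W12 m. (\<lambda>k. D f A (v k)) \<longlonglongrightarrow> D f A w))"


section \<open>The tangent module\<close>

text \<open>As elements of the tangent module have to be compared by HOL equality, they are maps into the
  actual quotient \<open>L\<^sup>1\<close>, whose elements are the classes \<open>ae_class m f\<close>.\<close>

definition ae_class :: "'x measure \<Rightarrow> ('x \<Rightarrow> real) \<Rightarrow> ('x \<Rightarrow> real) set" where
  "ae_class m f = {g \<in> borel_measurable m. AE x in m. g x = f x}"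

definition L1 :: "'x measure \<Rightarrow> ('x \<Rightarrow> real) set set" where
  "L1 m = {ae_class m f | f. integrable m f}"

text \<open>Continuity of the linear map \<open>T\<close> is expressed by boundedness.\<close>

definition L2T :: "'x measure \<Rightarrow> (('x \<Rightarrow> real) \<Rightarrow> 'c::banach \<Rightarrow> 'c) \<Rightarrow> ('c \<Rightarrow> ('x \<Rightarrow> real) set) set" where
  "L2T m act = {T. (\<forall>\<omega>. T \<omega> \<in> L1 m)
    \<and> (\<forall>\<omega> \<eta>. \<forall>f\<in>T \<omega>. \<forall>g\<in>T \<eta>. (\<lambda>x. f x + g x) \<in> T (\<omega> + \<eta>))
    \<and> (\<forall>h\<in>Linf m. \<forall>\<omega>. \<forall>f\<in>T \<omega>. (\<lambda>x. h x * f x) \<in> T (act h \<omega>))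
    \<and> (\<exists>C. \<forall>\<omega>. \<forall>f\<in>T \<omega>. (\<integral>x. \<bar>f x\<bar> \<partial>m) \<le> C * norm \<omega>)}"

definition tan_zero :: "'x measure \<Rightarrow> 'c \<Rightarrow> ('x \<Rightarrow> real) set" where
  "tan_zero m = (\<lambda>\<omega>. ae_class m (\<lambda>_. 0))"

text \<open>In these unions all the classes involved coincide.\<close>

definition tan_add :: "'x measure \<Rightarrow> ('c \<Rightarrow> ('x \<Rightarrow> real) set) \<Rightarrow> ('c \<Rightarrow> ('x \<Rightarrow> real) set) \<Rightarrow> 'c \<Rightarrow> ('x \<Rightarrow> real) set" where
  "tan_add m T S = (\<lambda>\<omega>. \<Union>f\<in>T \<omega>. \<Union>g\<in>S \<omega>. ae_class m (\<lambda>x. f x + g x))"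

definition tan_mult :: "'x measure \<Rightarrow> ('x \<Rightarrow> real) \<Rightarrow> ('c \<Rightarrow> ('x \<Rightarrow> real) set) \<Rightarrow> 'c \<Rightarrow> ('x \<Rightarrow> real) set" where
  "tan_mult m h T = (\<lambda>\<omega>. \<Union>f\<in>T \<omega>. ae_class m (\<lambda>x. h x * f x))"

text \<open>The dual pointwise norm: the essential supremum of \<open>T \<omega>\<close> over all \<open>\<omega>\<close> with \<open>|\<omega>| \<le> 1\<close>.\<close>

definition is_dual_pnorm ::
    "'x measure \<Rightarrow> ('c \<Rightarrow> 'x \<Rightarrow> real) \<Rightarrow> ('c \<Rightarrow> ('x \<Rightarrow> real) set) \<Rightarrow> ('x \<Rightarrow> real) \<Rightarrow> bool" where
  "is_dual_pnorm m pn T h \<longleftrightarrow>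
    (let ub = (\<lambda>k. k \<in> borel_measurable m \<and>
       (\<forall>\<omega>. (AE x in m. pn \<omega> x \<le> 1) \<longrightarrow> (\<forall>f\<in>T \<omega>. AE x in m. f x \<le> k x)))
     in ub h \<and> (\<forall>k. ub k \<longrightarrow> (AE x in m. h x \<le> k x)))"

definition dual_pnorm ::
    "'x measure \<Rightarrow> ('c \<Rightarrow> 'x \<Rightarrow> real) \<Rightarrow> ('c \<Rightarrow> ('x \<Rightarrow> real) set) \<Rightarrow> 'x \<Rightarrow> real" where
  "dual_pnorm m pn T = (SOME h. is_dual_pnorm m pn T h)"

definition LinfT :: "'x::polish_space measure \<Rightarrow> (('x \<Rightarrow> real) \<Rightarrow> 'c::banach \<Rightarrow> 'c) \<Rightarrow> ('c \<Rightarrow> 'x \<Rightarrow> real)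
    \<Rightarrow> ('x, 'c \<Rightarrow> ('x \<Rightarrow> real) set) normed_cb_module" where
  "LinfT m act pn = \<lparr>carrier = {T \<in> L2T m act. \<exists>h\<in>Linf m. is_dual_pnorm m pn T h},
    monoid.mult = undefined, one = undefined, zero = tan_zero m, add = tan_add m,
    smult = (\<lambda>g. tan_mult m (apply_bcontfun g)),
    vnorm = (\<lambda>T. Linf_norm m (dual_pnorm m pn T))\<rparr>"

text \<open>The map \<open>D f A T = \<integral>\<^sub>A df(T)\<close>, where \<open>df(T) = T (d f)\<close> is the duality pairing.\<close>

definition D_tangent :: "'x::polish_space measure \<Rightarrow> (('x \<Rightarrow> real) \<Rightarrow> 'c::banach \<Rightarrow> 'c) \<Rightarrow> ('c \<Rightarrow> 'x \<Rightarrow> real)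
    \<Rightarrow> (('x \<Rightarrow> real) \<Rightarrow> 'c) \<Rightarrow> ('x \<Rightarrow> real) \<Rightarrow> 'x set \<Rightarrow> ('c \<Rightarrow> ('x \<Rightarrow> real) set) \<Rightarrow> real" where
  "D_tangent m act pn d f A T = (if A \<in> sets borel \<and> T \<in> carrier (LinfT m act pn)
     then set_lebesgue_integral m A (SOME h. h \<in> T (d f)) else 0)"

text \<open>The \<open>L\<^sup>0\<close>-completion of the tangent module, for a finite measure: the metric completion, by classes
  of Cauchy sequences, for the distance \<open>\<integral> min 1 |T - S|\<close>; the pointwise norm is extended by continuity
  with respect to convergence in measure.\<close>

definition L0_dist :: "'x measure \<Rightarrow> ('c \<Rightarrow> 'x \<Rightarrow> real) \<Rightarrow> ('c \<Rightarrow> ('x \<Rightarrow> real) set)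
    \<Rightarrow> ('c \<Rightarrow> ('x \<Rightarrow> real) set) \<Rightarrow> real" where
  "L0_dist m pn T S = (\<integral>x. min 1 (dual_pnorm m pn (tan_add m T (tan_mult m (\<lambda>_. - 1) S)) x) \<partial>m)"

definition L0_cauchy :: "'x measure \<Rightarrow> (('x \<Rightarrow> real) \<Rightarrow> 'c::banach \<Rightarrow> 'c) \<Rightarrow> ('c \<Rightarrow> 'x \<Rightarrow> real)
    \<Rightarrow> (nat \<Rightarrow> 'c \<Rightarrow> ('x \<Rightarrow> real) set) set" where
  "L0_cauchy m act pn = {s. (\<forall>n. s n \<in> L2T m act) \<and>
     (\<forall>e>0. \<exists>n0. \<forall>i\<ge>n0. \<forall>j\<ge>n0. L0_dist m pn (s i) (s j) < e)}"

definition L0_rel :: "'x measure \<Rightarrow> (('x \<Rightarrow> real) \<Rightarrow> 'c::banach \<Rightarrow> 'c) \<Rightarrow> ('c \<Rightarrow> 'x \<Rightarrow> real)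
    \<Rightarrow> (nat \<Rightarrow> 'c \<Rightarrow> ('x \<Rightarrow> real) set) rel" where
  "L0_rel m act pn = {(s, t). s \<in> L0_cauchy m act pn \<and> t \<in> L0_cauchy m act pn \<and>
     (\<lambda>n. L0_dist m pn (s n) (t n)) \<longlonglongrightarrow> 0}"

definition L0T :: "'x measure \<Rightarrow> (('x \<Rightarrow> real) \<Rightarrow> 'c::banach \<Rightarrow> 'c) \<Rightarrow> ('c \<Rightarrow> 'x \<Rightarrow> real)
    \<Rightarrow> (nat \<Rightarrow> 'c \<Rightarrow> ('x \<Rightarrow> real) set) set set" where
  "L0T m act pn = L0_cauchy m act pn // L0_rel m act pn"

definition L0_embed :: "'x measure \<Rightarrow> (('x \<Rightarrow> real) \<Rightarrow> 'c::banach \<Rightarrow> 'c) \<Rightarrow> ('c \<Rightarrow> 'x \<Rightarrow> real)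
    \<Rightarrow> ('c \<Rightarrow> ('x \<Rightarrow> real) set) \<Rightarrow> (nat \<Rightarrow> 'c \<Rightarrow> ('x \<Rightarrow> real) set) set" where
  "L0_embed m act pn T = L0_rel m act pn `` {\<lambda>_. T}"

definition is_L0_pnorm :: "'x measure \<Rightarrow> ('c \<Rightarrow> 'x \<Rightarrow> real)
    \<Rightarrow> (nat \<Rightarrow> 'c \<Rightarrow> ('x \<Rightarrow> real) set) set \<Rightarrow> ('x \<Rightarrow> real) \<Rightarrow> bool" where
  "is_L0_pnorm m pn \<xi> h \<longleftrightarrow> h \<in> borel_measurable m \<and>
     (\<forall>s\<in>\<xi>. (\<lambda>n. \<integral>x. min 1 \<bar>dual_pnorm m pn (s n) x - h x\<bar> \<partial>m) \<longlonglongrightarrow> 0)"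

end

theory Submission
  imports Defs
begin

text \<open>Bounded vector fields are the linear functionals \<open>l\<close> on the cotangent module with
  \<open>|l(\<omega>)| \<le> C \<integral> |\<omega>| dm\<close>, the least \<open>C\<close> being the norm: the density of \<open>A \<mapsto> l(\<chi>\<^sub>A \<omega>)\<close> is the pairing with \<open>\<omega>\<close>.
  If \<open>(D, V)\<close> satisfies (i)--(iii), every \<open>v\<close> in \<open>V\<close> induces such a functional \<open>\<ell>\<^sub>v\<close>, determined by
  \<open>\<ell>\<^sub>v(\<chi>\<^sub>A df) = Df(A)(v)\<close>; the bound with \<open>C = \<parallel>v\<parallel>\<close> follows from (i), because on a common piece of a partition
  a sum of terms \<open>\<chi>\<^sub>A df\<close> is the differential of a single function. Locality makes \<open>v \<mapsto> \<ell>\<^sub>v\<close> linear over \<open>C\<^sub>b\<close>.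
  Total variation is a supremum over partitions, and elements of \<open>V\<close> cut off by functions with disjoint supports
  can be added without increasing the norm; this gives \<open>\<integral> |\<omega>| dm = sup {\<ell>\<^sub>v(\<omega>) : \<parallel>v\<parallel> \<le> 1}\<close>, so that (ii) makes
  \<open>v \<mapsto> \<ell>\<^sub>v\<close> isometric. It is onto: by Hahn-Banach and reflexivity every \<open>l\<close> is a limit, in the norm of the dual of
  the cotangent module, of functionals \<open>\<ell>\<^sub>v\<close> with bounded \<open>v\<close>, and (iii) provides an element of \<open>V\<close> inducing \<open>l\<close>.
  Hence \<open>V\<close> is, up to a unique isomorphism, the space of all these functionals, which in turn is a couple.\<close>


section \<open>Dominated extension of linear functionals\<close>

text \<open>Two norms compete. Total variations are values of \<open>N1\<close>, the L^1 norm of the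
  pointwise norm, while completeness, reflexivity and the density of combinations of differentials
  belong to the L^2 norm of the module. Since m is finite, functionals dominated by
  \<open>N1\<close> are continuous for the L^2 norm; but an approximation in the L^2 dual norm alone
  gives no control on norms in V, and (iii) requires bounded sequences. Both demands are put into
  one gauge, the infimal convolution of the norm of V with n times the dual norm. Two facts have to
  be in place before. Condition (i) and the cotangent module each refer to some minimal relaxed
  slope; that these agree almost everywhere takes a Mazur argument and a projection argument in L^2.
  The pointwise triangle inequality, and with it that of \<open>N1\<close>, has to be derived from
  the norm. For the realization, a truncation argument places the bounded elements of the L^0
  completion inside the tangent module.\<close>

text \<open>The extended functional is given by its graph \<open>R\<close>, so that its being well defined is a
  consequence of the domination.\<close>

lemma hahn_banach_graph:
  fixes p :: "'a::real_vector \<Rightarrow> real" and R :: "('a \<times> real) set"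
  assumes p_add: "\<And>x y. p (x + y) \<le> p x + p y"
    and p_scale: "\<And>c x. 0 \<le> c \<Longrightarrow> p (c *\<^sub>R x) = c * p x"
    and R: "subspace R" and dom: "\<And>x r. (x, r) \<in> R \<Longrightarrow> r \<le> p x"
  obtains l where "linear l" "\<And>x. l x \<le> p x" "\<And>x r. (x, r) \<in> R \<Longrightarrow> l x = r"
proof -
  define A where "A = {S. subspace S \<and> R \<subseteq> S \<and> (\<forall>(x, r) \<in> S. r \<le> p x)}"
  have "\<exists>M\<in>A. \<forall>X\<in>A. M \<subseteq> X \<longrightarrow> X = M"
  proof (rule subset_Zorn_nonempty)
    show "A \<noteq> {}" using R dom by (auto simp: A_def)
    fix C assume C: "C \<noteq> {}" "subset.chain A C"
    have CA: "S \<in> C \<Longrightarrow> subspace S \<and> R \<subseteq> S \<and> (\<forall>(x, r) \<in> S. r \<le> p x)" for S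
      using C(2) by (auto simp: subset.chain_def A_def)
    have "subspace (\<Union>C)"
      unfolding subspace_def
    proof (intro conjI ballI allI)
      show "0 \<in> \<Union>C" using C(1) CA by (meson UnionI ex_in_conv subspace_0)
      show "x + y \<in> \<Union>C" if xy: "x \<in> \<Union>C" "y \<in> \<Union>C" for x y
      proof -
        obtain S T where "S \<in> C" "T \<in> C" "x \<in> S" "y \<in> T" using xy by blast
        moreover from this have "S \<subseteq> T \<or> T \<subseteq> S" using C(2) by (auto simp: subset.chain_def)
        ultimately show ?thesis using CA by (metis UnionI subsetD subspace_add)
      qed
      show "c *\<^sub>R x \<in> \<Union>C" if "x \<in> \<Union>C" for c x
        using that CA by (meson UnionE UnionI subspace_scale)
    qed
    with C CA show "\<Union>C \<in> A" unfolding A_def by blast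
  qed
  then obtain M where "M \<in> A" and max: "\<And>X. X \<in> A \<Longrightarrow> M \<subseteq> X \<Longrightarrow> X = M" by blast
  then have M: "subspace M" "R \<subseteq> M" "\<And>x r. (x, r) \<in> M \<Longrightarrow> r \<le> p x" by (auto simp: A_def)
  have p0: "p 0 = 0" using p_scale[of 0 0] by simp
  \<comment> \<open>Domination is applied to (0, r - s) and to its negative; both second components
    lie below \<open>p 0 = 0\<close>.\<close>
  have uniq: "r = s" if "(x, r) \<in> M" "(x, s) \<in> M" for x r s
  proof -
    have "(0, r - s) \<in> M" using subspace_diff[OF M(1) that] by simp
    from M(3)[OF subspace_scale[OF M(1) this, of 1, simplified]]
      M(3)[OF subspace_scale[OF M(1) this, of "-1", simplified]] p0 show ?thesis by simp
  qed
  have total: "\<exists>r. (x, r) \<in> M" for x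
  proof (rule ccontr)
    assume no: "\<nexists>r. (x, r) \<in> M"
    \<comment> \<open>A value at \<open>x\<close> compatible with the domination lies above every r
      - p (z - x) and below every p (y + x) - s. By subadditivity no such lower bound exceeds an
      upper one, so the supremum of the lower bounds serves.\<close>
    define L where "L = {r - p (z - x) |z r. (z, r) \<in> M}"
    have sep: "r - p (z - x) \<le> p (y + x) - s" if "(z, r) \<in> M" "(y, s) \<in> M" for z y r s
    proof -
      have "r + s \<le> p (z + y)" using M(3)[OF subspace_add[OF M(1) that, simplified]] .
      also have "\<dots> \<le> p (z - x) + p (y + x)" using p_add[of "z - x" "y + x"] by simp
      finally show ?thesis by simp
    qed
    have M0: "(0, 0) \<in> M" using subspace_0[OF M(1)] by (simp add: zero_prod_def)
    define a where "a = Sup L"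
    have bdd: "bdd_above L" using sep[OF _ M0] by (auto simp: L_def intro!: bdd_aboveI)
    have a1: "r - p (z - x) \<le> a" if "(z, r) \<in> M" for z r
      unfolding a_def using that bdd by (intro cSup_upper) (auto simp: L_def)
    have a2: "a \<le> p (y + x) - s" if "(y, s) \<in> M" for y s
      unfolding a_def using that M0 sep by (intro cSup_least) (auto simp: L_def)
    define X where "X = (\<Union>c. (\<lambda>z. z + c *\<^sub>R (x, a)) ` M)"
    have XI: "z + c *\<^sub>R (x, a) \<in> X" if "z \<in> M" for z c using that by (auto simp: X_def)
    have "subspace X"
      unfolding subspace_def
    proof (intro conjI ballI allI)
      show "0 \<in> X" using XI[OF subspace_0[OF M(1)], of 0] by (simp add: zero_prod_def)
      fix u assume "u \<in> X"
      then obtain z c where u: "u = z + c *\<^sub>R (x, a)" "z \<in> M" by (auto simp: X_def)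
      show "k *\<^sub>R u \<in> X" for k
        using XI[OF subspace_scale[OF M(1) u(2)], of k "k * c"]
        unfolding u(1) by (simp add: scaleR_add_right mult.assoc)
      fix v assume "v \<in> X"
      then obtain y e where v: "v = y + e *\<^sub>R (x, a)" "y \<in> M" by (auto simp: X_def)
      show "u + v \<in> X" using XI[OF subspace_add[OF M(1) u(2) v(2)], of "c + e"]
        unfolding u(1) v(1) by (simp only: scaleR_add_left add.assoc add.commute add.left_commute)
    qed
    moreover have MX: "M \<subseteq> X" using XI[of _ 0] by auto
    moreover have "r' \<le> p x'" if "(x', r') \<in> X" for x' r'
    proof -
      from that obtain z r c where zr: "(z, r) \<in> M" "x' = z + c *\<^sub>R x" "r' = r + c * a"
        by (fastforce simp: X_def)
      \<comment> \<open>The upper bounds \<open>a2\<close> of \<open>a\<close> settle c > 0 and the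
        lower bounds \<open>a1\<close> settle c < 0, after rescaling the element of \<open>M\<close>
        by 1/c or -1/c.\<close>
      consider "c = 0" | "c > 0" | "c < 0" by linarith
      then show ?thesis
      proof cases
        case 1 then show ?thesis using zr M(3) by simp
      next
        case 2
        from subspace_scale[OF M(1) zr(1), of "1/c"]
        have "a \<le> p ((1/c) *\<^sub>R z + x) - r / c" using a2 by simp
        also have "(1/c) *\<^sub>R z + x = (1/c) *\<^sub>R x'" using 2 by (simp add: zr scaleR_add_right)
        also have "p \<dots> = (1/c) * p x'" using 2 by (intro p_scale) simp
        finally have "c * a \<le> c * ((1/c) * p x' - r/c)" using 2 by (intro mult_left_mono) auto
        then show ?thesis using 2 zr by (simp add: algebra_simps)
      next
        case 3
        from subspace_scale[OF M(1) zr(1), of "-1/c"]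
        have "- r / c - p ((-1/c) *\<^sub>R z - x) \<le> a" using a1 by simp
        also have "(-1/c) *\<^sub>R z - x = (-1/c) *\<^sub>R x'" using 3 by (simp add: zr scaleR_add_right)
        also have "p \<dots> = (-1/c) * p x'" using 3 by (intro p_scale) (simp add: divide_simps)
        finally have "-c * (- r / c - (-1/c) * p x') \<le> -c * a" using 3 by (intro mult_left_mono) auto
        then show ?thesis using 3 zr by (simp add: algebra_simps)
      qed
    qed
    ultimately have "X \<in> A" using M(2) by (auto simp: A_def)
    then have "X = M" using max MX by blast
    moreover have "(x, a) \<in> X" using XI[OF subspace_0[OF M(1)], of 1] by simp
    ultimately show False using no by blast
  qed
  define l where "l x = (THE r. (x, r) \<in> M)" for x
  have l: "(x, l x) \<in> M" for x
    unfolding l_def using total[of x] uniq by (metis (no_types, lifting) theI)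
  have leq: "(x, r) \<in> M \<Longrightarrow> l x = r" for x r using uniq[OF l] .
  show ?thesis
  proof (rule that[of l])
    show "linear l"
      by (rule linearI; rule leq)
        (use subspace_add[OF M(1) l l] subspace_scale[OF M(1) l] in auto)
  qed (use M(2,3) l leq in auto)
qed

text \<open>The extension starts from the line through \<open>v\<close> with value c * p v at c v.
  For negative c the domination is just p \<ge> 0. Taken as a graph, the line needs no separate case
  for v = 0.\<close>

lemma hahn_banach_point:
  fixes p :: "'a::real_vector \<Rightarrow> real"
  assumes p_add: "\<And>x y. p (x + y) \<le> p x + p y" and p_scale: "\<And>c x. 0 \<le> c \<Longrightarrow> p (c *\<^sub>R x) = c * p x"
    and p_nonneg: "\<And>x. 0 \<le> p x"
  obtains l where "linear l" "\<And>x. l x \<le> p x" "l v = p v"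
proof -
  define R where "R = range (\<lambda>c. (c *\<^sub>R v, c * p v))"
  have R: "subspace R"
    unfolding subspace_def
  proof (intro conjI ballI allI)
    show "0 \<in> R" unfolding R_def by (rule range_eqI[of _ _ 0]) (simp add: zero_prod_def)
    show "x + y \<in> R" if xy: "x \<in> R" "y \<in> R" for x y
    proof -
      obtain a b where "x = (a *\<^sub>R v, a * p v)" "y = (b *\<^sub>R v, b * p v)" using xy by (auto simp: R_def)
      then show ?thesis unfolding R_def by (intro range_eqI[of _ _ "a + b"]) (simp add: algebra_simps)
    qed
    show "k *\<^sub>R x \<in> R" if x: "x \<in> R" for k x
    proof -
      obtain a where "x = (a *\<^sub>R v, a * p v)" using x by (auto simp: R_def)
      then show ?thesis unfolding R_def by (intro range_eqI[of _ _ "k * a"]) simp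
    qed
  qed
  have dom: "r \<le> p x" if "(x, r) \<in> R" for x r
  proof -
    from that have "\<exists>c. x = c *\<^sub>R v \<and> r = c * p v" unfolding R_def by auto
    then obtain c where c: "x = c *\<^sub>R v" "r = c * p v" by blast
    show ?thesis
    proof (cases "0 \<le> c")
      case False
      then have "c * p v \<le> 0" using p_nonneg[of v] by (simp add: mult_nonpos_nonneg)
      then show ?thesis unfolding c using p_nonneg[of "c *\<^sub>R v"] by linarith
    qed (simp add: c p_scale)
  qed
  show ?thesis
  proof (rule hahn_banach_graph[of p R, OF p_add p_scale R dom])
    fix l assume l: "linear l" "\<And>x. l x \<le> p x" and ext: "\<And>x r. (x, r) \<in> R \<Longrightarrow> l x = r"
    have "l v = p v" by (rule ext) (auto simp: R_def intro: range_eqI[of _ _ 1])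
    with l show thesis by (rule that)
  qed
qed

section \<open>Square integrable functions\<close>

locale finite_borel = finite_measure m for m :: "'x::polish_space measure" +
  assumes sets_m [measurable_cong, simp]: "sets m = sets borel"
begin

abbreviation sqint :: "('x \<Rightarrow> real) \<Rightarrow> real" where
  "sqint f \<equiv> LINT x|m. (f x)\<^sup>2"

abbreviation setint :: "'x set \<Rightarrow> ('x \<Rightarrow> real) \<Rightarrow> real" where
  "setint A f \<equiv> LINT x|m. indicat_real A x * f x"

lemma space_m [simp]: "space m = UNIV"
  using sets_eq_imp_space_eq[OF sets_m] by simp

lemma measurable_m_iff [simp]: "borel_measurable m = borel_measurable borel"
  by (rule measurable_cong_sets) simp_all

lemma L2D [measurable_dest]: "f \<in> L2 m \<Longrightarrow> f \<in> borel_measurable borel"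
  by (simp add: L2_def)

lemma L2_square: "f \<in> L2 m \<Longrightarrow> integrable m (\<lambda>x. (f x)\<^sup>2)"
  by (simp add: L2_def)

lemma L2_product:
  assumes "f \<in> L2 m" "g \<in> L2 m"
  shows "integrable m (\<lambda>x. f x * g x)"
proof (rule Bochner_Integration.integrable_bound[OF Bochner_Integration.integrable_add])
  show "integrable m (\<lambda>x. (f x)\<^sup>2)" "integrable m (\<lambda>x. (g x)\<^sup>2)" using assms L2_square by auto
  show "(\<lambda>x. f x * g x) \<in> borel_measurable m" using assms[THEN L2D] by simp
  have "\<bar>f x * g x\<bar> \<le> (f x)\<^sup>2 + (g x)\<^sup>2" for x
  proof -
    have "2 * \<bar>f x * g x\<bar> \<le> (f x)\<^sup>2 + (g x)\<^sup>2"
      using sum_squares_bound[of "\<bar>f x\<bar>" "\<bar>g x\<bar>"] by (simp add: abs_mult)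
    then show ?thesis by linarith
  qed
  then show "AE x in m. norm (f x * g x) \<le> norm ((f x)\<^sup>2 + (g x)\<^sup>2)" by auto
qed

lemma L2_const [simp]: "(\<lambda>_. c) \<in> L2 m"
  by (simp add: L2_def)

lemma L2_integrable: "f \<in> L2 m \<Longrightarrow> integrable m f"
  using L2_product[of f "\<lambda>_. 1"] by simp

lemma L2_add: "f \<in> L2 m \<Longrightarrow> g \<in> L2 m \<Longrightarrow> (\<lambda>x. f x + g x) \<in> L2 m"
  using L2_product[of f g] by (auto simp: L2_def power2_sum mult.assoc)

lemma L2_scale: "f \<in> L2 m \<Longrightarrow> (\<lambda>x. c * f x) \<in> L2 m"
  by (auto simp: L2_def power_mult_distrib)

lemma L2_divide: "f \<in> L2 m \<Longrightarrow> (\<lambda>x. f x / c) \<in> L2 m"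
  using L2_scale[of f "1/c"] by simp

lemma L2_diff: "f \<in> L2 m \<Longrightarrow> g \<in> L2 m \<Longrightarrow> (\<lambda>x. f x - g x) \<in> L2 m"
  using L2_add[of f "\<lambda>x. - 1 * g x"] L2_scale[of g "-1"] by simp

lemma L2_bounded:
  assumes "f \<in> borel_measurable borel" "AE x in m. \<bar>f x\<bar> \<le> C"
  shows "f \<in> L2 m"
proof -
  have "AE x in m. norm ((f x)\<^sup>2) \<le> C\<^sup>2"
    using assms(2) by eventually_elim (metis abs_ge_zero norm_power power_mono real_norm_def)
  then show ?thesis using assms(1)
    by (auto simp: L2_def intro!: integrable_const_bound[where B = "C\<^sup>2"])
qed

lemma cauchy_schwarz:
  assumes "f \<in> L2 m" "g \<in> L2 m"
  shows "(LINT x|m. \<bar>f x * g x\<bar>) \<le> sqrt (sqint f) * sqrt (sqint g)"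
proof -
  note L2D[OF assms(1), measurable] L2D[OF assms(2), measurable]
  have "(\<integral>\<^sup>+x. ennreal \<bar>f x\<bar> * ennreal \<bar>g x\<bar> \<partial>m)\<^sup>2
      \<le> (\<integral>\<^sup>+x. (ennreal \<bar>f x\<bar>)\<^sup>2 \<partial>m) * (\<integral>\<^sup>+x. (ennreal \<bar>g x\<bar>)\<^sup>2 \<partial>m)"
    by (rule Cauchy_Schwarz_nn_integral) measurable
  also have "(\<integral>\<^sup>+x. ennreal \<bar>f x\<bar> * ennreal \<bar>g x\<bar> \<partial>m) = ennreal (LINT x|m. \<bar>f x * g x\<bar>)"
    using nn_integral_eq_integral[OF integrable_abs[OF L2_product[OF assms]]]
    by (simp add: abs_mult ennreal_mult)
  also have "(\<integral>\<^sup>+x. (ennreal \<bar>f x\<bar>)\<^sup>2 \<partial>m) = ennreal (sqint f)"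
    using nn_integral_eq_integral[OF L2_square[OF assms(1)]] by (simp add: ennreal_power)
  also have "(\<integral>\<^sup>+x. (ennreal \<bar>g x\<bar>)\<^sup>2 \<partial>m) = ennreal (sqint g)"
    using nn_integral_eq_integral[OF L2_square[OF assms(2)]] by (simp add: ennreal_power)
  finally have "(LINT x|m. \<bar>f x * g x\<bar>)\<^sup>2 \<le> sqint f * sqint g"
    by (simp add: ennreal_power flip: ennreal_mult)
  then show ?thesis by (metis real_le_rsqrt real_sqrt_mult)
qed

lemma L1_le_L2:
  assumes "f \<in> L2 m"
  shows "(LINT x|m. \<bar>f x\<bar>) \<le> sqrt (measure m UNIV) * sqrt (sqint f)"
  using cauchy_schwarz[OF L2_const[of 1] assms] by simp

lemma L2_minkowski:
  assumes f: "f \<in> L2 m" and g: "g \<in> L2 m"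
  shows "sqrt (LINT x|m. (f x + g x)\<^sup>2) \<le> sqrt (sqint f) + sqrt (sqint g)"
proof (rule real_le_lsqrt)
  have "(LINT x|m. (f x + g x)\<^sup>2) = sqint f + sqint g + 2 * (LINT x|m. f x * g x)"
    using L2_square[OF f] L2_square[OF g] L2_product[OF f g]
    by (simp add: power2_sum mult.assoc)
  also have "(LINT x|m. f x * g x) \<le> (LINT x|m. \<bar>f x * g x\<bar>)"
    using L2_product[OF f g] by (intro integral_mono) auto
  also have "\<dots> \<le> sqrt (sqint f) * sqrt (sqint g)" by (rule cauchy_schwarz[OF f g])
  finally show "(LINT x|m. (f x + g x)\<^sup>2) \<le> (sqrt (sqint f) + sqrt (sqint g))\<^sup>2"
    by (simp add: power2_sum)
qed simp

text \<open>Stated with the midpoint: the convex sets used below contain midpoints, so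
  near-minimality bounds the last term from below and the identity then bounds the distance of two
  near-minimizers.\<close>

lemma L2_parallelogram:
  assumes f: "f \<in> L2 m" and g: "g \<in> L2 m"
  shows "sqint (\<lambda>x. f x - g x)
    = 2 * sqint f + 2 * sqint g - 4 * (LINT x|m. ((f x + g x) / 2)\<^sup>2)"
proof -
  have "sqint (\<lambda>x. f x - g x) = (LINT x|m. 2 * (f x)\<^sup>2 + 2 * (g x)\<^sup>2 - 4 * ((f x + g x) / 2)\<^sup>2)"
    by (intro Bochner_Integration.integral_cong) (auto simp: power2_eq_square algebra_simps)
  then show ?thesis
    using L2_square[OF f] L2_square[OF g] L2_square[OF L2_divide[OF L2_add[OF f g]], of 2] by simp
qed

lemma tendsto_L2_iff:
  assumes "\<And>k. F k \<in> L2 m" "f \<in> L2 m"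
  shows "tendsto_L2 m F f \<longleftrightarrow> (\<lambda>k. \<integral>x. (F k x - f x)\<^sup>2 \<partial>m) \<longlonglongrightarrow> 0"
proof -
  have "(\<integral>\<^sup>+ x. ennreal ((F k x - f x)\<^sup>2) \<partial>m) = ennreal (sqint (\<lambda>x. F k x - f x))" for k
    by (rule nn_integral_eq_integral[OF L2_square[OF L2_diff[OF assms]]]) simp
  moreover have "(\<lambda>k. ennreal (a k)) \<longlonglongrightarrow> 0 \<longleftrightarrow> a \<longlonglongrightarrow> 0" if "\<And>k. a k \<ge> 0" for a :: "nat \<Rightarrow> real"
    using that tendsto_ennreal_iff[of a sequentially 0] by simp
  ultimately show ?thesis unfolding tendsto_L2_def by simp
qed

text \<open>Riesz-Fischer: a fast subsequence has summable L^1 increments, hence converges almost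
  everywhere, and Fatou identifies the pointwise limit as the L^2 limit.\<close>

lemma L2_complete:
  assumes f: "\<And>n. f n \<in> L2 m"
    and cauchy: "\<And>e. e > 0 \<Longrightarrow> \<exists>N. \<forall>i\<ge>N. \<forall>j\<ge>N. sqint (\<lambda>x. f i x - f j x) < e"
  obtains g where "g \<in> L2 m" "(\<lambda>n. \<integral>x. (f n x - g x)\<^sup>2 \<partial>m) \<longlonglongrightarrow> 0"
proof -
  note f[THEN L2D, measurable]
  have "\<exists>N\<ge>M. \<forall>i\<ge>N. \<forall>j\<ge>N. sqint (\<lambda>x. f i x - f j x) < (1/4)^k" for k M
  proof -
    obtain N where "\<forall>i\<ge>N. \<forall>j\<ge>N. sqint (\<lambda>x. f i x - f j x) < (1/4)^k"
      using cauchy[of "(1/4)^k"] by auto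
    then show ?thesis by (intro exI[of _ "max M N"]) auto
  qed
  note ex = this
  \<comment> \<open>The rate (1/4)^n for squared distances becomes (1/2)^n for L^1 distances, which
    is summable.\<close>
  have "\<exists>r. \<forall>n. (\<forall>i\<ge>r n. \<forall>j\<ge>r n. sqint (\<lambda>x. f i x - f j x) < (1/4)^n) \<and> Suc (r n) \<le> r (Suc n)"
  proof (rule dependent_nat_choice)
    show "\<exists>N. \<forall>i\<ge>N. \<forall>j\<ge>N. sqint (\<lambda>x. f i x - f j x) < (1/4)^0" using ex[of 0 0] by blast
    show "\<exists>N. (\<forall>i\<ge>N. \<forall>j\<ge>N. sqint (\<lambda>x. f i x - f j x) < (1/4)^Suc n) \<and> Suc M \<le> N" for M n
      using ex[of "Suc M" "Suc n"] by blast
  qed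
  then obtain r where r: "\<And>n i j. i \<ge> r n \<Longrightarrow> j \<ge> r n \<Longrightarrow> sqint (\<lambda>x. f i x - f j x) < (1/4)^n"
    and "\<And>n. r n < r (Suc n)" by (auto simp: Suc_le_eq)
  then have mono: "strict_mono r" by (simp add: strict_mono_Suc_iff)
  define c where "c = sqrt (measure m UNIV)"
  have d: "(\<integral>\<^sup>+x. ennreal \<bar>f (r (Suc n)) x - f (r n) x\<bar> \<partial>m) \<le> ennreal (c * (1/2)^n)" for n
  proof -
    have "(LINT x|m. \<bar>f (r (Suc n)) x - f (r n) x\<bar>) \<le> c * sqrt (LINT x|m. (f (r (Suc n)) x - f (r n) x)\<^sup>2)"
      unfolding c_def by (rule L1_le_L2[OF L2_diff[OF f f]])
    also have "\<dots> \<le> c * sqrt ((1/4)^n)"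
      using r[of n "r (Suc n)" "r n"] mono
      by (intro mult_left_mono real_sqrt_le_mono) (auto simp: c_def strict_mono_def less_imp_le)
    also have "sqrt ((1/4)^n) = (1/2::real)^n"
      by (simp add: real_sqrt_power real_sqrt_divide)
    finally show ?thesis
      using nn_integral_eq_integral[OF integrable_abs[OF L2_integrable[OF L2_diff[OF f f]]], of "r (Suc n)" "r n"]
      by (simp add: ennreal_leI)
  qed
  have "(\<integral>\<^sup>+x. (\<Sum>n. ennreal \<bar>f (r (Suc n)) x - f (r n) x\<bar>) \<partial>m)
      = (\<Sum>n. \<integral>\<^sup>+x. ennreal \<bar>f (r (Suc n)) x - f (r n) x\<bar> \<partial>m)"
    by (rule nn_integral_suminf) measurable
  also have "\<dots> \<le> (\<Sum>n. ennreal (c * (1/2)^n))" by (intro suminf_le d) auto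
  also have "\<dots> = ennreal (\<Sum>n. c * (1/2)^n)"
    by (rule suminf_ennreal2) (auto simp: c_def intro!: summable_mult)
  finally have "(\<integral>\<^sup>+x. (\<Sum>n. ennreal \<bar>f (r (Suc n)) x - f (r n) x\<bar>) \<partial>m) \<noteq> \<infinity>"
    by (auto simp: top_unique)
  then have "AE x in m. (\<Sum>n. ennreal \<bar>f (r (Suc n)) x - f (r n) x\<bar>) \<noteq> \<infinity>"
    by (intro nn_integral_PInf_AE) auto
  then have conv: "AE x in m. convergent (\<lambda>n. f (r n) x)"
  proof eventually_elim
    case (elim x)
    have "summable (\<lambda>n. \<bar>f (r (Suc n)) x - f (r n) x\<bar>)"
      using elim by (intro summable_suminf_not_top) auto
    then have "summable (\<lambda>n. f (r (Suc n)) x - f (r n) x)" by (rule summable_rabs_cancel)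
    then have "convergent (\<lambda>n. \<Sum>i<n. f (r (Suc i)) x - f (r i) x)"
      by (simp add: summable_iff_convergent)
    then have "convergent (\<lambda>n. f (r n) x - f (r 0) x)" by (simp add: sum_lessThan_telescope[of "\<lambda>i. f (r i) x"])
    then have "convergent (\<lambda>n. (f (r n) x - f (r 0) x) + f (r 0) x)" by (rule convergent_add[OF _ convergent_const])
    then show ?case by simp
  qed
  define g where "g x = lim (\<lambda>n. f (r n) x)" for x
  have [measurable]: "g \<in> borel_measurable borel"
    unfolding g_def by (intro borel_measurable_lim_metric) measurable
  have lim: "AE x in m. (\<lambda>n. f (r n) x) \<longlonglongrightarrow> g x"
    using conv by eventually_elim (simp add: g_def convergent_LIMSEQ_iff)
  \<comment> \<open>Fatou along the subsequence bounds the distance from the limit to every late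
    member of the whole sequence, not only of the subsequence.\<close>
  have fatou: "(\<integral>\<^sup>+x. ennreal ((f i x - g x)\<^sup>2) \<partial>m) \<le> ennreal ((1/4)^n)" if "i \<ge> r n" for i n
  proof -
    have "(\<integral>\<^sup>+x. ennreal ((f i x - g x)\<^sup>2) \<partial>m)
        = (\<integral>\<^sup>+x. liminf (\<lambda>k. ennreal ((f i x - f (r k) x)\<^sup>2)) \<partial>m)"
    proof (rule nn_integral_cong_AE, use lim in eventually_elim)
      case (elim x)
      have "(\<lambda>k. ennreal ((f i x - f (r k) x)\<^sup>2)) \<longlonglongrightarrow> ennreal ((f i x - g x)\<^sup>2)"
        using elim by (intro tendsto_intros)
      then show ?case by (metis lim_imp_Liminf sequentially_bot)
    qed
    also have "\<dots> \<le> liminf (\<lambda>k. \<integral>\<^sup>+x. ennreal ((f i x - f (r k) x)\<^sup>2) \<partial>m)"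
      by (rule nn_integral_liminf) measurable
    also have "\<dots> \<le> ennreal ((1/4)^n)"
    proof (intro Liminf_le eventually_sequentiallyI[of n])
      fix k assume "n \<le> k"
      then have "r n \<le> r k" using mono by (simp add: strict_mono_less_eq)
      then have "(LINT x|m. (f i x - f (r k) x)\<^sup>2) < (1/4)^n" using r that by blast
      then show "(\<integral>\<^sup>+x. ennreal ((f i x - f (r k) x)\<^sup>2) \<partial>m) \<le> ennreal ((1/4)^n)"
        using nn_integral_eq_integral[OF L2_square[OF L2_diff[OF f f]], of i "r k"]
        by (simp add: ennreal_leI)
    qed simp
    finally show ?thesis .
  qed
  have diff: "(\<lambda>x. f i x - g x) \<in> L2 m" if "i \<ge> r n" for i n
    using le_less_trans[OF fatou[OF that] ennreal_less_top] by (simp add: L2_def integrable_iff_bounded)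
  have gL2: "g \<in> L2 m"
    using L2_diff[OF f[of "r 0"] diff[of 0 "r 0"]] by simp
  show ?thesis
  proof (rule that[OF gL2])
    show "(\<lambda>n. \<integral>x. (f n x - g x)\<^sup>2 \<partial>m) \<longlonglongrightarrow> 0"
    proof (rule LIMSEQ_I)
      fix e :: real assume "e > 0"
      then obtain k where k: "(1/4)^k < e" using real_arch_pow_inv[of e "1/4"] by auto
      have "sqint (\<lambda>x. f n x - g x) < e" if "n \<ge> r k" for n
      proof -
        have "sqint (\<lambda>x. f n x - g x) \<le> (1/4)^k"
          using fatou[OF that] nn_integral_eq_integral[OF L2_square[OF L2_diff[OF f gL2]], of n]
          by (simp add: ennreal_le_iff)
        with k show ?thesis by simp
      qed
      moreover have "0 \<le> sqint (\<lambda>x. f n x - g x)" for n by (rule Bochner_Integration.integral_nonneg) simp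
      ultimately have "\<forall>n\<ge>r k. norm (sqint (\<lambda>x. f n x - g x) - 0) < e"
        by (metis abs_of_nonneg diff_zero real_norm_def)
      then show "\<exists>no. \<forall>n\<ge>no. norm (sqint (\<lambda>x. f n x - g x) - 0) < e" by blast
    qed
  qed
qed

end

section \<open>Pointwise Lipschitz constants and Sobolev functions\<close>

text \<open>Radii 1 / Suc n suffice, so that measurability of \<open>lip f\<close> can be read off
  from a countable infimum.\<close>

lemma lip_eq_INF:
  fixes f :: "'x::metric_space \<Rightarrow> real"
  shows "lip f x = (INF n. SUP y\<in>ball x (1 / Suc n) - {x}. ennreal (\<bar>f y - f x\<bar> / dist y x))"
proof (unfold lip_def Limsup_at, rule antisym)
  show "(INF e\<in>{0<..}. SUP y\<in>ball x e - {x}. ennreal (\<bar>f y - f x\<bar> / dist y x))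
      \<le> (INF n. SUP y\<in>ball x (1 / Suc n) - {x}. ennreal (\<bar>f y - f x\<bar> / dist y x))"
    by (rule INF_greatest, rule INF_lower2[where i = "1 / Suc _"]) auto
  show "(INF n. SUP y\<in>ball x (1 / Suc n) - {x}. ennreal (\<bar>f y - f x\<bar> / dist y x))
      \<le> (INF e\<in>{0<..}. SUP y\<in>ball x e - {x}. ennreal (\<bar>f y - f x\<bar> / dist y x))"
  proof (rule INF_greatest)
    fix e :: real assume "e \<in> {0<..}"
    then obtain n where n: "1 / Suc n < e" using nat_approx_posE by auto
    then have "ball x (1 / Suc n) - {x} \<subseteq> ball x e - {x}" by (intro Diff_mono subset_ball) auto
    then show "(INF n. SUP y\<in>ball x (1 / Suc n) - {x}. ennreal (\<bar>f y - f x\<bar> / dist y x))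
      \<le> (SUP y\<in>ball x e - {x}. ennreal (\<bar>f y - f x\<bar> / dist y x))"
      by (intro INF_lower2[where i = n] SUP_subset_mono) auto
  qed
qed

text \<open>For a fixed radius the supremum of the difference quotients is lower semicontinuous in
  x: for each y, the points x near y, different from y and with quotient above c form an open
  set.\<close>

lemma borel_measurable_lip:
  fixes f :: "'x::metric_space \<Rightarrow> real"
  assumes f: "continuous_on UNIV f"
  shows "lip f \<in> borel_measurable borel"
proof -
  define q where "q n x = (SUP y\<in>ball x (1 / Suc n) - {x}. ennreal (\<bar>f y - f x\<bar> / dist y x))" for n x
  have "open {x. c < q n x}" for n c
  proof -
    have "{x. c < q n x} = (\<Union>y. {x. dist x y < 1 / Suc n \<and> x \<noteq> y \<and> c < ennreal (\<bar>f y - f x\<bar> / dist y x)})"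
      by (auto simp: q_def less_SUP_iff)
    also have "open \<dots>"
    proof (intro open_UN ballI)
      fix y
      have "{x. dist x y < 1 / Suc n \<and> x \<noteq> y \<and> c < ennreal (\<bar>f y - f x\<bar> / dist y x)}
          = (ball y (1 / Suc n) - {y}) \<inter> (\<lambda>x. ennreal (\<bar>f y - f x\<bar> / dist y x)) -` {c<..}"
        by (auto simp: dist_commute)
      also have "open \<dots>"
      proof (rule continuous_open_preimage)
        show "continuous_on (ball y (1 / Suc n) - {y}) (\<lambda>x. ennreal (\<bar>f y - f x\<bar> / dist y x))"
          by (intro continuous_on_ennreal continuous_intros continuous_on_subset[OF f subset_UNIV]) auto
      qed auto
      finally show "open {x. dist x y < 1 / Suc n \<and> x \<noteq> y \<and> c < ennreal (\<bar>f y - f x\<bar> / dist y x)}" .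
    qed
    finally show ?thesis .
  qed
  then have "q n \<in> borel_measurable borel" for n by (intro borel_measurableI_greater) auto
  then have "(\<lambda>x. INF n. q n x) \<in> borel_measurable borel" by (intro borel_measurable_INF) auto
  moreover have "lip f = (\<lambda>x. INF n. q n x)" by (simp add: fun_eq_iff lip_eq_INF q_def)
  ultimately show ?thesis by simp
qed

lemma LIPb_continuous: "f \<in> LIPb \<Longrightarrow> continuous_on UNIV f"
  unfolding LIPb_def using lipschitz_on_continuous_on by blast

lemma LIPb_lip_bounded:
  assumes "f \<in> LIPb"
  obtains L where "L \<ge> 0" "\<And>x. lip f x \<le> ennreal L"
proof -
  obtain L where L: "L-lipschitz_on UNIV f" using assms by (auto simp: LIPb_def)
  have "lip f x \<le> ennreal L" for x
    unfolding lip_def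
  proof (rule Limsup_bounded, rule always_eventually, rule allI)
    fix y
    have "\<bar>f y - f x\<bar> \<le> L * dist y x" using lipschitz_onD[OF L, of y x] by (simp add: dist_real_def)
    then have "\<bar>f y - f x\<bar> / dist y x \<le> L"
      using lipschitz_on_nonneg[OF L] by (cases "x = y") (auto simp: field_simps)
    then show "ennreal (\<bar>f y - f x\<bar> / dist y x) \<le> ennreal L" by (rule ennreal_leI)
  qed
  then show ?thesis using that lipschitz_on_nonneg[OF L] by blast
qed

lemma LIPb_add:
  assumes "f \<in> LIPb" "g \<in> LIPb" shows "(\<lambda>x. f x + g x) \<in> LIPb"
proof -
  have "bounded (range (\<lambda>x. f x + g x))"
    using assms by (auto simp: LIPb_def intro: bounded_plus_comp)
  moreover obtain L M where "L-lipschitz_on UNIV f" "M-lipschitz_on UNIV g" using assms by (auto simp: LIPb_def)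
  then have "(L + M)-lipschitz_on UNIV (\<lambda>x. f x + g x)" by (rule lipschitz_on_add)
  ultimately show ?thesis by (auto simp: LIPb_def)
qed

lemma LIPb_scale:
  assumes "f \<in> LIPb" shows "(\<lambda>x. c * f x) \<in> LIPb"
proof -
  have "bounded (range (\<lambda>x. c * f x))"
    using assms bounded_scaleR_comp[of f UNIV c] by (simp add: LIPb_def)
  moreover obtain L where "L-lipschitz_on UNIV f" using assms by (auto simp: LIPb_def)
  then have "(\<bar>c\<bar> * L)-lipschitz_on UNIV (\<lambda>x. c * f x)" by (rule lipschitz_on_cmult_real)
  ultimately show ?thesis by (auto simp: LIPb_def)
qed

text \<open>Real-valued slope. On \<open>LIPb\<close> it carries the same information as
  \<open>lip\<close>, which is finite there.\<close>

definition rlip :: "('x::metric_space \<Rightarrow> real) \<Rightarrow> 'x \<Rightarrow> real" where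
  "rlip f x = enn2real (lip f x)"

lemma LIPb_lip_eq: "f \<in> LIPb \<Longrightarrow> lip f x = ennreal (rlip f x)"
  unfolding rlip_def by (rule LIPb_lip_bounded, assumption)
    (metis ennreal_enn2real ennreal_less_top le_less_trans)

lemma rlip_nonneg [simp]: "0 \<le> rlip f x"
  by (simp add: rlip_def)

text \<open>Together with \<open>rlip_less\<close> this trades the upper limit for eventual bounds
  on difference quotients; the slack e is needed because the upper limit does not bound the
  quotients themselves. Sublinearity of \<open>rlip\<close> is proved through this pair.\<close>

lemma rlip_le:
  assumes f: "f \<in> LIPb" and ev: "\<And>e. e > 0 \<Longrightarrow> eventually (\<lambda>z. \<bar>f z - f x\<bar> / dist z x \<le> C + e) (at x)" and "C \<ge> 0"
  shows "rlip f x \<le> C"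
proof -
  have "lip f x \<le> ennreal C"
  proof (rule ennreal_le_epsilon)
    fix e :: real assume "e > 0"
    have "lip f x \<le> ennreal (C + e)"
      unfolding lip_def using ev[OF \<open>e > 0\<close>] by (intro Limsup_bounded) (auto elim!: eventually_mono intro: ennreal_leI)
    then show "lip f x \<le> ennreal C + ennreal e" using \<open>e > 0\<close> \<open>C \<ge> 0\<close> by simp
  qed
  then show ?thesis using \<open>C \<ge> 0\<close> by (simp add: LIPb_lip_eq[OF f])
qed

lemma rlip_less:
  assumes f: "f \<in> LIPb" and "rlip f x < C"
  shows "eventually (\<lambda>z. \<bar>f z - f x\<bar> / dist z x \<le> C) (at x)"
proof -
  have "0 \<le> C" using assms(2) rlip_nonneg[of f x] by linarith
  then have "lip f x < ennreal C" using assms(2) by (simp add: LIPb_lip_eq[OF f] ennreal_less_iff)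
  then have "eventually (\<lambda>z. ennreal (\<bar>f z - f x\<bar> / dist z x) < ennreal C) (at x)"
    unfolding lip_def by (rule Limsup_lessD)
  then show ?thesis using \<open>0 \<le> C\<close> by (auto elim!: eventually_mono simp: ennreal_less_iff)
qed

lemma rlip_add:
  assumes f: "f \<in> LIPb" and g: "g \<in> LIPb"
  shows "rlip (\<lambda>x. f x + g x) x \<le> rlip f x + rlip g x"
proof (rule rlip_le[OF LIPb_add[OF f g]])
  fix e :: real assume "e > 0"
  then have "eventually (\<lambda>z. \<bar>f z - f x\<bar> / dist z x \<le> rlip f x + e / 2) (at x)"
    "eventually (\<lambda>z. \<bar>g z - g x\<bar> / dist z x \<le> rlip g x + e / 2) (at x)"
    by (auto intro!: rlip_less f g)
  then show "eventually (\<lambda>z. \<bar>f z + g z - (f x + g x)\<bar> / dist z x \<le> rlip f x + rlip g x + e) (at x)"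
  proof eventually_elim
    case (elim z)
    have "\<bar>f z + g z - (f x + g x)\<bar> / dist z x \<le> \<bar>f z - f x\<bar> / dist z x + \<bar>g z - g x\<bar> / dist z x"
      unfolding add_divide_distrib[symmetric] by (intro divide_right_mono) auto
    with elim show ?case by linarith
  qed
qed simp

lemma rlip_scale:
  assumes f: "f \<in> LIPb" shows "rlip (\<lambda>x. c * f x) x \<le> \<bar>c\<bar> * rlip f x"
proof (rule rlip_le[OF LIPb_scale[OF f]])
  fix e :: real assume "e > 0"
  \<comment> \<open>The denominator \<bar>c\<bar> + 1 is positive also for c = 0 and leaves an error
    of at most e after multiplication by \<bar>c\<bar>.\<close>
  then have "eventually (\<lambda>z. \<bar>f z - f x\<bar> / dist z x \<le> rlip f x + e / (\<bar>c\<bar> + 1)) (at x)"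
    by (intro rlip_less f) simp
  then show "eventually (\<lambda>z. \<bar>c * f z - c * f x\<bar> / dist z x \<le> \<bar>c\<bar> * rlip f x + e) (at x)"
  proof eventually_elim
    case (elim z)
    have "\<bar>c * f z - c * f x\<bar> / dist z x = \<bar>c\<bar> * (\<bar>f z - f x\<bar> / dist z x)"
      by (simp add: abs_mult flip: right_diff_distrib)
    also have "\<dots> \<le> \<bar>c\<bar> * (rlip f x + e / (\<bar>c\<bar> + 1))" using elim by (rule mult_left_mono) simp
    also have "\<dots> = \<bar>c\<bar> * rlip f x + e * (\<bar>c\<bar> / (\<bar>c\<bar> + 1))" by (simp add: algebra_simps)
    also have "\<dots> \<le> \<bar>c\<bar> * rlip f x + e * 1" using \<open>e > 0\<close> by (intro add_left_mono mult_left_mono) auto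
    finally show ?case by simp
  qed
qed simp

context finite_borel
begin

lemma LIPb_L2:
  assumes "f \<in> LIPb" shows "f \<in> L2 m"
proof -
  obtain C where C: "\<And>x. \<bar>f x\<bar> \<le> C" using assms by (auto simp: LIPb_def bounded_iff)
  have "f \<in> borel_measurable borel"
    using LIPb_continuous[OF assms] by (rule borel_measurable_continuous_onI)
  then show ?thesis using C by (intro L2_bounded[where C = C]) auto
qed

lemma rlip_L2:
  assumes "f \<in> LIPb" shows "rlip f \<in> L2 m"
proof -
  note borel_measurable_lip[OF LIPb_continuous[OF assms], measurable]
  obtain L where L: "L \<ge> 0" "\<And>x. lip f x \<le> ennreal L" using LIPb_lip_bounded[OF assms] by blast
  have "rlip f x \<le> L" for x using L(2)[of x] L(1) by (simp add: LIPb_lip_eq[OF assms])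
  then have "AE x in m. \<bar>rlip f x\<bar> \<le> L" by simp
  moreover have "rlip f \<in> borel_measurable borel" unfolding rlip_def[abs_def] by measurable
  ultimately show ?thesis by (intro L2_bounded)
qed

lemma nn_integral_lip:
  assumes "f \<in> LIPb"
  shows "(\<integral>\<^sup>+ x. (lip f x)\<^sup>2 \<partial>m) = ennreal (sqint (rlip f))"
  using nn_integral_eq_integral[OF L2_square[OF rlip_L2[OF assms]]]
  by (simp add: LIPb_lip_eq[OF assms] ennreal_power)

text \<open>A finite lower limit lies below some C, and infinitely many members of the sequence then
  have energy at most C, so a subsequence has uniformly bounded energy. In this form the vector
  space operations on \<open>W12 m\<close> are immediate from sublinearity of
  \<open>rlip\<close>.\<close>

lemma W12_iff:
  "f \<in> W12 m \<longleftrightarrow> f \<in> L2 m \<and> (\<exists>F C. (\<forall>k. F k \<in> LIPb \<and> sqint (rlip (F k)) \<le> C) \<and> tendsto_L2 m F f)"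
  (is "_ \<longleftrightarrow> _ \<and> ?R")
proof -
  have half: "a / 2 < \<infinity> \<longleftrightarrow> a < \<infinity>" for a :: ennreal
    by (cases a) (auto simp: ennreal_top_divide ennreal_divide_numeral)
  have "Ch m f < \<infinity> \<longleftrightarrow> ?R"
  proof
    assume "Ch m f < \<infinity>"
    then have "(INF F \<in> {F. (\<forall>k. F k \<in> LIPb \<inter> L2 m) \<and> tendsto_L2 m F f}.
               liminf (\<lambda>k. \<integral>\<^sup>+ x. (lip (F k) x)\<^sup>2 \<partial>m)) < \<infinity>"
      unfolding Ch_def half .
    then obtain F where F: "\<And>k. F k \<in> LIPb" "tendsto_L2 m F f"
      and lim: "liminf (\<lambda>k. \<integral>\<^sup>+ x. (lip (F k) x)\<^sup>2 \<partial>m) < \<infinity>"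
      by (auto simp: INF_less_iff)
    then obtain C where C: "liminf (\<lambda>k. \<integral>\<^sup>+ x. (lip (F k) x)\<^sup>2 \<partial>m) < ennreal C" "C \<ge> 0"
    proof (cases "liminf (\<lambda>k. \<integral>\<^sup>+ x. (lip (F k) x)\<^sup>2 \<partial>m)")
      case (real r)
      then show ?thesis by (intro that[of "r + 1"]) (auto simp: ennreal_less_iff)
    qed (auto simp: lim)
    have "\<exists>k>n. sqint (rlip (F k)) \<le> C" for n :: nat
    proof (rule ccontr)
      assume "\<not> (\<exists>k>n. sqint (rlip (F k)) \<le> C)"
      then have "\<And>k. k \<ge> Suc n \<Longrightarrow> ennreal C \<le> (\<integral>\<^sup>+ x. (lip (F k) x)\<^sup>2 \<partial>m)"
        by (auto simp: nn_integral_lip[OF F(1)] Suc_le_eq not_le less_imp_le intro!: ennreal_leI)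
      then have "ennreal C \<le> liminf (\<lambda>k. \<integral>\<^sup>+ x. (lip (F k) x)\<^sup>2 \<partial>m)"
        by (intro Liminf_bounded eventually_sequentiallyI)
      with C show False by simp
    qed
    note ex = this
    have "\<exists>r. \<forall>n::nat. (LINT x|m. (rlip (F (r n)) x)\<^sup>2) \<le> C \<and> r n < r (Suc n)"
    proof (rule dependent_nat_choice)
      show "\<exists>k. sqint (rlip (F k)) \<le> C" using ex[of 0] by blast
      show "\<exists>l. sqint (rlip (F l)) \<le> C \<and> k < l" for k using ex[of k] by blast
    qed
    then obtain r :: "nat \<Rightarrow> nat" where r: "\<And>n. (LINT x|m. (rlip (F (r n)) x)\<^sup>2) \<le> C" "strict_mono r"
      by (auto simp: strict_mono_Suc_iff)
    have "tendsto_L2 m (\<lambda>n. F (r n)) f"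
      using LIMSEQ_subseq_LIMSEQ[OF F(2)[unfolded tendsto_L2_def] r(2)] by (simp add: tendsto_L2_def o_def)
    with F(1) r(1) show ?R by (intro exI[of _ "\<lambda>n. F (r n)"] exI[of _ C]) simp
  next
    assume ?R
    then obtain F C where F: "\<And>k. F k \<in> LIPb" "\<And>k. sqint (rlip (F k)) \<le> C" "tendsto_L2 m F f"
      by blast
    have "(INF F \<in> {F. (\<forall>k. F k \<in> LIPb \<inter> L2 m) \<and> tendsto_L2 m F f}.
               liminf (\<lambda>k. \<integral>\<^sup>+ x. (lip (F k) x)\<^sup>2 \<partial>m)) \<le> liminf (\<lambda>k. \<integral>\<^sup>+ x. (lip (F k) x)\<^sup>2 \<partial>m)"
      by (intro INF_lower) (auto simp: F LIPb_L2)
    also have "\<dots> \<le> ennreal C"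
      using F(1,2) by (intro Liminf_le) (auto simp: nn_integral_lip ennreal_leI)
    also have "\<dots> < \<infinity>" by simp
    finally show "Ch m f < \<infinity>" unfolding Ch_def half .
  qed
  then show ?thesis by (simp add: W12_def)
qed

lemma W12_L2: "f \<in> W12 m \<Longrightarrow> f \<in> L2 m"
  by (simp add: W12_def)

lemma tendsto_L2_add:
  assumes "\<And>k. F k \<in> L2 m" "f \<in> L2 m" "\<And>k. G k \<in> L2 m" "g \<in> L2 m" "tendsto_L2 m F f" "tendsto_L2 m G g"
  shows "tendsto_L2 m (\<lambda>k x. F k x + G k x) (\<lambda>x. f x + g x)"
proof -
  have lim: "(\<lambda>k. 2 * sqint (\<lambda>x. F k x - f x) + 2 * sqint (\<lambda>x. G k x - g x)) \<longlonglongrightarrow> 2 * 0 + 2 * 0"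
    using assms by (intro tendsto_intros) (auto simp: tendsto_L2_iff)
  have le: "(LINT x|m. (F k x + G k x - (f x + g x))\<^sup>2)
      \<le> 2 * sqint (\<lambda>x. F k x - f x) + 2 * sqint (\<lambda>x. G k x - g x)" for k
  proof -
    note 1 = L2_diff[OF assms(1,2), of k] and 2 = L2_diff[OF assms(3,4), of k]
    have eq: "F k x + G k x - (f x + g x) = (F k x - f x) + (G k x - g x)" for x by simp
    have "(LINT x|m. (F k x + G k x - (f x + g x))\<^sup>2) \<le> (LINT x|m. 2 * (F k x - f x)\<^sup>2 + 2 * (G k x - g x)\<^sup>2)"
      unfolding eq
    proof (rule integral_mono)
      show "(F k x - f x + (G k x - g x))\<^sup>2 \<le> 2 * (F k x - f x)\<^sup>2 + 2 * (G k x - g x)\<^sup>2" for x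
        using sum_squares_bound[of "F k x - f x" "G k x - g x"] by (simp add: power2_sum)
    qed (use L2_square[OF L2_add[OF 1 2]] L2_square[OF 1] L2_square[OF 2] in auto)
    then show ?thesis using L2_square[OF 1] L2_square[OF 2] by simp
  qed
  have "(\<lambda>k. \<integral>x. (F k x + G k x - (f x + g x))\<^sup>2 \<partial>m) \<longlonglongrightarrow> 0"
  proof (rule tendsto_sandwich)
    show "eventually (\<lambda>k. 0 \<le> (LINT x|m. (F k x + G k x - (f x + g x))\<^sup>2)) sequentially" by simp
    show "eventually (\<lambda>k. (LINT x|m. (F k x + G k x - (f x + g x))\<^sup>2)
        \<le> 2 * sqint (\<lambda>x. F k x - f x) + 2 * sqint (\<lambda>x. G k x - g x)) sequentially"
      by (rule always_eventually, rule allI, rule le)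
    show "(\<lambda>k. 2 * sqint (\<lambda>x. F k x - f x) + 2 * sqint (\<lambda>x. G k x - g x)) \<longlonglongrightarrow> 0"
      using lim by (simp only: mult_zero_right add_0_right)
  qed (rule tendsto_const)
  then show ?thesis using assms by (subst tendsto_L2_iff) (auto intro: L2_add)
qed

lemma W12_add:
  assumes "f \<in> W12 m" "g \<in> W12 m"
  shows "(\<lambda>x. f x + g x) \<in> W12 m"
proof -
  obtain F C where F: "\<And>k. F k \<in> LIPb" "\<And>k. sqint (rlip (F k)) \<le> C" "tendsto_L2 m F f"
    using assms(1) unfolding W12_iff by blast
  obtain G D where G: "\<And>k. G k \<in> LIPb" "\<And>k. sqint (rlip (G k)) \<le> D" "tendsto_L2 m G g"
    using assms(2) unfolding W12_iff by blast
  have "(LINT x|m. (rlip (\<lambda>x. F k x + G k x) x)\<^sup>2) \<le> 2 * C + 2 * D" for k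
  proof -
    have "(LINT x|m. (rlip (\<lambda>x. F k x + G k x) x)\<^sup>2) \<le> (LINT x|m. 2 * (rlip (F k) x)\<^sup>2 + 2 * (rlip (G k) x)\<^sup>2)"
    proof (rule integral_mono)
      fix x
      have "(rlip (\<lambda>x. F k x + G k x) x)\<^sup>2 \<le> (rlip (F k) x + rlip (G k) x)\<^sup>2"
        using rlip_add[OF F(1) G(1)] by (intro power_mono) auto
      also have "\<dots> \<le> 2 * (rlip (F k) x)\<^sup>2 + 2 * (rlip (G k) x)\<^sup>2"
        using sum_squares_bound[of "rlip (F k) x" "rlip (G k) x"] by (simp add: power2_sum)
      finally show "(rlip (\<lambda>x. F k x + G k x) x)\<^sup>2 \<le> 2 * (rlip (F k) x)\<^sup>2 + 2 * (rlip (G k) x)\<^sup>2" .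
    qed (use L2_square[OF rlip_L2[OF LIPb_add[OF F(1) G(1)]], of k k] L2_square[OF rlip_L2[OF F(1)], of k] L2_square[OF rlip_L2[OF G(1)], of k] in auto)
    also have "(LINT x|m. 2 * (rlip (F k) x)\<^sup>2 + 2 * (rlip (G k) x)\<^sup>2) = 2 * sqint (rlip (F k)) + 2 * sqint (rlip (G k))"
      using L2_square[OF rlip_L2[OF F(1)], of k] L2_square[OF rlip_L2[OF G(1)], of k] by simp
    finally show ?thesis using F(2)[of k] G(2)[of k] by simp
  qed
  moreover have "tendsto_L2 m (\<lambda>k x. F k x + G k x) (\<lambda>x. f x + g x)"
    using F G assms by (intro tendsto_L2_add) (auto intro: LIPb_L2 W12_L2)
  ultimately show ?thesis
    unfolding W12_iff using L2_add[OF assms[THEN W12_L2]] LIPb_add[OF F(1) G(1)]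
    by (intro conjI exI[of _ "\<lambda>k x. F k x + G k x"] exI[of _ "2 * C + 2 * D"] allI)
qed

lemma W12_scale:
  assumes "f \<in> W12 m"
  shows "(\<lambda>x. c * f x) \<in> W12 m"
proof -
  obtain F C where F: "\<And>k. F k \<in> LIPb" "\<And>k. sqint (rlip (F k)) \<le> C" "tendsto_L2 m F f"
    using assms(1) unfolding W12_iff by blast
  have "(LINT x|m. (rlip (\<lambda>x. c * F k x) x)\<^sup>2) \<le> c\<^sup>2 * C" for k
  proof -
    have "(LINT x|m. (rlip (\<lambda>x. c * F k x) x)\<^sup>2) \<le> (LINT x|m. c\<^sup>2 * (rlip (F k) x)\<^sup>2)"
    proof (rule integral_mono)
      fix x
      have "(rlip (\<lambda>x. c * F k x) x)\<^sup>2 \<le> (\<bar>c\<bar> * rlip (F k) x)\<^sup>2"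
        using rlip_scale[OF F(1)] by (intro power_mono) auto
      then show "(rlip (\<lambda>x. c * F k x) x)\<^sup>2 \<le> c\<^sup>2 * (rlip (F k) x)\<^sup>2" by (simp add: power_mult_distrib)
    qed (use L2_square[OF rlip_L2[OF LIPb_scale[OF F(1)]], of c k] L2_square[OF rlip_L2[OF F(1)], of k] in auto)
    also have "\<dots> \<le> c\<^sup>2 * C" using F(2)[of k] by (simp add: mult_left_mono)
    finally show ?thesis .
  qed
  moreover have "tendsto_L2 m (\<lambda>k x. c * F k x) (\<lambda>x. c * f x)"
  proof -
    have "(\<lambda>k. c\<^sup>2 * sqint (\<lambda>x. F k x - f x)) \<longlonglongrightarrow> c\<^sup>2 * 0"
      using F assms by (intro tendsto_intros) (auto simp: tendsto_L2_iff LIPb_L2 W12_L2)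
    moreover have "(LINT x|m. (c * F k x - c * f x)\<^sup>2) = c\<^sup>2 * sqint (\<lambda>x. F k x - f x)" for k
      by (simp flip: right_diff_distrib add: power_mult_distrib)
    ultimately show ?thesis using F assms by (subst tendsto_L2_iff) (auto intro: L2_scale LIPb_L2 W12_L2)
  qed
  ultimately show ?thesis
    unfolding W12_iff using L2_scale[OF W12_L2[OF assms]] LIPb_scale[OF F(1)]
    by (intro conjI exI[of _ "\<lambda>k x. c * F k x"] exI[of _ "c\<^sup>2 * C"] allI)
qed

lemma W12_zero: "(\<lambda>_. 0) \<in> W12 m"
proof -
  have "(\<lambda>_. 0 :: real) \<in> LIPb" by (auto simp: LIPb_def intro: lipschitz_on_constant)
  then show ?thesis unfolding W12_iff
    by (intro conjI exI[of _ "\<lambda>_ _. 0"] exI[of _ "\<integral>x. (rlip (\<lambda>_. 0) x)\<^sup>2 \<partial>m"]) (auto simp: tendsto_L2_def)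
qed

end

section \<open>Minimal relaxed slopes and their uniqueness\<close>

context finite_borel
begin

lemma L2_norm_tendsto:
  assumes c: "\<And>n. c n \<in> L2 m" and h: "h \<in> L2 m" and lim: "(\<lambda>n. \<integral>x. (c n x - h x)\<^sup>2 \<partial>m) \<longlonglongrightarrow> 0"
  shows "(\<lambda>n. \<integral>x. (c n x)\<^sup>2 \<partial>m) \<longlonglongrightarrow> sqint h"
proof -
  define d where "d n = sqrt (sqint (\<lambda>x. c n x - h x))" for n
  have d0: "d \<longlonglongrightarrow> 0" unfolding d_def[abs_def] using tendsto_real_sqrt[OF lim] by simp
  have "\<bar>sqrt (sqint (c n)) - sqrt (sqint h)\<bar> \<le> d n" for n
    using L2_minkowski[OF L2_diff[OF c[of n] h] h] L2_minkowski[OF L2_diff[OF h c[of n]] c[of n]]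
    by (simp add: d_def power2_commute[of "h _"] abs_le_iff)
  then have "(\<lambda>n. sqrt (sqint (c n))) \<longlonglongrightarrow> sqrt (sqint h)"
    using Lim_null_comparison[OF always_eventually d0, of "\<lambda>n. sqrt (sqint (c n)) - sqrt (sqint h)"]
    by (simp add: LIM_zero_iff)
  from tendsto_power[OF this, of 2] show ?thesis by simp
qed

text \<open>The projection argument in a Hilbert space: for i \<le> j the midpoint of c i and c j
  lies in C i, so the parallelogram law bounds their squared distance by 2 (a j - a i) + 4 / Suc i
  with a n the squared norms. A constant family gives the usual minimizing sequence, a decreasing
  one is needed for slopes.\<close>

lemma L2_nested_minimizing:
  assumes C: "\<And>n. C n \<subseteq> L2 m" "decseq C"
    and mid: "\<And>n a b. a \<in> C n \<Longrightarrow> b \<in> C n \<Longrightarrow> (\<lambda>x. (a x + b x) / 2) \<in> C n"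
    and c: "\<And>n. c n \<in> C n" "\<And>n y. y \<in> C n \<Longrightarrow> sqint (c n) \<le> sqint y + 1 / Suc n"
    and B: "\<And>n. sqint (c n) \<le> B"
  obtains h where "h \<in> L2 m" "(\<lambda>n. \<integral>x. (c n x - h x)\<^sup>2 \<partial>m) \<longlonglongrightarrow> 0"
proof -
  have cL2: "c n \<in> L2 m" for n using c(1) C(1) by blast
  define a where "a n = sqint (c n)" for n
  \<comment> \<open>The squared norms need not increase, but a i - 1 / Suc i lies below every later
    a j; hence both a n and these lowered values cluster at this supremum.\<close>
  define S where "S = (SUP n. a n - 1 / Suc n)"
  have cC: "c j \<in> C i" if "i \<le> j" for i j using c(1)[of j] decseqD[OF C(2) that] by blast
  have aa: "a i - 1 / Suc i \<le> a j" if "i \<le> j" for i j using c(2)[OF cC[OF that]] by (simp add: a_def)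
  have bdd: "bdd_above (range (\<lambda>n. a n - 1 / Suc n))"
  proof (rule bdd_aboveI2)
    show "a n - 1 / Suc n \<le> B" for n
    proof -
      have "0 \<le> 1 / real (Suc n)" by simp
      with B[of n] show ?thesis unfolding a_def by linarith
    qed
  qed
  define u where "u n = 1 / real (Suc n)" for n
  have diff: "sqint (\<lambda>x. c i x - c j x) \<le> 2 * (a j - a i) + 4 * u i" if "i \<le> j" for i j
    using L2_parallelogram[OF cL2 cL2, of i j] c(2)[OF mid[OF c(1) cC[OF that]]] unfolding a_def u_def by argo
  have cauchy: "\<exists>N. \<forall>i\<ge>N. \<forall>j\<ge>N. sqint (\<lambda>x. c i x - c j x) < e" if "e > 0" for e
  proof -
    \<comment> \<open>With e / 16 one has a j - a i < e / 8 and 1 / Suc i < e / 16, so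
      \<open>diff\<close> yields less than e / 4 + e / 4.\<close>
    have "S - e / 16 < S" using that by simp
    then have "\<exists>i. S - e / 16 < a i - 1 / Suc i"
      using less_cSUP_iff[OF UNIV_not_empty bdd, of "S - e / 16"] unfolding S_def by blast
    then obtain i0 where i0: "S - e / 16 < a i0 - 1 / Suc i0" by blast
    have "e / 16 > 0" using that by simp
    then obtain k where k: "1 / Suc k < e / 16" using nat_approx_posE by blast
    define N where "N = max i0 k"
    have small: "u i < e / 16" if "i \<ge> N" for i
    proof -
      have "1 / real (Suc i) \<le> 1 / real (Suc k)" using that by (intro divide_left_mono) (auto simp: N_def)
      with k show ?thesis unfolding u_def by linarith
    qed
    have low: "S - e / 16 < a i" if "i \<ge> N" for i
      using aa[of i0 i] i0 that by (simp add: N_def)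
    have up: "a i < S + e / 16" if "i \<ge> N" for i
      using cSUP_upper[OF UNIV_I bdd, of i, folded S_def] small[OF that] unfolding u_def by linarith
    have main: "sqint (\<lambda>x. c i x - c j x) < e" if "i \<ge> N" "i \<le> j" for i j
    proof -
      have "j \<ge> N" using that by simp
      from diff[OF that(2)] low[OF that(1)] up[OF \<open>j \<ge> N\<close>] small[OF that(1)] \<open>e > 0\<close>
      show ?thesis by argo
    qed
    show ?thesis
    proof (intro exI allI impI)
      fix i j assume "i \<ge> N" "j \<ge> N"
      then show "sqint (\<lambda>x. c i x - c j x) < e"
        using main[of i j] main[of j i] by (cases "i \<le> j") (auto simp: power2_commute[of "c i _"])
    qed
  qed
  show ?thesis using L2_complete[OF cL2 cauchy] that by blast
qed

text \<open>The infimum may fail to be attained, since the sets in question are not known to be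
  closed; hence the slack e.\<close>

lemma L2_near_minimizer:
  fixes C :: "('x \<Rightarrow> real) set"
  assumes "C \<noteq> {}" "e > 0"
  obtains c where "c \<in> C" "\<And>y. y \<in> C \<Longrightarrow> sqint c \<le> sqint y + e"
proof -
  define q where "q y = sqint y" for y :: "'x \<Rightarrow> real"
  have bdd: "bdd_below (q ` C)" by (rule bdd_belowI2[where m = 0]) (simp add: q_def)
  have "Inf (q ` C) < Inf (q ` C) + e" using assms by simp
  then obtain c where "c \<in> C" "q c < Inf (q ` C) + e"
    using cInf_less_iff[of "q ` C"] bdd assms by blast
  moreover have "Inf (q ` C) \<le> q y" if "y \<in> C" for y using that bdd by (intro cInf_lower) auto
  ultimately have "q c \<le> q y + e" if "y \<in> C" for y using that by fastforce
  with \<open>c \<in> C\<close> show ?thesis by (intro that[of c]) (auto simp: q_def)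
qed

text \<open>A form of Mazur's lemma: the element of minimal norm \<open>h\<close> of the closure of \<open>C\<close> satisfies
  \<open>\<integral> h y \<ge> \<integral> h\<^sup>2\<close> for all \<open>y\<close> in \<open>C\<close>.\<close>

lemma weak_limit_approximable:
  assumes C: "C \<subseteq> L2 m"
    and conv: "\<And>a b t. a \<in> C \<Longrightarrow> b \<in> C \<Longrightarrow> 0 \<le> t \<Longrightarrow> t \<le> 1 \<Longrightarrow> (\<lambda>x. (1 - t) * a x + t * b x) \<in> C"
    and y: "\<And>k. y k \<in> C" "\<And>h. h \<in> L2 m \<Longrightarrow> (\<lambda>k. \<integral>x. y k x * h x \<partial>m) \<longlonglongrightarrow> 0" and "e > 0"
  obtains c where "c \<in> C" "sqint c < e"
proof -
  have "C \<noteq> {}" using y(1) by blast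
  then have "\<exists>c\<in>C. \<forall>y\<in>C. sqint c \<le> sqint y + 1 / Suc n" for n
    using L2_near_minimizer[of C "1 / Suc n"] by (metis of_nat_0_less_iff zero_less_Suc zero_less_divide_1_iff)
  then obtain c where c: "\<And>n. c n \<in> C" "\<And>n y. y \<in> C \<Longrightarrow> sqint (c n) \<le> sqint y + 1 / Suc n"
    by metis
  have cL2: "c n \<in> L2 m" for n using c(1) C by blast
  have cB: "sqint (c n) \<le> sqint (c 0) + 1" for n
    using c(2)[OF c(1), of n 0] by (rule order_trans) simp
  have mid: "(\<lambda>x. (a x + b x) / 2) \<in> C" if "a \<in> C" "b \<in> C" for a b
  proof -
    have "(\<lambda>x. (1 - 1 / 2) * a x + 1 / 2 * b x) = (\<lambda>x. (a x + b x) / 2)" by (simp add: fun_eq_iff field_simps)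
    then show ?thesis using conv[OF that, of "1/2"] by simp
  qed
  obtain h where h: "h \<in> L2 m" "(\<lambda>n. \<integral>x. (c n x - h x)\<^sup>2 \<partial>m) \<longlonglongrightarrow> 0"
    by (rule L2_nested_minimizing[of "\<lambda>_. C" c, OF C _ mid c cB]) (auto simp: decseq_def)
  note lim = L2_norm_tendsto[OF cL2 h]
  define A where "A = sqint h"
  \<comment> \<open>The limit \<open>h\<close> need not belong to \<open>C\<close>, so its
    minimality along segments towards elements of \<open>C\<close> is obtained by passing to the
    limit in that of the near-minimizers \<open>c n\<close>.\<close>
  have min: "A \<le> (LINT x|m. ((1 - t) * h x + t * z x)\<^sup>2)" if z: "z \<in> C" and t: "0 \<le> t" "t \<le> 1" for z t
  proof -
    define w where "w n x = (1 - t) * c n x + t * z x" for n x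
    define w0 where "w0 x = (1 - t) * h x + t * z x" for x
    have w: "w n \<in> C" for n unfolding w_def using conv[OF c(1) z t] .
    have w0: "w0 \<in> L2 m" unfolding w0_def using z C h(1) by (intro L2_add L2_scale) auto
    have "(\<lambda>n. (1 - t)\<^sup>2 * sqint (\<lambda>x. c n x - h x)) \<longlonglongrightarrow> (1 - t)\<^sup>2 * 0"
      by (intro tendsto_intros h)
    moreover have "(1 - t)\<^sup>2 * sqint (\<lambda>x. c n x - h x) = sqint (\<lambda>x. w n x - w0 x)" for n
    proof -
      have "(w n x - w0 x)\<^sup>2 = (1 - t)\<^sup>2 * (c n x - h x)\<^sup>2" for x
        by (simp add: w_def w0_def flip: right_diff_distrib power_mult_distrib)
      then show ?thesis by simp
    qed
    ultimately have "(\<lambda>n. \<integral>x. (w n x - w0 x)\<^sup>2 \<partial>m) \<longlonglongrightarrow> 0" by simp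
    then have wl: "(\<lambda>n. \<integral>x. (w n x)\<^sup>2 \<partial>m) \<longlonglongrightarrow> sqint w0"
      using w C w0 by (intro L2_norm_tendsto) auto
    have "(\<lambda>n. sqint (w n) + 1 / Suc n) \<longlonglongrightarrow> sqint w0 + 0"
      by (intro tendsto_add wl lim_1_over_n[THEN LIMSEQ_Suc])
    then have "A \<le> sqint w0 + 0"
      unfolding A_def by (rule LIMSEQ_le[OF lim]) (use c(2)[OF w] in blast)
    then show ?thesis by (simp add: w0_def)
  qed
  \<comment> \<open>First variation at \<open>h\<close>: if the product integral B were below A,
    moving slightly from \<open>h\<close> towards z would decrease the squared norm.\<close>
  have Ale: "A \<le> (LINT x|m. z x * h x)" if z: "z \<in> C" for z
  proof (rule ccontr)
    define B where "B = (LINT x|m. z x * h x)"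
    define D where "D = sqint z"
    assume "\<not> A \<le> (LINT x|m. z x * h x)"
    then have AB: "A - B > 0" by (simp add: B_def)
    have zL: "z \<in> L2 m" using z C by blast
    define M where "M = \<bar>A - 2 * B + D\<bar> + 1"
    \<comment> \<open>With t * M \<le> A - B the quadratic term of the expansion is at most half of
      the linear gain 2 (A - B).\<close>
    define t where "t = min 1 ((A - B) / M)"
    have M: "M > 0" by (simp add: M_def)
    have t: "0 < t" "t \<le> 1" "t * M \<le> A - B" using AB M by (auto simp: t_def min_def field_simps)
    have "A \<le> (LINT x|m. ((1 - t) * h x + t * z x)\<^sup>2)" using min[OF z] t by simp
    also have "\<dots> = (LINT x|m. (1 - t)\<^sup>2 * (h x)\<^sup>2 + (t\<^sup>2 * (z x)\<^sup>2 + 2 * (1 - t) * t * (z x * h x)))"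
      by (intro Bochner_Integration.integral_cong) (auto simp: power2_eq_square algebra_simps)
    also have "\<dots> = (1 - t)\<^sup>2 * A + (t\<^sup>2 * D + 2 * (1 - t) * t * B)"
      using L2_square[OF h(1)] L2_square[OF zL] L2_product[OF zL h(1)] by (simp add: A_def B_def D_def)
    finally have "t * (2 * (A - B)) \<le> t * (t * (A - 2 * B + D))" by (simp add: power2_eq_square algebra_simps)
    then have "2 * (A - B) \<le> t * (A - 2 * B + D)" using t by simp
    also have "\<dots> \<le> t * M" using t by (intro mult_left_mono) (auto simp: M_def)
    finally show False using t AB by simp
  qed
  \<comment> \<open>Here the weak convergence to 0 of the given sequence enters, tested against
    \<open>h\<close> itself.\<close>
  have "A \<le> 0" using LIMSEQ_le_const[OF y(2)[OF h(1)]] Ale[OF y(1)] by blast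
  then have "sqint h < e" using \<open>e > 0\<close> by (simp add: A_def)
  then have "eventually (\<lambda>n. sqint (c n) < e) sequentially" by (rule order_tendstoD(2)[OF lim])
  then obtain N where "\<forall>n\<ge>N. sqint (c n) < e" unfolding eventually_sequentially by blast
  then have "sqint (c N) < e" by simp
  with c(1) show ?thesis by (rule that)
qed

text \<open>Upper bounds of slopes are collected instead of slopes: since \<open>rlip\<close> is
  only sublinear, a convex combination of slopes need not be a slope, but it bounds the slope of the
  combined function. This makes the set convex.\<close>

definition near_slopes :: "('x \<Rightarrow> real) \<Rightarrow> real \<Rightarrow> ('x \<Rightarrow> real) set" where
  "near_slopes f e = {h \<in> L2 m. \<exists>F\<in>LIPb. sqint (\<lambda>x. F x - f x) \<le> e \<and> (AE x in m. rlip F x \<le> h x)}"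

lemma near_slopes_convex:
  assumes f: "f \<in> L2 m" and a: "a \<in> near_slopes f e" and b: "b \<in> near_slopes f e" and t: "0 \<le> t" "t \<le> 1"
  shows "(\<lambda>x. (1 - t) * a x + t * b x) \<in> near_slopes f e"
proof -
  obtain F where F: "F \<in> LIPb" "sqint (\<lambda>x. F x - f x) \<le> e" "AE x in m. rlip F x \<le> a x"
    using a by (auto simp: near_slopes_def)
  obtain G where G: "G \<in> LIPb" "sqint (\<lambda>x. G x - f x) \<le> e" "AE x in m. rlip G x \<le> b x"
    using b by (auto simp: near_slopes_def)
  define E where "E x = (1 - t) * F x + t * G x" for x
  note FG = LIPb_scale[OF F(1), of "1 - t"] LIPb_scale[OF G(1), of t]
  have E: "E \<in> LIPb" unfolding E_def by (rule LIPb_add[OF FG])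
  have "rlip E x \<le> (1 - t) * rlip F x + t * rlip G x" for x
    using rlip_add[OF FG, of x] rlip_scale[OF F(1), of "1 - t" x] rlip_scale[OF G(1), of t x] t
    by (simp add: E_def[abs_def])
  note E_le = this
  have slope: "AE x in m. rlip E x \<le> (1 - t) * a x + t * b x"
    using F(3) G(3)
  proof eventually_elim
    case (elim x)
    have "(1 - t) * rlip F x + t * rlip G x \<le> (1 - t) * a x + t * b x"
      using elim t by (intro add_mono mult_left_mono) auto
    with E_le show ?case by (rule order_trans)
  qed
  note 1 = L2_diff[OF LIPb_L2[OF F(1)] f] and 2 = L2_diff[OF LIPb_L2[OF G(1)] f]
  have "sqint (\<lambda>x. E x - f x) \<le> (LINT x|m. (1 - t) * (F x - f x)\<^sup>2 + t * (G x - f x)\<^sup>2)"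
  proof (rule integral_mono)
    show "(E x - f x)\<^sup>2 \<le> (1 - t) * (F x - f x)\<^sup>2 + t * (G x - f x)\<^sup>2" for x
    proof -
      have "(1 - t) * (F x - f x)\<^sup>2 + t * (G x - f x)\<^sup>2 - (E x - f x)\<^sup>2 = t * (1 - t) * (F x - G x)\<^sup>2"
        unfolding E_def by (simp add: power2_eq_square algebra_simps)
      moreover have "0 \<le> t * (1 - t) * (F x - G x)\<^sup>2" using t by simp
      ultimately show ?thesis by linarith
    qed
  qed (use L2_square[OF 1] L2_square[OF 2] L2_square[OF L2_diff[OF LIPb_L2[OF E] f]] in auto)
  also have "\<dots> = (1 - t) * sqint (\<lambda>x. F x - f x) + t * sqint (\<lambda>x. G x - f x)"
    using L2_square[OF 1] L2_square[OF 2] by simp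
  also have "\<dots> \<le> (1 - t) * e + t * e" using F(2) G(2) t by (intro add_mono mult_left_mono) auto
  finally have "sqint (\<lambda>x. E x - f x) \<le> e" by (simp add: algebra_simps)
  moreover have "(\<lambda>x. (1 - t) * a x + t * b x) \<in> L2 m"
    using a b by (intro L2_add L2_scale) (auto simp: near_slopes_def)
  ultimately show ?thesis using E slope by (auto simp: near_slopes_def)
qed

lemma relaxed_slope_alt:
  "relaxed_slope m f G \<longleftrightarrow> G \<in> L2 m \<and> (\<exists>F H. (\<forall>k. F k \<in> LIPb) \<and> tendsto_L2 m F f \<and> H \<in> L2 m
      \<and> (\<forall>h \<in> L2 m. (\<lambda>k. \<integral>x. rlip (F k) x * h x \<partial>m) \<longlonglongrightarrow> (LINT x|m. H x * h x))
      \<and> (AE x in m. H x \<le> G x))"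
proof -
  have "(F k \<in> LIPb \<inter> L2 m \<and> (\<lambda>x. enn2real (lip (F k) x)) \<in> L2 m) \<longleftrightarrow> F k \<in> LIPb" for F :: "nat \<Rightarrow> 'x \<Rightarrow> real" and k
    using rlip_L2[of "F k"] LIPb_L2[of "F k"] by (auto simp: rlip_def[abs_def])
  then show ?thesis by (simp add: relaxed_slope_def rlip_def[symmetric])
qed

text \<open>Mazur: the slopes converge only weakly to H, but convex combinations of them come close
  in norm and stay in the convex set \<open>near_slopes f e\<close>.\<close>

lemma relaxed_slope_approx:
  assumes f: "f \<in> L2 m" and G: "relaxed_slope m f G" and "e > 0"
  obtains h where "h \<in> near_slopes f e" "sqint (\<lambda>x. h x - G x) < e"
proof -
  obtain F H where F: "\<And>k. F k \<in> LIPb" "tendsto_L2 m F f" and H: "H \<in> L2 m"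
      "\<And>h. h \<in> L2 m \<Longrightarrow> (\<lambda>k. \<integral>x. rlip (F k) x * h x \<partial>m) \<longlonglongrightarrow> (LINT x|m. H x * h x)"
      "AE x in m. H x \<le> G x" and GL: "G \<in> L2 m"
    using G unfolding relaxed_slope_alt by blast
  have "(\<lambda>k. \<integral>x. (F k x - f x)\<^sup>2 \<partial>m) \<longlonglongrightarrow> 0" using F LIPb_L2 f by (simp add: tendsto_L2_iff)
  then have "eventually (\<lambda>k. sqint (\<lambda>x. F k x - f x) < e) sequentially"
    using \<open>e > 0\<close> by (rule order_tendstoD)
  then obtain N where "\<forall>k\<ge>N. sqint (\<lambda>x. F k x - f x) < e" unfolding eventually_sequentially by blast
  then have N: "sqint (\<lambda>x. F k x - f x) \<le> e" if "k \<ge> N" for k using that less_imp_le by blast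
  \<comment> \<open>Translation by H turns the weak limit into 0; dropping the first N members of
    the sequence puts all slopes that are used into \<open>near_slopes f e\<close>.\<close>
  define C where "C = {c \<in> L2 m. (\<lambda>x. c x + H x) \<in> near_slopes f e}"
  obtain c where c: "c \<in> C" "sqint c < e"
  proof (rule weak_limit_approximable[of C "\<lambda>k x. rlip (F (k + N)) x - H x" e])
    show "C \<subseteq> L2 m" by (auto simp: C_def)
    show "(\<lambda>x. (1 - t) * a x + t * b x) \<in> C" if "a \<in> C" "b \<in> C" "0 \<le> t" "t \<le> 1" for a b t
    proof -
      have "(\<lambda>x. (1 - t) * (a x + H x) + t * (b x + H x)) \<in> near_slopes f e"
        using that by (intro near_slopes_convex f) (auto simp: C_def)
      moreover have "(1 - t) * (a x + H x) + t * (b x + H x) = (1 - t) * a x + t * b x + H x" for x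
        by (simp add: algebra_simps)
      moreover have "(\<lambda>x. (1 - t) * a x + t * b x) \<in> L2 m" using that by (intro L2_add L2_scale) (auto simp: C_def)
      ultimately show ?thesis by (simp add: C_def)
    qed
    show "(\<lambda>x. rlip (F (k + N)) x - H x) \<in> C" for k
      using F(1)[of "k + N"] N[of "k + N"] rlip_L2[OF F(1), of "k + N"] H(1)
      by (auto simp: C_def near_slopes_def intro!: L2_diff bexI[of _ "F (k + N)"])
    show "(\<lambda>k. \<integral>x. (rlip (F (k + N)) x - H x) * h x \<partial>m) \<longlonglongrightarrow> 0" if h: "h \<in> L2 m" for h
    proof -
      have "(LINT x|m. (rlip (F (k + N)) x - H x) * h x) = (LINT x|m. rlip (F (k + N)) x * h x) - (LINT x|m. H x * h x)" for k
        using L2_product[OF rlip_L2[OF F(1)] h, of "k + N"] L2_product[OF H(1) h] by (simp add: left_diff_distrib)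
      then show ?thesis using LIMSEQ_ignore_initial_segment[OF H(2)[OF h], of N] by (simp add: LIM_zero)
    qed
  qed (rule \<open>e > 0\<close>, blast)
  \<comment> \<open>H may lie strictly below G. Enlarging a slope bound keeps it in
    \<open>near_slopes f e\<close>, so the same small correction c serves for G.\<close>
  have "(\<lambda>x. c x + G x) \<in> near_slopes f e"
  proof -
    have cH: "(\<lambda>x. c x + H x) \<in> near_slopes f e" "c \<in> L2 m" using c by (auto simp: C_def)
    then obtain E where E: "E \<in> LIPb" "sqint (\<lambda>x. E x - f x) \<le> e" "AE x in m. rlip E x \<le> c x + H x"
      by (auto simp: near_slopes_def)
    from E(3) H(3) have "AE x in m. rlip E x \<le> c x + G x" by eventually_elim simp
    with E(1,2) show ?thesis using L2_add[OF cH(2) GL] by (auto simp: near_slopes_def)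
  qed
  then show ?thesis by (rule that) (use c in simp)
qed

text \<open>Near-minimal elements of the decreasing sets \<open>near_slopes f (1 / Suc n)\<close>
  converge strongly to a relaxed slope H. The approximations of g lie in the same sets, so the norm
  of H cannot exceed that of g; no pointwise comparison of H with g results.\<close>

lemma relaxed_slope_of_approx:
  assumes f: "f \<in> L2 m" and g: "g \<in> L2 m"
    and approx: "\<And>e. e > 0 \<Longrightarrow> \<exists>h\<in>near_slopes f e. sqint (\<lambda>x. h x - g x) \<le> e"
  obtains H where "relaxed_slope m f H" "sqint H \<le> sqint g"
proof -
  define K where "K n = near_slopes f (1 / Suc n)" for n
  have "\<exists>h\<in>K n. sqint (\<lambda>x. h x - g x) \<le> 1 / Suc n" for n unfolding K_def by (rule approx) simp
  then obtain h where h: "\<And>n. h n \<in> K n" "\<And>n. sqint (\<lambda>x. h n x - g x) \<le> 1 / Suc n" by metis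
  have KL2: "K n \<subseteq> L2 m" for n by (auto simp: K_def near_slopes_def)
  have "(\<lambda>n. \<integral>x. (h n x - g x)\<^sup>2 \<partial>m) \<longlonglongrightarrow> 0"
    by (rule tendsto_sandwich[OF _ _ tendsto_const lim_1_over_n[THEN LIMSEQ_Suc]])
      (use h in \<open>auto intro!: always_eventually\<close>)
  then have hlim: "(\<lambda>n. \<integral>x. (h n x)\<^sup>2 \<partial>m) \<longlonglongrightarrow> sqint g"
    using h(1) KL2 g by (intro L2_norm_tendsto) auto
  have "\<exists>F. F \<in> LIPb \<and> sqint (\<lambda>x. F x - f x) \<le> 1 / Suc n
      \<and> (\<forall>y\<in>K n. sqint (rlip F) \<le> sqint y + 1 / Suc n)" for n
  proof -
    obtain c where c: "c \<in> K n" "\<And>y. y \<in> K n \<Longrightarrow> sqint c \<le> sqint y + 1 / Suc n"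
      using L2_near_minimizer[of "K n" "1 / Suc n"] h(1)[of n]
      by (metis empty_iff of_nat_0_less_iff zero_less_Suc zero_less_divide_1_iff)
    obtain F where F: "F \<in> LIPb" "sqint (\<lambda>x. F x - f x) \<le> 1 / Suc n" "AE x in m. rlip F x \<le> c x" and cL: "c \<in> L2 m"
      using c(1) by (auto simp: K_def near_slopes_def)
    \<comment> \<open>Passing from the bound c to the slope below it only lowers the norm, so the
      sequence remains near-minimal and consists of genuine slopes, as a relaxed slope
      demands.\<close>
    have "sqint (rlip F) \<le> sqint c"
    proof (intro integral_mono_AE L2_square rlip_L2 F cL)
      show "AE x in m. (rlip F x)\<^sup>2 \<le> (c x)\<^sup>2" using F(3) by eventually_elim (simp add: power_mono)
    qed
    then have "\<forall>y\<in>K n. sqint (rlip F) \<le> sqint y + 1 / Suc n"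
      using c(2) order_trans by blast
    with F show ?thesis by blast
  qed
  then have "\<forall>n. \<exists>F. F \<in> LIPb \<and> sqint (\<lambda>x. F x - f x) \<le> 1 / Suc n
      \<and> (\<forall>y\<in>K n. sqint (rlip F) \<le> sqint y + 1 / Suc n)" ..
  from choice[OF this] obtain F where F': "\<forall>n. F n \<in> LIPb \<and> sqint (\<lambda>x. F n x - f x) \<le> 1 / Suc n
      \<and> (\<forall>y\<in>K n. sqint (rlip (F n)) \<le> sqint y + 1 / Suc n)" ..
  have F: "F n \<in> LIPb" "sqint (\<lambda>x. F n x - f x) \<le> 1 / Suc n"
    "y \<in> K n \<Longrightarrow> sqint (rlip (F n)) \<le> sqint y + 1 / Suc n" for n y
    using F'[rule_format, of n] by auto
  have "Bseq (\<lambda>n. \<integral>x. (h n x)\<^sup>2 \<partial>m)" by (rule convergent_imp_Bseq[OF convergentI[OF hlim]])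
  then obtain B where "\<forall>n. norm (sqint (h n)) \<le> B" unfolding Bseq_def by blast
  then have B: "sqint (h n) \<le> B" for n using abs_le_D1 unfolding real_norm_def by blast
  obtain H where H: "H \<in> L2 m" "(\<lambda>n. \<integral>x. (rlip (F n) x - H x)\<^sup>2 \<partial>m) \<longlonglongrightarrow> 0"
  proof (rule L2_nested_minimizing[of K "\<lambda>n. rlip (F n)" "B + 1"])
    show "decseq K"
    proof (rule decseq_SucI)
      show "K (Suc n) \<subseteq> K n" for n
      proof -
        have "1 / real (Suc (Suc n)) \<le> 1 / real (Suc n)" by (intro divide_left_mono) auto
        then have "a \<le> 1 / real (Suc n)" if "a \<le> 1 / real (Suc (Suc n))" for a using that by linarith
        then show ?thesis unfolding K_def near_slopes_def by blast
      qed
    qed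
    show "(\<lambda>x. (a x + b x) / 2) \<in> K n" if "a \<in> K n" "b \<in> K n" for a b n
    proof -
      have "(\<lambda>x. (1 - 1 / 2) * a x + 1 / 2 * b x) = (\<lambda>x. (a x + b x) / 2)" by (simp add: fun_eq_iff field_simps)
      then show ?thesis using near_slopes_convex[OF f that[unfolded K_def], of "1/2"] by (simp add: K_def)
    qed
    show "rlip (F n) \<in> K n" for n using F rlip_L2 by (auto simp: K_def near_slopes_def)
    show "sqint (rlip (F n)) \<le> B + 1" for n
    proof -
      have "1 / real (Suc n) \<le> 1" by simp
      with F(3)[OF h(1)[of n]] B[of n] show ?thesis by linarith
    qed
  qed (rule KL2, rule F(3), blast+)
  have rl: "rlip (F n) \<in> L2 m" for n using rlip_L2 F by blast
  have "relaxed_slope m f H"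
    unfolding relaxed_slope_alt
  proof (intro conjI exI[of _ F] exI[of _ H] ballI allI F H)
    have "(\<lambda>k. \<integral>x. (F k x - f x)\<^sup>2 \<partial>m) \<longlonglongrightarrow> 0"
      by (rule tendsto_sandwich[OF _ _ tendsto_const lim_1_over_n[THEN LIMSEQ_Suc]])
        (use F in \<open>auto intro!: always_eventually\<close>)
    then show "tendsto_L2 m F f" using F LIPb_L2 f by (simp add: tendsto_L2_iff)
    fix q assume q: "q \<in> L2 m"
    have bound: "norm ((LINT x|m. rlip (F k) x * q x) - (LINT x|m. H x * q x))
        \<le> sqrt (LINT x|m. (rlip (F k) x - H x)\<^sup>2) * sqrt (sqint q)" for k
    proof -
      have "(LINT x|m. rlip (F k) x * q x) - (LINT x|m. H x * q x) = (LINT x|m. (rlip (F k) x - H x) * q x)"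
        using L2_product[OF rl q, of k] L2_product[OF H(1) q] by (simp add: left_diff_distrib)
      also have "norm \<dots> \<le> (LINT x|m. \<bar>(rlip (F k) x - H x) * q x\<bar>)" by (simp add: integral_abs_bound)
      also have "\<dots> \<le> sqrt (LINT x|m. (rlip (F k) x - H x)\<^sup>2) * sqrt (sqint q)"
        by (rule cauchy_schwarz[OF L2_diff[OF rl H(1)] q])
      finally show ?thesis .
    qed
    have "(\<lambda>k. sqrt (LINT x|m. (rlip (F k) x - H x)\<^sup>2) * sqrt (sqint q)) \<longlonglongrightarrow> sqrt 0 * sqrt (sqint q)"
      by (intro tendsto_intros H)
    then have "(\<lambda>k. sqrt (LINT x|m. (rlip (F k) x - H x)\<^sup>2) * sqrt (sqint q)) \<longlonglongrightarrow> 0" by simp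
    from Lim_null_comparison[OF always_eventually this, OF allI, OF bound]
    show "(\<lambda>k. \<integral>x. rlip (F k) x * q x \<partial>m) \<longlonglongrightarrow> (LINT x|m. H x * q x)" by (simp add: LIM_zero_iff)
  qed simp
  moreover have "sqint H \<le> sqint g + 0"
    by (rule LIMSEQ_le[OF L2_norm_tendsto[OF rl H] tendsto_add[OF hlim lim_1_over_n[THEN LIMSEQ_Suc]]])
      (use F(3)[OF h(1)] in blast)
  ultimately show ?thesis using that by simp
qed

text \<open>The midpoint of G and G' is again a limit of near slopes, so some relaxed slope has norm
  at most that of the midpoint. Minimality of G and G' and the parallelogram law leave no room for a
  difference. Thus the slope in condition (i) of a couple can be replaced by
  \<open>pn (d f)\<close>.\<close>

lemma minimal_relaxed_slope_unique:
  assumes f: "f \<in> L2 m" and G: "minimal_relaxed_slope m f G" and G': "minimal_relaxed_slope m f G'"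
  shows "AE x in m. G x = G' x"
proof -
  have rs: "relaxed_slope m f G" "relaxed_slope m f G'" using G G' by (auto simp: minimal_relaxed_slope_def)
  then have L2: "G \<in> L2 m" "G' \<in> L2 m" by (auto simp: relaxed_slope_def)
  obtain H where H: "relaxed_slope m f H" "sqint H \<le> (LINT x|m. ((G x + G' x) / 2)\<^sup>2)"
  proof (rule relaxed_slope_of_approx[OF f L2_divide[OF L2_add[OF L2], of 2]])
    fix e :: real assume "e > 0"
    obtain h where h: "h \<in> near_slopes f e" "sqint (\<lambda>x. h x - G x) < e"
      using relaxed_slope_approx[OF f rs(1) \<open>e > 0\<close>] by blast
    obtain h' where h': "h' \<in> near_slopes f e" "(LINT x|m. (h' x - G' x)\<^sup>2) < e"
      using relaxed_slope_approx[OF f rs(2) \<open>e > 0\<close>] by blast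
    have hL: "h \<in> L2 m" "h' \<in> L2 m" using h h' by (auto simp: near_slopes_def)
    note 1 = L2_diff[OF hL(1) L2(1)] and 2 = L2_diff[OF hL(2) L2(2)]
    have "(\<lambda>x. (1 - 1 / 2) * h x + 1 / 2 * h' x) \<in> near_slopes f e"
      by (rule near_slopes_convex[OF f h(1) h'(1)]) auto
    moreover have "(\<lambda>x. (1 - 1 / 2) * h x + 1 / 2 * h' x) = (\<lambda>x. (h x + h' x) / 2)" by (simp add: fun_eq_iff field_simps)
    moreover have "(LINT x|m. ((h x + h' x) / 2 - (G x + G' x) / 2)\<^sup>2) \<le> e"
    proof -
      have eq: "(h x + h' x) / 2 - (G x + G' x) / 2 = ((h x - G x) + (h' x - G' x)) / 2" for x
        by (simp add: field_simps)
      have "0 \<le> (LINT x|m. ((h x - G x) - (h' x - G' x))\<^sup>2)" by simp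
      then show ?thesis using L2_parallelogram[OF 1 2] h(2) h'(2) unfolding eq by linarith
    qed
    ultimately show "\<exists>h\<in>near_slopes f e. (LINT x|m. (h x - (G x + G' x) / 2)\<^sup>2) \<le> e" by auto
  qed
  have "sqint G \<le> sqint H" "(LINT x|m. (G' x)\<^sup>2) \<le> sqint H"
    using G G' H(1) by (auto simp: minimal_relaxed_slope_def)
  then have "(LINT x|m. (G x - G' x)\<^sup>2) \<le> 0" using L2_parallelogram[OF L2] H(2) by simp
  moreover have "0 \<le> (LINT x|m. (G x - G' x)\<^sup>2)" by simp
  ultimately have "(LINT x|m. (G x - G' x)\<^sup>2) = 0" by simp
  then have "AE x in m. (G x - G' x)\<^sup>2 = 0"
    using integral_nonneg_eq_0_iff_AE[OF L2_square[OF L2_diff[OF L2]]] by simp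
  then show ?thesis by eventually_elim simp
qed

end

section \<open>Integration and approximation of sets\<close>

context finite_borel
begin

lemma integrable_indicator_mult [intro]:
  assumes "integrable m h" "A \<in> sets borel"
  shows "integrable m (\<lambda>x. indicat_real A x * h x)"
  using integrable_real_mult_indicator[of A m h] assms by (simp add: mult.commute)

lemma integral_indicator_nonneg:
  assumes "AE x in m. 0 \<le> h x"
  shows "0 \<le> setint A h"
  by (rule integral_nonneg_AE, use assms in eventually_elim) simp

text \<open>The inequality is tested on the set where it fails.\<close>

lemma AE_le_of_set_integrals:
  assumes f: "integrable m f" and g: "integrable m g"
    and le: "\<And>A. A \<in> sets borel \<Longrightarrow> setint A f \<le> setint A g"
  shows "AE x in m. f x \<le> g x"
proof -
  have [measurable]: "f \<in> borel_measurable borel" "g \<in> borel_measurable borel"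
    using f g by (auto dest: borel_measurable_integrable)
  define A where "A = {x. g x < f x}"
  have A: "A \<in> sets borel" unfolding A_def by measurable
  have int: "integrable m (\<lambda>x. indicat_real A x * (f x - g x))" using f g A by auto
  have "(LINT x|m. indicat_real A x * (f x - g x)) = setint A f - setint A g"
    using integrable_indicator_mult[OF f A] integrable_indicator_mult[OF g A] by (simp add: right_diff_distrib)
  then have le0: "(LINT x|m. indicat_real A x * (f x - g x)) \<le> 0" using le[OF A] by simp
  have nn: "0 \<le> indicat_real A x * (f x - g x)" for x by (simp add: A_def indicator_def)
  then have "0 \<le> (LINT x|m. indicat_real A x * (f x - g x))" by simp
  with le0 have "(LINT x|m. indicat_real A x * (f x - g x)) = 0" by linarith
  then have "AE x in m. indicat_real A x * (f x - g x) = 0"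
    using integral_nonneg_eq_0_iff_AE[OF int] nn by simp
  then show ?thesis by eventually_elim (auto simp: A_def indicator_def split: if_splits)
qed

text \<open>The remainder of a union after n sets shrinks to the empty set. Countable additivity of
  the measures built from \<open>N1\<close> is reduced to this.\<close>

lemma integral_tail_tendsto_0:
  assumes h: "integrable m h" and A: "range A \<subseteq> sets borel"
  shows "(\<lambda>n::nat. \<integral>x. indicat_real ((\<Union>i. A i) - (\<Union>i<n. A i)) x * h x \<partial>m) \<longlonglongrightarrow> 0"
proof -
  have A': "A i \<in> sets borel" for i using A by blast
  have [measurable]: "h \<in> borel_measurable borel" using h by (auto dest: borel_measurable_integrable)
  have S: "(\<Union>i. A i) - (\<Union>i<n. A i) \<in> sets borel" for n
    using A' by (intro sets.Diff sets.countable_UN sets.finite_UN) auto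
  have "(\<lambda>n. \<integral>x. indicat_real ((\<Union>i. A i) - (\<Union>i<n. A i)) x * h x \<partial>m) \<longlonglongrightarrow> (LINT x|m. 0)"
  proof (rule integral_dominated_convergence)
    show "integrable m (\<lambda>x. \<bar>h x\<bar>)" using h by simp
    show "(\<lambda>x. indicat_real ((\<Union>i. A i) - (\<Union>i<n. A i)) x * h x) \<in> borel_measurable m" for n
      using S[of n] by simp
    show "AE x in m. (\<lambda>n. indicat_real ((\<Union>i. A i) - (\<Union>i<n. A i)) x * h x) \<longlonglongrightarrow> 0"
    proof (rule AE_I2)
      fix x
      obtain N where N: "x \<notin> (\<Union>i. A i) \<or> x \<in> A N" by blast
      have "indicat_real ((\<Union>i. A i) - (\<Union>i<n. A i)) x * h x = 0" if "n \<ge> Suc N" for n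
      proof -
        have "N \<in> {..<n}" using that by simp
        then have "x \<notin> (\<Union>i. A i) - (\<Union>i<n. A i)" using N by blast
        then show ?thesis by simp
      qed
      then show "(\<lambda>n. indicat_real ((\<Union>i. A i) - (\<Union>i<n. A i)) x * h x) \<longlonglongrightarrow> 0"
        by (intro tendsto_eventually eventually_sequentiallyI[of "Suc N"]) auto
    qed
    show "AE x in m. norm (indicat_real ((\<Union>i. A i) - (\<Union>i<n. A i)) x * h x) \<le> \<bar>h x\<bar>" for n
      by (rule AE_I2) (auto simp: indicator_def)
  qed simp
  then show ?thesis by simp
qed

text \<open>Inner regularity of the finite Borel measure with density h on a Polish space.\<close>

lemma compact_approx:
  assumes h: "integrable m h" and nn: "AE x in m. 0 \<le> h x" and A: "A \<in> sets borel" and "e > 0"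
  obtains K where "compact K" "K \<subseteq> A" "setint (A - K) h < e"
proof -
  have [measurable]: "h \<in> borel_measurable borel" using h by (auto dest: borel_measurable_integrable)
  define M where "M = density m (\<lambda>x. ennreal (h x))"
  have sM: "sets M = sets borel" by (simp add: M_def)
  have em: "emeasure M B = ennreal (setint B h)" if B: "B \<in> sets borel" for B
  proof -
    have "emeasure M B = (\<integral>\<^sup>+x. ennreal (h x) * indicator B x \<partial>m)"
      unfolding M_def using B by (intro emeasure_density) auto
    also have "\<dots> = (\<integral>\<^sup>+x. ennreal (indicat_real B x * h x) \<partial>m)"
      by (rule nn_integral_cong) (auto simp: indicator_def)
    also have "\<dots> = ennreal (setint B h)"
      by (rule nn_integral_eq_integral[OF integrable_indicator_mult[OF h B]], use nn in eventually_elim) simp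
    finally show ?thesis .
  qed
  have fin: "emeasure M (space M) \<noteq> \<infinity>" using em[of UNIV] sets_eq_imp_space_eq[OF sM] by simp
  have inn: "0 \<le> setint B h" for B by (rule integral_indicator_nonneg[OF nn])
  define q where "q B = setint B h" for B
  have qnn: "0 \<le> q B" for B using inn by (simp add: q_def)
  have "\<exists>K. K \<subseteq> A \<and> compact K \<and> q A - e < q K"
  proof (cases "q A < e")
    case True
    then show ?thesis using qnn[of "{}"] by (intro exI[of _ "{}"]) auto
  next
    case False
    have "ennreal (q A - e) < emeasure M A"
      using em[OF A] False \<open>e > 0\<close> by (simp add: q_def ennreal_less_iff)
    also have "emeasure M A = (SUP K \<in> {K. K \<subseteq> A \<and> compact K}. emeasure M K)"
      by (rule inner_regular[OF sM fin A])
    finally obtain K where K: "K \<subseteq> A" "compact K" "ennreal (q A - e) < emeasure M K"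
      unfolding less_SUP_iff by blast
    have "K \<in> sets borel" using K(2) compact_imp_closed by (intro borel_closed) auto
    then have "q A - e < q K" using K(3) em[of K] False by (simp add: q_def ennreal_less_iff)
    with K show ?thesis by blast
  qed
  then obtain K where K: "K \<subseteq> A" "compact K" "q A - e < q K" by blast
  have Kb: "K \<in> sets borel" using K(2) compact_imp_closed by (intro borel_closed) auto
  have "q A = q (A - K) + q K"
  proof -
    have "q (A - K) + q K = (LINT x|m. indicat_real (A - K) x * h x + indicat_real K x * h x)"
      unfolding q_def using Kb A by (intro Bochner_Integration.integral_add[symmetric] integrable_indicator_mult h) auto
    also have "\<dots> = q A" unfolding q_def
      using K(1) by (intro Bochner_Integration.integral_cong) (auto simp: indicator_def)
    finally show ?thesis by simp
  qed
  with K(3) have "q (A - K) < e" by simp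
  then show ?thesis using that[OF K(2,1)] by (simp add: q_def)
qed

end

section \<open>Cutoff functions and uniform approximation by simple functions\<close>

lemma bump_function:
  fixes K :: "'a::metric_space set"
  assumes "r > 0"
  obtains h :: "'a \<Rightarrow>\<^sub>C real" where "\<And>x. 0 \<le> apply_bcontfun h x" "\<And>x. apply_bcontfun h x \<le> 1" "norm h \<le> 1"
    "\<And>x. x \<in> K \<Longrightarrow> apply_bcontfun h x = 1" "supp h \<subseteq> {x. K \<noteq> {} \<and> infdist x K \<le> r}"
proof -
  \<comment> \<open>The distance \<open>infdist x {}\<close> is 0, so an empty \<open>K\<close>
    would yield the constant 1; it is sent to the zero function instead.\<close>
  define f where "f x = (if K = {} then 0 else max 0 (1 - infdist x K / r))" for x
  have bnd: "0 \<le> f x" "f x \<le> 1" for x using assms by (auto simp: f_def infdist_nonneg)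
  have "continuous_on UNIV f"
  proof (cases "K = {}")
    case False
    then have "f = (\<lambda>x. max 0 (1 - infdist x K / r))" by (simp add: f_def fun_eq_iff)
    then show ?thesis using assms by (auto intro!: continuous_intros)
  qed (simp add: f_def[abs_def])
  then have "f \<in> bcontfun" by (rule bcontfun_normI[of _ 1]) (use bnd in simp)
  then have app: "apply_bcontfun (Bcontfun f) = f" by (rule Bcontfun_inverse)
  show ?thesis
  proof (rule that[of "Bcontfun f"])
    show "norm (Bcontfun f) \<le> 1" by (rule norm_bound) (simp add: app bnd)
    show "apply_bcontfun (Bcontfun f) x = 1" if "x \<in> K" for x using that by (auto simp: app f_def)
    show "supp (Bcontfun f) \<subseteq> {x. K \<noteq> {} \<and> infdist x K \<le> r}"
      unfolding supp_def app
    proof (rule closure_minimal)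
      show "{x. f x \<noteq> 0} \<subseteq> {x. K \<noteq> {} \<and> infdist x K \<le> r}"
        using assms by (auto simp: f_def max_def divide_simps split: if_splits)
      show "closed {x. K \<noteq> {} \<and> infdist x K \<le> r}"
        by (cases "K = {}") (auto intro!: closed_Collect_le continuous_intros)
    qed
  qed (simp_all add: app bnd)
qed

lemma separate_compact_closed_metric:
  fixes K :: "'a::metric_space set"
  assumes "compact K" "closed F" "K \<inter> F = {}"
  shows "\<exists>e>0. \<forall>x\<in>K. \<forall>y\<in>F. e \<le> dist x y"
proof (cases "K = {} \<or> F = {}")
  case True
  then show ?thesis by (intro exI[of _ 1]) auto
next
  case False
  have "continuous_on K (\<lambda>x. infdist x F)" by (intro continuous_intros)
  then obtain x0 where x0: "x0 \<in> K" "\<And>x. x \<in> K \<Longrightarrow> infdist x0 F \<le> infdist x F"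
    using continuous_attains_inf[OF assms(1)] False by blast
  have "infdist x0 F \<noteq> 0" using in_closed_iff_infdist_zero[OF assms(2)] False x0(1) assms(3) by blast
  then have "0 < infdist x0 F" using infdist_nonneg[of x0 F] by linarith
  moreover have "infdist x0 F \<le> dist x y" if "x \<in> K" "y \<in> F" for x y
    using x0(2)[OF that(1)] infdist_le[OF that(2), of x] by linarith
  ultimately show ?thesis by blast
qed

text \<open>A compact set has positive distance r from a disjoint closed set. A bump supported
  within r / 2 of \<open>K\<close> therefore has its whole support, not merely its nonzero set, off
  \<open>F\<close>.\<close>

lemma bump_between:
  fixes K :: "'a::metric_space set"
  assumes "compact K" "closed F" "K \<inter> F = {}"
  obtains f :: "'a \<Rightarrow>\<^sub>C real" where "\<And>x. 0 \<le> apply_bcontfun f x" "\<And>x. apply_bcontfun f x \<le> 1" "norm f \<le> 1"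
    "\<And>x. x \<in> K \<Longrightarrow> apply_bcontfun f x = 1" "supp f \<inter> F = {}" "\<And>x. x \<in> F \<Longrightarrow> apply_bcontfun f x = 0"
proof -
  obtain r where r: "r > 0" "\<And>x y. x \<in> K \<Longrightarrow> y \<in> F \<Longrightarrow> r \<le> dist x y"
    using separate_compact_closed_metric[OF assms] by blast
  have "r / 2 > 0" using r(1) by simp
  then obtain f :: "'a \<Rightarrow>\<^sub>C real" where f: "\<And>x. 0 \<le> apply_bcontfun f x" "\<And>x. apply_bcontfun f x \<le> 1" "norm f \<le> 1"
    "\<And>x. x \<in> K \<Longrightarrow> apply_bcontfun f x = 1" "supp f \<subseteq> {x. K \<noteq> {} \<and> infdist x K \<le> r / 2}"
    by (rule bump_function) (rule that)
  have "x \<notin> F" if "x \<in> supp f" for x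
  proof
    assume "x \<in> F"
    have x: "K \<noteq> {}" "infdist x K \<le> r / 2" using f(5) that by auto
    have "r \<le> infdist x K"
      unfolding infdist_notempty[OF x(1)] using x(1) r(2) \<open>x \<in> F\<close> by (intro cINF_greatest) (auto simp: dist_commute)
    with x(2) r(1) show False by simp
  qed
  then have s: "supp f \<inter> F = {}" by blast
  have "apply_bcontfun f x = 0" if "x \<in> F" for x
  proof (rule ccontr)
    assume "apply_bcontfun f x \<noteq> 0"
    then have "x \<in> supp f" unfolding supp_def by (intro subsetD[OF closure_subset]) simp
    then show False using s that by blast
  qed
  with f(1-4) s show ?thesis by (rule that)
qed

text \<open>The level sets are indexed by the integer part j of g / e, with value c j = j e;
  boundedness of g leaves finitely many indices. Some of the sets may be empty.\<close>

lemma finite_level_sets: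
  fixes g :: "'a::topological_space \<Rightarrow> real"
  assumes [measurable]: "g \<in> borel_measurable borel" and C: "\<And>x. \<bar>g x\<bar> \<le> C" and "e > 0"
  obtains J :: "int set" and B c where "finite J" "\<And>j. B j \<in> sets borel" "disjoint_family_on B J"
    "(\<Union>j\<in>J. B j) = UNIV" "\<And>j x. x \<in> B j \<Longrightarrow> \<bar>g x - c j\<bar> \<le> e"
proof -
  define B where "B j = {x. \<lfloor>g x / e\<rfloor> = j}" for j
  define J where "J = {\<lfloor>- C / e\<rfloor>..\<lfloor>C / e\<rfloor>}"
  have "\<lfloor>g x / e\<rfloor> \<in> J" for x
  proof -
    have "- C / e \<le> g x / e" "g x / e \<le> C / e"
      using C[of x] \<open>e > 0\<close> divide_right_mono[of "- C" "g x" e] divide_right_mono[of "g x" C e] by auto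
    then show ?thesis by (auto simp: J_def intro: floor_mono)
  qed
  then have U: "(\<Union>j\<in>J. B j) = UNIV" by (auto simp: B_def)
  have near: "\<bar>g x - real_of_int j * e\<bar> \<le> e" if "x \<in> B j" for j x
  proof -
    have "real_of_int j \<le> g x / e" "g x / e < real_of_int j + 1"
      using that by (auto simp: B_def)
    then have "real_of_int j * e \<le> g x" "g x < (real_of_int j + 1) * e"
      using \<open>e > 0\<close> by (auto simp: pos_le_divide_eq pos_divide_less_eq)
    then show ?thesis by (simp add: algebra_simps)
  qed
  have meas: "B j \<in> sets borel" for j unfolding B_def by measurable
  have disj: "disjoint_family_on B J" by (auto simp: disjoint_family_on_def B_def)
  show ?thesis by (rule that[OF _ meas disj U near]) (simp add: J_def)
qed

lemma simple_approx:
  fixes g :: "'a \<Rightarrow> real"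
  assumes "finite J" "disjoint_family_on B J" "(\<Union>j\<in>J. B j) = UNIV" "\<And>j x. x \<in> B j \<Longrightarrow> \<bar>g x - c j\<bar> \<le> e"
  shows "\<bar>g x - (\<Sum>j\<in>J. c j * indicat_real (B j) x)\<bar> \<le> e"
proof -
  obtain j where j: "j \<in> J" "x \<in> B j" using assms(3) by blast
  have z: "x \<notin> B i" if "i \<in> J - {j}" for i using assms(2) j that by (auto simp: disjoint_family_on_def)
  have "(\<Sum>i\<in>J. c i * indicat_real (B i) x) = c j * indicat_real (B j) x + (\<Sum>i\<in>J - {j}. c i * indicat_real (B i) x)"
    using assms(1) j(1) by (rule sum.remove)
  also have "(\<Sum>i\<in>J - {j}. c i * indicat_real (B i) x) = 0"
    by (rule sum.neutral) (simp add: z)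
  finally show ?thesis using j(2) assms(4)[OF j(2)] by simp
qed

text \<open>Closes the approximation arguments below: an error linear in e suffices, with any factor
  K that does not depend on e.\<close>

lemma real_eq_of_small:
  fixes a b K :: real
  assumes "\<And>e. e > 0 \<Longrightarrow> \<bar>a - b\<bar> \<le> e * K" shows "a = b"
proof (rule ccontr)
  assume "a \<noteq> b"
  then have p: "\<bar>a - b\<bar> > 0" by simp
  define e where "e = \<bar>a - b\<bar> / (2 * (\<bar>K\<bar> + 1))"
  have e: "e > 0" using p by (simp add: e_def)
  have "\<bar>a - b\<bar> \<le> e * K" using assms[OF e] .
  also have "\<dots> \<le> e * (\<bar>K\<bar> + 1)" using e by (intro mult_left_mono) auto
  also have "\<dots> = \<bar>a - b\<bar> / 2" by (simp add: e_def field_simps add_pos_nonneg)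
  finally show False using p by simp
qed

lemma sum_lessThan_add:
  fixes h :: "nat \<Rightarrow> 'a::comm_monoid_add"
  shows "(\<Sum>i<n + k. h i) = (\<Sum>i<n. h i) + (\<Sum>i<k. h (n + i))"
  by (induction k) (simp_all add: add.assoc)

section \<open>The cotangent module\<close>

lemma bcontfun_borel [measurable]: "apply_bcontfun (g :: 'a::topological_space \<Rightarrow>\<^sub>C real) \<in> borel_measurable borel"
  by (intro borel_measurable_continuous_onI) (simp add: continuous_on_apply_bcontfun)

lemma bcontfun_abs_le: "\<bar>apply_bcontfun (g :: 'a::topological_space \<Rightarrow>\<^sub>C real) x\<bar> \<le> norm g"
  using norm_bounded[of g x] by simp

locale cotangent = finite_borel m for m :: "'x::polish_space measure" +
  fixes act :: "('x \<Rightarrow> real) \<Rightarrow> 'c::banach \<Rightarrow> 'c"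
    and pn :: "'c \<Rightarrow> 'x \<Rightarrow> real"
    and d :: "('x \<Rightarrow> real) \<Rightarrow> 'c"
  assumes cotangent: "cotangent_module m act pn d"
begin

lemma module: "L2_normed_module m act pn"
  using cotangent by (simp add: cotangent_module_def)

lemma Linf_iff: "f \<in> Linf m \<longleftrightarrow> f \<in> borel_measurable borel \<and> (\<exists>C. AE x in m. \<bar>f x\<bar> \<le> C)"
  by (simp add: Linf_def)

lemma LinfI: "f \<in> borel_measurable borel \<Longrightarrow> (\<And>x. \<bar>f x\<bar> \<le> C) \<Longrightarrow> f \<in> Linf m"
  unfolding Linf_iff by (intro conjI exI[of _ C] AE_I2)

lemma Linf_const [simp]: "(\<lambda>_. c) \<in> Linf m"
  by (rule LinfI[where C = "\<bar>c\<bar>"]) auto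

lemma Linf_indicator [simp]: "A \<in> sets borel \<Longrightarrow> indicat_real A \<in> Linf m"
  by (rule LinfI[where C = 1]) (auto simp: indicator_def)

lemma Linf_mult [simp]:
  assumes "f \<in> Linf m" "g \<in> Linf m" shows "(\<lambda>x. f x * g x) \<in> Linf m"
proof -
  obtain C where C: "AE x in m. \<bar>f x\<bar> \<le> C" using assms by (auto simp: Linf_iff)
  obtain D where D: "AE x in m. \<bar>g x\<bar> \<le> D" using assms by (auto simp: Linf_iff)
  from C D have "AE x in m. \<bar>f x * g x\<bar> \<le> C * D"
    by eventually_elim (simp add: abs_mult mult_mono')
  then show ?thesis using assms by (auto simp: Linf_iff)
qed

lemma Linf_add [simp]:
  assumes "f \<in> Linf m" "g \<in> Linf m" shows "(\<lambda>x. f x + g x) \<in> Linf m"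
proof -
  obtain C where C: "AE x in m. \<bar>f x\<bar> \<le> C" using assms by (auto simp: Linf_iff)
  obtain D where D: "AE x in m. \<bar>g x\<bar> \<le> D" using assms by (auto simp: Linf_iff)
  from C D have "AE x in m. \<bar>f x + g x\<bar> \<le> C + D" by eventually_elim simp
  then show ?thesis using assms by (auto simp: Linf_iff)
qed

lemma Linf_sum [simp]: "finite I \<Longrightarrow> (\<And>i. i \<in> I \<Longrightarrow> f i \<in> Linf m) \<Longrightarrow> (\<lambda>x. \<Sum>i\<in>I. f i x) \<in> Linf m"
  by (induction I rule: finite_induct) auto

lemma Linf_diff [simp]: "f \<in> Linf m \<Longrightarrow> g \<in> Linf m \<Longrightarrow> (\<lambda>x. f x - g x) \<in> Linf m"
  using Linf_add[OF _ Linf_mult[OF Linf_const[of "- 1"]]] by simp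

lemma bcontfun_Linf [simp]: "apply_bcontfun (g :: 'x \<Rightarrow>\<^sub>C real) \<in> Linf m"
  by (rule LinfI[OF bcontfun_borel bcontfun_abs_le])

lemma act_cong: "f \<in> Linf m \<Longrightarrow> g \<in> Linf m \<Longrightarrow> AE x in m. f x = g x \<Longrightarrow> act f v = act g v"
  by (rule module[unfolded L2_normed_module_def, THEN conjunct1, rule_format])

lemma act_add: "f \<in> Linf m \<Longrightarrow> act f (v + w) = act f v + act f w"
  by (rule module[unfolded L2_normed_module_def, THEN conjunct2, THEN conjunct1, rule_format])

lemma act_plus: "f \<in> Linf m \<Longrightarrow> g \<in> Linf m \<Longrightarrow> act (\<lambda>x. f x + g x) v = act f v + act g v"
  by (rule module[unfolded L2_normed_module_def, THEN conjunct2, THEN conjunct2, THEN conjunct1, rule_format])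

lemma act_times: "f \<in> Linf m \<Longrightarrow> g \<in> Linf m \<Longrightarrow> act (\<lambda>x. f x * g x) v = act f (act g v)"
  by (rule module[unfolded L2_normed_module_def, THEN conjunct2, THEN conjunct2, THEN conjunct2, THEN conjunct1, rule_format])

lemma act_const: "act (\<lambda>_. c) v = c *\<^sub>R v"
  by (rule module[unfolded L2_normed_module_def, THEN conjunct2, THEN conjunct2, THEN conjunct2, THEN conjunct2, THEN conjunct1, rule_format])

lemma pn_L2 [simp]: "pn v \<in> L2 m"
  by (rule module[unfolded L2_normed_module_def, THEN conjunct2, THEN conjunct2, THEN conjunct2, THEN conjunct2, THEN conjunct2, THEN conjunct1, rule_format, THEN conjunct1])

lemma pn_nonneg: "AE x in m. 0 \<le> pn v x"
  by (rule module[unfolded L2_normed_module_def, THEN conjunct2, THEN conjunct2, THEN conjunct2, THEN conjunct2, THEN conjunct2, THEN conjunct1, rule_format, THEN conjunct2])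

lemma norm_pn: "norm v = sqrt (sqint (pn v))"
  by (rule module[unfolded L2_normed_module_def, THEN conjunct2, THEN conjunct2, THEN conjunct2, THEN conjunct2, THEN conjunct2, THEN conjunct2, THEN conjunct1, rule_format])

lemma pn_act: "f \<in> Linf m \<Longrightarrow> AE x in m. pn (act f v) x = \<bar>f x\<bar> * pn v x"
  by (rule module[unfolded L2_normed_module_def, THEN conjunct2, THEN conjunct2, THEN conjunct2, THEN conjunct2, THEN conjunct2, THEN conjunct2, THEN conjunct2, rule_format])

lemma d_cong: "f \<in> W12 m \<Longrightarrow> g \<in> W12 m \<Longrightarrow> AE x in m. f x = g x \<Longrightarrow> d f = d g"
  by (rule cotangent[unfolded cotangent_module_def, THEN conjunct2, THEN conjunct1, rule_format])

lemma d_add: "f \<in> W12 m \<Longrightarrow> g \<in> W12 m \<Longrightarrow> d (\<lambda>x. f x + g x) = d f + d g"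
  by (rule cotangent[unfolded cotangent_module_def, THEN conjunct2, THEN conjunct2, THEN conjunct1, rule_format])

lemma d_scale: "f \<in> W12 m \<Longrightarrow> d (\<lambda>x. c * f x) = c *\<^sub>R d f"
  by (rule cotangent[unfolded cotangent_module_def, THEN conjunct2, THEN conjunct2, THEN conjunct2, THEN conjunct1, rule_format])

lemma d_slope: "f \<in> W12 m \<Longrightarrow> minimal_relaxed_slope m f (pn (d f))"
  by (rule cotangent[unfolded cotangent_module_def, THEN conjunct2, THEN conjunct2, THEN conjunct2, THEN conjunct2, THEN conjunct1, rule_format])

lemma d_dense: "closure {\<Sum>i<n. act (g i) (d (f i)) | (n::nat) g f. \<forall>i<n. g i \<in> Linf m \<and> f i \<in> W12 m} = UNIV"
  by (rule cotangent[unfolded cotangent_module_def, THEN conjunct2, THEN conjunct2, THEN conjunct2, THEN conjunct2, THEN conjunct2])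

lemma pn_borel [measurable]: "pn v \<in> borel_measurable borel"
  using pn_L2 by (rule L2D)

lemma pn_integrable [simp]: "integrable m (pn v)"
  by (rule L2_integrable) simp

lemma linear_act: "f \<in> Linf m \<Longrightarrow> linear (act f)"
proof (rule linearI)
  fix c v assume f: "f \<in> Linf m"
  have "act f (c *\<^sub>R v) = act (\<lambda>x. f x * c) v" using f by (simp add: act_times act_const)
  also have "\<dots> = act (\<lambda>x. c * f x) v" by (simp add: mult.commute)
  also have "\<dots> = c *\<^sub>R act f v" using f by (simp add: act_times[of "\<lambda>_. c"] act_const)
  finally show "act f (c *\<^sub>R v) = c *\<^sub>R act f v" .
qed (rule act_add)

lemma act_one: "act (\<lambda>_. 1) v = v"
  by (simp add: act_const)

lemma act_scaled: "f \<in> Linf m \<Longrightarrow> act (\<lambda>x. c * f x) v = c *\<^sub>R act f v"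
  by (simp add: act_times[of "\<lambda>_. c"] act_const)

lemma act_diff: "f \<in> Linf m \<Longrightarrow> g \<in> Linf m \<Longrightarrow> act (\<lambda>x. f x - g x) v = act f v - act g v"
  using act_plus[of f "\<lambda>x. - 1 * g x" v] act_scaled[of g "- 1" v] Linf_mult[OF Linf_const[of "-1"], of g] by simp

lemma act_sum: "finite I \<Longrightarrow> (\<And>i. i \<in> I \<Longrightarrow> f i \<in> Linf m) \<Longrightarrow> act (\<lambda>x. \<Sum>i\<in>I. f i x) v = (\<Sum>i\<in>I. act (f i) v)"
proof (induction I rule: finite_induct)
  case empty
  show ?case using act_const[of 0 v] by simp
qed (simp add: act_plus)

definition cut :: "'x set \<Rightarrow> 'c \<Rightarrow> 'c" where
  "cut A = act (indicat_real A)"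

lemma linear_cut: "A \<in> sets borel \<Longrightarrow> linear (cut A)"
  by (simp add: cut_def linear_act)

lemma cut_UNIV [simp]: "cut UNIV v = v"
  using act_one by (simp add: cut_def indicator_def[abs_def])

lemma cut_empty [simp]: "cut {} v = 0"
  using act_const[of 0] by (simp add: cut_def indicator_def[abs_def])

lemma cut_cut: "A \<in> sets borel \<Longrightarrow> B \<in> sets borel \<Longrightarrow> cut A (cut B v) = cut (A \<inter> B) v"
  by (simp add: cut_def act_times[symmetric] indicator_inter_arith[symmetric])

lemma cut_UN:
  assumes "finite I" "\<And>i. i \<in> I \<Longrightarrow> A i \<in> sets borel" "disjoint_family_on A I"
  shows "cut (\<Union>i\<in>I. A i) v = (\<Sum>i\<in>I. cut (A i) v)"
proof -
  have "indicat_real (\<Union>i\<in>I. A i) = (\<lambda>x. \<Sum>i\<in>I. indicat_real (A i) x)"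
    by (rule ext) (rule indicator_UN_disjoint[OF assms(1,3)])
  then show ?thesis using assms by (simp add: cut_def act_sum)
qed

lemma cut_Un:
  assumes "A \<in> sets borel" "B \<in> sets borel" "A \<inter> B = {}"
  shows "cut (A \<union> B) v = cut A v + cut B v"
proof -
  have "indicat_real (A \<union> B) = (\<lambda>x. indicat_real A x + indicat_real B x)"
    using assms(3) by (auto simp: fun_eq_iff indicator_def)
  then show ?thesis using assms by (simp add: cut_def act_plus)
qed

lemma pn_cut: "A \<in> sets borel \<Longrightarrow> AE x in m. pn (cut A v) x = indicat_real A x * pn v x"
  using pn_act[of "indicat_real A" v] by (simp add: cut_def)

lemma pn_scale: "AE x in m. pn (c *\<^sub>R v) x = \<bar>c\<bar> * pn v x"
  using pn_act[of "\<lambda>_. c" v] by (simp add: act_const)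

lemma pn_zero: "AE x in m. pn 0 x = 0"
  using pn_scale[of 0 0] by simp

lemma pn_minus: "AE x in m. pn (- v) x = pn v x"
  using pn_scale[of "- 1" v] by simp

lemma norm_cut:
  assumes A: "A \<in> sets borel"
  shows "norm (cut A v) = sqrt (LINT x|m. indicat_real A x * (pn v x)\<^sup>2)"
proof -
  have "(LINT x|m. (pn (cut A v) x)\<^sup>2) = (LINT x|m. indicat_real A x * (pn v x)\<^sup>2)"
  proof (rule integral_cong_AE)
    show "AE x in m. (pn (cut A v) x)\<^sup>2 = indicat_real A x * (pn v x)\<^sup>2"
      using pn_cut[OF A, of v] by eventually_elim (simp add: power_mult_distrib indicator_def)
  qed (use A in \<open>auto intro!: borel_measurable_times borel_measurable_power\<close>)
  then show ?thesis by (simp add: norm_pn)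
qed

text \<open>The pointwise triangle inequality is not an axiom of \<open>L\<^sup>2\<close>-normed modules: it follows from the one
  for the norm, localized to a set on which the three pointwise norms are almost constant.\<close>

lemma pn_triangle: "AE x in m. pn (v + w) x \<le> pn v x + pn w x"
proof -
  \<comment> \<open>The rationals a and b make the exceptional set a countable union. On
    \<open>A a b\<close> the norms of the cut vectors \<open>v\<close> and \<open>w\<close> are at
    most sqrt (m A) times a and b, whereas positive measure would force the norm of the cut sum
    above sqrt (m A) (a + b).\<close>
  define A where "A a b = {x. pn v x \<le> of_rat a \<and> pn w x \<le> of_rat b \<and> of_rat a + of_rat b < pn (v + w) x
    \<and> 0 \<le> pn v x \<and> 0 \<le> pn w x}" for a b
  have A [measurable]: "A a b \<in> sets borel" for a b unfolding A_def by measurable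
  have null: "emeasure m (A a b) = 0" for a b
  proof (rule ccontr)
    assume "emeasure m (A a b) \<noteq> 0"
    then have pos: "measure m (A a b) > 0" by (simp add: emeasure_eq_measure zero_less_measure_iff)
    then obtain x where x: "x \<in> A a b" by (metis ex_in_conv measure_empty less_irrefl)
    define c e where "c = (of_rat a :: real)" and "e = (of_rat b :: real)"
    have AD: "0 \<le> pn v y \<and> pn v y \<le> c" "0 \<le> pn w y \<and> pn w y \<le> e" "c + e < pn (v + w) y"
      if "y \<in> A a b" for y using that by (simp_all add: A_def c_def e_def)
    have ce: "0 \<le> c" "0 \<le> e" using AD[OF x] by linarith+
    have int2: "integrable m (\<lambda>x. indicat_real (A a b) x * k)" for k
      using A by (intro integrable_indicator_mult) auto
    have int1: "integrable m (\<lambda>x. indicat_real (A a b) x * (pn u x)\<^sup>2)" for u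
      using L2_square[OF pn_L2] A by auto
    have bound: "norm (cut (A a b) u) \<le> sqrt (measure m (A a b)) * k"
      if u: "\<And>x. x \<in> A a b \<Longrightarrow> 0 \<le> pn u x \<and> pn u x \<le> k" and "0 \<le> k" for u k
    proof -
      have "(LINT x|m. indicat_real (A a b) x * (pn u x)\<^sup>2) \<le> (LINT x|m. indicat_real (A a b) x * k\<^sup>2)"
      proof (rule integral_mono[OF int1 int2])
        show "indicat_real (A a b) x * (pn u x)\<^sup>2 \<le> indicat_real (A a b) x * k\<^sup>2" for x
          using u[of x] by (simp add: indicator_def power_mono)
      qed
      also have "\<dots> = measure m (A a b) * k\<^sup>2" by simp
      finally have "norm (cut (A a b) u) \<le> sqrt (measure m (A a b) * k\<^sup>2)"
        by (simp add: norm_cut)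
      then show ?thesis using \<open>0 \<le> k\<close> by (simp add: real_sqrt_mult)
    qed
    have "norm (cut (A a b) v) \<le> sqrt (measure m (A a b)) * c" "norm (cut (A a b) w) \<le> sqrt (measure m (A a b)) * e"
      using bound[OF AD(1) ce(1)] bound[OF AD(2) ce(2)] by blast+
    then have "norm (cut (A a b) (v + w)) \<le> sqrt (measure m (A a b)) * (c + e)"
      using norm_triangle_ineq[of "cut (A a b) v" "cut (A a b) w"]
      by (simp add: linear_add[OF linear_cut] distrib_left)
    then have "(norm (cut (A a b) (v + w)))\<^sup>2 \<le> (sqrt (measure m (A a b)) * (c + e))\<^sup>2"
      by (intro power_mono) auto
    then have le: "(LINT x|m. indicat_real (A a b) x * (pn (v + w) x)\<^sup>2) \<le> measure m (A a b) * (c + e)\<^sup>2"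
      by (simp add: norm_cut power_mult_distrib integral_nonneg_AE)
    define q where "q x = indicat_real (A a b) x * ((pn (v + w) x)\<^sup>2 - (c + e)\<^sup>2)" for x
    have qi: "integrable m q"
      unfolding q_def[abs_def] right_diff_distrib by (intro Bochner_Integration.integrable_diff int1 int2)
    have "(LINT x|m. q x) \<le> 0"
      unfolding q_def right_diff_distrib Bochner_Integration.integral_diff[OF int1 int2] using le by simp
    moreover have qnn: "0 \<le> q x" for x
      using ce AD(3)[of x] by (auto simp: q_def indicator_def intro!: power_mono)
    ultimately have "(LINT x|m. q x) = 0" by (metis Bochner_Integration.integral_nonneg order_antisym)
    then have "AE x in m. q x = 0" using integral_nonneg_eq_0_iff_AE[OF qi] qnn by simp
    moreover have "q x \<noteq> 0" if "x \<in> A a b" for x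
    proof -
      have "(c + e)\<^sup>2 < (pn (v + w) x)\<^sup>2"
        using AD(3)[OF that] ce by (intro power_strict_mono) auto
      then show ?thesis using that by (simp add: q_def)
    qed
    ultimately have "AE x in m. x \<notin> A a b" by (auto elim: eventually_mono)
    then have "emeasure m (A a b) = 0" using AE_iff_measurable[of "A a b" m "\<lambda>x. x \<notin> A a b"] A by simp
    with pos show False by (simp add: emeasure_eq_measure)
  qed
  have "AE x in m. x \<notin> A a b" for a b
    using AE_iff_measurable[of "A a b" m "\<lambda>x. x \<notin> A a b"] A null by simp
  then have "AE x in m. \<forall>a b. x \<notin> A a b" by (simp add: AE_all_countable)
  then show ?thesis using pn_nonneg[of v] pn_nonneg[of w]
  proof eventually_elim
    case (elim x)
    show ?case
    proof (rule ccontr)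
      assume "\<not> pn (v + w) x \<le> pn v x + pn w x"
      then have pos: "0 < pn (v + w) x - (pn v x + pn w x)" by simp
      define r where "r = (pn (v + w) x - (pn v x + pn w x)) / 2"
      have r: "0 < r" using pos by (simp add: r_def)
      obtain a where a: "pn v x < of_rat a" "of_rat a < pn v x + r" using of_rat_dense[of "pn v x" "pn v x + r"] r by auto
      obtain b where b: "pn w x < of_rat b" "of_rat b < pn w x + r" using of_rat_dense[of "pn w x" "pn w x + r"] r by auto
      have "of_rat a + of_rat b < pn v x + r + (pn w x + r)" using a b by linarith
      also have "\<dots> = pn (v + w) x" by (simp add: r_def field_simps)
      finally have "x \<in> A a b" using a b elim(2,3) by (simp add: A_def)
      with elim(1) show False by blast
    qed
  qed
qed

text \<open>The L^1 norm of the pointwise norm. Its values on cut differentials are the total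
  variations of condition (i); the norm of the module is the L^2 norm, and finiteness of m gives the
  comparison \<open>N1_le_norm\<close>.\<close>

definition N1 :: "'c \<Rightarrow> real" where
  "N1 v = (LINT x|m. pn v x)"

lemma N1_nonneg [simp]: "0 \<le> N1 v"
  unfolding N1_def by (rule integral_nonneg_AE[OF pn_nonneg])

lemma N1_act: "f \<in> Linf m \<Longrightarrow> N1 (act f v) = (LINT x|m. \<bar>f x\<bar> * pn v x)"
  unfolding N1_def by (rule integral_cong_AE) (use pn_act in \<open>auto simp: Linf_iff\<close>)

lemma N1_cut: "A \<in> sets borel \<Longrightarrow> N1 (cut A v) = setint A (pn v)"
  using N1_act[of "indicat_real A" v] by (simp add: cut_def)

lemma N1_triangle: "N1 (v + w) \<le> N1 v + N1 w"
  unfolding N1_def Bochner_Integration.integral_add[OF pn_integrable pn_integrable, symmetric]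
  by (rule integral_mono_AE) (auto intro: pn_triangle)

lemma N1_scale: "N1 (c *\<^sub>R v) = \<bar>c\<bar> * N1 v"
  using N1_act[of "\<lambda>_. c" v] by (simp add: act_const N1_def)

lemma N1_zero [simp]: "N1 0 = 0"
  using N1_scale[of 0 0] by simp

lemma N1_minus [simp]: "N1 (- v) = N1 v"
  using N1_scale[of "- 1" v] by simp

lemma N1_diff_commute: "N1 (v - w) = N1 (w - v)"
  using N1_minus[of "v - w"] by simp

lemma N1_le_norm: "N1 v \<le> sqrt (measure m UNIV) * norm v"
proof -
  have "N1 v \<le> (LINT x|m. \<bar>pn v x\<bar>)" unfolding N1_def by (rule integral_mono) auto
  also have "\<dots> \<le> sqrt (measure m UNIV) * norm v" unfolding norm_pn by (rule L1_le_L2) simp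
  finally show ?thesis .
qed

lemma integral_indicator_mult_le:
  assumes "B \<in> sets borel" "A \<in> sets borel" "A \<subseteq> B"
  shows "setint A (pn v) \<le> setint B (pn v)"
proof (rule integral_mono_AE)
  show "AE x in m. indicat_real A x * pn v x \<le> indicat_real B x * pn v x"
    using pn_nonneg by eventually_elim (use assms(3) in \<open>auto simp: indicator_def\<close>)
qed (use assms in auto)

lemma N1_cut_le: "A \<in> sets borel \<Longrightarrow> N1 (cut A v) \<le> N1 v"
  using integral_indicator_mult_le[of UNIV A v] by (subst N1_cut) (simp_all add: N1_def)

lemma N1_cut_split:
  assumes "A \<in> sets borel" "B \<in> sets borel" "A \<inter> B = {}"
  shows "N1 (cut (A \<union> B) v) = N1 (cut A v) + N1 (cut B v)"
proof -
  have "indicat_real (A \<union> B) x * pn v x = indicat_real A x * pn v x + indicat_real B x * pn v x" for x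
    using assms(3) by (auto simp: indicator_def)
  then show ?thesis using assms by (simp add: N1_cut integrable_indicator_mult)
qed

lemma N1_cut_UN:
  assumes "finite I" "\<And>i. i \<in> I \<Longrightarrow> A i \<in> sets borel" "disjoint_family_on A I"
  shows "N1 (cut (\<Union>i\<in>I. A i) v) = (\<Sum>i\<in>I. N1 (cut (A i) v))"
  using assms
proof (induction I rule: finite_induct)
  case (insert i I)
  have "A i \<inter> (\<Union>i\<in>I. A i) = {}"
    using insert.hyps insert.prems(2) by (auto simp: disjoint_family_on_def)
  moreover have "disjoint_family_on A I" using insert.prems(2) by (auto simp: disjoint_family_on_def)
  moreover have "(\<Union>i\<in>I. A i) \<in> sets borel" using insert.prems(1) insert.hyps by (intro sets.finite_UN) auto
  ultimately show ?case using insert N1_cut_split[of "A i" "\<Union>i\<in>I. A i" v] by simp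
qed simp

lemma N1_act_le:
  assumes f: "f \<in> borel_measurable borel" and le: "\<And>x. \<bar>f x\<bar> \<le> C"
  shows "N1 (act f v) \<le> C * N1 v"
proof -
  have fL: "f \<in> Linf m" using f le by (rule LinfI)
  have "AE x in m. norm (\<bar>f x\<bar> * pn v x) \<le> norm (C * pn v x)"
    using pn_nonneg[of v]
  proof eventually_elim
    case (elim x)
    have "\<bar>f x\<bar> * pn v x \<le> C * pn v x" using le elim by (rule mult_right_mono)
    moreover have "0 \<le> \<bar>f x\<bar> * pn v x" using elim by simp
    ultimately show ?case by simp
  qed
  then have "integrable m (\<lambda>x. \<bar>f x\<bar> * pn v x)"
    by (rule Bochner_Integration.integrable_bound[rotated 2]) (use f in \<open>auto intro: borel_measurable_times\<close>)
  moreover have "AE x in m. \<bar>f x\<bar> * pn v x \<le> C * pn v x"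
    using pn_nonneg[of v] by eventually_elim (rule mult_right_mono[OF le])
  ultimately have "(LINT x|m. \<bar>f x\<bar> * pn v x) \<le> (LINT x|m. C * pn v x)" by (intro integral_mono_AE) auto
  then show ?thesis by (subst N1_act[OF fL]) (simp add: N1_def)
qed

lemma norm_act_le:
  assumes f: "f \<in> Linf m" and le: "AE x in m. \<bar>f x\<bar> \<le> C" and "0 \<le> C"
  shows "norm (act f v) \<le> C * norm v"
proof -
  have "(LINT x|m. (pn (act f v) x)\<^sup>2) \<le> (LINT x|m. C\<^sup>2 * (pn v x)\<^sup>2)"
  proof (rule integral_mono_AE)
    show "AE x in m. (pn (act f v) x)\<^sup>2 \<le> C\<^sup>2 * (pn v x)\<^sup>2"
      using pn_act[OF f, of v] le
    proof eventually_elim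
      case (elim x)
      have "(f x)\<^sup>2 \<le> C\<^sup>2" using elim(2) \<open>0 \<le> C\<close> by (metis abs_of_nonneg abs_le_square_iff)
      then show ?case unfolding elim(1) by (simp add: power_mult_distrib mult_right_mono)
    qed
  qed (use L2_square[OF pn_L2] in auto)
  also have "\<dots> = C\<^sup>2 * sqint (pn v)" by simp
  finally have "norm (act f v) \<le> sqrt (C\<^sup>2 * sqint (pn v))" by (simp add: norm_pn)
  then show ?thesis using \<open>0 \<le> C\<close> by (simp add: norm_pn real_sqrt_mult)
qed

lemma act_simple:
  assumes "finite J" "\<And>j. B j \<in> sets borel"
  shows "act (\<lambda>x. \<Sum>j\<in>J. c j * indicat_real (B j) x) v = (\<Sum>j\<in>J. c j *\<^sub>R cut (B j) v)"
proof -
  have "act (\<lambda>x. \<Sum>j\<in>J. c j * indicat_real (B j) x) v = (\<Sum>j\<in>J. act (\<lambda>x. c j * indicat_real (B j) x) v)"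
    by (rule act_sum[OF assms(1)]) (simp add: assms(2))
  also have "\<dots> = (\<Sum>j\<in>J. c j *\<^sub>R cut (B j) v)"
    unfolding cut_def by (rule sum.cong) (simp_all add: act_scaled assms(2))
  finally show ?thesis .
qed

text \<open>The induction principle for the cotangent module: simple functions approximate a bounded
  coefficient uniformly, so indicator coefficients already generate a dense subspace.\<close>

lemma cut_d_dense:
  assumes S: "subspace S" "closed S" and cut: "\<And>A f. A \<in> sets borel \<Longrightarrow> f \<in> W12 m \<Longrightarrow> cut A (d f) \<in> S"
  shows "v \<in> S"
proof -
  have act: "act g (d f) \<in> S" if g: "g \<in> Linf m" and f: "f \<in> W12 m" for g f
  proof -
    have gm: "g \<in> borel_measurable borel" using g by (simp add: Linf_iff)
    obtain C where C: "AE x in m. \<bar>g x\<bar> \<le> C" using g by (auto simp: Linf_iff)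
    \<comment> \<open>Finitely many level sets require a bound at every point, while g is bounded
      almost everywhere only; \<open>h\<close> is a bounded representative.\<close>
    define h where "h x = (if \<bar>g x\<bar> \<le> C then g x else 0)" for x
    have hm: "h \<in> borel_measurable borel" unfolding h_def using gm by measurable
    have hC: "\<bar>h x\<bar> \<le> max C 0" for x by (auto simp: h_def)
    have hL: "h \<in> Linf m" using hm hC by (rule LinfI)
    have eq: "act g (d f) = act h (d f)"
      by (rule act_cong[OF g hL]) (use C in \<open>eventually_elim, simp add: h_def\<close>)
    have "act h (d f) \<in> closure S"
      unfolding closure_approachable
    proof (intro allI impI)
      fix e :: real assume "e > 0"
      define e' where "e' = e / (2 * (norm (d f) + 1))"
      have n1: "norm (d f) + 1 > 0" using norm_ge_zero[of "d f"] by linarith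
      have e': "e' > 0" using \<open>e > 0\<close> n1 by (simp add: e'_def)
      obtain J :: "int set" and B c where J: "finite J" "\<And>j. B j \<in> sets borel" "disjoint_family_on B J"
          "(\<Union>j\<in>J. B j) = UNIV" "\<And>j x. x \<in> B j \<Longrightarrow> \<bar>h x - c j\<bar> \<le> e'"
        by (rule finite_level_sets[OF hm hC e']) (rule that)
      define s where "s x = (\<Sum>j\<in>J. c j * indicat_real (B j) x)" for x
      have sL: "s \<in> Linf m" unfolding s_def[abs_def] using J(1,2) by (intro Linf_sum Linf_mult) auto
      have sx: "\<bar>h x - s x\<bar> \<le> e'" for x unfolding s_def by (rule simple_approx[OF J(1,3,4,5)])
      have "act s (d f) \<in> S"
        unfolding s_def[abs_def] act_simple[OF J(1,2)]
        by (intro subspace_sum[OF S(1)] subspace_scale[OF S(1)] cut J(2) f)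
      moreover have "dist (act s (d f)) (act h (d f)) < e"
      proof -
        have "dist (act s (d f)) (act h (d f)) = norm (act (\<lambda>x. h x - s x) (d f))"
          using hL sL by (simp add: act_diff dist_norm norm_minus_commute)
        also have "\<dots> \<le> e' * norm (d f)"
          by (rule norm_act_le[OF Linf_diff[OF hL sL] AE_I2[OF sx] less_imp_le[OF e']])
        also have "\<dots> \<le> e' * (norm (d f) + 1)" using e' by (intro mult_left_mono) auto
        also have "\<dots> = e / 2" using n1 by (simp add: e'_def divide_simps)
        also have "\<dots> < e" using \<open>e > 0\<close> by simp
        finally show ?thesis .
      qed
      ultimately show "\<exists>y\<in>S. dist y (act h (d f)) < e" by blast
    qed
    then show ?thesis using S(2) eq by (simp add: closure_closed)
  qed
  have "{\<Sum>i<n. act (g i) (d (f i)) | (n::nat) g f. \<forall>i<n. g i \<in> Linf m \<and> f i \<in> W12 m} \<subseteq> S"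
    using act by (auto intro!: subspace_sum[OF S(1)])
  then have "closure {\<Sum>i<n. act (g i) (d (f i)) | (n::nat) g f. \<forall>i<n. g i \<in> Linf m \<and> f i \<in> W12 m} \<subseteq> S"
    using S(2) by (rule closure_minimal)
  then show ?thesis using d_dense by auto
qed

end

section \<open>Functionals dominated by the \<open>L\<^sup>1\<close>-seminorm\<close>

context cotangent
begin

definition bdf :: "real \<Rightarrow> ('c \<Rightarrow> real) \<Rightarrow> bool" where
  "bdf C l \<longleftrightarrow> linear l \<and> (\<forall>v. \<bar>l v\<bar> \<le> C * N1 v)"

lemma bdf_linear: "bdf C l \<Longrightarrow> linear l"
  by (simp add: bdf_def)

lemma bdf_le: "bdf C l \<Longrightarrow> \<bar>l v\<bar> \<le> C * N1 v"
  by (simp add: bdf_def)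

lemma bdf_bounded_linear:
  assumes "bdf C l" shows "bounded_linear l"
proof (rule bounded_linear_intro)
  show "l (v + w) = l v + l w" for v w using bdf_linear[OF assms] by (rule linear_add)
  show "l (c *\<^sub>R v) = c *\<^sub>R l v" for c v using bdf_linear[OF assms] by (rule linear_scale)
  show "norm (l v) \<le> norm v * (\<bar>C\<bar> * sqrt (measure m UNIV))" for v
  proof -
    have "\<bar>l v\<bar> \<le> C * N1 v" by (rule bdf_le[OF assms])
    also have "\<dots> \<le> \<bar>C\<bar> * N1 v" by (intro mult_right_mono) auto
    also have "\<dots> \<le> \<bar>C\<bar> * (sqrt (measure m UNIV) * norm v)" by (intro mult_left_mono N1_le_norm) auto
    finally show ?thesis by (simp add: mult_ac)
  qed
qed

text \<open>The set where two continuous linear functionals agree is a closed subspace, so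
  \<open>cut_d_dense\<close> applies. Uniqueness of the functional attached to an element of a
  couple rests on this.\<close>

lemma bdf_eqI:
  assumes l: "bdf C l" and k: "bdf D k"
    and eq: "\<And>A f. A \<in> sets borel \<Longrightarrow> f \<in> W12 m \<Longrightarrow> l (cut A (d f)) = k (cut A (d f))"
  shows "l = k"
proof
  fix v
  have "v \<in> {v. l v = k v}"
  proof (rule cut_d_dense)
    show "subspace {v. l v = k v}"
      using bdf_linear[OF l] bdf_linear[OF k] by (auto simp: subspace_def linear_0 linear_add linear_scale)
    show "closed {v. l v = k v}"
      using bdf_bounded_linear[OF l] bdf_bounded_linear[OF k]
      by (intro closed_Collect_eq linear_continuous_on)
  qed (use eq in auto)
  then show "l v = k v" by simp
qed

text \<open>Hahn-Banach for the seminorm \<open>N1\<close>. Once such functionals are represented by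
  vector fields, this is the lower bound for the dual norms of the measures of the
  realization.\<close>

lemma bdf_norming:
  obtains l where "bdf 1 l" "l v = N1 v"
proof -
  obtain l where l: "linear l" "\<And>x. l x \<le> N1 x" "l v = N1 v"
    by (rule hahn_banach_point[of N1 v, OF N1_triangle]) (simp_all add: N1_scale)
  have "\<bar>l w\<bar> \<le> N1 w" for w
    using l(2)[of w] l(2)[of "- w"] linear_neg[OF l(1), of w] by simp
  then have "bdf 1 l" using l(1) by (simp add: bdf_def)
  then show ?thesis using l(3) by (rule that)
qed

lemma bdf_mono: "bdf C l \<Longrightarrow> C \<le> D \<Longrightarrow> bdf D l"
  unfolding bdf_def by (meson N1_nonneg mult_right_mono order_trans)

lemma N1_cut_tail:
  assumes A: "range A \<subseteq> sets borel"
  shows "(\<lambda>n::nat. N1 (cut ((\<Union>i. A i) - (\<Union>i<n. A i)) v)) \<longlonglongrightarrow> 0"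
proof -
  have A': "A i \<in> sets borel" for i using A by blast
  have S: "(\<Union>i. A i) - (\<Union>i<n. A i) \<in> sets borel" for n
    using A' by (intro sets.Diff sets.countable_UN sets.finite_UN) auto
  have "(\<lambda>n. N1 (cut ((\<Union>i. A i) - (\<Union>i<n. A i)) v)) = (\<lambda>n. \<integral>x. indicat_real ((\<Union>i. A i) - (\<Union>i<n. A i)) x * pn v x \<partial>m)"
    by (rule ext) (rule N1_cut[OF S])
  then show ?thesis using integral_tail_tendsto_0[OF pn_integrable A, of v] by simp
qed

text \<open>The Radon-Nikodym derivative of \<open>A \<mapsto> l (\<chi>\<^sub>A v)\<close>, made nonnegative by adding the measure \<open>C |v| m\<close>.\<close>

lemma bdf_density:
  assumes l: "bdf C l"
  shows "\<exists>p. integrable m p \<and> (\<forall>A\<in>sets borel. l (cut A v) = setint A p)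
    \<and> (AE x in m. \<bar>p x\<bar> \<le> C * pn v x)"
proof -
  define q where "q A = l (cut A v) + C * N1 (cut A v)" for A
  have q: "0 \<le> q A" "q A \<le> 2 * (C * N1 (cut A v))" for A
    using bdf_le[OF l, of "cut A v"] by (auto simp: q_def abs_le_iff)
  have q_UN: "q (\<Union>i\<in>I. A i) = (\<Sum>i\<in>I. q (A i))"
    if "finite I" "\<And>i. i \<in> I \<Longrightarrow> A i \<in> sets borel" "disjoint_family_on A I" for I :: "nat set" and A
  proof -
    have "cut (\<Union>i\<in>I. A i) v = (\<Sum>i\<in>I. cut (A i) v)" by (rule cut_UN[OF that])
    moreover have "N1 (cut (\<Union>i\<in>I. A i) v) = (\<Sum>i\<in>I. N1 (cut (A i) v))" by (rule N1_cut_UN[OF that])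
    ultimately show ?thesis
      by (simp add: q_def linear_sum[OF bdf_linear[OF l]] sum.distrib sum_distrib_left)
  qed
  have q_Un: "q (A \<union> B) = q A + q B" if "A \<in> sets borel" "B \<in> sets borel" "A \<inter> B = {}" for A B
    unfolding q_def N1_cut_split[OF that] unfolding cut_Un[OF that]
    by (simp add: linear_add[OF bdf_linear[OF l]] algebra_simps)
  define N where "N = measure_of UNIV (sets borel) (\<lambda>A. ennreal (q A))"
  have sa: "sigma_algebra UNIV (sets (borel :: 'x measure))" using sets.sigma_algebra_axioms[of borel] by simp
  have N_sets: "sets N = sets borel" unfolding N_def by (rule sigma_algebra.sets_measure_of_eq[OF sa])
  have q_empty: "q {} = 0" using linear_0[OF bdf_linear[OF l]] by (simp add: q_def)
  have em: "emeasure N A = ennreal (q A)" if "A \<in> sets borel" for A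
    unfolding N_def
  proof (rule emeasure_measure_of_sigma[OF sa _ _ that])
    show "positive (sets borel) (\<lambda>A. ennreal (q A))" by (simp add: positive_def q_empty)
    show "countably_additive (sets borel) (\<lambda>A. ennreal (q A))"
    proof (rule countably_additiveI)
      fix A :: "nat \<Rightarrow> 'x set"
      assume A: "range A \<subseteq> sets borel" "disjoint_family A" "\<Union> (range A) \<in> sets borel"
      have A': "A i \<in> sets borel" for i using A by blast
      define T where "T n = (\<Union>i. A i) - (\<Union>i<n. A i)" for n
      have S: "(\<Union>i<n. A i) \<in> sets borel" for n using A' by (intro sets.finite_UN) auto
      have T: "T n \<in> sets borel" for n unfolding T_def by (intro sets.Diff S A(3))
      \<comment> \<open>Finite additivity leaves the tail \<open>T n\<close>, which the domination
        by \<open>N1\<close> sends to 0.\<close>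
      have "(\<Sum>i<n. q (A i)) = q (\<Union>i. A i) - q (T n)" for n
      proof -
        have "(\<Union>i. A i) = (\<Union>i<n. A i) \<union> T n" by (auto simp: T_def)
        moreover have "(\<Union>i<n. A i) \<inter> T n = {}" by (auto simp: T_def)
        ultimately have U: "q (\<Union>i. A i) = q (\<Union>i<n. A i) + q (T n)"
          using q_Un[OF S[of n] T[of n]] by simp
        have "disjoint_family_on A {..<n}" using A(2) by (auto simp: disjoint_family_on_def)
        then have "q (\<Union>i<n. A i) = (\<Sum>i<n. q (A i))" using A' by (intro q_UN) auto
        with U show ?thesis by simp
      qed
      moreover have "(\<lambda>n. q (T n)) \<longlonglongrightarrow> 0"
      proof (rule tendsto_sandwich[OF always_eventually always_eventually tendsto_const])
        show "\<forall>n. 0 \<le> q (T n)" using q by blast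
        show "\<forall>n. q (T n) \<le> 2 * (C * N1 (cut (T n) v))" using q by blast
        show "(\<lambda>n. 2 * (C * N1 (cut (T n) v))) \<longlonglongrightarrow> 0"
          unfolding T_def by (intro tendsto_mult_right_zero N1_cut_tail A(1))
      qed
      then have "(\<lambda>n. q (\<Union>i. A i) - q (T n)) \<longlonglongrightarrow> q (\<Union>i. A i) - 0" by (intro tendsto_intros)
      ultimately have "(\<lambda>i. q (A i)) sums q (\<Union>i. A i)" by (simp add: sums_def)
      then show "(\<Sum>i. ennreal (q (A i))) = ennreal (q (\<Union> (range A)))"
        by (intro suminf_ennreal_eq q)
    qed
  qed
  \<comment> \<open>On an m-null set \<open>N1 (cut A v)\<close> vanishes, and \<open>q A\<close>
    lies between 0 and twice C times it.\<close>
  have "absolutely_continuous m N"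
    unfolding absolutely_continuous_def
  proof
    fix A assume A: "A \<in> null_sets m"
    then have Ab: "A \<in> sets borel" by auto
    have "AE x in m. indicat_real A x * pn v x = 0"
      using AE_not_in[OF A] by eventually_elim simp
    then have "setint A (pn v) = 0" by (rule integral_eq_zero_AE)
    then have "N1 (cut A v) = 0" by (simp add: N1_cut[OF Ab])
    then have "q A = 0" using q[of A] by simp
    then show "A \<in> null_sets N" using Ab em[OF Ab] N_sets by (auto simp: null_sets_def)
  qed
  then obtain f where f: "f \<in> borel_measurable m" "density m f = N"
    using Radon_Nikodym[of N] N_sets by auto
  have fb [measurable]: "f \<in> borel_measurable borel" using f(1) by simp
  have fA: "(\<integral>\<^sup>+x. f x * indicator A x \<partial>m) = ennreal (q A)" if A: "A \<in> sets borel" for A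
    using em[OF A] emeasure_density[OF f(1), of A] A f(2) by simp
  have "(\<integral>\<^sup>+x. f x \<partial>m) \<noteq> \<infinity>" using fA[of UNIV] by simp
  then have fin: "AE x in m. f x \<noteq> \<infinity>" by (rule nn_integral_PInf_AE[OF f(1)])
  define r where "r x = enn2real (f x)" for x
  have rb [measurable]: "r \<in> borel_measurable borel" unfolding r_def[abs_def] by measurable
  have rA: "(\<integral>\<^sup>+x. ennreal (indicat_real A x * r x) \<partial>m) = ennreal (q A)" if A: "A \<in> sets borel" for A
  proof -
    have "(\<integral>\<^sup>+x. ennreal (indicat_real A x * r x) \<partial>m) = (\<integral>\<^sup>+x. f x * indicator A x \<partial>m)"
    proof (rule nn_integral_cong_AE, use fin in eventually_elim)
      case (elim x)
      then have "ennreal (r x) = f x" unfolding r_def by (simp add: less_top)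
      then show ?case by (auto simp: indicator_def)
    qed
    then show ?thesis using fA[OF A] by simp
  qed
  have rnn: "0 \<le> indicat_real A x * r x" for A x by (simp add: r_def)
  have rint: "integrable m r"
    using rA[of UNIV] by (auto simp: integrable_iff_bounded r_def)
  have rq: "setint A r = q A" if A: "A \<in> sets borel" for A
  proof -
    have "ennreal (setint A r) = ennreal (q A)"
      using rA[OF A] nn_integral_eq_integral[OF integrable_indicator_mult[OF rint A]] rnn by simp
    then show ?thesis using q(1)[of A] rnn by (subst (asm) ennreal_inj) (auto intro!: Bochner_Integration.integral_nonneg)
  qed
  define p where "p x = r x - C * pn v x" for x
  have pi: "integrable m p" unfolding p_def[abs_def] using rint by simp
  have int: "l (cut A v) = setint A p" if A: "A \<in> sets borel" for A
  proof -
    have "setint A p = (LINT x|m. indicat_real A x * r x - C * (indicat_real A x * pn v x))"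
      by (rule Bochner_Integration.integral_cong) (auto simp: p_def algebra_simps)
    also have "\<dots> = q A - C * N1 (cut A v)"
      using integrable_indicator_mult[OF rint A] integrable_indicator_mult[OF pn_integrable A, of v]
      by (simp add: rq[OF A] N1_cut[OF A])
    finally show ?thesis by (simp add: q_def)
  qed
  have Cint: "(LINT x|m. indicat_real A x * (c * pn v x)) = c * N1 (cut A v)" if "A \<in> sets borel" for A c
    by (simp add: N1_cut[OF that] mult.left_commute)
  \<comment> \<open>The domination of l on every cut of v, written with integrals over A, becomes a
    pointwise bound of the density.\<close>
  have "AE x in m. p x \<le> C * pn v x"
  proof (rule AE_le_of_set_integrals[OF pi])
    show "setint A p \<le> (LINT x|m. indicat_real A x * (C * pn v x))" if A: "A \<in> sets borel" for A
      using bdf_le[OF l, of "cut A v"] unfolding Cint[OF A] int[OF A, symmetric] by linarith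
  qed simp
  moreover have "AE x in m. - C * pn v x \<le> p x"
  proof (rule AE_le_of_set_integrals[OF _ pi])
    show "(LINT x|m. indicat_real A x * (- C * pn v x)) \<le> setint A p" if A: "A \<in> sets borel" for A
      using bdf_le[OF l, of "cut A v"] unfolding Cint[OF A] int[OF A, symmetric] by linarith
  qed simp
  ultimately have "AE x in m. \<bar>p x\<bar> \<le> C * pn v x" by eventually_elim auto
  with pi int show ?thesis by blast
qed

text \<open>The vectors behind the generated module: in the realization the measures of the
  C_b-module generated by the differentials are the pairings with these vectors.\<close>

definition cb_comb :: "'c set" where
  "cb_comb = {\<Sum>i<n. act (apply_bcontfun (g i)) (d (f i)) |(n::nat) (g :: nat \<Rightarrow> 'x \<Rightarrow>\<^sub>C real) f. \<forall>i<n. f i \<in> W12 m}"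

lemma subspace_cb_comb: "subspace cb_comb"
  unfolding subspace_def
proof (intro conjI ballI allI)
  show "0 \<in> cb_comb" unfolding cb_comb_def by (intro CollectI exI[of _ 0]) auto
  fix v assume "v \<in> cb_comb"
  then obtain n and g :: "nat \<Rightarrow> 'x \<Rightarrow>\<^sub>C real" and f where
    v: "v = (\<Sum>i<n. act (apply_bcontfun (g i)) (d (f i)))" "\<forall>i<n. f i \<in> W12 m" unfolding cb_comb_def by blast
  show "c *\<^sub>R v \<in> cb_comb" for c
  proof -
    have "act (apply_bcontfun (g i)) (d (\<lambda>x. c * f i x)) = c *\<^sub>R act (apply_bcontfun (g i)) (d (f i))" if "i < n" for i
      using v(2) that by (simp add: d_scale linear_scale[OF linear_act])
    then have "c *\<^sub>R v = (\<Sum>i<n. act (apply_bcontfun (g i)) (d (\<lambda>x. c * f i x)))"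
      by (simp add: v(1) scaleR_sum_right)
    moreover have "\<forall>i<n. (\<lambda>x. c * f i x) \<in> W12 m" using v(2) W12_scale by blast
    ultimately show ?thesis unfolding cb_comb_def
      by (intro CollectI exI[of _ n] exI[of _ g] exI[of _ "\<lambda>i x. c * f i x"] conjI)
  qed
  fix w assume "w \<in> cb_comb"
  then obtain k and g' :: "nat \<Rightarrow> 'x \<Rightarrow>\<^sub>C real" and f' where
    w: "w = (\<Sum>i<k. act (apply_bcontfun (g' i)) (d (f' i)))" "\<forall>i<k. f' i \<in> W12 m" unfolding cb_comb_def by blast
  define G where "G i = (if i < n then g i else g' (i - n))" for i
  define F where "F i = (if i < n then f i else f' (i - n))" for i
  have "v + w = (\<Sum>i<n + k. act (apply_bcontfun (G i)) (d (F i)))"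
    unfolding sum_lessThan_add v(1) w(1) by (intro arg_cong2[of _ _ _ _ "(+)"] sum.cong) (auto simp: G_def F_def)
  moreover have "\<forall>i<n + k. F i \<in> W12 m" using v(2) w(2) by (auto simp: F_def)
  ultimately show "v + w \<in> cb_comb" unfolding cb_comb_def by blast
qed

text \<open>f vanishes outside E, so v may be replaced by \<open>cut E v\<close> before the bound
  \<bar>f\<bar> \<le> 1 is used.\<close>

lemma N1_act_le_cut:
  assumes f: "f \<in> borel_measurable borel" and E: "E \<in> sets borel" and le: "\<And>x. \<bar>f x\<bar> \<le> indicat_real E x"
  shows "N1 (act f v) \<le> N1 (cut E v)"
proof -
  have le1: "\<bar>f x\<bar> \<le> 1" for x using le[of x] by (rule order_trans) (simp add: indicator_def)
  have "f x * indicat_real E x = f x" for x using le[of x] by (auto simp: indicator_def)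
  then have "(\<lambda>x. f x * indicat_real E x) = f" by (rule ext)
  then have "act f v = act f (cut E v)"
    using act_times[OF LinfI[OF f le1] Linf_indicator[OF E], of v] unfolding cut_def by metis
  then show ?thesis using N1_act_le[OF f le1, of "cut E v"] by simp
qed

lemma compact_approx_N1:
  assumes A: "A \<in> sets borel" and "e > 0"
  obtains K where "compact K" "K \<subseteq> A" "K \<in> sets borel" "N1 (cut (A - K) v) < e"
proof -
  obtain K where K: "compact K" "K \<subseteq> A" "setint (A - K) (pn v) < e"
    by (rule compact_approx[OF pn_integrable pn_nonneg A \<open>e > 0\<close>])
  have Kb: "K \<in> sets borel" by (rule borel_closed[OF compact_imp_closed[OF K(1)]])
  have "N1 (cut (A - K) v) = setint (A - K) (pn v)" by (rule N1_cut[OF sets.Diff[OF A Kb]])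
  then show ?thesis using K Kb by (intro that[of K]) auto
qed

text \<open>The difference between the indicator of A and g vanishes on K and on L and is at most 1
  in modulus elsewhere.\<close>

lemma N1_cut_minus_act:
  fixes g :: "'x \<Rightarrow>\<^sub>C real"
  assumes A: "A \<in> sets borel" and K: "K \<in> sets borel" "K \<subseteq> A" and L: "L \<in> sets borel" "L \<subseteq> - A"
    and g: "\<And>x. 0 \<le> apply_bcontfun g x" "\<And>x. apply_bcontfun g x \<le> 1"
      "\<And>x. x \<in> K \<Longrightarrow> apply_bcontfun g x = 1" "\<And>x. x \<in> L \<Longrightarrow> apply_bcontfun g x = 0"
  shows "N1 (cut A v - act (apply_bcontfun g) v) \<le> N1 (cut (A - K) v) + N1 (cut (- A - L) v)"
proof -
  have E: "A - K \<in> sets borel" "- A - L \<in> sets borel" using A K L by auto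
  have "N1 (cut A v - act (apply_bcontfun g) v) = N1 (act (\<lambda>x. indicat_real A x - apply_bcontfun g x) v)"
    using A by (simp add: act_diff cut_def)
  also have "\<dots> \<le> N1 (cut ((A - K) \<union> (- A - L)) v)"
  proof (rule N1_act_le_cut)
    show "(\<lambda>x. indicat_real A x - apply_bcontfun g x) \<in> borel_measurable borel"
      using A by (intro borel_measurable_diff bcontfun_borel borel_measurable_indicator) auto
    show "\<bar>indicat_real A x - apply_bcontfun g x\<bar> \<le> indicat_real ((A - K) \<union> (- A - L)) x" for x
      using g(1,2,3,4)[of x] K(2) L(2) by (auto simp: indicator_def)
  qed (use E in auto)
  also have "\<dots> = N1 (cut (A - K) v) + N1 (cut (- A - L) v)" using E by (rule N1_cut_split) blast
  finally show ?thesis .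
qed

text \<open>Inner regularity is used for A and for its complement: g has to be 1 on most of A and 0
  on most of the complement, measured by the density \<bar>v\<bar>.\<close>

lemma cut_cb_approx:
  assumes A: "A \<in> sets borel" and "e > 0"
  obtains g :: "'x \<Rightarrow>\<^sub>C real" where "N1 (cut A v - act (apply_bcontfun g) v) < e"
proof -
  have e2: "e / 2 > 0" using \<open>e > 0\<close> by simp
  obtain K where K: "compact K" "K \<subseteq> A" "K \<in> sets borel" "N1 (cut (A - K) v) < e / 2"
    by (rule compact_approx_N1[OF A e2])
  obtain L where L: "compact L" "L \<subseteq> - A" "L \<in> sets borel" "N1 (cut (- A - L) v) < e / 2"
    by (rule compact_approx_N1[OF borel_comp[OF A] e2])
  have "K \<inter> L = {}" using K(2) L(2) by blast
  then obtain g :: "'x \<Rightarrow>\<^sub>C real" where g: "\<And>x. 0 \<le> apply_bcontfun g x" "\<And>x. apply_bcontfun g x \<le> 1" "norm g \<le> 1"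
      "\<And>x. x \<in> K \<Longrightarrow> apply_bcontfun g x = 1" "supp g \<inter> L = {}" "\<And>x. x \<in> L \<Longrightarrow> apply_bcontfun g x = 0"
    by (rule bump_between[OF K(1) compact_imp_closed[OF L(1)]]) (rule that)
  have "N1 (cut A v - act (apply_bcontfun g) v) \<le> N1 (cut (A - K) v) + N1 (cut (- A - L) v)"
    by (rule N1_cut_minus_act[OF A K(3,2) L(3,2) g(1,2,4,6)])
  also have "\<dots> < e" using K(4) L(4) by linarith
  finally show ?thesis by (rule that)
qed

lemma N1_closure_approx:
  assumes v: "v \<in> closure S" and "e > 0"
  obtains w where "w \<in> S" "N1 (v - w) < e"
proof -
  define k where "k = sqrt (measure m UNIV) + 1"
  have k: "k > 0" unfolding k_def by (simp add: add_nonneg_pos)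
  then have "e / k > 0" using \<open>e > 0\<close> by simp
  then obtain w where w: "w \<in> S" "dist w v < e / k" using v unfolding closure_approachable by blast
  have "N1 (v - w) \<le> sqrt (measure m UNIV) * norm (v - w)" by (rule N1_le_norm)
  also have "\<dots> \<le> k * norm (v - w)" unfolding k_def by (intro mult_right_mono) auto
  also have "\<dots> < e" using w(2) k by (simp add: dist_norm norm_minus_commute pos_less_divide_eq mult_ac)
  finally show ?thesis using w(1) by (rule that[rotated])
qed

text \<open>Density holds with respect to \<open>N1\<close>. The \<open>N1\<close>-closure of
  \<open>cb_comb\<close> is closed for the stronger L^2 norm as well, so that
  \<open>cut_d_dense\<close> applies to it.\<close>

lemma cb_comb_dense:
  assumes "e > 0"
  obtains w where "w \<in> cb_comb" "N1 (v - w) < e"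
proof -
  define S where "S = {v. \<forall>e>0. \<exists>w\<in>cb_comb. N1 (v - w) < e}"
  have "v \<in> S"
  proof (rule cut_d_dense)
    show "subspace S"
      unfolding subspace_def
    proof (intro conjI ballI allI)
      show "0 \<in> S" using subspace_0[OF subspace_cb_comb] unfolding S_def by (intro CollectI allI impI bexI[of _ 0]) simp_all
      fix u assume u: "u \<in> S"
      show "u + v \<in> S" if v: "v \<in> S" for v
        unfolding S_def
      proof (intro CollectI allI impI)
        fix e :: real assume "e > 0"
        then have "e / 2 > 0" by simp
        then obtain a b where ab: "a \<in> cb_comb" "N1 (u - a) < e / 2" "b \<in> cb_comb" "N1 (v - b) < e / 2"
          using u v unfolding S_def by blast
        have "N1 (u + v - (a + b)) \<le> N1 (u - a) + N1 (v - b)"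
          using N1_triangle[of "u - a" "v - b"] by (simp add: algebra_simps)
        then have "N1 (u + v - (a + b)) < e" using ab by linarith
        then show "\<exists>w\<in>cb_comb. N1 (u + v - w) < e" using subspace_add[OF subspace_cb_comb ab(1,3)] by blast
      qed
      show "c *\<^sub>R u \<in> S" for c
        unfolding S_def
      proof (intro CollectI allI impI)
        fix e :: real assume "e > 0"
        then have "e / (\<bar>c\<bar> + 1) > 0" by simp
        then obtain a where a: "a \<in> cb_comb" "N1 (u - a) < e / (\<bar>c\<bar> + 1)" using u unfolding S_def by blast
        have "N1 (c *\<^sub>R u - c *\<^sub>R a) = \<bar>c\<bar> * N1 (u - a)" by (simp add: N1_scale flip: scaleR_diff_right)
        also have "\<dots> \<le> (\<bar>c\<bar> + 1) * N1 (u - a)" by (intro mult_right_mono) auto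
        also have "\<dots> < e" using a(2) by (simp add: pos_less_divide_eq mult.commute)
        finally show "\<exists>w\<in>cb_comb. N1 (c *\<^sub>R u - w) < e" using subspace_scale[OF subspace_cb_comb a(1)] by blast
      qed
    qed
    have "u \<in> S" if u: "u \<in> closure S" for u
      unfolding S_def
    proof (intro CollectI allI impI)
      fix e :: real assume "e > 0"
      then have e2: "e / 2 > 0" by simp
      obtain y where y: "y \<in> S" "N1 (u - y) < e / 2" by (rule N1_closure_approx[OF u e2])
      obtain w where w: "w \<in> cb_comb" "N1 (y - w) < e / 2" using y(1) e2 unfolding S_def by blast
      have "N1 (u - w) < e" using N1_triangle[of "u - y" "y - w"] y(2) w(2) by simp
      with w(1) show "\<exists>w\<in>cb_comb. N1 (u - w) < e" by blast
    qed
    then show "closed S" by (metis closure_subset closure_closed closed_closure subsetI subset_antisym)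
    show "cut A (d f) \<in> S" if A: "A \<in> sets borel" and f: "f \<in> W12 m" for A f
      unfolding S_def
    proof (intro CollectI allI impI)
      fix e :: real assume "e > 0"
      obtain g :: "'x \<Rightarrow>\<^sub>C real" where g: "N1 (cut A (d f) - act (apply_bcontfun g) (d f)) < e"
        by (rule cut_cb_approx[OF A \<open>e > 0\<close>])
      have "act (apply_bcontfun g) (d f) \<in> cb_comb"
        unfolding cb_comb_def
        by (intro CollectI exI[of _ 1] exI[of _ "\<lambda>_. g"] exI[of _ "\<lambda>_. f"]) (use f in simp)
      with g show "\<exists>w\<in>cb_comb. N1 (cut A (d f) - w) < e" by blast
    qed
  qed
  then obtain w where "w \<in> cb_comb" "N1 (v - w) < e" using assms unfolding S_def by blast
  then show ?thesis by (rule that)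
qed

end

section \<open>The tangent module\<close>

context finite_borel
begin

lemma mem_ae_class: "g \<in> ae_class m f \<longleftrightarrow> g \<in> borel_measurable borel \<and> (AE x in m. g x = f x)"
  by (simp add: ae_class_def)

lemma ae_class_cong:
  assumes "AE x in m. f x = g x" shows "ae_class m f = ae_class m g"
proof -
  have "(AE x in m. k x = f x) \<longleftrightarrow> (AE x in m. k x = g x)" for k
    using assms by (auto elim: eventually_elim2)
  then show ?thesis by (simp add: ae_class_def)
qed

lemma ae_class_self: "f \<in> borel_measurable borel \<Longrightarrow> f \<in> ae_class m f"
  by (simp add: mem_ae_class)

lemma L1_member:
  assumes "c \<in> L1 m" "h \<in> c"
  shows "integrable m h" "c = ae_class m h"
proof -
  obtain f where f: "integrable m f" "c = ae_class m f" using assms(1) by (auto simp: L1_def)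
  have h: "h \<in> borel_measurable borel" "AE x in m. h x = f x" using assms(2) f(2) by (auto simp: mem_ae_class)
  have "f \<in> borel_measurable m" using f(1) by (rule borel_measurable_integrable)
  then show "integrable m h" using h f(1) integrable_cong_AE[of h m f] by simp
  show "c = ae_class m h" unfolding f(2) using h(2) by (intro ae_class_cong) (auto elim: eventually_mono)
qed

lemma L1_nonempty: "c \<in> L1 m \<Longrightarrow> \<exists>h. h \<in> c"
  unfolding L1_def using ae_class_self borel_measurable_integrable measurable_m_iff by blast

end

text \<open>A chosen representative of the class \<open>T u\<close>. It is the same choice as in
  \<open>D_tangent\<close>, so integrals of the two agree literally.\<close>

definition ev :: "('c \<Rightarrow> ('x \<Rightarrow> real) set) \<Rightarrow> 'c \<Rightarrow> 'x \<Rightarrow> real" where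
  "ev T u = (SOME h. h \<in> T u)"

context cotangent
begin

lemma L2T_iff: "T \<in> L2T m act \<longleftrightarrow> (\<forall>u. T u \<in> L1 m)
    \<and> (\<forall>u y. \<forall>f\<in>T u. \<forall>g\<in>T y. (\<lambda>x. f x + g x) \<in> T (u + y))
    \<and> (\<forall>h\<in>Linf m. \<forall>u. \<forall>f\<in>T u. (\<lambda>x. h x * f x) \<in> T (act h u))
    \<and> (\<exists>C. \<forall>u. \<forall>f\<in>T u. (LINT x|m. \<bar>f x\<bar>) \<le> C * norm u)"
  unfolding L2T_def by (rule mem_Collect_eq)

lemma L2T_L1: "T \<in> L2T m act \<Longrightarrow> T u \<in> L1 m"
  unfolding L2T_iff by blast

lemma ev_mem: "T \<in> L2T m act \<Longrightarrow> ev T u \<in> T u"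
  unfolding ev_def using L1_nonempty[OF L2T_L1] by (rule someI_ex)

lemma ev_integrable [simp]: "T \<in> L2T m act \<Longrightarrow> integrable m (ev T u)"
  by (rule L1_member(1)[OF L2T_L1 ev_mem])

lemma ev_borel [measurable]: "T \<in> L2T m act \<Longrightarrow> ev T u \<in> borel_measurable borel"
  using borel_measurable_integrable[OF ev_integrable] by simp

lemma L2T_eq: "T \<in> L2T m act \<Longrightarrow> T u = ae_class m (ev T u)"
  by (rule L1_member(2)[OF L2T_L1 ev_mem])

lemma L2T_memD: "T \<in> L2T m act \<Longrightarrow> f \<in> T u \<Longrightarrow> AE x in m. f x = ev T u x"
  by (simp add: L2T_eq mem_ae_class)

lemma ev_add:
  assumes T: "T \<in> L2T m act"
  shows "AE x in m. ev T (u + h) x = ev T u x + ev T h x"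
proof -
  have "(\<lambda>x. ev T u x + ev T h x) \<in> T (u + h)"
    using T ev_mem[OF T, of u] ev_mem[OF T, of h] unfolding L2T_iff by blast
  from L2T_memD[OF T this] show ?thesis by eventually_elim simp
qed

lemma ev_act:
  assumes T: "T \<in> L2T m act" and h: "h \<in> Linf m"
  shows "AE x in m. ev T (act h u) x = h x * ev T u x"
proof -
  have "(\<lambda>x. h x * ev T u x) \<in> T (act h u)"
    using T h ev_mem[OF T, of u] unfolding L2T_iff by blast
  from L2T_memD[OF T this] show ?thesis by eventually_elim simp
qed

lemma ev_bound:
  assumes T: "T \<in> L2T m act"
  obtains C where "0 \<le> C" "\<And>u. (LINT x|m. \<bar>ev T u x\<bar>) \<le> C * norm u"
proof -
  obtain C where C: "\<forall>u. \<forall>f\<in>T u. (LINT x|m. \<bar>f x\<bar>) \<le> C * norm u"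
    using T unfolding L2T_iff by blast
  have "(LINT x|m. \<bar>ev T u x\<bar>) \<le> \<bar>C\<bar> * norm u" for u
  proof -
    have "(LINT x|m. \<bar>ev T u x\<bar>) \<le> C * norm u" using C ev_mem[OF T] by blast
    also have "\<dots> \<le> \<bar>C\<bar> * norm u" by (intro mult_right_mono) auto
    finally show ?thesis .
  qed
  then show ?thesis by (rule that[of "\<bar>C\<bar>", rotated]) simp
qed

lemma ev_cut: "T \<in> L2T m act \<Longrightarrow> A \<in> sets borel \<Longrightarrow> AE x in m. ev T (cut A u) x = indicat_real A x * ev T u x"
  unfolding cut_def by (rule ev_act) auto

lemma ev_scale: "T \<in> L2T m act \<Longrightarrow> AE x in m. ev T (c *\<^sub>R u) x = c * ev T u x"
  using ev_act[of T "\<lambda>_. c" u] by (simp add: act_const)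

lemma ev_zero: "T \<in> L2T m act \<Longrightarrow> AE x in m. ev T 0 x = 0"
  using ev_scale[of T 0 0] by simp

lemma ev_minus: "T \<in> L2T m act \<Longrightarrow> AE x in m. ev T (- u) x = - ev T u x"
  using ev_scale[of T "- 1" u] by simp

lemma L2T_ext:
  assumes "T \<in> L2T m act" "S \<in> L2T m act" "\<And>u. AE x in m. ev T u x = ev S u x"
  shows "T = S"
  by (rule ext) (use assms(1,2) ae_class_cong[OF assms(3)] in \<open>simp add: L2T_eq\<close>)

text \<open>Constructor for elements of the tangent module: a family of representatives satisfying
  the module laws almost everywhere passes to classes, and \<open>ev\<close> recovers the family up
  to null sets.\<close>

lemma L2T_I:
  assumes R: "\<And>u. integrable m (R u)"
    and add: "\<And>u y. AE x in m. R (u + y) x = R u x + R y x"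
    and act: "\<And>h u. h \<in> Linf m \<Longrightarrow> AE x in m. R (act h u) x = h x * R u x"
    and bound: "\<And>u. (LINT x|m. \<bar>R u x\<bar>) \<le> C * norm u"
  shows "(\<lambda>u. ae_class m (R u)) \<in> L2T m act" (is "?T \<in> _")
    and "AE x in m. ev (\<lambda>u. ae_class m (R u)) u x = R u x"
proof -
  have Rb: "R u \<in> borel_measurable borel" for u using borel_measurable_integrable[OF R] by simp
  have 1: "?T u \<in> L1 m" for u using R unfolding L1_def by blast
  have 2: "(\<lambda>x. f x + g x) \<in> ?T (u + y)" if "f \<in> ?T u" "g \<in> ?T y" for f g u y
  proof -
    have fg: "f \<in> borel_measurable borel" "AE x in m. f x = R u x" "g \<in> borel_measurable borel" "AE x in m. g x = R y x"
      using that by (simp_all add: mem_ae_class)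
    have "AE x in m. f x + g x = R (u + y) x" using fg(2,4) add[of u y] by eventually_elim simp
    then show ?thesis using fg(1,3) by (simp add: mem_ae_class)
  qed
  have 3: "(\<lambda>x. h x * f x) \<in> ?T (act h u)" if "h \<in> Linf m" "f \<in> ?T u" for h f u
  proof -
    have f: "f \<in> borel_measurable borel" "AE x in m. f x = R u x" "h \<in> borel_measurable borel"
      using that by (simp_all add: mem_ae_class Linf_iff)
    have "AE x in m. h x * f x = R (act h u) x" using f(2) act[OF that(1), of u] by eventually_elim simp
    then show ?thesis using f(1,3) by (simp add: mem_ae_class)
  qed
  have 4: "(LINT x|m. \<bar>f x\<bar>) \<le> C * norm u" if "f \<in> ?T u" for f u
  proof -
    have f: "f \<in> borel_measurable borel" "AE x in m. f x = R u x" using that by (simp_all add: mem_ae_class)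
    have "(LINT x|m. \<bar>f x\<bar>) = (LINT x|m. \<bar>R u x\<bar>)"
      using f Rb by (intro integral_cong_AE) (auto elim: eventually_mono)
    then show ?thesis using bound by simp
  qed
  show T: "?T \<in> L2T m act" unfolding L2T_iff using 1 2 3 4 by blast
  show "AE x in m. ev ?T u x = R u x" using ev_mem[OF T, of u] by (simp add: mem_ae_class)
qed

lemma tan_zero_L2T: "tan_zero m \<in> L2T m act" "AE x in m. ev (tan_zero m) (u :: 'c) x = 0"
proof -
  show T: "tan_zero m \<in> L2T m act"
    unfolding tan_zero_def by (rule L2T_I(1)[of "\<lambda>_ _. 0" 0]) simp_all
  show "AE x in m. ev (tan_zero m) (u :: 'c) x = 0"
    using ev_mem[OF T, of u] mem_ae_class[of "ev (tan_zero m) u" "\<lambda>_. 0"] by (simp add: tan_zero_def)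
qed

lemma tan_add_eq:
  assumes T: "T \<in> L2T m act" and S: "S \<in> L2T m act"
  shows "tan_add m T S = (\<lambda>u. ae_class m (\<lambda>x. ev T u x + ev S u x))"
proof
  fix u
  have "ae_class m (\<lambda>x. f x + g x) = ae_class m (\<lambda>x. ev T u x + ev S u x)" if "f \<in> T u" "g \<in> S u" for f g
    by (rule ae_class_cong, use L2T_memD[OF T that(1)] L2T_memD[OF S that(2)] in eventually_elim) simp
  then show "tan_add m T S u = ae_class m (\<lambda>x. ev T u x + ev S u x)"
    unfolding tan_add_def using ev_mem[OF T, of u] ev_mem[OF S, of u] by blast
qed

lemma tan_mult_eq:
  assumes T: "T \<in> L2T m act"
  shows "tan_mult m h T = (\<lambda>u. ae_class m (\<lambda>x. h x * ev T u x))"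
proof
  fix u
  have "ae_class m (\<lambda>x. h x * f x) = ae_class m (\<lambda>x. h x * ev T u x)" if "f \<in> T u" for f
    by (rule ae_class_cong, use L2T_memD[OF T that(1)] in eventually_elim) simp
  then show "tan_mult m h T u = ae_class m (\<lambda>x. h x * ev T u x)"
    unfolding tan_mult_def using ev_mem[OF T, of u] by blast
qed

lemma tan_add_L2T:
  assumes T: "T \<in> L2T m act" and S: "S \<in> L2T m act"
  shows "tan_add m T S \<in> L2T m act" "AE x in m. ev (tan_add m T S) u x = ev T u x + ev S u x"
proof -
  obtain C where C: "\<And>u. (LINT x|m. \<bar>ev T u x\<bar>) \<le> C * norm u" by (rule ev_bound[OF T]) (rule that)
  obtain D where D: "\<And>u. (LINT x|m. \<bar>ev S u x\<bar>) \<le> D * norm u" by (rule ev_bound[OF S]) (rule that)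
  have "(LINT x|m. \<bar>ev T u x + ev S u x\<bar>) \<le> (C + D) * norm u" for u
  proof -
    have "(LINT x|m. \<bar>ev T u x + ev S u x\<bar>) \<le> (LINT x|m. \<bar>ev T u x\<bar> + \<bar>ev S u x\<bar>)"
      using T S by (intro integral_mono) auto
    also have "\<dots> = (LINT x|m. \<bar>ev T u x\<bar>) + (LINT x|m. \<bar>ev S u x\<bar>)" using T S by simp
    finally show ?thesis using C[of u] D[of u] by (simp add: algebra_simps)
  qed
  moreover have "AE x in m. ev T (u + y) x + ev S (u + y) x = (ev T u x + ev S u x) + (ev T y x + ev S y x)" for u y
    using ev_add[OF T, of u y] ev_add[OF S, of u y] by eventually_elim simp
  moreover have "AE x in m. ev T (act h u) x + ev S (act h u) x = h x * (ev T u x + ev S u x)" if "h \<in> Linf m" for h u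
    using ev_act[OF T that, of u] ev_act[OF S that, of u] by eventually_elim (simp add: algebra_simps)
  moreover have "integrable m (\<lambda>x. ev T u x + ev S u x)" for u using T S by simp
  ultimately show "tan_add m T S \<in> L2T m act" "AE x in m. ev (tan_add m T S) u x = ev T u x + ev S u x"
    unfolding tan_add_eq[OF T S] by - (rule L2T_I[of "\<lambda>u x. ev T u x + ev S u x" "C + D"]; assumption)+
qed

lemma Linf_mult_integrable:
  assumes "h \<in> Linf m" "integrable m f" shows "integrable m (\<lambda>x. h x * f x)"
proof -
  obtain C where C: "AE x in m. \<bar>h x\<bar> \<le> C" using assms(1) by (auto simp: Linf_iff)
  have f: "f \<in> borel_measurable borel" using borel_measurable_integrable[OF assms(2)] by simp
  have h: "h \<in> borel_measurable borel" using assms(1) by (simp add: Linf_iff)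
  have "AE x in m. norm (h x * f x) \<le> norm (C * f x)"
    using C
  proof eventually_elim
    case (elim x)
    then have "\<bar>h x\<bar> * \<bar>f x\<bar> \<le> \<bar>C\<bar> * \<bar>f x\<bar>" by (intro mult_right_mono) auto
    then show ?case by (simp add: abs_mult)
  qed
  then show ?thesis
    by (rule Bochner_Integration.integrable_bound[rotated 2]) (use assms(2) f h in simp_all)
qed

lemma tan_mult_L2T:
  assumes T: "T \<in> L2T m act" and h: "h \<in> Linf m"
  shows "tan_mult m h T \<in> L2T m act" "AE x in m. ev (tan_mult m h T) u x = h x * ev T u x"
proof -
  obtain C where C: "0 \<le> C" "\<And>u. (LINT x|m. \<bar>ev T u x\<bar>) \<le> C * norm u" by (rule ev_bound[OF T]) (rule that)
  obtain K where K: "AE x in m. \<bar>h x\<bar> \<le> K" using h by (auto simp: Linf_iff)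
  have int: "integrable m (\<lambda>x. h x * ev T u x)" for u by (rule Linf_mult_integrable[OF h ev_integrable[OF T]])
  have "(LINT x|m. \<bar>h x * ev T u x\<bar>) \<le> (\<bar>K\<bar> * C) * norm u" for u
  proof -
    have "(LINT x|m. \<bar>h x * ev T u x\<bar>) \<le> (LINT x|m. \<bar>K\<bar> * \<bar>ev T u x\<bar>)"
    proof (rule integral_mono_AE)
      show "AE x in m. \<bar>h x * ev T u x\<bar> \<le> \<bar>K\<bar> * \<bar>ev T u x\<bar>"
        using K by eventually_elim (auto simp: abs_mult intro!: mult_right_mono)
    qed (use T int in auto)
    also have "\<dots> = \<bar>K\<bar> * (LINT x|m. \<bar>ev T u x\<bar>)" by simp
    also have "\<dots> \<le> \<bar>K\<bar> * (C * norm u)" by (intro mult_left_mono C(2)) simp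
    finally show ?thesis by (simp add: mult_ac)
  qed
  moreover have "AE x in m. h x * ev T (u + y) x = h x * ev T u x + h x * ev T y x" for u y
    using ev_add[OF T, of u y] by eventually_elim (simp add: algebra_simps)
  moreover have "AE x in m. h x * ev T (act k u) x = k x * (h x * ev T u x)" if "k \<in> Linf m" for k u
    using ev_act[OF T that, of u] by eventually_elim simp
  ultimately show "tan_mult m h T \<in> L2T m act" "AE x in m. ev (tan_mult m h T) u x = h x * ev T u x"
    unfolding tan_mult_eq[OF T] using int by - (rule L2T_I[of "\<lambda>u x. h x * ev T u x" "\<bar>K\<bar> * C"]; assumption)+
qed

subsection \<open>The dual pointwise norm\<close>

text \<open>Gluing: u is kept where its pairing with T is the larger one and h elsewhere. Hence the
  pairings of T with the unit ball form an upward directed family.\<close>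

lemma unit_ball_join:
  assumes T: "T \<in> L2T m act" and u: "AE x in m. pn u x \<le> 1" and h: "AE x in m. pn h x \<le> 1"
  obtains z where "AE x in m. pn z x \<le> 1" "AE x in m. ev T z x = max (ev T u x) (ev T h x)"
proof -
  note [measurable] = ev_borel[OF T]
  define A where "A = {x. ev T h x \<le> ev T u x}"
  have A: "A \<in> sets borel" "- A \<in> sets borel" unfolding A_def by measurable
  define z where "z = cut A u + cut (- A) h"
  have "AE x in m. pn z x \<le> 1"
    using pn_triangle[of "cut A u" "cut (- A) h"] pn_cut[OF A(1), of u] pn_cut[OF A(2), of h] u h
  proof eventually_elim
    case (elim x)
    then show ?case by (cases "x \<in> A") (simp_all add: z_def)
  qed
  moreover have "AE x in m. ev T z x = max (ev T u x) (ev T h x)"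
    using ev_add[OF T, of "cut A u" "cut (- A) h"] ev_cut[OF T A(1), of u] ev_cut[OF T A(2), of h]
    by eventually_elim (auto simp: z_def A_def indicator_def max_def)
  ultimately show ?thesis by (rule that)
qed

text \<open>The essential supremum of a directed family is an increasing limit: maximize the
  integral of \<open>ev T u\<close> over the unit ball along an almost everywhere increasing
  sequence. The last claim records that a single u nearly attains the integral of the dual
  norm.\<close>

lemma dual_pnorm_exists:
  assumes T: "T \<in> L2T m act"
  obtains h where "is_dual_pnorm m pn T h" "integrable m h"
    "\<And>e. e > 0 \<Longrightarrow> \<exists>u. (AE x in m. pn u x \<le> 1) \<and> (LINT x|m. h x) - e < (LINT x|m. ev T u x)"
proof -
  note [measurable] = ev_borel[OF T]
  define U where "U = {u. AE x in m. pn u x \<le> 1}"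
  define I where "I u = (LINT x|m. ev T u x)" for u
  have int: "integrable m (ev T u)" for u by (rule ev_integrable[OF T])
  obtain C where C: "0 \<le> C" "\<And>u. (LINT x|m. \<bar>ev T u x\<bar>) \<le> C * norm u" by (rule ev_bound[OF T]) (rule that)
  \<comment> \<open>A vector with pointwise norm at most 1 has L^2 norm at most the square root of
    m(X).\<close>
  define B where "B = C * sqrt (measure m UNIV)"
  have IB: "I u \<le> B" if u: "u \<in> U" for u
  proof -
    have "sqint (pn u) \<le> (LINT x|m. 1)"
    proof (rule integral_mono_AE)
      show "AE x in m. (pn u x)\<^sup>2 \<le> 1"
        using u[unfolded U_def mem_Collect_eq] pn_nonneg[of u] by eventually_elim (simp add: power_le_one)
    qed (use L2_square[OF pn_L2] in auto)
    then have "norm u \<le> sqrt (measure m UNIV)" by (simp add: norm_pn)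
    then have "C * norm u \<le> B" unfolding B_def using C(1) by (rule mult_left_mono)
    moreover have "I u \<le> (LINT x|m. \<bar>ev T u x\<bar>)" unfolding I_def using int by (intro integral_mono) auto
    ultimately show ?thesis using C(2)[of u] by linarith
  qed
  have U0: "0 \<in> U" unfolding U_def mem_Collect_eq using pn_zero by eventually_elim simp
  define M where "M = Sup (I ` U)"
  have bdd: "bdd_above (I ` U)" using IB by (intro bdd_aboveI2[where M = B])
  have IM: "I u \<le> M" if "u \<in> U" for u unfolding M_def using bdd that by (intro cSUP_upper)
  have near: "\<exists>u\<in>U. M - e < I u" if "e > 0" for e
  proof -
    have "M - e < Sup (I ` U)" using that by (simp add: M_def)
    then show ?thesis using U0 less_cSUP_iff[OF _ bdd] by blast
  qed
  have "\<exists>y. \<forall>n. (y n \<in> U \<and> M - 1 / Suc n < I (y n)) \<and> (AE x in m. ev T (y n) x \<le> ev T (y (Suc n)) x)"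
  proof (rule dependent_nat_choice)
    have "(0::real) < 1 / Suc 0" by simp
    from near[OF this] show "\<exists>u. u \<in> U \<and> M - 1 / real (Suc 0) < I u" by blast
    fix u n assume u: "u \<in> U \<and> M - 1 / real (Suc n) < I u"
    have "(0::real) < 1 / Suc (Suc n)" by simp
    from near[OF this] obtain y where y: "y \<in> U" "M - 1 / real (Suc (Suc n)) < I y" by blast
    obtain z where z: "AE x in m. pn z x \<le> 1" "AE x in m. ev T z x = max (ev T u x) (ev T y x)"
      using u y unfolding U_def mem_Collect_eq by (elim conjE) (rule unit_ball_join[OF T])
    have "AE x in m. ev T y x \<le> ev T z x" using z(2) by eventually_elim simp
    then have "I y \<le> I z" unfolding I_def by (intro integral_mono_AE int)
    then have "M - 1 / real (Suc (Suc n)) < I z" using y(2) by linarith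
    moreover have "AE x in m. ev T u x \<le> ev T z x" using z(2) by eventually_elim simp
    ultimately show "\<exists>z. (z \<in> U \<and> M - 1 / real (Suc (Suc n)) < I z) \<and> (AE x in m. ev T u x \<le> ev T z x)"
      using z(1) unfolding U_def mem_Collect_eq by blast
  qed
  then obtain y where y': "\<forall>n. (y n \<in> U \<and> M - 1 / Suc n < I (y n)) \<and> (AE x in m. ev T (y n) x \<le> ev T (y (Suc n)) x)" ..
  have y: "y n \<in> U" "M - 1 / Suc n < I (y n)" "AE x in m. ev T (y n) x \<le> ev T (y (Suc n)) x" for n
    using y'[rule_format, of n] by blast+
  define g where "g n = ev T (y n)" for n
  have gb [measurable]: "g n \<in> borel_measurable borel" for n unfolding g_def by measurable
  have gi: "integrable m (g n)" for n unfolding g_def by (rule int)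
  have "AE x in m. \<forall>n. g n x \<le> g (Suc n) x" unfolding AE_all_countable g_def using y(3) by blast
  then have mono: "AE x in m. incseq (\<lambda>n. g n x)" by eventually_elim (simp add: incseq_SucI)
  have IgM: "(LINT x|m. g n x) \<le> M" for n using IM[OF y(1)] by (simp add: g_def I_def)
  have Ilim: "(\<lambda>n. \<integral>x. g n x \<partial>m) \<longlonglongrightarrow> M"
  proof (rule tendsto_sandwich[OF always_eventually always_eventually])
    show "\<forall>n. M - 1 / real (Suc n) \<le> (LINT x|m. g n x)" using y(2) by (auto simp: g_def I_def less_imp_le)
    show "\<forall>n. (LINT x|m. g n x) \<le> M" using IgM by blast
    have "(\<lambda>n. M - 1 / real (Suc n)) \<longlonglongrightarrow> M - 0" by (intro tendsto_diff tendsto_const lim_1_over_n[THEN LIMSEQ_Suc])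
    then show "(\<lambda>n. M - 1 / real (Suc n)) \<longlonglongrightarrow> M" by simp
  qed (rule tendsto_const)
  \<comment> \<open>Subtracting g 0 makes the sequence nonnegative; monotone convergence then shows
    that the supremum is finite almost everywhere.\<close>
  have "(\<integral>\<^sup>+x. (SUP n. ennreal (g n x - g 0 x)) \<partial>m) = (SUP n. \<integral>\<^sup>+x. ennreal (g n x - g 0 x) \<partial>m)"
  proof (rule nn_integral_monotone_convergence_SUP_AE)
    show "AE x in m. ennreal (g n x - g 0 x) \<le> ennreal (g (Suc n) x - g 0 x)" for n
      using mono by eventually_elim (intro ennreal_leI diff_right_mono incseq_SucD)
  qed simp
  also have "\<dots> \<le> ennreal (M - (LINT x|m. g 0 x))"
  proof (rule SUP_least)
    fix n
    have "(\<integral>\<^sup>+x. ennreal (g n x - g 0 x) \<partial>m) = ennreal (LINT x|m. g n x - g 0 x)"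
    proof (rule nn_integral_eq_integral)
      show "AE x in m. 0 \<le> g n x - g 0 x" using mono
      proof eventually_elim
        case (elim x)
        then show ?case using incseqD[OF elim, of 0 n] by simp
      qed
    qed (use gi in simp)
    also have "\<dots> \<le> ennreal (M - (LINT x|m. g 0 x))" using IgM[of n] gi by (intro ennreal_leI) simp
    finally show "(\<integral>\<^sup>+x. ennreal (g n x - g 0 x) \<partial>m) \<le> ennreal (M - (LINT x|m. g 0 x))" .
  qed
  finally have "(\<integral>\<^sup>+x. (SUP n. ennreal (g n x - g 0 x)) \<partial>m) \<noteq> \<infinity>" by (auto simp: top_unique)
  then have fin: "AE x in m. (SUP n. ennreal (g n x - g 0 x)) \<noteq> \<infinity>" by (intro nn_integral_PInf_AE) simp
  define h where "h x = lim (\<lambda>n. g n x)" for x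
  have hb [measurable]: "h \<in> borel_measurable borel" unfolding h_def by (intro borel_measurable_lim_metric) measurable
  have lim: "AE x in m. (\<lambda>n. g n x) \<longlonglongrightarrow> h x"
    using mono fin
  proof eventually_elim
    case (elim x)
    obtain b where b: "0 \<le> b" "(SUP n. ennreal (g n x - g 0 x)) = ennreal b"
      using elim(2) by (cases "SUP n. ennreal (g n x - g 0 x)") auto
    have "g n x \<le> g 0 x + b" for n
    proof -
      have "ennreal (g n x - g 0 x) \<le> ennreal b" unfolding b(2)[symmetric] by (rule SUP_upper) simp
      then show ?thesis using b(1) by (simp add: ennreal_le_iff)
    qed
    then have "convergent (\<lambda>n. g n x)" using incseq_convergent[OF elim(1)] convergentI by blast
    then show ?case by (simp add: h_def convergent_LIMSEQ_iff)
  qed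
  have hint: "integrable m h" and hM: "(LINT x|m. h x) = M"
    using integrable_monotone_convergence[OF gi mono lim Ilim] integral_monotone_convergence[OF gi mono lim Ilim] by simp_all
  have gh: "AE x in m. g n x \<le> h x" for n
    using mono lim by eventually_elim (rule incseq_le)
  have ub: "AE x in m. ev T u x \<le> h x" if u: "u \<in> U" for u
  proof -
    \<comment> \<open>The part of \<open>ev T u\<close> exceeding h. Joining u with the n-th
      maximizing vector cannot raise the integral above M, so q integrates to at most M minus the
      integral of g n, which tends to 0.\<close>
    define q where "q x = max (ev T u x) (h x) - h x" for x
    have qi: "integrable m q" unfolding q_def[abs_def] using int hint by simp
    have qnn: "0 \<le> q x" for x by (simp add: q_def)
    have "(LINT x|m. q x) \<le> M - (LINT x|m. g n x)" for n
    proof -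
      obtain z where z: "AE x in m. pn z x \<le> 1" "AE x in m. ev T z x = max (ev T u x) (ev T (y n) x)"
        using u y(1)[of n] unfolding U_def mem_Collect_eq by (rule unit_ball_join[OF T])
      have "(LINT x|m. q x) \<le> (LINT x|m. ev T z x - g n x)"
      proof (rule integral_mono_AE[OF qi])
        show "AE x in m. q x \<le> ev T z x - g n x"
          using z(2) gh[of n] by eventually_elim (auto simp: q_def g_def max_def)
      qed (use int gi in simp)
      also have "\<dots> = I z - (LINT x|m. g n x)" using int gi by (simp add: I_def)
      also have "\<dots> \<le> M - (LINT x|m. g n x)" using IM[of z] z(1) by (simp add: U_def)
      finally show ?thesis .
    qed
    then have "(LINT x|m. q x) \<le> M - M"
      by (intro LIMSEQ_le_const[OF tendsto_diff[OF tendsto_const Ilim]]) blast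
    moreover have "0 \<le> (LINT x|m. q x)" using qnn by simp
    ultimately have "(LINT x|m. q x) = 0" by simp
    then have "AE x in m. q x = 0" using integral_nonneg_eq_0_iff_AE[OF qi] qnn by simp
    then show ?thesis by eventually_elim (simp add: q_def max_def split: if_splits)
  qed
  have "is_dual_pnorm m pn T h"
    unfolding is_dual_pnorm_def Let_def
  proof (intro conjI allI impI ballI)
    show "h \<in> borel_measurable m" by simp
    fix u f assume "AE x in m. pn u x \<le> 1" "f \<in> T u"
    then have "AE x in m. ev T u x \<le> h x" by (intro ub) (simp add: U_def)
    with L2T_memD[OF T \<open>f \<in> T u\<close>] show "AE x in m. f x \<le> h x" by eventually_elim simp
  next
    fix k assume k: "k \<in> borel_measurable m \<and> (\<forall>u. (AE x in m. pn u x \<le> 1) \<longrightarrow> (\<forall>f\<in>T u. AE x in m. f x \<le> k x))"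
    have "AE x in m. g n x \<le> k x" for n
      using k y(1)[of n] ev_mem[OF T, of "y n"] unfolding g_def U_def mem_Collect_eq by blast
    then have "AE x in m. \<forall>n. g n x \<le> k x" unfolding AE_all_countable by blast
    with lim show "AE x in m. h x \<le> k x" by eventually_elim (rule LIMSEQ_le_const2, auto)
  qed
  moreover have "\<exists>u. (AE x in m. pn u x \<le> 1) \<and> (LINT x|m. h x) - e < (LINT x|m. ev T u x)" if "e > 0" for e
    using near[OF that] unfolding hM U_def I_def by blast
  ultimately show ?thesis using hint by (intro that)
qed

abbreviation PT :: "('c \<Rightarrow> ('x \<Rightarrow> real) set) \<Rightarrow> 'x \<Rightarrow> real" where
  "PT T \<equiv> dual_pnorm m pn T"

lemma is_dual_pnorm_PT:
  assumes "T \<in> L2T m act" shows "is_dual_pnorm m pn T (PT T)"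
proof -
  obtain h where "is_dual_pnorm m pn T h" by (rule dual_pnorm_exists[OF assms])
  then show ?thesis unfolding dual_pnorm_def by (rule someI[where P = "is_dual_pnorm m pn T"])
qed

lemma is_dual_pnorm_unique:
  assumes "is_dual_pnorm m pn T h" "is_dual_pnorm m pn T k" shows "AE x in m. h x = k x"
proof -
  have "AE x in m. h x \<le> k x" "AE x in m. k x \<le> h x"
    using assms unfolding is_dual_pnorm_def Let_def by blast+
  then show ?thesis by eventually_elim simp
qed

lemma is_dual_pnorm_cong:
  assumes h: "is_dual_pnorm m pn T h" and k: "k \<in> borel_measurable borel" "AE x in m. h x = k x"
  shows "is_dual_pnorm m pn T k"
  unfolding is_dual_pnorm_def Let_def
proof (intro conjI allI impI ballI)
  fix u f assume "AE x in m. pn u x \<le> 1" "f \<in> T u"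
  then have "AE x in m. f x \<le> h x" using h unfolding is_dual_pnorm_def Let_def by blast
  with k(2) show "AE x in m. f x \<le> k x" by eventually_elim simp
next
  fix q assume "q \<in> borel_measurable m \<and> (\<forall>u. (AE x in m. pn u x \<le> 1) \<longrightarrow> (\<forall>f\<in>T u. AE x in m. f x \<le> q x))"
  then have "AE x in m. h x \<le> q x" using h unfolding is_dual_pnorm_def Let_def by blast
  with k(2) show "AE x in m. k x \<le> q x" by eventually_elim simp
qed (use k in simp)

lemma is_dual_pnorm_iff:
  assumes T: "T \<in> L2T m act"
  shows "is_dual_pnorm m pn T h \<longleftrightarrow> h \<in> borel_measurable borel \<and> (AE x in m. PT T x = h x)"
proof
  assume h: "is_dual_pnorm m pn T h"
  then have "h \<in> borel_measurable borel" unfolding is_dual_pnorm_def Let_def by simp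
  then show "h \<in> borel_measurable borel \<and> (AE x in m. PT T x = h x)"
    using is_dual_pnorm_unique[OF is_dual_pnorm_PT[OF T] h] by simp
qed (use is_dual_pnorm_cong[OF is_dual_pnorm_PT[OF T]] in blast)

lemma PT_borel [measurable]: "T \<in> L2T m act \<Longrightarrow> PT T \<in> borel_measurable borel"
  using is_dual_pnorm_PT[of T] by (simp add: is_dual_pnorm_iff)

text \<open>By the second claim, a bound on the pairings that is uniform over the unit ball becomes
  an L^1 bound for the dual pointwise norm.\<close>

lemma PT_integrable:
  assumes T: "T \<in> L2T m act"
  shows "integrable m (PT T)"
    and "e > 0 \<Longrightarrow> \<exists>u. (AE x in m. pn u x \<le> 1) \<and> (LINT x|m. PT T x) - e < (LINT x|m. ev T u x)"
proof -
  obtain h where h: "is_dual_pnorm m pn T h" "integrable m h"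
    "\<And>e. e > 0 \<Longrightarrow> \<exists>u. (AE x in m. pn u x \<le> 1) \<and> (LINT x|m. h x) - e < (LINT x|m. ev T u x)"
    by (rule dual_pnorm_exists[OF T]) (rule that)
  have eq: "AE x in m. PT T x = h x" and hb: "h \<in> borel_measurable borel"
    using h(1) by (simp_all add: is_dual_pnorm_iff[OF T])
  show "integrable m (PT T)" using integrable_cong_AE[OF _ _ eq] h(2) hb PT_borel[OF T] by simp
  have "(LINT x|m. PT T x) = (LINT x|m. h x)" using hb PT_borel[OF T] eq by (intro integral_cong_AE) auto
  then show "e > 0 \<Longrightarrow> \<exists>u. (AE x in m. pn u x \<le> 1) \<and> (LINT x|m. PT T x) - e < (LINT x|m. ev T u x)"
    using h(3) by simp
qed

lemma ev_le_PT_unit: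
  assumes T: "T \<in> L2T m act" and "AE x in m. pn u x \<le> 1"
  shows "AE x in m. ev T u x \<le> PT T x"
  using is_dual_pnorm_PT[OF T] assms(2) ev_mem[OF T] unfolding is_dual_pnorm_def Let_def by blast

lemma PT_nonneg:
  assumes T: "T \<in> L2T m act" shows "AE x in m. 0 \<le> PT T x"
proof -
  have "AE x in m. pn 0 x \<le> 1" using pn_zero by eventually_elim simp
  from ev_le_PT_unit[OF T this] ev_zero[OF T] show ?thesis by eventually_elim simp
qed

text \<open>The normalization u / \<bar>u\<bar> is an admissible multiple only where \<bar>u\<bar>
  is bounded away from 0, hence the cutoffs \<open>f n\<close> on the sets \<bar>u\<bar> > 1 / Suc
  n.\<close>

lemma ev_le_PT_one_sided:
  assumes T: "T \<in> L2T m act"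
  shows "AE x in m. ev T u x \<le> PT T x * pn u x"
proof -
  define A where "A n = {x. 1 / real (Suc n) < pn u x}" for n
  have A [measurable]: "A n \<in> sets borel" for n unfolding A_def by measurable
  define f where "f n x = indicat_real (A n) x / pn u x" for n x
  have f: "f n \<in> Linf m" for n
  proof (rule LinfI)
    show "f n \<in> borel_measurable borel" unfolding f_def[abs_def] by measurable
    show "\<bar>f n x\<bar> \<le> real (Suc n)" for x
    proof (cases "x \<in> A n")
      case True
      then have *: "1 / real (Suc n) < pn u x" by (simp add: A_def)
      moreover have "0 < 1 / real (Suc n)" by simp
      ultimately have pos: "0 < pn u x" by linarith
      have "1 < real (Suc n) * pn u x" using * by (simp add: field_simps)
      then have "1 / pn u x < real (Suc n)" using pos by (simp add: pos_divide_less_eq)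
      then show ?thesis using True pos by (simp add: f_def)
    qed (simp add: f_def)
  qed
  have "AE x in m. ev T (act (f n) u) x \<le> PT T x" for n
  proof (rule ev_le_PT_unit[OF T])
    show "AE x in m. pn (act (f n) u) x \<le> 1"
      using pn_act[OF f, of n u] pn_nonneg[of u]
      by eventually_elim (auto simp: f_def indicator_def)
  qed
  then have 1: "AE x in m. \<forall>n. ev T (act (f n) u) x \<le> PT T x" unfolding AE_all_countable by blast
  have 2: "AE x in m. \<forall>n. ev T (act (f n) u) x = f n x * ev T u x"
    unfolding AE_all_countable using ev_act[OF T f] by blast
  define Z where "Z = {x. pn u x = 0}"
  have Z: "Z \<in> sets borel" unfolding Z_def by measurable
  \<comment> \<open>Where the pointwise norm of u vanishes the normalization gives nothing; but the
    cut of u to that set is the zero vector, so its pairing vanishes there.\<close>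
  have "norm (cut Z u) = 0"
  proof -
    have "indicat_real Z x * (pn u x)\<^sup>2 = 0" for x by (cases "x \<in> Z") (simp_all add: Z_def)
    then show ?thesis unfolding norm_cut[OF Z] by (simp only: Bochner_Integration.integral_zero real_sqrt_zero)
  qed
  then have "cut Z u = 0" by simp
  then have 3: "AE x in m. indicat_real Z x * ev T u x = 0"
    using ev_cut[OF T Z, of u] ev_zero[OF T] by (auto elim: eventually_elim2)
  show ?thesis using 1 2 3 pn_nonneg[of u]
  proof eventually_elim
    case (elim x)
    show ?case
    proof (cases "pn u x = 0")
      case True
      then show ?thesis using elim(3) by (simp add: Z_def)
    next
      case False
      then have pos: "0 < pn u x" using elim(4) by simp
      then obtain n where "1 / real (Suc n) < pn u x" using nat_approx_posE by blast
      then have "f n x = 1 / pn u x" by (simp add: f_def A_def)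
      then have "ev T u x / pn u x \<le> PT T x" using elim(1,2)[rule_format, of n] by simp
      then show ?thesis using pos by (simp add: pos_divide_le_eq)
    qed
  qed
qed

lemma ev_le_PT:
  assumes T: "T \<in> L2T m act" shows "AE x in m. \<bar>ev T u x\<bar> \<le> PT T x * pn u x"
  using ev_le_PT_one_sided[OF T, of u] ev_le_PT_one_sided[OF T, of "- u"] ev_minus[OF T, of u] pn_minus[of u]
  by eventually_elim (simp add: abs_le_iff)

lemma PT_least:
  assumes T: "T \<in> L2T m act" and k: "k \<in> borel_measurable borel" "AE x in m. 0 \<le> k x"
    and le: "\<And>u. AE x in m. ev T u x \<le> k x * pn u x"
  shows "AE x in m. PT T x \<le> k x"
proof -
  have "AE x in m. f x \<le> k x" if "AE x in m. pn u x \<le> 1" "f \<in> T u" for u f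
    using L2T_memD[OF T that(2)] le[of u] that(1) k(2)
  proof eventually_elim
    case (elim x)
    have "k x * pn u x \<le> k x * 1" using elim(3,4) by (intro mult_left_mono)
    then show ?case using elim by simp
  qed
  then show ?thesis using is_dual_pnorm_PT[OF T] k(1) unfolding is_dual_pnorm_def Let_def measurable_m_iff by blast
qed

lemma PT_mult:
  assumes T: "T \<in> L2T m act" and h: "h \<in> Linf m"
  shows "AE x in m. PT (tan_mult m h T) x \<le> \<bar>h x\<bar> * PT T x"
proof (rule PT_least[OF tan_mult_L2T(1)[OF T h]])
  show "(\<lambda>x. \<bar>h x\<bar> * PT T x) \<in> borel_measurable borel"
    using PT_borel[OF T] h by (intro borel_measurable_times borel_measurable_abs) (auto simp: Linf_iff)
  show "AE x in m. 0 \<le> \<bar>h x\<bar> * PT T x" using PT_nonneg[OF T] by eventually_elim simp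
  show "AE x in m. ev (tan_mult m h T) u x \<le> \<bar>h x\<bar> * PT T x * pn u x" for u
    using tan_mult_L2T(2)[OF T h, of u] ev_le_PT[OF T, of u]
  proof eventually_elim
    case (elim x)
    have "h x * ev T u x \<le> \<bar>h x\<bar> * \<bar>ev T u x\<bar>" by (metis abs_ge_self abs_mult)
    also have "\<dots> \<le> \<bar>h x\<bar> * (PT T x * pn u x)" using elim(2) by (rule mult_left_mono) simp
    finally show ?case using elim(1) by (simp add: mult_ac)
  qed
qed

end

section \<open>The ring of bounded continuous functions\<close>

lemma bcontfun_mult: "(\<lambda>x. apply_bcontfun f x * apply_bcontfun g x) \<in> bcontfun"
  for f g :: "'x::topological_space \<Rightarrow>\<^sub>C real"
proof (rule bcontfun_normI)
  show "continuous_on UNIV (\<lambda>x. apply_bcontfun f x * apply_bcontfun g x)"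
    by (intro continuous_intros continuous_on_apply_bcontfun)
  show "norm (apply_bcontfun f x * apply_bcontfun g x) \<le> norm f * norm g" for x
    unfolding norm_mult by (intro mult_mono norm_bounded) auto
qed

lemma apply_cb_mult [simp]:
  "apply_bcontfun (cb_mult f g) x = apply_bcontfun f x * apply_bcontfun g x"
  for f g :: "'x::topological_space \<Rightarrow>\<^sub>C real"
  by (simp add: Bcontfun_inverse[OF bcontfun_mult])

lemma Cb_simps [simp]: "carrier Cb = UNIV" "monoid.mult Cb = cb_mult" "one Cb = const_bcontfun 1"
  "zero Cb = 0" "add Cb = (+)"
  by (simp_all add: Cb_def)

lemma cring_Cb: "cring (Cb :: ('x::topological_space \<Rightarrow>\<^sub>C real) ring)"
proof (rule cringI)
  show "abelian_group (Cb :: ('x \<Rightarrow>\<^sub>C real) ring)"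
  proof (rule abelian_groupI)
    show "\<exists>y\<in>carrier Cb. y \<oplus>\<^bsub>Cb\<^esub> x = \<zero>\<^bsub>Cb\<^esub>" for x :: "'x \<Rightarrow>\<^sub>C real"
      by (rule bexI[of _ "- x"]) simp_all
  qed (simp_all add: add.assoc add.commute)
  show "Group.comm_monoid (Cb :: ('x \<Rightarrow>\<^sub>C real) ring)"
    by (rule comm_monoidI) (auto intro!: bcontfun_eqI simp: mult_ac apply_bcontfun_inverse)
  show "(f \<oplus>\<^bsub>Cb\<^esub> g) \<otimes>\<^bsub>Cb\<^esub> h = f \<otimes>\<^bsub>Cb\<^esub> h \<oplus>\<^bsub>Cb\<^esub> g \<otimes>\<^bsub>Cb\<^esub> h" for f g h :: "'x \<Rightarrow>\<^sub>C real"
    unfolding Cb_simps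
    by (rule bcontfun_eqI, unfold apply_cb_mult) (simp add: plus_bcontfun.rep_eq distrib_right)
qed

section \<open>The bounded vector fields as a normed module\<close>

context cotangent
begin

abbreviation TM :: "('x, 'c \<Rightarrow> ('x \<Rightarrow> real) set) normed_cb_module" where
  "TM \<equiv> LinfT m act pn"

text \<open>Passage from a vector field to its functional on the cotangent module. As T can be
  recovered from \<open>J T\<close>, identities and norm bounds of fields are proved for the
  functionals.\<close>

definition J :: "('c \<Rightarrow> ('x \<Rightarrow> real) set) \<Rightarrow> 'c \<Rightarrow> real" where
  "J T u = (LINT x|m. ev T u x)"

lemma TM_simps [simp]:
  "zero TM = tan_zero m" "add TM = tan_add m" "smult TM g = tan_mult m (apply_bcontfun g)"
  "vnorm TM T = Linf_norm m (PT T)"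
  by (simp_all add: LinfT_def)

lemma carrier_TM: "T \<in> carrier TM \<longleftrightarrow> T \<in> L2T m act \<and> (\<exists>C. AE x in m. PT T x \<le> C)"
proof -
  have "(\<exists>h\<in>Linf m. is_dual_pnorm m pn T h) \<longleftrightarrow> (\<exists>C. AE x in m. PT T x \<le> C)" if T: "T \<in> L2T m act"
  proof
    assume "\<exists>h\<in>Linf m. is_dual_pnorm m pn T h"
    then obtain h where h: "h \<in> Linf m" "AE x in m. PT T x = h x" using T by (auto simp: is_dual_pnorm_iff)
    then obtain C where "AE x in m. \<bar>h x\<bar> \<le> C" by (auto simp: Linf_iff)
    with h(2) have "AE x in m. PT T x \<le> C" by eventually_elim auto
    then show "\<exists>C. AE x in m. PT T x \<le> C" ..
  next
    assume "\<exists>C. AE x in m. PT T x \<le> C"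
    then obtain C where "AE x in m. PT T x \<le> C" ..
    with PT_nonneg[OF T] have "AE x in m. \<bar>PT T x\<bar> \<le> C" by eventually_elim simp
    then have "PT T \<in> Linf m" using PT_borel[OF T] by (auto simp: Linf_iff)
    then show "\<exists>h\<in>Linf m. is_dual_pnorm m pn T h" using is_dual_pnorm_PT[OF T] by blast
  qed
  then show ?thesis by (auto simp: LinfT_def)
qed

lemma TM_L2T: "T \<in> carrier TM \<Longrightarrow> T \<in> L2T m act"
  by (simp add: carrier_TM)

text \<open>The infimum in \<open>Linf_norm\<close> is attained, as an intersection of countably
  many full sets.\<close>

lemma Linf_norm_props:
  assumes "AE x in m. \<bar>f x\<bar> \<le> C"
  shows "AE x in m. \<bar>f x\<bar> \<le> Linf_norm m f" "0 \<le> Linf_norm m f"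
proof -
  define K where "K = {C. 0 \<le> C \<and> (AE x in m. \<bar>f x\<bar> \<le> C)}"
  have "AE x in m. \<bar>f x\<bar> \<le> \<bar>C\<bar>" using assms by eventually_elim simp
  then have K: "\<bar>C\<bar> \<in> K" by (simp add: K_def)
  have bdd: "bdd_below K" by (rule bdd_belowI[of _ 0]) (simp add: K_def)
  have L: "Linf_norm m f = Inf K" by (simp add: Linf_norm_def K_def)
  show "0 \<le> Linf_norm m f" unfolding L using K by (intro cInf_greatest) (blast, simp add: K_def)
  have "AE x in m. \<bar>f x\<bar> \<le> Inf K + 1 / Suc n" for n
  proof -
    have "Inf K < Inf K + 1 / Suc n" by simp
    then obtain D where D: "D \<in> K" "D < Inf K + 1 / Suc n" using K bdd cInf_less_iff[of K] by blast
    from D(1) have "AE x in m. \<bar>f x\<bar> \<le> D" by (simp add: K_def)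
    then show ?thesis by eventually_elim (use D(2) in linarith)
  qed
  then have "AE x in m. \<forall>n. \<bar>f x\<bar> \<le> Inf K + 1 / Suc n" unfolding AE_all_countable by blast
  then show "AE x in m. \<bar>f x\<bar> \<le> Linf_norm m f"
    unfolding L
  proof eventually_elim
    case (elim x)
    have "(\<lambda>n. Inf K + 1 / real (Suc n)) \<longlonglongrightarrow> Inf K + 0"
      by (intro tendsto_add tendsto_const lim_1_over_n[THEN LIMSEQ_Suc])
    then have "\<bar>f x\<bar> \<le> Inf K + 0" by (rule LIMSEQ_le_const) (use elim in blast)
    then show ?case by simp
  qed
qed

lemma vn_bound: "T \<in> carrier TM \<Longrightarrow> AE x in m. PT T x \<le> vnorm TM T"
  and vn_nonneg: "T \<in> carrier TM \<Longrightarrow> 0 \<le> vnorm TM T"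
proof -
  assume T: "T \<in> carrier TM"
  then obtain C where "AE x in m. PT T x \<le> C" by (auto simp: carrier_TM)
  with PT_nonneg[OF TM_L2T[OF T]] have "AE x in m. \<bar>PT T x\<bar> \<le> C" by eventually_elim simp
  note p = Linf_norm_props[OF this]
  show "0 \<le> vnorm TM T" using p(2) by simp
  show "AE x in m. PT T x \<le> vnorm TM T" using p(1) by eventually_elim simp
qed

lemma vn_least:
  assumes "T \<in> L2T m act" "0 \<le> C" "AE x in m. PT T x \<le> C"
  shows "T \<in> carrier TM" "vnorm TM T \<le> C"
proof -
  show "T \<in> carrier TM" using assms by (auto simp: carrier_TM)
  have "AE x in m. \<bar>PT T x\<bar> \<le> C" using assms(3) PT_nonneg[OF assms(1)] by eventually_elim simp
  then show "vnorm TM T \<le> C"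
    using assms(2) by (simp add: Linf_norm_def) (intro cInf_lower bdd_belowI[of _ 0], auto)
qed

lemma J_add:
  assumes T: "T \<in> L2T m act" shows "J T (u + h) = J T u + J T h"
proof -
  have "J T (u + h) = (LINT x|m. ev T u x + ev T h x)"
    unfolding J_def by (rule integral_cong_AE[OF _ _ ev_add[OF T]]) (use ev_borel[OF T] in simp_all)
  then show ?thesis using T by (simp add: J_def)
qed

lemma J_act: "T \<in> L2T m act \<Longrightarrow> h \<in> Linf m \<Longrightarrow> J T (act h u) = (LINT x|m. h x * ev T u x)"
  unfolding J_def by (intro integral_cong_AE ev_act) (auto simp: Linf_iff)

lemma J_cut: "T \<in> L2T m act \<Longrightarrow> A \<in> sets borel \<Longrightarrow> J T (cut A u) = (LINT x|m. indicat_real A x * ev T u x)"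
  unfolding cut_def by (rule J_act) auto

lemma J_linear: "T \<in> L2T m act \<Longrightarrow> linear (J T)"
proof (rule linearI)
  assume T: "T \<in> L2T m act"
  show "J T (c *\<^sub>R u) = c *\<^sub>R J T u" for c u
    using J_act[OF T, of "\<lambda>_. c" u] by (simp add: act_const J_def)
qed (rule J_add)

lemma J_bdf:
  assumes T: "T \<in> L2T m act" and C: "AE x in m. PT T x \<le> C"
  shows "bdf C (J T)"
  unfolding bdf_def
proof (intro conjI allI J_linear T)
  fix u
  have "\<bar>J T u\<bar> \<le> (LINT x|m. \<bar>ev T u x\<bar>)" unfolding J_def by (rule integral_abs_bound)
  also have "\<dots> \<le> (LINT x|m. C * pn u x)"
  proof (rule integral_mono_AE)
    show "AE x in m. \<bar>ev T u x\<bar> \<le> C * pn u x"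
      using ev_le_PT[OF T, of u] C pn_nonneg[of u]
    proof eventually_elim
      case (elim x)
      have "PT T x * pn u x \<le> C * pn u x" using elim(2,3) by (rule mult_right_mono)
      with elim(1) show ?case by simp
    qed
  qed (use T in simp_all)
  also have "\<dots> = C * N1 u" by (simp add: N1_def)
  finally show "\<bar>J T u\<bar> \<le> C * N1 u" .
qed

lemma J_bdf_vnorm: "T \<in> carrier TM \<Longrightarrow> bdf (vnorm TM T) (J T)"
  by (rule J_bdf[OF TM_L2T vn_bound])

lemma J_le: "T \<in> carrier TM \<Longrightarrow> \<bar>J T u\<bar> \<le> vnorm TM T * N1 u"
  by (rule bdf_le[OF J_bdf_vnorm])

text \<open>Testing the integral bound on all cuts of u makes it pointwise, and
  \<open>PT_least\<close> turns it into a bound of the dual norm. With \<open>J_bdf_vnorm\<close>,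
  the norm of T is the least constant dominating \<open>J T\<close>.\<close>

lemma vnorm_le_of_bdf:
  assumes T: "T \<in> L2T m act" and b: "bdf C (J T)" and "0 \<le> C"
  shows "T \<in> carrier TM" "vnorm TM T \<le> C"
proof -
  have "AE x in m. PT T x \<le> C"
  proof (rule PT_least[OF T])
    show "AE x in m. ev T u x \<le> C * pn u x" for u
    proof (rule AE_le_of_set_integrals)
      fix A :: "'x set" assume A: "A \<in> sets borel"
      have "(LINT x|m. indicat_real A x * ev T u x) = J T (cut A u)" by (rule J_cut[OF T A, symmetric])
      also have "\<dots> \<le> C * N1 (cut A u)" using bdf_le[OF b, of "cut A u"] by simp
      also have "\<dots> = (LINT x|m. indicat_real A x * (C * pn u x))" by (simp add: N1_cut[OF A] mult.left_commute)
      finally show "(LINT x|m. indicat_real A x * ev T u x) \<le> (LINT x|m. indicat_real A x * (C * pn u x))" .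
    qed (use T in simp_all)
  qed (use \<open>0 \<le> C\<close> in simp_all)
  from vn_least[OF T \<open>0 \<le> C\<close> this] show "T \<in> carrier TM" "vnorm TM T \<le> C" .
qed

lemma AE_eq_of_set_integrals:
  assumes "integrable m f" "integrable m g"
    and "\<And>A. A \<in> sets borel \<Longrightarrow> setint A f = setint A g"
  shows "AE x in m. f x = g x"
proof -
  have "AE x in m. f x \<le> g x" "AE x in m. g x \<le> f x"
    using assms by (auto intro!: AE_le_of_set_integrals)
  then show ?thesis by eventually_elim simp
qed

lemma J_inj:
  assumes T: "T \<in> L2T m act" and S: "S \<in> L2T m act" and eq: "J T = J S"
  shows "T = S"
proof (rule L2T_ext[OF T S])
  show "AE x in m. ev T u x = ev S u x" for u
  proof (rule AE_eq_of_set_integrals)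
    fix A :: "'x set" assume A: "A \<in> sets borel"
    show "(LINT x|m. indicat_real A x * ev T u x) = (LINT x|m. indicat_real A x * ev S u x)"
      using J_cut[OF T A, of u] J_cut[OF S A, of u] eq by simp
  qed (use T S in simp_all)
qed

lemma Linf_bounded_version:
  assumes g: "g \<in> Linf m"
  obtains h C where "h \<in> borel_measurable borel" "\<And>x. \<bar>h x\<bar> \<le> C" "AE x in m. g x = h x"
proof -
  obtain C where C: "AE x in m. \<bar>g x\<bar> \<le> C" using g by (auto simp: Linf_iff)
  define h where "h x = (if \<bar>g x\<bar> \<le> C then g x else 0)" for x
  have "g \<in> borel_measurable borel" using g by (simp add: Linf_iff)
  then have "h \<in> borel_measurable borel" unfolding h_def by measurable
  moreover have "\<bar>h x\<bar> \<le> max C 0" for x by (auto simp: h_def)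
  moreover have "AE x in m. g x = h x" using C by eventually_elim (simp add: h_def)
  ultimately show ?thesis by (rule that)
qed

text \<open>From indicators to bounded functions by uniform approximation with simple ones: the left
  side is controlled by the domination through \<open>N1\<close>, the right side by integrability of
  r. This gives the densities of a functional their linearity over L^\<infinity>.\<close>

lemma bdf_act_integral:
  assumes l: "bdf C l" and r: "integrable m r"
    and int: "\<And>A. A \<in> sets borel \<Longrightarrow> l (cut A u) = setint A r"
    and k: "k \<in> Linf m"
  shows "l (act k u) = (LINT x|m. k x * r x)"
proof -
  obtain h D where hm: "h \<in> borel_measurable borel" and hD: "\<And>x. \<bar>h x\<bar> \<le> D" and hk: "AE x in m. k x = h x"
    by (rule Linf_bounded_version[OF k]) (rule that)
  have rb: "r \<in> borel_measurable borel" using borel_measurable_integrable[OF r] by simp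
  have hL: "h \<in> Linf m" using hm hD by (rule LinfI)
  have kb: "k \<in> borel_measurable borel" using k by (simp add: Linf_iff)
  have 1: "l (act k u) = l (act h u)" using act_cong[OF k hL hk] by simp
  have 2: "(LINT x|m. k x * r x) = (LINT x|m. h x * r x)"
    by (rule integral_cong_AE) (use kb hm rb hk in \<open>auto elim: eventually_mono\<close>)
  have "l (act h u) = (LINT x|m. h x * r x)"
  proof (rule real_eq_of_small)
    fix e :: real assume "e > 0"
    obtain J :: "int set" and B c where B: "finite J" "\<And>j. B j \<in> sets borel" "disjoint_family_on B J"
        "(\<Union>j\<in>J. B j) = UNIV" "\<And>j x. x \<in> B j \<Longrightarrow> \<bar>h x - c j\<bar> \<le> e"
      by (rule finite_level_sets[OF hm hD \<open>e > 0\<close>]) (rule that)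
    define s where "s x = (\<Sum>j\<in>J. c j * indicat_real (B j) x)" for x
    have sx: "\<bar>h x - s x\<bar> \<le> e" for x unfolding s_def by (rule simple_approx[OF B(1,3,4,5)])
    have sL: "s \<in> Linf m" unfolding s_def[abs_def] using B(1,2) by (intro Linf_sum Linf_mult) auto
    have ls: "l (act s u) = (LINT x|m. s x * r x)"
    proof -
      have "l (act s u) = (\<Sum>j\<in>J. c j * l (cut (B j) u))"
        unfolding s_def[abs_def] act_simple[OF B(1,2)]
        by (simp add: linear_sum[OF bdf_linear[OF l]] linear_scale[OF bdf_linear[OF l]])
      also have "\<dots> = (\<Sum>j\<in>J. \<integral>x. c j * (indicat_real (B j) x * r x) \<partial>m)"
        using integrable_indicator_mult[OF r B(2)] by (simp add: int[OF B(2)])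
      also have "\<dots> = (LINT x|m. (\<Sum>j\<in>J. c j * (indicat_real (B j) x * r x)))"
        using integrable_indicator_mult[OF r B(2)] by (intro Bochner_Integration.integral_sum[symmetric]) auto
      also have "\<dots> = (LINT x|m. s x * r x)"
        by (simp add: s_def sum_distrib_right mult.assoc)
      finally show ?thesis .
    qed
    have "\<bar>l (act h u) - l (act s u)\<bar> = \<bar>l (act (\<lambda>x. h x - s x) u)\<bar>"
      by (simp add: act_diff[OF hL sL] linear_diff[OF bdf_linear[OF l]])
    also have "\<dots> \<le> C * N1 (act (\<lambda>x. h x - s x) u)" by (rule bdf_le[OF l])
    also have "\<dots> \<le> \<bar>C\<bar> * N1 (act (\<lambda>x. h x - s x) u)" by (intro mult_right_mono) auto
    also have "\<dots> \<le> \<bar>C\<bar> * (e * N1 u)"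
    proof (intro mult_left_mono N1_act_le sx)
      show "(\<lambda>x. h x - s x) \<in> borel_measurable borel" using hm conjunct1[OF sL[unfolded Linf_iff]] by (rule borel_measurable_diff)
    qed simp
    finally have a: "\<bar>l (act h u) - l (act s u)\<bar> \<le> \<bar>C\<bar> * (e * N1 u)" .
    have hi: "integrable m (\<lambda>x. h x * r x)" "integrable m (\<lambda>x. s x * r x)"
      using Linf_mult_integrable[OF hL r] Linf_mult_integrable[OF sL r] .
    have "\<bar>(LINT x|m. h x * r x) - (LINT x|m. s x * r x)\<bar> = \<bar>\<integral>x. (h x - s x) * r x \<partial>m\<bar>"
      using hi by (simp add: left_diff_distrib)
    also have "\<dots> \<le> (LINT x|m. \<bar>(h x - s x) * r x\<bar>)" by (rule integral_abs_bound)
    also have "\<dots> \<le> (LINT x|m. e * \<bar>r x\<bar>)"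
    proof (rule integral_mono)
      show "integrable m (\<lambda>x. \<bar>(h x - s x) * r x\<bar>)"
        using Bochner_Integration.integrable_diff[OF hi] by (simp add: left_diff_distrib)
      show "\<bar>(h x - s x) * r x\<bar> \<le> e * \<bar>r x\<bar>" for x
        unfolding abs_mult by (intro mult_right_mono sx) simp
    qed (use r in simp)
    finally have b: "\<bar>(LINT x|m. h x * r x) - (LINT x|m. s x * r x)\<bar> \<le> e * (LINT x|m. \<bar>r x\<bar>)" by simp
    have "\<bar>l (act h u) - (LINT x|m. h x * r x)\<bar> \<le> \<bar>C\<bar> * (e * N1 u) + e * (LINT x|m. \<bar>r x\<bar>)"
      using a b ls by linarith
    then show "\<bar>l (act h u) - (LINT x|m. h x * r x)\<bar> \<le> e * (\<bar>C\<bar> * N1 u + (LINT x|m. \<bar>r x\<bar>))"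
      by (simp add: algebra_simps)
  qed
  with 1 2 show ?thesis by simp
qed

text \<open>The densities of \<open>bdf_density\<close> are chosen for each u separately. Their
  uniqueness up to null sets makes the choice additive and linear over L^\<infinity> almost
  everywhere, which is what a class-valued map requires.\<close>

lemma bdf_representation:
  assumes l: "bdf C l" and "0 \<le> C"
  obtains T where "T \<in> carrier TM" "J T = l" "vnorm TM T \<le> C"
proof -
  from choice[OF allI[OF bdf_density[OF l]]] obtain R where R': "\<forall>u. integrable m (R u)
      \<and> (\<forall>A\<in>sets borel. l (cut A u) = setint A (R u)) \<and> (AE x in m. \<bar>R u x\<bar> \<le> C * pn u x)" ..
  have Ri: "integrable m (R u)" and Rc: "A \<in> sets borel \<Longrightarrow> l (cut A u) = setint A (R u)"
    and Rb: "AE x in m. \<bar>R u x\<bar> \<le> C * pn u x" for u A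
    using R'[rule_format, of u] by auto
  have add: "AE x in m. R (u + y) x = R u x + R y x" for u y
  proof (rule AE_eq_of_set_integrals)
    fix A :: "'x set" assume A: "A \<in> sets borel"
    have "(LINT x|m. indicat_real A x * (R u x + R y x)) = l (cut A u) + l (cut A y)"
      using integrable_indicator_mult[OF Ri A] by (simp add: Rc[OF A] distrib_left)
    also have "\<dots> = l (cut A (u + y))" by (simp add: linear_add[OF linear_cut[OF A]] linear_add[OF bdf_linear[OF l]])
    finally show "(LINT x|m. indicat_real A x * R (u + y) x) = (LINT x|m. indicat_real A x * (R u x + R y x))"
      by (simp add: Rc[OF A])
  qed (use Ri in simp_all)
  have act: "AE x in m. R (act h u) x = h x * R u x" if h: "h \<in> Linf m" for h u
  proof (rule AE_eq_of_set_integrals)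
    show "integrable m (\<lambda>x. h x * R u x)" by (rule Linf_mult_integrable[OF h Ri])
    fix A :: "'x set" assume A: "A \<in> sets borel"
    have "(LINT x|m. indicat_real A x * R (act h u) x) = l (cut A (act h u))" by (rule Rc[OF A, symmetric])
    also have "cut A (act h u) = act (\<lambda>x. indicat_real A x * h x) u"
      unfolding cut_def using A h by (simp add: act_times)
    also have "l \<dots> = (LINT x|m. (indicat_real A x * h x) * R u x)"
      by (rule bdf_act_integral[OF l Ri Rc]) (use A h in simp_all)
    finally show "(LINT x|m. indicat_real A x * R (act h u) x) = (LINT x|m. indicat_real A x * (h x * R u x))"
      by (simp add: mult.assoc)
  qed (rule Ri)
  have bound: "(LINT x|m. \<bar>R u x\<bar>) \<le> (C * sqrt (measure m UNIV)) * norm u" for u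
  proof -
    have "(LINT x|m. \<bar>R u x\<bar>) \<le> (LINT x|m. C * pn u x)" by (rule integral_mono_AE[OF _ _ Rb]) (use Ri in simp_all)
    also have "\<dots> = C * N1 u" by (simp add: N1_def)
    also have "\<dots> \<le> C * (sqrt (measure m UNIV) * norm u)" by (intro mult_left_mono N1_le_norm \<open>0 \<le> C\<close>)
    finally show ?thesis by (simp add: mult.assoc)
  qed
  define T where "T = (\<lambda>u. ae_class m (R u))"
  have T: "T \<in> L2T m act" unfolding T_def by (rule L2T_I(1)[OF Ri add act bound])
  have evT: "AE x in m. ev T u x = R u x" for u unfolding T_def by (rule L2T_I(2)[OF Ri add act bound])
  have "J T = l"
  proof
    fix u
    have "J T u = (LINT x|m. R u x)"
      unfolding J_def using borel_measurable_integrable[OF Ri] T by (intro integral_cong_AE evT) auto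
    also have "\<dots> = l u" using Rc[of UNIV u] by simp
    finally show "J T u = l u" .
  qed
  moreover from this l have "bdf C (J T)" by simp
  ultimately show ?thesis using vnorm_le_of_bdf[OF T _ \<open>0 \<le> C\<close>] by (intro that) auto
qed

lemma J_tan_add:
  assumes T: "T \<in> L2T m act" and S: "S \<in> L2T m act"
  shows "J (tan_add m T S) u = J T u + J S u"
proof -
  have "J (tan_add m T S) u = (LINT x|m. ev T u x + ev S u x)"
    unfolding J_def by (rule integral_cong_AE[OF _ _ tan_add_L2T(2)[OF T S]])
      (use ev_borel[OF T] ev_borel[OF S] ev_borel[OF tan_add_L2T(1)[OF T S]] in simp_all)
  then show ?thesis using T S by (simp add: J_def)
qed

lemma J_tan_mult:
  assumes T: "T \<in> L2T m act" and h: "h \<in> Linf m"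
  shows "J (tan_mult m h T) u = J T (act h u)"
proof -
  have hb: "h \<in> borel_measurable borel" using h by (simp add: Linf_iff)
  have "J (tan_mult m h T) u = (LINT x|m. h x * ev T u x)"
    unfolding J_def by (rule integral_cong_AE[OF _ _ tan_mult_L2T(2)[OF T h]])
      (use hb ev_borel[OF T] ev_borel[OF tan_mult_L2T(1)[OF T h]] in simp_all)
  then show ?thesis using J_act[OF T h] by simp
qed

lemma J_tan_zero: "J (tan_zero m) u = 0"
proof -
  have "J (tan_zero m) u = (LINT x|m. 0)"
    unfolding J_def by (rule integral_cong_AE) (auto intro!: tan_zero_L2T ev_borel)
  then show ?thesis by simp
qed

lemma bdf_add: "bdf C l \<Longrightarrow> bdf D k \<Longrightarrow> bdf (C + D) (\<lambda>v. l v + k v)"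
  unfolding bdf_def
proof (elim conjE, intro conjI allI)
  assume "linear l" "linear k" then show "linear (\<lambda>v. l v + k v)" by (rule linear_compose_add)
  fix v assume "\<forall>v. \<bar>l v\<bar> \<le> C * N1 v" "\<forall>v. \<bar>k v\<bar> \<le> D * N1 v"
  then have "\<bar>l v\<bar> \<le> C * N1 v" "\<bar>k v\<bar> \<le> D * N1 v" by blast+
  then show "\<bar>l v + k v\<bar> \<le> (C + D) * N1 v" unfolding distrib_right by linarith
qed

lemma bdf_act:
  assumes l: "bdf C l" and "0 \<le> C" and g: "g \<in> borel_measurable borel" "\<And>x. \<bar>g x\<bar> \<le> D"
  shows "bdf (D * C) (\<lambda>v. l (act g v))"
  unfolding bdf_def
proof (intro conjI allI)
  have gL: "g \<in> Linf m" using g by (rule LinfI)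
  show "linear (\<lambda>v. l (act g v))"
    using linear_compose[OF linear_act[OF gL] bdf_linear[OF l]] by (simp add: o_def)
  show "\<bar>l (act g v)\<bar> \<le> D * C * N1 v" for v
  proof -
    have "\<bar>l (act g v)\<bar> \<le> C * N1 (act g v)" by (rule bdf_le[OF l])
    also have "\<dots> \<le> C * (D * N1 v)" by (intro mult_left_mono N1_act_le g \<open>0 \<le> C\<close>)
    finally show ?thesis by (simp add: mult_ac)
  qed
qed

lemma TM_zero: "tan_zero m \<in> carrier TM" "vnorm TM (tan_zero m) = 0"
proof -
  have "bdf 0 (J (tan_zero m))" unfolding bdf_def by (simp add: J_tan_zero J_linear tan_zero_L2T)
  from vnorm_le_of_bdf[OF tan_zero_L2T(1) this]
  show "tan_zero m \<in> carrier TM" and "vnorm TM (tan_zero m) = 0"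
    using vn_nonneg[of "tan_zero m"] by auto
qed

lemma TM_add:
  assumes T: "T \<in> carrier TM" and S: "S \<in> carrier TM"
  shows "tan_add m T S \<in> carrier TM" "vnorm TM (tan_add m T S) \<le> vnorm TM T + vnorm TM S"
proof -
  have "J (tan_add m T S) = (\<lambda>v. J T v + J S v)" using J_tan_add[OF TM_L2T[OF T] TM_L2T[OF S]] by (rule ext)
  then have "bdf (vnorm TM T + vnorm TM S) (J (tan_add m T S))"
    using bdf_add[OF J_bdf_vnorm[OF T] J_bdf_vnorm[OF S]] by simp
  from vnorm_le_of_bdf[OF tan_add_L2T(1)[OF TM_L2T[OF T] TM_L2T[OF S]] this add_nonneg_nonneg[OF vn_nonneg[OF T] vn_nonneg[OF S]]]
  show "tan_add m T S \<in> carrier TM" "vnorm TM (tan_add m T S) \<le> vnorm TM T + vnorm TM S" .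
qed

lemma TM_mult:
  assumes T: "T \<in> carrier TM" and g: "g \<in> borel_measurable borel" "\<And>x. \<bar>g x\<bar> \<le> D"
  shows "tan_mult m g T \<in> carrier TM" "vnorm TM (tan_mult m g T) \<le> D * vnorm TM T"
proof -
  have gL: "g \<in> Linf m" using g by (rule LinfI)
  have D: "0 \<le> D" using g(2) abs_ge_zero order_trans by blast
  have "J (tan_mult m g T) = (\<lambda>v. J T (act g v))" using J_tan_mult[OF TM_L2T[OF T] gL] by (rule ext)
  then have "bdf (D * vnorm TM T) (J (tan_mult m g T))"
    using bdf_act[OF J_bdf_vnorm[OF T] vn_nonneg[OF T] g] by simp
  from vnorm_le_of_bdf[OF tan_mult_L2T(1)[OF TM_L2T[OF T] gL] this mult_nonneg_nonneg[OF D vn_nonneg[OF T]]]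
  show "tan_mult m g T \<in> carrier TM" "vnorm TM (tan_mult m g T) \<le> D * vnorm TM T" .
qed

lemma TM_eqI: "T \<in> carrier TM \<Longrightarrow> S \<in> carrier TM \<Longrightarrow> (\<And>u. J T u = J S u) \<Longrightarrow> T = S"
  by (rule J_inj) (auto simp: TM_L2T)

lemma TM_smult: "T \<in> carrier TM \<Longrightarrow> tan_mult m (apply_bcontfun g) T \<in> carrier TM"
  by (rule TM_mult(1)[OF _ bcontfun_borel bcontfun_abs_le])

lemma J_TM_add: "T \<in> carrier TM \<Longrightarrow> S \<in> carrier TM \<Longrightarrow> J (tan_add m T S) u = J T u + J S u"
  by (rule J_tan_add) (rule TM_L2T, assumption)+

lemma J_TM_smult: "T \<in> carrier TM \<Longrightarrow> J (tan_mult m (apply_bcontfun g) T) u = J T (act (apply_bcontfun g) u)"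
  by (rule J_tan_mult[OF TM_L2T bcontfun_Linf])

lemma linear_J: "T \<in> carrier TM \<Longrightarrow> linear (J T)"
  by (rule J_linear[OF TM_L2T])

text \<open>Each axiom is an equality of vector fields and is checked after applying
  \<open>J\<close>, where the product by a function g becomes the action of g on the
  argument.\<close>

lemma module_TM: "Module.module Cb TM"
proof (rule moduleI[OF cring_Cb])
  show "abelian_group TM"
  proof (rule abelian_groupI)
    fix T assume T: "T \<in> carrier TM"
    define g where "g = (const_bcontfun (- 1) :: 'x \<Rightarrow>\<^sub>C real)"
    have g: "act (apply_bcontfun g) u = - u" for u
      using act_const[of "- 1" u] by (simp add: g_def const_bcontfun.rep_eq)
    have S: "tan_mult m (apply_bcontfun g) T \<in> carrier TM" by (rule TM_smult[OF T])
    moreover have "tan_add m (tan_mult m (apply_bcontfun g) T) T = tan_zero m"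
    proof (rule TM_eqI[OF TM_add(1)[OF S T] TM_zero(1)])
      show "J (tan_add m (tan_mult m (apply_bcontfun g) T) T) u = J (tan_zero m) u" for u
        using linear_neg[OF linear_J[OF T], of u]
        by (simp add: J_TM_add[OF S T] J_TM_smult[OF T] g J_tan_zero)
    qed
    ultimately show "\<exists>S\<in>carrier TM. S \<oplus>\<^bsub>TM\<^esub> T = \<zero>\<^bsub>TM\<^esub>" by (intro bexI) simp_all
  next
    show "\<zero>\<^bsub>TM\<^esub> \<in> carrier TM" by (simp add: TM_zero)
  next
    fix T S assume "T \<in> carrier TM" "S \<in> carrier TM"
    then show "T \<oplus>\<^bsub>TM\<^esub> S \<in> carrier TM" by (simp add: TM_add)
  next
    fix T S R assume *: "T \<in> carrier TM" "S \<in> carrier TM" "R \<in> carrier TM"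
    show "(T \<oplus>\<^bsub>TM\<^esub> S) \<oplus>\<^bsub>TM\<^esub> R = T \<oplus>\<^bsub>TM\<^esub> (S \<oplus>\<^bsub>TM\<^esub> R)"
      by (rule TM_eqI) (use * in \<open>simp_all add: TM_add J_TM_add\<close>)
  next
    fix T S assume *: "T \<in> carrier TM" "S \<in> carrier TM"
    show "T \<oplus>\<^bsub>TM\<^esub> S = S \<oplus>\<^bsub>TM\<^esub> T"
      by (rule TM_eqI) (use * in \<open>simp_all add: TM_add J_TM_add\<close>)
  next
    fix T assume *: "T \<in> carrier TM"
    show "\<zero>\<^bsub>TM\<^esub> \<oplus>\<^bsub>TM\<^esub> T = T"
      by (rule TM_eqI) (use * in \<open>simp_all add: TM_add J_TM_add TM_zero J_tan_zero\<close>)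
  qed
next
  fix g T assume *: "T \<in> carrier TM"
  then show "g \<odot>\<^bsub>TM\<^esub> T \<in> carrier TM" by (simp add: TM_smult)
next
  fix f g T assume *: "T \<in> carrier TM"
  show "(f \<oplus>\<^bsub>Cb\<^esub> g) \<odot>\<^bsub>TM\<^esub> T = f \<odot>\<^bsub>TM\<^esub> T \<oplus>\<^bsub>TM\<^esub> g \<odot>\<^bsub>TM\<^esub> T"
  proof (rule TM_eqI)
    have "act (apply_bcontfun (f + g)) u = act (apply_bcontfun f) u + act (apply_bcontfun g) u" for u
      using act_plus[of "apply_bcontfun f" "apply_bcontfun g" u] by (simp add: plus_bcontfun.rep_eq)
    then show "J ((f \<oplus>\<^bsub>Cb\<^esub> g) \<odot>\<^bsub>TM\<^esub> T) u = J (f \<odot>\<^bsub>TM\<^esub> T \<oplus>\<^bsub>TM\<^esub> g \<odot>\<^bsub>TM\<^esub> T) u" for u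
      unfolding Cb_simps TM_simps J_TM_add[OF TM_smult[OF *] TM_smult[OF *]] J_TM_smult[OF *]
      by (simp add: linear_add[OF linear_J[OF *]])
    show "(f \<oplus>\<^bsub>Cb\<^esub> g) \<odot>\<^bsub>TM\<^esub> T \<in> carrier TM" unfolding TM_simps by (rule TM_smult[OF *])
    show "f \<odot>\<^bsub>TM\<^esub> T \<oplus>\<^bsub>TM\<^esub> g \<odot>\<^bsub>TM\<^esub> T \<in> carrier TM" unfolding TM_simps by (intro TM_add TM_smult *)
  qed
  show "(f \<otimes>\<^bsub>Cb\<^esub> g) \<odot>\<^bsub>TM\<^esub> T = f \<odot>\<^bsub>TM\<^esub> (g \<odot>\<^bsub>TM\<^esub> T)"
  proof (rule TM_eqI)
    have "apply_bcontfun (cb_mult f g) = (\<lambda>x. apply_bcontfun g x * apply_bcontfun f x)"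
      by (rule ext, unfold apply_cb_mult) (rule mult.commute)
    then have "act (apply_bcontfun (cb_mult f g)) u = act (apply_bcontfun g) (act (apply_bcontfun f) u)" for u
      using act_times[of "apply_bcontfun g" "apply_bcontfun f" u] by simp
    then show "J ((f \<otimes>\<^bsub>Cb\<^esub> g) \<odot>\<^bsub>TM\<^esub> T) u = J (f \<odot>\<^bsub>TM\<^esub> (g \<odot>\<^bsub>TM\<^esub> T)) u" for u
      unfolding Cb_simps TM_simps J_TM_smult[OF *] J_TM_smult[OF TM_smult[OF *]] by simp
  next
    show "(f \<otimes>\<^bsub>Cb\<^esub> g) \<odot>\<^bsub>TM\<^esub> T \<in> carrier TM" unfolding TM_simps by (rule TM_smult[OF *])
    show "f \<odot>\<^bsub>TM\<^esub> (g \<odot>\<^bsub>TM\<^esub> T) \<in> carrier TM" unfolding TM_simps by (intro TM_smult *)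
  qed
next
  fix g T S assume *: "T \<in> carrier TM" "S \<in> carrier TM"
  show "g \<odot>\<^bsub>TM\<^esub> (T \<oplus>\<^bsub>TM\<^esub> S) = g \<odot>\<^bsub>TM\<^esub> T \<oplus>\<^bsub>TM\<^esub> g \<odot>\<^bsub>TM\<^esub> S"
    by (rule TM_eqI) (simp_all add: J_TM_add TM_smult TM_add * J_TM_smult)
next
  fix T assume *: "T \<in> carrier TM"
  show "\<one>\<^bsub>Cb\<^esub> \<odot>\<^bsub>TM\<^esub> T = T"
  proof (rule TM_eqI[OF _ *])
    show "\<one>\<^bsub>Cb\<^esub> \<odot>\<^bsub>TM\<^esub> T \<in> carrier TM" unfolding TM_simps by (rule TM_smult[OF *])
    show "J (\<one>\<^bsub>Cb\<^esub> \<odot>\<^bsub>TM\<^esub> T) u = J T u" for u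
      unfolding Cb_simps TM_simps J_TM_smult[OF *] by (simp add: const_bcontfun.rep_eq act_one)
  qed
qed

lemma J_finsum:
  assumes "finite I" "\<And>i. i \<in> I \<Longrightarrow> v i \<in> carrier TM"
  shows "finsum TM v I \<in> carrier TM \<and> J (finsum TM v I) u = (\<Sum>i\<in>I. J (v i) u)"
  using assms
proof (induction I rule: finite_induct)
  case empty
  interpret Module.module Cb TM by (rule module_TM)
  show ?case using TM_zero(1) J_tan_zero[of u] M.finsum_empty[of v] by simp
next
  case (insert i I)
  interpret Module.module Cb TM by (rule module_TM)
  have v: "v i \<in> carrier TM" "v \<in> I \<rightarrow> carrier TM" using insert.prems by auto
  have IH: "finsum TM v I \<in> carrier TM" "J (finsum TM v I) u = (\<Sum>i\<in>I. J (v i) u)"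
    using insert.IH insert.prems by auto
  have "finsum TM v (insert i I) = tan_add m (v i) (finsum TM v I)"
    using M.finsum_insert[OF insert.hyps v(2,1)] by simp
  then show ?case using TM_add(1)[OF v(1) IH(1)] J_TM_add[OF v(1) IH(1)] IH(2) insert.hyps by simp
qed

text \<open>At each point at most one of the functions is nonzero.\<close>

lemma sum_abs_disjoint_supp:
  fixes f :: "nat \<Rightarrow> 'x \<Rightarrow>\<^sub>C real"
  assumes "disjoint_family_on (\<lambda>i. supp (f i)) {..<n}" and K: "\<And>i. i < n \<Longrightarrow> norm (f i) \<le> K" and "0 \<le> K"
  shows "(\<Sum>i<n. \<bar>apply_bcontfun (f i) x\<bar>) \<le> K"
proof (cases "\<exists>i<n. apply_bcontfun (f i) x \<noteq> 0")
  case True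
  then obtain i where i: "i < n" "apply_bcontfun (f i) x \<noteq> 0" by blast
  have mem: "x \<in> supp (f j)" if "apply_bcontfun (f j) x \<noteq> 0" for j
    unfolding supp_def by (rule subsetD[OF closure_subset]) (use that in simp)
  have z: "apply_bcontfun (f j) x = 0" if "j < n" "j \<noteq> i" for j
  proof (rule ccontr)
    assume "apply_bcontfun (f j) x \<noteq> 0"
    then have "x \<in> supp (f j) \<inter> supp (f i)" using mem i(2) by blast
    moreover have "supp (f j) \<inter> supp (f i) = {}" using assms(1) that i(1) by (auto simp: disjoint_family_on_def)
    ultimately show False by blast
  qed
  have "(\<Sum>i<n. \<bar>apply_bcontfun (f i) x\<bar>) = \<bar>apply_bcontfun (f i) x\<bar> + (\<Sum>j\<in>{..<n} - {i}. \<bar>apply_bcontfun (f j) x\<bar>)"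
    using i(1) by (intro sum.remove) auto
  also have "(\<Sum>j\<in>{..<n} - {i}. \<bar>apply_bcontfun (f j) x\<bar>) = 0" using z by (intro sum.neutral) auto
  finally show ?thesis using bcontfun_abs_le[of "f i" x] K[OF i(1)] by simp
next
  case False
  then have "(\<Sum>i<n. \<bar>apply_bcontfun (f i) x\<bar>) = 0" by (intro sum.neutral) auto
  with \<open>0 \<le> K\<close> show ?thesis by simp
qed

lemma normed_module_TM: "is_normed_cb_module TM"
  unfolding is_normed_cb_module_def
proof (intro conjI ballI allI impI module_TM)
  fix T assume T: "T \<in> carrier TM"
  show "0 \<le> vnorm TM T" by (rule vn_nonneg[OF T])
  show "vnorm TM T = 0 \<longleftrightarrow> T = \<zero>\<^bsub>TM\<^esub>"
  proof
    assume "vnorm TM T = 0"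
    then have "J T u = J (tan_zero m) u" for u using J_le[OF T, of u] by (simp add: J_tan_zero)
    then show "T = \<zero>\<^bsub>TM\<^esub>" using TM_eqI[OF T TM_zero(1)] by simp
  qed (use TM_zero(2) in simp)
  show "vnorm TM (T \<oplus>\<^bsub>TM\<^esub> S) \<le> vnorm TM T + vnorm TM S" if S: "S \<in> carrier TM" for S
    using TM_add(2)[OF T S] by simp
  \<comment> \<open>Only this inequality is direct; equality follows by applying it with 1 / c to
    the scaled field.\<close>
  have le: "vnorm TM (vscale TM c T) \<le> \<bar>c\<bar> * vnorm TM T" if T: "T \<in> carrier TM" for c T
    using TM_mult(2)[OF T, of "\<lambda>_. c" "\<bar>c\<bar>"] by (simp add: const_bcontfun.rep_eq)
  fix c
  show "vnorm TM (vscale TM c T) = \<bar>c\<bar> * vnorm TM T"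
  proof (cases "c = 0")
    case True
    then show ?thesis using le[OF T, of 0] vn_nonneg[OF TM_smult[OF T], of "const_bcontfun 0"] by simp
  next
    case False
    have cT: "vscale TM c T \<in> carrier TM" unfolding TM_simps by (rule TM_smult[OF T])
    have "vscale TM (1 / c) (vscale TM c T) = T"
    proof (rule TM_eqI[OF _ T])
      show "vscale TM (1 / c) (vscale TM c T) \<in> carrier TM" unfolding TM_simps by (rule TM_smult[OF TM_smult[OF T]])
      show "J (vscale TM (1 / c) (vscale TM c T)) u = J T u" for u
        unfolding TM_simps J_TM_smult[OF TM_smult[OF T]] J_TM_smult[OF T]
        using False by (simp add: const_bcontfun.rep_eq act_const)
    qed
    then have "vnorm TM T \<le> \<bar>1 / c\<bar> * vnorm TM (vscale TM c T)" using le[OF cT, of "1 / c"] by metis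
    then have "\<bar>c\<bar> * vnorm TM T \<le> vnorm TM (vscale TM c T)" using False by (simp add: field_simps)
    with le[OF T, of c] show ?thesis by (rule order_antisym)
  qed
next
  fix n :: nat and f :: "nat \<Rightarrow> 'x \<Rightarrow>\<^sub>C real" and v
  assume *: "0 < n \<and> (\<forall>i<n. v i \<in> carrier TM) \<and> disjoint_family_on (\<lambda>i. supp (f i)) {..<n}"
  define F where "F = (MAX i\<in>{..<n}. norm (f i))"
  define G where "G = (MAX i\<in>{..<n}. vnorm TM (v i))"
  have F: "norm (f i) \<le> F" if "i < n" for i unfolding F_def using that by (intro Max_ge) auto
  have G: "vnorm TM (v i) \<le> G" if "i < n" for i unfolding G_def using that by (intro Max_ge) auto
  have F0: "0 \<le> F" using F[of 0] * norm_ge_zero[of "f 0"] by linarith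
  have "0 \<le> vnorm TM (v 0)" using * by (intro vn_nonneg) simp
  then have G0: "0 \<le> G" using G[of 0] * by linarith
  have fv: "f i \<odot>\<^bsub>TM\<^esub> v i \<in> carrier TM" if "i \<in> {..<n}" for i using * that by (simp add: TM_smult)
  define S where "S = finsum TM (\<lambda>i. f i \<odot>\<^bsub>TM\<^esub> v i) {..<n}"
  have S: "S \<in> carrier TM" "J S u = (\<Sum>i<n. J (f i \<odot>\<^bsub>TM\<^esub> v i) u)" for u
    unfolding S_def using J_finsum[OF finite_lessThan fv] by auto
  \<comment> \<open>The n summands are not estimated one by one: after pulling out G, the sum of the
    \<bar>f i\<bar> is bounded pointwise by F, and this is where disjointness of the supports
    enters.\<close>
  have "bdf (F * G) (J S)"
    unfolding bdf_def
  proof (intro conjI allI linear_J S(1))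
    fix u
    have int: "integrable m (\<lambda>x. \<bar>apply_bcontfun (f i) x\<bar> * pn u x)" for i
      using Linf_mult_integrable[OF bcontfun_Linf pn_integrable, of "f i" "u"] integrable_abs
      by (intro Linf_mult_integrable pn_integrable LinfI[where C = "norm (f i)"]) (auto simp: bcontfun_abs_le)
    have "\<bar>J S u\<bar> \<le> (\<Sum>i<n. \<bar>J (f i \<odot>\<^bsub>TM\<^esub> v i) u\<bar>)" unfolding S(2) by (rule sum_abs)
    also have "\<dots> \<le> (\<Sum>i<n. G * (LINT x|m. \<bar>apply_bcontfun (f i) x\<bar> * pn u x))"
    proof (rule sum_mono)
      fix i assume i: "i \<in> {..<n}"
      have vi: "v i \<in> carrier TM" using * i by simp
      have "\<bar>J (f i \<odot>\<^bsub>TM\<^esub> v i) u\<bar> = \<bar>J (v i) (act (apply_bcontfun (f i)) u)\<bar>" by (simp add: J_TM_smult[OF vi])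
      also have "\<dots> \<le> vnorm TM (v i) * N1 (act (apply_bcontfun (f i)) u)" by (rule J_le[OF vi])
      also have "\<dots> \<le> G * N1 (act (apply_bcontfun (f i)) u)" using G i by (intro mult_right_mono) auto
      finally show "\<bar>J (f i \<odot>\<^bsub>TM\<^esub> v i) u\<bar> \<le> G * (LINT x|m. \<bar>apply_bcontfun (f i) x\<bar> * pn u x)"
        by (simp add: N1_act)
    qed
    also have "\<dots> = G * (LINT x|m. (\<Sum>i<n. \<bar>apply_bcontfun (f i) x\<bar> * pn u x))"
      using int by (simp add: sum_distrib_left[symmetric])
    also have "\<dots> \<le> G * (LINT x|m. F * pn u x)"
    proof (rule mult_left_mono[OF integral_mono_AE G0])
      show "AE x in m. (\<Sum>i<n. \<bar>apply_bcontfun (f i) x\<bar> * pn u x) \<le> F * pn u x"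
        using pn_nonneg[of u]
      proof eventually_elim
        case (elim x)
        show ?case unfolding sum_distrib_right[symmetric]
          by (rule mult_right_mono[OF sum_abs_disjoint_supp elim]) (use * F F0 in auto)
      qed
    qed (use int in simp_all)
    finally show "\<bar>J S u\<bar> \<le> F * G * N1 u" by (simp add: N1_def mult_ac)
  qed
  from vnorm_le_of_bdf(2)[OF TM_L2T[OF S(1)] this mult_nonneg_nonneg[OF F0 G0]]
  show "vnorm TM (finsum TM (\<lambda>i. f i \<odot>\<^bsub>TM\<^esub> v i) {..<n}) \<le> (MAX i\<in>{..<n}. norm (f i)) * (MAX i\<in>{..<n}. vnorm TM (v i))"
    unfolding S_def F_def G_def .
qed

end

section \<open>The completion for convergence in measure\<close>

context cotangent
begin

text \<open>Written exactly as the difference inside \<open>L0_dist\<close>, so that the distance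
  unfolds to it.\<close>

definition sub :: "('c \<Rightarrow> ('x \<Rightarrow> real) set) \<Rightarrow> ('c \<Rightarrow> ('x \<Rightarrow> real) set) \<Rightarrow> 'c \<Rightarrow> ('x \<Rightarrow> real) set" where
  "sub T S = tan_add m T (tan_mult m (\<lambda>_. - 1) S)"

lemma sub_L2T:
  assumes T: "T \<in> L2T m act" and S: "S \<in> L2T m act"
  shows "sub T S \<in> L2T m act" "AE x in m. ev (sub T S) u x = ev T u x - ev S u x"
proof -
  have S': "tan_mult m (\<lambda>_. - 1) S \<in> L2T m act" by (rule tan_mult_L2T(1)[OF S Linf_const])
  show "sub T S \<in> L2T m act" unfolding sub_def by (rule tan_add_L2T(1)[OF T S'])
  show "AE x in m. ev (sub T S) u x = ev T u x - ev S u x"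
    using tan_add_L2T(2)[OF T S', of u] tan_mult_L2T(2)[OF S Linf_const, of "- 1" u]
    unfolding sub_def by eventually_elim simp
qed

lemma J_sub: "T \<in> L2T m act \<Longrightarrow> S \<in> L2T m act \<Longrightarrow> J (sub T S) u = J T u - J S u"
proof -
  assume T: "T \<in> L2T m act" and S: "S \<in> L2T m act"
  have "J (sub T S) u = (LINT x|m. ev T u x - ev S u x)"
    unfolding J_def by (rule integral_cong_AE[OF _ _ sub_L2T(2)[OF T S]])
      (use ev_borel[OF T] ev_borel[OF S] ev_borel[OF sub_L2T(1)[OF T S]] in simp_all)
  then show ?thesis using T S by (simp add: J_def)
qed

abbreviation PD :: "('c \<Rightarrow> ('x \<Rightarrow> real) set) \<Rightarrow> ('c \<Rightarrow> ('x \<Rightarrow> real) set) \<Rightarrow> 'x \<Rightarrow> real" where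
  "PD T S \<equiv> PT (sub T S)"

lemma PD_nonneg: "T \<in> L2T m act \<Longrightarrow> S \<in> L2T m act \<Longrightarrow> AE x in m. 0 \<le> PD T S x"
  by (rule PT_nonneg[OF sub_L2T(1)])

lemma PD_borel: "T \<in> L2T m act \<Longrightarrow> S \<in> L2T m act \<Longrightarrow> PD T S \<in> borel_measurable borel"
  by (rule PT_borel[OF sub_L2T(1)])

text \<open>All metric inequalities for the dual pointwise norm reduce to pointwise inequalities
  between pairings through this domination.\<close>

lemma PT_le_add:
  assumes U: "U \<in> L2T m act" and T: "T \<in> L2T m act" and S: "S \<in> L2T m act"
    and le: "\<And>u. AE x in m. ev U u x \<le> \<bar>ev T u x\<bar> + \<bar>ev S u x\<bar>"
  shows "AE x in m. PT U x \<le> PT T x + PT S x"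
proof (rule PT_least[OF U])
  note [measurable] = PT_borel[OF T] PT_borel[OF S]
  show "(\<lambda>x. PT T x + PT S x) \<in> borel_measurable borel" by measurable
  show "AE x in m. 0 \<le> PT T x + PT S x" using PT_nonneg[OF T] PT_nonneg[OF S] by eventually_elim simp
  show "AE x in m. ev U u x \<le> (PT T x + PT S x) * pn u x" for u
    using le[of u] ev_le_PT[OF T, of u] ev_le_PT[OF S, of u]
    by eventually_elim (simp add: algebra_simps)
qed

lemma PD_triangle:
  assumes T: "T \<in> L2T m act" and S: "S \<in> L2T m act" and R: "R \<in> L2T m act"
  shows "AE x in m. PD T R x \<le> PD T S x + PD S R x"
proof (rule PT_le_add[OF sub_L2T(1)[OF T R] sub_L2T(1)[OF T S] sub_L2T(1)[OF S R]])
  show "AE x in m. ev (sub T R) u x \<le> \<bar>ev (sub T S) u x\<bar> + \<bar>ev (sub S R) u x\<bar>" for u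
    using sub_L2T(2)[OF T R, of u] sub_L2T(2)[OF T S, of u] sub_L2T(2)[OF S R, of u] by eventually_elim linarith
qed

lemma PT_le_PD:
  assumes T: "T \<in> L2T m act" and S: "S \<in> L2T m act"
  shows "AE x in m. PT T x \<le> PT S x + PD T S x"
proof (rule PT_le_add[OF T S sub_L2T(1)[OF T S]])
  show "AE x in m. ev T u x \<le> \<bar>ev S u x\<bar> + \<bar>ev (sub T S) u x\<bar>" for u
    using sub_L2T(2)[OF T S, of u] by eventually_elim linarith
qed

lemma PD_self:
  assumes T: "T \<in> L2T m act" shows "AE x in m. PD T T x = 0"
proof -
  have "AE x in m. PD T T x \<le> 0"
  proof (rule PT_least[OF sub_L2T(1)[OF T T]])
    show "AE x in m. ev (sub T T) u x \<le> 0 * pn u x" for u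
      using sub_L2T(2)[OF T T, of u] by eventually_elim simp
  qed simp_all
  with PD_nonneg[OF T T] show ?thesis by eventually_elim simp
qed

text \<open>Obtained from \<open>PT_le_add\<close> with the vanishing summand \<open>PD T T\<close>,
  once in each direction.\<close>

lemma PD_commute:
  assumes T: "T \<in> L2T m act" and S: "S \<in> L2T m act"
  shows "AE x in m. PD T S x = PD S T x"
proof -
  have "AE x in m. PD T S x \<le> PD T T x + PD S T x" if T: "T \<in> L2T m act" and S: "S \<in> L2T m act" for T S
  proof (rule PT_le_add[OF sub_L2T(1)[OF T S] sub_L2T(1)[OF T T] sub_L2T(1)[OF S T]])
    show "AE x in m. ev (sub T S) u x \<le> \<bar>ev (sub T T) u x\<bar> + \<bar>ev (sub S T) u x\<bar>" for u
      using sub_L2T(2)[OF T S, of u] sub_L2T(2)[OF T T, of u] sub_L2T(2)[OF S T, of u] by eventually_elim linarith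
  qed
  from this[OF T S] this[OF S T] PD_self[OF T] PD_self[OF S] show ?thesis by eventually_elim simp
qed

lemma PT_diff_le_PD:
  assumes T: "T \<in> L2T m act" and S: "S \<in> L2T m act"
  shows "AE x in m. \<bar>PT T x - PT S x\<bar> \<le> PD T S x"
  using PT_le_PD[OF T S] PT_le_PD[OF S T] PD_commute[OF T S] by eventually_elim linarith

abbreviation D0 :: "('c \<Rightarrow> ('x \<Rightarrow> real) set) \<Rightarrow> ('c \<Rightarrow> ('x \<Rightarrow> real) set) \<Rightarrow> real" where
  "D0 T S \<equiv> L0_dist m pn T S"

lemma L0_dist_eq: "D0 T S = (LINT x|m. min 1 (PD T S x))"
  by (simp add: L0_dist_def sub_def)

lemma min1_integrable:
  fixes f :: "'x \<Rightarrow> real"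
  assumes "f \<in> borel_measurable borel" "AE x in m. 0 \<le> f x"
  shows "integrable m (\<lambda>x. min 1 (f x))"
proof (rule Bochner_Integration.integrable_bound[of m "\<lambda>_. 1 :: real"])
  show "AE x in m. norm (min 1 (f x)) \<le> norm (1 :: real)" using assms(2) by eventually_elim simp
  show "(\<lambda>x. min 1 (f x)) \<in> borel_measurable m" using assms(1) by simp
qed simp

lemma min1_PD_integrable: "T \<in> L2T m act \<Longrightarrow> S \<in> L2T m act \<Longrightarrow> integrable m (\<lambda>x. min 1 (PD T S x))"
  by (rule min1_integrable[OF PD_borel PD_nonneg])

lemma D0_nonneg:
  assumes "T \<in> L2T m act" "S \<in> L2T m act" shows "0 \<le> D0 T S"
  unfolding L0_dist_eq by (rule integral_nonneg_AE, use PD_nonneg[OF assms] in eventually_elim) simp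

lemma D0_self: "T \<in> L2T m act \<Longrightarrow> D0 T T = 0"
  unfolding L0_dist_eq by (rule integral_eq_zero_AE, drule PD_self) (auto elim: eventually_mono)

lemma D0_commute:
  assumes "T \<in> L2T m act" "S \<in> L2T m act" shows "D0 T S = D0 S T"
  unfolding L0_dist_eq
proof (rule integral_cong_AE)
  show "AE x in m. min 1 (PD T S x) = min 1 (PD S T x)" using PD_commute[OF assms] by eventually_elim simp
qed (use PD_borel assms in simp_all)

lemma D0_triangle:
  assumes T: "T \<in> L2T m act" and S: "S \<in> L2T m act" and R: "R \<in> L2T m act"
  shows "D0 T R \<le> D0 T S + D0 S R"
proof -
  have "D0 T R \<le> (LINT x|m. min 1 (PD T S x) + min 1 (PD S R x))"
    unfolding L0_dist_eq
  proof (rule integral_mono_AE)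
    show "AE x in m. min 1 (PD T R x) \<le> min 1 (PD T S x) + min 1 (PD S R x)"
      using PD_triangle[OF T S R] PD_nonneg[OF T S] PD_nonneg[OF S R] by eventually_elim (auto simp: min_def)
  qed (use min1_PD_integrable[OF T R] min1_PD_integrable[OF T S] min1_PD_integrable[OF S R] in simp_all)
  then show ?thesis using min1_PD_integrable[OF T S] min1_PD_integrable[OF S R] by (simp add: L0_dist_eq)
qed

lemma D0_eq_0:
  assumes T: "T \<in> L2T m act" and S: "S \<in> L2T m act" and "D0 T S = 0"
  shows "T = S"
proof (rule L2T_ext[OF T S])
  fix u
  have "AE x in m. 0 \<le> min 1 (PD T S x)" using PD_nonneg[OF T S] by eventually_elim simp
  then have "AE x in m. min 1 (PD T S x) = 0"
    using integral_nonneg_eq_0_iff_AE[OF min1_PD_integrable[OF T S]] assms(3) by (simp add: L0_dist_eq)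
  then show "AE x in m. ev T u x = ev S u x"
    using ev_le_PT[OF sub_L2T(1)[OF T S], of u] sub_L2T(2)[OF T S, of u]
    by eventually_elim (auto simp: min_def split: if_splits)
qed

lemma L0_cauchyD: "s \<in> L0_cauchy m act pn \<Longrightarrow> s n \<in> L2T m act"
  by (simp add: L0_cauchy_def)

lemma L0_relD:
  assumes "(s, t) \<in> L0_rel m act pn"
  shows "s \<in> L0_cauchy m act pn" "t \<in> L0_cauchy m act pn" "(\<lambda>n. D0 (s n) (t n)) \<longlonglongrightarrow> 0"
  using assms by (auto simp: L0_rel_def)

lemma L0_rel_trans_aux:
  assumes "(s, t) \<in> L0_rel m act pn" "(t, u) \<in> L0_rel m act pn"
  shows "(s, u) \<in> L0_rel m act pn"
proof -
  note 1 = L0_relD[OF assms(1)] and 2 = L0_relD[OF assms(2)]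
  have st: "s n \<in> L2T m act" "t n \<in> L2T m act" "u n \<in> L2T m act" for n
    using 1(1,2) 2(2) by (auto simp: L0_cauchyD)
  have "(\<lambda>n. D0 (s n) (u n)) \<longlonglongrightarrow> 0"
  proof (rule tendsto_sandwich[OF always_eventually always_eventually tendsto_const])
    show "\<forall>n. 0 \<le> D0 (s n) (u n)" using D0_nonneg st by blast
    show "\<forall>n. D0 (s n) (u n) \<le> D0 (s n) (t n) + D0 (t n) (u n)" using D0_triangle st by blast
    show "(\<lambda>n. D0 (s n) (t n) + D0 (t n) (u n)) \<longlonglongrightarrow> 0" using tendsto_add[OF 1(3) 2(3)] by simp
  qed
  then show ?thesis using 1(1) 2(2) by (simp add: L0_rel_def)
qed

lemma L0_equiv: "equiv (L0_cauchy m act pn) (L0_rel m act pn)"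
proof (rule equivI)
  show "L0_rel m act pn \<subseteq> L0_cauchy m act pn \<times> L0_cauchy m act pn"
    by (auto simp: L0_rel_def)
  show "refl_on (L0_cauchy m act pn) (L0_rel m act pn)"
    by (rule refl_onI) (auto simp: L0_rel_def D0_self L0_cauchyD)
  show "sym (L0_rel m act pn)"
  proof (rule symI)
    fix s t assume "(s, t) \<in> L0_rel m act pn"
    note 1 = L0_relD[OF this]
    have "D0 (s n) (t n) = D0 (t n) (s n)" for n by (rule D0_commute[OF L0_cauchyD[OF 1(1)] L0_cauchyD[OF 1(2)]])
    then show "(t, s) \<in> L0_rel m act pn" using 1 by (simp add: L0_rel_def)
  qed
  show "trans (L0_rel m act pn)" by (rule transI) (rule L0_rel_trans_aux)
qed

lemma const_cauchy: "T \<in> L2T m act \<Longrightarrow> (\<lambda>_. T) \<in> L0_cauchy m act pn"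
  by (simp add: L0_cauchy_def D0_self)

lemma embed_mem: "s \<in> L0_embed m act pn T \<longleftrightarrow> ((\<lambda>_. T), s) \<in> L0_rel m act pn"
  by (simp add: L0_embed_def)

text \<open>The constant sequence is one representative of the embedded element, which forces h.
  Conversely the reverse triangle inequality bounds the error along any other representative by its
  distance to T.\<close>

lemma is_L0_pnorm_embed:
  assumes T: "T \<in> L2T m act"
  shows "is_L0_pnorm m pn (L0_embed m act pn T) h \<longleftrightarrow> is_dual_pnorm m pn T h"
proof
  assume h: "is_L0_pnorm m pn (L0_embed m act pn T) h"
  have "(\<lambda>_. T) \<in> L0_embed m act pn T"
    using const_cauchy[OF T] D0_self[OF T] by (simp add: embed_mem L0_rel_def)
  then have "(\<lambda>n::nat. \<integral>x. min 1 \<bar>PT T x - h x\<bar> \<partial>m) \<longlonglongrightarrow> 0" and hb: "h \<in> borel_measurable borel"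
    using h unfolding is_L0_pnorm_def measurable_m_iff by (auto dest: bspec)
  then have 0: "(LINT x|m. min 1 \<bar>PT T x - h x\<bar>) = 0" using LIMSEQ_const_iff by blast
  have "integrable m (\<lambda>x. min 1 \<bar>PT T x - h x\<bar>)"
    by (rule min1_integrable) (use hb PT_borel[OF T] in simp_all)
  then have "AE x in m. min 1 \<bar>PT T x - h x\<bar> = 0"
    using integral_nonneg_eq_0_iff_AE[of m "\<lambda>x. min 1 \<bar>PT T x - h x\<bar>"] 0 by simp
  then have "AE x in m. PT T x = h x" by eventually_elim (auto simp: min_def split: if_splits)
  then show "is_dual_pnorm m pn T h" using hb by (simp add: is_dual_pnorm_iff[OF T])
next
  assume "is_dual_pnorm m pn T h"
  then have hb: "h \<in> borel_measurable borel" and eq: "AE x in m. PT T x = h x" by (simp_all add: is_dual_pnorm_iff[OF T])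
  show "is_L0_pnorm m pn (L0_embed m act pn T) h"
    unfolding is_L0_pnorm_def
  proof (intro conjI ballI)
    fix s assume "s \<in> L0_embed m act pn T"
    note 1 = L0_relD[OF this[unfolded embed_mem]]
    have s: "s n \<in> L2T m act" for n by (rule L0_cauchyD[OF 1(2)])
    show "(\<lambda>n. \<integral>x. min 1 \<bar>PT (s n) x - h x\<bar> \<partial>m) \<longlonglongrightarrow> 0"
    proof (rule tendsto_sandwich[OF always_eventually always_eventually tendsto_const 1(3)])
      show "\<forall>n. 0 \<le> (LINT x|m. min 1 \<bar>PT (s n) x - h x\<bar>)" by simp
      show "\<forall>n. (LINT x|m. min 1 \<bar>PT (s n) x - h x\<bar>) \<le> D0 T (s n)"
      proof
        fix n
        show "(LINT x|m. min 1 \<bar>PT (s n) x - h x\<bar>) \<le> D0 T (s n)"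
          unfolding L0_dist_eq
        proof (rule integral_mono_AE)
          show "integrable m (\<lambda>x. min 1 \<bar>PT (s n) x - h x\<bar>)"
            by (rule min1_integrable) (use hb PT_borel[OF s, of n] in simp_all)
          show "AE x in m. min 1 \<bar>PT (s n) x - h x\<bar> \<le> min 1 (PD T (s n) x)"
            using PT_diff_le_PD[OF T s, of n] eq by eventually_elim (auto simp: min_def abs_minus_commute)
        qed (rule min1_PD_integrable[OF T s])
      qed
    qed
  qed (use hb in simp)
qed

text \<open>Truncation makes a Cauchy sequence with bounded limiting norm converge in \<open>L\<^sup>1\<close>.\<close>

lemma L0_bounded_limit:
  assumes s: "s \<in> L0_cauchy m act pn" and h: "h \<in> Linf m"
    and lim: "(\<lambda>n. \<integral>x. min 1 \<bar>PT (s n) x - h x\<bar> \<partial>m) \<longlonglongrightarrow> 0"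
  obtains T where "T \<in> carrier TM" "(\<lambda>n. D0 (s n) T) \<longlonglongrightarrow> 0"
proof -
  have sL: "s n \<in> L2T m act" for n by (rule L0_cauchyD[OF s])
  have hb: "h \<in> borel_measurable borel" using h by (simp add: Linf_iff)
  obtain C where C: "AE x in m. \<bar>h x\<bar> \<le> C" using h by (auto simp: Linf_iff)
  \<comment> \<open>The margin 1 matters: at a truncated point the pointwise norm exceeds K, hence
    differs from h by at least 1, so the truncation error is dominated by the integrand of
    \<open>lim\<close>.\<close>
  define K where "K = \<bar>C\<bar> + 1"
  have K: "1 \<le> K" by (simp add: K_def)
  define B where "B n = {x. PT (s n) x \<le> K}" for n
  have B: "B n \<in> sets borel" for n unfolding B_def using PT_borel[OF sL, of n] by measurable
  define t where "t n = tan_mult m (indicat_real (B n)) (s n)" for n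
  have tL: "t n \<in> L2T m act" and evt: "AE x in m. ev (t n) u x = indicat_real (B n) x * ev (s n) u x" for n u
    unfolding t_def using tan_mult_L2T[OF sL Linf_indicator[OF B]] by blast+
  have PTt: "AE x in m. PT (t n) x \<le> K" for n
    using PT_mult[OF sL Linf_indicator[OF B], of n n] PT_nonneg[OF sL, of n]
    unfolding t_def
  proof eventually_elim
    case (elim x)
    then show ?case using K by (cases "x \<in> B n") (auto simp: B_def)
  qed
  define a where "a n = D0 (s n) (t n)" for n
  have a: "a \<longlonglongrightarrow> 0"
  proof (rule tendsto_sandwich[OF always_eventually always_eventually tendsto_const lim])
    show "\<forall>n. 0 \<le> a n" unfolding a_def using D0_nonneg sL tL by blast
    show "\<forall>n. a n \<le> (LINT x|m. min 1 \<bar>PT (s n) x - h x\<bar>)"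
    proof
      fix n
      have le: "AE x in m. PD (s n) (t n) x \<le> indicat_real (- B n) x * PT (s n) x"
      proof (rule PT_least[OF sub_L2T(1)[OF sL tL]])
        show "(\<lambda>x. indicat_real (- B n) x * PT (s n) x) \<in> borel_measurable borel"
          using B PT_borel[OF sL, of n] by (intro borel_measurable_times) auto
        show "AE x in m. 0 \<le> indicat_real (- B n) x * PT (s n) x" using PT_nonneg[OF sL, of n] by eventually_elim simp
        show "AE x in m. ev (sub (s n) (t n)) u x \<le> indicat_real (- B n) x * PT (s n) x * pn u x" for u
          using sub_L2T(2)[OF sL tL, of n n u] evt[of n u] ev_le_PT[OF sL, of n u]
        proof eventually_elim
          case (elim x)
          then show ?case by (cases "x \<in> B n") auto
        qed
      qed
      show "a n \<le> (LINT x|m. min 1 \<bar>PT (s n) x - h x\<bar>)"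
        unfolding a_def L0_dist_eq
      proof (rule integral_mono_AE[OF min1_PD_integrable[OF sL tL]])
        show "integrable m (\<lambda>x. min 1 \<bar>PT (s n) x - h x\<bar>)"
          by (rule min1_integrable) (use hb PT_borel[OF sL, of n] in simp_all)
        show "AE x in m. min 1 (PD (s n) (t n) x) \<le> min 1 \<bar>PT (s n) x - h x\<bar>"
          using le C
        proof eventually_elim
          case (elim x)
          show ?case
          proof (cases "x \<in> B n")
            case True
            then have "min 1 (PD (s n) (t n) x) \<le> 0" using elim by simp
            also have "0 \<le> min 1 \<bar>PT (s n) x - h x\<bar>" by simp
            finally show ?thesis .
          next
            case False
            then have "K < PT (s n) x" by (simp add: B_def)
            then have "1 \<le> \<bar>PT (s n) x - h x\<bar>" using elim(2) by (simp add: K_def)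
            then show ?thesis by simp
          qed
        qed
      qed
    qed
  qed
  define b where "b i j = (LINT x|m. PD (t i) (t j) x)" for i j
  have PDi: "integrable m (PD (t i) (t j))" for i j by (rule PT_integrable(1)[OF sub_L2T(1)[OF tL tL]])
  \<comment> \<open>Truncated fields have pointwise distance at most 2 K, hence at most 2 K times
    its minimum with 1. This upgrades convergence in measure to L^1.\<close>
  have b_le: "b i j \<le> 2 * K * (a i + D0 (s i) (s j) + a j)" for i j
  proof -
    have "b i j \<le> (LINT x|m. 2 * K * min 1 (PD (t i) (t j) x))"
      unfolding b_def
    proof (rule integral_mono_AE[OF PDi])
      have "AE x in m. PD (t i) (t j) x \<le> PT (t i) x + PT (t j) x"
      proof (rule PT_le_add[OF sub_L2T(1)[OF tL tL] tL tL])
        show "AE x in m. ev (sub (t i) (t j)) u x \<le> \<bar>ev (t i) u x\<bar> + \<bar>ev (t j) u x\<bar>" for u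
          using sub_L2T(2)[OF tL tL, of i j u] by eventually_elim linarith
      qed
      then show "AE x in m. PD (t i) (t j) x \<le> 2 * K * min 1 (PD (t i) (t j) x)"
        using PTt[of i] PTt[of j] PD_nonneg[OF tL tL, of i j]
      proof eventually_elim
        case (elim x)
        show ?case
        proof (cases "PD (t i) (t j) x \<le> 1")
          case True
          have "1 * PD (t i) (t j) x \<le> 2 * K * PD (t i) (t j) x" using K elim(4) by (intro mult_right_mono) auto
          with True show ?thesis by (simp add: min_def)
        next
          case False
          with elim K show ?thesis by (simp add: min_def)
        qed
      qed
    qed (use min1_PD_integrable[OF tL tL, of i j] in simp)
    also have "\<dots> = 2 * K * D0 (t i) (t j)" by (simp add: L0_dist_eq)
    also have "D0 (t i) (t j) \<le> a i + D0 (s i) (s j) + a j"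
      using D0_triangle[OF tL[of i] sL[of i] tL[of j]] D0_triangle[OF sL[of i] sL[of j] tL[of j]]
        D0_commute[OF tL[of i] sL[of i]] by (simp add: a_def)
    finally show ?thesis using K by simp
  qed
  have cauchy: "\<exists>N. \<forall>i\<ge>N. \<forall>j\<ge>N. b i j < e" if "e > 0" for e
  proof -
    \<comment> \<open>Three summands below e', multiplied by 2 K.\<close>
    define e' where "e' = e / (6 * K)"
    have e': "e' > 0" using that K by (simp add: e'_def)
    obtain N1 where N1: "\<forall>i\<ge>N1. \<forall>j\<ge>N1. D0 (s i) (s j) < e'" using s e' unfolding L0_cauchy_def by blast
    have "eventually (\<lambda>n. a n < e') sequentially" using order_tendstoD(2)[OF a e'] .
    then obtain N2 where N2: "\<forall>n\<ge>N2. a n < e'" unfolding eventually_sequentially by blast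
    have "b i j < e" if ij: "i \<ge> max N1 N2" "j \<ge> max N1 N2" for i j
    proof -
      have "a i + D0 (s i) (s j) + a j < e' + e' + e'" using N1 N2 ij by (intro add_strict_mono) auto
      then have "2 * K * (a i + D0 (s i) (s j) + a j) < 2 * K * (e' + e' + e')" using K by (intro mult_strict_left_mono) auto
      also have "\<dots> = e" using K by (simp add: e'_def)
      finally show ?thesis using b_le[of i j] by simp
    qed
    then show ?thesis by blast
  qed
  have tb: "bdf K (J (t n))" for n by (rule J_bdf[OF tL PTt])
  have Jdiff: "\<bar>J (t i) u - J (t j) u\<bar> \<le> R * b i j" if R: "AE x in m. pn u x \<le> R" for i j u R
  proof -
    note sub = sub_L2T(1)[OF tL[of i] tL[of j]]
    have "\<bar>J (t i) u - J (t j) u\<bar> = \<bar>J (sub (t i) (t j)) u\<bar>" by (simp add: J_sub[OF tL tL])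
    also have "\<dots> \<le> (LINT x|m. \<bar>ev (sub (t i) (t j)) u x\<bar>)" unfolding J_def by (rule integral_abs_bound)
    also have "\<dots> \<le> (LINT x|m. R * PD (t i) (t j) x)"
    proof (rule integral_mono_AE)
      show "AE x in m. \<bar>ev (sub (t i) (t j)) u x\<bar> \<le> R * PD (t i) (t j) x"
        using ev_le_PT[OF sub, of u] R PD_nonneg[OF tL tL, of i j]
      proof eventually_elim
        case (elim x)
        then show ?case using mult_left_mono[OF elim(2,3)] by (simp add: mult.commute)
      qed
    qed (use PDi sub in simp_all)
    finally show ?thesis by (simp add: b_def)
  qed
  \<comment> \<open>\<open>Jdiff\<close> asks for a bounded \<bar>u\<bar>. The part of u where
    \<bar>u\<bar> is large is small in \<open>N1\<close> and costs at most e / 4 for each of the two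
    indices by the uniform domination with K; the rest costs e / 2 by the L^1 Cauchy
    property.\<close>
  have "Cauchy (\<lambda>n. J (t n) u)" for u
  proof (rule metric_CauchyI)
    fix e :: real assume "e > 0"
    define A where "A i = {x. pn u x \<le> real i}" for i :: nat
    have A: "A i \<in> sets borel" for i unfolding A_def by measurable
    have AU: "(\<Union>i. A i) = UNIV" by (auto simp: A_def intro: real_arch_simple)
    have "(\<lambda>n. N1 (cut ((\<Union>i. A i) - (\<Union>i<n. A i)) u)) \<longlonglongrightarrow> 0" by (rule N1_cut_tail) (use A in blast)
    moreover have "e / (4 * K) > 0" using \<open>e > 0\<close> K by simp
    ultimately have "eventually (\<lambda>n. N1 (cut ((\<Union>i. A i) - (\<Union>i<n. A i)) u) < e / (4 * K)) sequentially"
      by (rule order_tendstoD)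
    then obtain n where n: "N1 (cut (- (\<Union>i<n. A i)) u) < e / (4 * K)"
      unfolding AU eventually_sequentially Compl_eq_Diff_UNIV by blast
    define A' where "A' = (\<Union>i<n. A i)"
    have A': "A' \<in> sets borel" unfolding A'_def by (intro sets.finite_UN A) simp
    have split: "u = cut A' u + cut (- A') u"
      using cut_Un[OF A', of "- A'" u] A' by simp
    have pnA': "AE x in m. pn (cut A' u) x \<le> real n"
      using pn_cut[OF A', of u]
    proof eventually_elim
      case (elim x)
      have "pn u x \<le> real n" if "x \<in> A'" using that by (force simp: A'_def A_def)
      then show ?case using elim by (cases "x \<in> A'") auto
    qed
    have "e / (2 * (real n + 1)) > 0" using \<open>e > 0\<close> by simp
    then obtain N where N: "\<forall>i\<ge>N. \<forall>j\<ge>N. b i j < e / (2 * (real n + 1))" using cauchy by blast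
    show "\<exists>M. \<forall>i\<ge>M. \<forall>j\<ge>M. dist (J (t i) u) (J (t j) u) < e"
    proof (intro exI allI impI)
      fix i j assume ij: "N \<le> i" "N \<le> j"
      have "\<bar>J (t i) (cut A' u) - J (t j) (cut A' u)\<bar> \<le> real n * b i j" by (rule Jdiff[OF pnA'])
      also have "\<dots> \<le> real n * (e / (2 * (real n + 1)))" using N ij by (intro mult_left_mono) (auto intro: less_imp_le)
      also have "\<dots> \<le> e / 2" using \<open>e > 0\<close> by (simp add: field_simps)
      finally have 1: "\<bar>J (t i) (cut A' u) - J (t j) (cut A' u)\<bar> \<le> e / 2" .
      have 2: "\<bar>J (t k) (cut (- A') u)\<bar> < e / 4" for k
      proof -
        have "\<bar>J (t k) (cut (- A') u)\<bar> \<le> K * N1 (cut (- A') u)" by (rule bdf_le[OF tb])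
        also have "\<dots> < K * (e / (4 * K))" using n K unfolding A'_def by (intro mult_strict_left_mono) auto
        also have "\<dots> = e / 4" using K by simp
        finally show ?thesis .
      qed
      have "J (t k) u = J (t k) (cut A' u) + J (t k) (cut (- A') u)" for k
        using J_add[OF tL, of k "cut A' u" "cut (- A') u"] split by simp
      from 1 2[of i] 2[of j] this[of i] this[of j] show "dist (J (t i) u) (J (t j) u) < e" unfolding dist_real_def by linarith
    qed
  qed
  then have conv: "convergent (\<lambda>n. J (t n) u)" for u by (rule Cauchy_convergent)
  define l where "l u = lim (\<lambda>n. J (t n) u)" for u
  have l: "(\<lambda>n. J (t n) u) \<longlonglongrightarrow> l u" for u using conv by (simp add: l_def convergent_LIMSEQ_iff)
  have "bdf K l"
    unfolding bdf_def
  proof (intro conjI allI linearI)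
    show "l (v + w) = l v + l w" for v w
      by (rule LIMSEQ_unique[OF l]) (use tendsto_add[OF l[of v] l[of w]] in \<open>simp add: J_add[OF tL]\<close>)
    show "l (c *\<^sub>R v) = c *\<^sub>R l v" for c v
      by (rule LIMSEQ_unique[OF l]) (use tendsto_scaleR[OF tendsto_const l[of v], of c] in \<open>simp add: linear_scale[OF J_linear[OF tL]]\<close>)
    show "\<bar>l v\<bar> \<le> K * N1 v" for v
      by (rule LIMSEQ_le_const2[OF tendsto_rabs[OF l]]) (use bdf_le[OF tb] in blast)
  qed
  then obtain T where T: "T \<in> carrier TM" "J T = l"
    by (rule bdf_representation) (use K in simp, rule that)
  note TL = TM_L2T[OF T(1)]
  have "(\<lambda>n. D0 (s n) T) \<longlonglongrightarrow> 0"
  proof (rule LIMSEQ_I)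
    fix e :: real assume "e > 0"
    have e4: "e / 4 > 0" using \<open>e > 0\<close> by simp
    obtain N1 where N1: "\<forall>i\<ge>N1. \<forall>j\<ge>N1. b i j < e / 4" using cauchy[OF e4] by blast
    have "eventually (\<lambda>n. a n < e / 4) sequentially" using order_tendstoD(2)[OF a e4] .
    then obtain N2 where N2: "\<forall>n\<ge>N2. a n < e / 4" unfolding eventually_sequentially by blast
    have "D0 (s n) T < e" if n: "n \<ge> max N1 N2" for n
    proof -
      have sub: "sub (t n) T \<in> L2T m act" by (rule sub_L2T(1)[OF tL TL])
      \<comment> \<open>One element of the unit ball nearly attains the L^1 distance from
        \<open>t n\<close> to T, and on the unit ball the functionals converge uniformly by
        \<open>Jdiff\<close>.\<close>
      obtain u where u: "AE x in m. pn u x \<le> 1" "(LINT x|m. PD (t n) T x) - e / 4 < (LINT x|m. ev (sub (t n) T) u x)"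
        using PT_integrable(2)[OF sub e4] by blast
      have "(LINT x|m. ev (sub (t n) T) u x) = J (t n) u - l u"
        using J_sub[OF tL TL, of n u] T(2) by (simp add: J_def)
      also have "\<dots> \<le> e / 4"
      proof (rule LIMSEQ_le_const2[OF tendsto_diff[OF tendsto_const l]])
        have "J (t n) u - J (t j) u \<le> e / 4" if "j \<ge> N1" for j
        proof -
          have "\<bar>J (t n) u - J (t j) u\<bar> \<le> 1 * b n j" by (rule Jdiff[OF u(1)])
          moreover have "b n j < e / 4" using N1 that n by simp
          ultimately show ?thesis by linarith
        qed
        then show "\<exists>N. \<forall>j\<ge>N. J (t n) u - J (t j) u \<le> e / 4" by blast
      qed
      finally have PDe: "(LINT x|m. PD (t n) T x) < e / 2" using u(2) by linarith
      have "D0 (t n) T \<le> (LINT x|m. PD (t n) T x)"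
        unfolding L0_dist_eq by (rule integral_mono[OF min1_PD_integrable[OF tL TL] PT_integrable(1)[OF sub]]) simp
      moreover have "D0 (s n) T \<le> a n + D0 (t n) T" unfolding a_def by (rule D0_triangle[OF sL tL TL])
      moreover have "a n < e / 4" using N2 n by simp
      ultimately show ?thesis using PDe \<open>e > 0\<close> by linarith
    qed
    then have "\<forall>n\<ge>max N1 N2. norm (D0 (s n) T - 0) < e" using D0_nonneg[OF sL TL] by simp
    then show "\<exists>no. \<forall>n\<ge>no. norm (D0 (s n) T - 0) < e" by blast
  qed
  with T(1) show ?thesis by (rule that)
qed

text \<open>Justifies defining bounded fields inside the tangent module: every element of the
  completion whose pointwise norm is bounded is the limit of constant sequences, by
  \<open>L0_bounded_limit\<close>.\<close>

lemma bij_betw_L0_embed: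
  "bij_betw (L0_embed m act pn) (carrier TM) {\<xi> \<in> L0T m act pn. \<exists>h\<in>Linf m. is_L0_pnorm m pn \<xi> h}"
  unfolding bij_betw_def
proof
  show "inj_on (L0_embed m act pn) (carrier TM)"
  proof (rule inj_onI)
    fix T S assume T: "T \<in> carrier TM" and S: "S \<in> carrier TM" and eq: "L0_embed m act pn T = L0_embed m act pn S"
    have "(\<lambda>_. S) \<in> L0_embed m act pn S"
      using const_cauchy[OF TM_L2T[OF S]] D0_self[OF TM_L2T[OF S]] by (simp add: embed_mem L0_rel_def)
    then have "((\<lambda>_. T), (\<lambda>_. S)) \<in> L0_rel m act pn" using eq by (simp add: embed_mem[symmetric])
    from L0_relD(3)[OF this] have "D0 T S = 0" by (simp add: LIMSEQ_const_iff)
    then show "T = S" by (rule D0_eq_0[OF TM_L2T[OF T] TM_L2T[OF S]])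
  qed
  show "L0_embed m act pn ` carrier TM = {\<xi> \<in> L0T m act pn. \<exists>h\<in>Linf m. is_L0_pnorm m pn \<xi> h}"
  proof (intro equalityI subsetI)
    fix \<xi> assume "\<xi> \<in> L0_embed m act pn ` carrier TM"
    then obtain T where T: "T \<in> carrier TM" "\<xi> = L0_embed m act pn T" by blast
    have "\<xi> \<in> L0T m act pn"
      unfolding T(2) L0_embed_def L0T_def using const_cauchy[OF TM_L2T[OF T(1)]] by (rule quotientI)
    moreover obtain h where "h \<in> Linf m" "is_dual_pnorm m pn T h" using T(1) by (auto simp: LinfT_def)
    ultimately show "\<xi> \<in> {\<xi> \<in> L0T m act pn. \<exists>h\<in>Linf m. is_L0_pnorm m pn \<xi> h}"
      using is_L0_pnorm_embed[OF TM_L2T[OF T(1)]] T(2) by blast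
  next
    fix \<xi> assume "\<xi> \<in> {\<xi> \<in> L0T m act pn. \<exists>h\<in>Linf m. is_L0_pnorm m pn \<xi> h}"
    then obtain h where \<xi>: "\<xi> \<in> L0T m act pn" and h: "h \<in> Linf m" "is_L0_pnorm m pn \<xi> h" by blast
    obtain s where s: "s \<in> L0_cauchy m act pn" "\<xi> = L0_rel m act pn `` {s}"
      using \<xi> unfolding L0T_def by (rule quotientE)
    have "s \<in> \<xi>" unfolding s(2) by (rule equiv_class_self[OF L0_equiv s(1)])
    then have "(\<lambda>n. \<integral>x. min 1 \<bar>PT (s n) x - h x\<bar> \<partial>m) \<longlonglongrightarrow> 0" using h(2) unfolding is_L0_pnorm_def by blast
    then obtain T where T: "T \<in> carrier TM" "(\<lambda>n. D0 (s n) T) \<longlonglongrightarrow> 0" by (rule L0_bounded_limit[OF s(1) h(1)]) (rule that)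
    have "(s, (\<lambda>_. T)) \<in> L0_rel m act pn" using s(1) const_cauchy[OF TM_L2T[OF T(1)]] T(2) by (simp add: L0_rel_def)
    then have "\<xi> = L0_embed m act pn T" unfolding s(2) L0_embed_def by (rule equiv_class_eq[OF L0_equiv])
    with T(1) show "\<xi> \<in> L0_embed m act pn ` carrier TM" by blast
  qed
qed

end

section \<open>Normed modules and local vector measures\<close>

locale cb_module =
  fixes V :: "('x::polish_space, 'v) normed_cb_module" (structure)
  assumes normed: "is_normed_cb_module V"
begin

abbreviation CV :: "'v set" where "CV \<equiv> carrier V"
abbreviation nV :: "'v \<Rightarrow> real" where "nV \<equiv> vnorm V"

lemma module_V: "Module.module Cb V"
  by (rule normed[unfolded is_normed_cb_module_def, THEN conjunct1])

lemma zero_CV [simp]: "\<zero> \<in> CV"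
proof -
  interpret Module.module Cb V by (rule module_V)
  show ?thesis by (rule M.zero_closed)
qed

lemma add_CV [simp]: "v \<in> CV \<Longrightarrow> w \<in> CV \<Longrightarrow> v \<oplus> w \<in> CV"
proof -
  interpret Module.module Cb V by (rule module_V)
  assume "v \<in> CV" "w \<in> CV" then show ?thesis by (rule M.add.m_closed)
qed

lemma smult_CV [simp]: "v \<in> CV \<Longrightarrow> f \<odot> v \<in> CV"
  using module.smult_closed[OF module_V] by simp

lemma smult_plus: "v \<in> CV \<Longrightarrow> (f + g) \<odot> v = f \<odot> v \<oplus> g \<odot> v"
  using module.smult_l_distr[OF module_V, of f g v] by simp

lemma smult_mult: "v \<in> CV \<Longrightarrow> cb_mult f g \<odot> v = f \<odot> (g \<odot> v)"
  using module.smult_assoc1[OF module_V, of f g v] unfolding Cb_simps by simp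

lemma smult_1: "v \<in> CV \<Longrightarrow> const_bcontfun 1 \<odot> v = v"
  using module.smult_one[OF module_V, of v] by simp

lemma nV_nonneg: "v \<in> CV \<Longrightarrow> 0 \<le> nV v"
  using normed[unfolded is_normed_cb_module_def, THEN conjunct2, THEN conjunct1] by blast

lemma nV_eq_0: "v \<in> CV \<Longrightarrow> nV v = 0 \<longleftrightarrow> v = \<zero>"
  using normed[unfolded is_normed_cb_module_def, THEN conjunct2, THEN conjunct1] by blast

lemma nV_add: "v \<in> CV \<Longrightarrow> w \<in> CV \<Longrightarrow> nV (v \<oplus> w) \<le> nV v + nV w"
  using normed[unfolded is_normed_cb_module_def, THEN conjunct2, THEN conjunct2, THEN conjunct1] by blast

lemma nV_scale: "v \<in> CV \<Longrightarrow> nV (vscale V c v) = \<bar>c\<bar> * nV v"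
  using normed[unfolded is_normed_cb_module_def, THEN conjunct2, THEN conjunct2, THEN conjunct2, THEN conjunct1] by blast

lemma nV_finsum:
  fixes f :: "nat \<Rightarrow> 'x \<Rightarrow>\<^sub>C real"
  assumes "0 < n" "\<And>i. i < n \<Longrightarrow> v i \<in> CV" "disjoint_family_on (\<lambda>i. supp (f i)) {..<n}"
  shows "nV (finsum V (\<lambda>i. f i \<odot> v i) {..<n}) \<le> (MAX i\<in>{..<n}. norm (f i)) * (MAX i\<in>{..<n}. nV (v i))"
  using normed[unfolded is_normed_cb_module_def, THEN conjunct2, THEN conjunct2, THEN conjunct2, THEN conjunct2, rule_format, of n v f]
    assms by blast

lemma nV_zero [simp]: "nV \<zero> = 0"
  using nV_eq_0[OF zero_CV] by simp

lemma finsum_one: "v \<in> CV \<Longrightarrow> finsum V (\<lambda>_. v) {..<Suc 0} = v"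
proof -
  interpret Module.module Cb V by (rule module_V)
  assume v: "v \<in> CV"
  show ?thesis using M.finsum_insert[of "{}" "0 :: nat" "\<lambda>_. v"] v by (simp add: lessThan_Suc)
qed

text \<open>The case of one summand in the axiom on sums with disjoint supports.\<close>

lemma nV_smult: "v \<in> CV \<Longrightarrow> nV (f \<odot> v) \<le> norm f * nV v"
proof -
  assume v: "v \<in> CV"
  have "disjoint_family_on (\<lambda>i. supp f) {..<Suc 0}" by (simp add: disjoint_family_on_def)
  from nV_finsum[of "Suc 0" "\<lambda>_. v" "\<lambda>_. f", OF _ _ this] v
  show ?thesis unfolding finsum_one[OF smult_CV[OF v]] by (simp add: lessThan_Suc)
qed

lemma zero_smult: "v \<in> CV \<Longrightarrow> 0 \<odot> v = \<zero>"
  using nV_smult[of v 0] nV_nonneg[of "0 \<odot> v"] nV_eq_0[of "0 \<odot> v"] by simp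

lemma eq_of_add_minus:
  assumes v: "v \<in> CV" and w: "w \<in> CV" and "v \<oplus> vscale V (- 1) w = \<zero>"
  shows "v = w"
proof -
  interpret Module.module Cb V by (rule module_V)
  have "const_bcontfun (- 1) + const_bcontfun 1 = (0 :: 'x \<Rightarrow>\<^sub>C real)"
    by (rule bcontfun_eqI) (simp add: plus_bcontfun.rep_eq const_bcontfun.rep_eq)
  then have neg: "vscale V (- 1) w \<oplus> w = \<zero>"
    using smult_plus[OF w, of "const_bcontfun (- 1)" "const_bcontfun 1"] by (simp add: smult_1[OF w] zero_smult[OF w])
  have "v = v \<oplus> (vscale V (- 1) w \<oplus> w)" unfolding neg using v by (simp add: M.r_zero)
  also have "\<dots> = (v \<oplus> vscale V (- 1) w) \<oplus> w" using v w by (simp add: M.a_assoc)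
  also have "\<dots> = w" unfolding assms(3) using w by (simp add: M.l_zero)
  finally show ?thesis .
qed

text \<open>Membership in \<open>vdual V\<close> without the convention of vanishing outside the
  carrier; linearity and boundedness can then be handled apart from that convention.\<close>

definition vlin :: "('v \<Rightarrow> real) \<Rightarrow> bool" where
  "vlin f \<longleftrightarrow> (\<forall>v\<in>CV. \<forall>w\<in>CV. f (v \<oplus> w) = f v + f w)
    \<and> (\<forall>c. \<forall>v\<in>CV. f (vscale V c v) = c * f v) \<and> (\<exists>C. \<forall>v\<in>CV. \<bar>f v\<bar> \<le> C * nV v)"

lemma vdual_iff: "f \<in> vdual V \<longleftrightarrow> vlin f \<and> (\<forall>v. v \<notin> CV \<longrightarrow> f v = 0)"
  unfolding vdual_def vlin_def by blast

lemma vdual_vlin: "f \<in> vdual V \<Longrightarrow> vlin f"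
  by (simp add: vdual_iff)

lemma vlinI:
  assumes "\<And>v w. v \<in> CV \<Longrightarrow> w \<in> CV \<Longrightarrow> f (v \<oplus> w) = f v + f w"
    "\<And>c v. v \<in> CV \<Longrightarrow> f (vscale V c v) = c * f v" "\<And>v. v \<in> CV \<Longrightarrow> \<bar>f v\<bar> \<le> C * nV v"
  shows "vlin f"
  unfolding vlin_def using assms by blast

lemma vlin_add: "vlin f \<Longrightarrow> v \<in> CV \<Longrightarrow> w \<in> CV \<Longrightarrow> f (v \<oplus> w) = f v + f w"
  by (simp add: vlin_def)

lemma vlin_scale: "vlin f \<Longrightarrow> v \<in> CV \<Longrightarrow> f (vscale V c v) = c * f v"
  by (simp add: vlin_def)

lemma vlin_zero: "vlin f \<Longrightarrow> f \<zero> = 0"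
  using nV_zero unfolding vlin_def by (metis abs_le_zero_iff mult_zero_right zero_CV)

lemma vlin_combination:
  assumes "vlin f" "vlin g" shows "vlin (\<lambda>v. a * f v + b * g v)"
proof -
  obtain C D where C: "\<forall>v\<in>CV. \<bar>f v\<bar> \<le> C * nV v" and D: "\<forall>v\<in>CV. \<bar>g v\<bar> \<le> D * nV v"
    using assms unfolding vlin_def by blast
  show ?thesis
  proof (rule vlinI[where C = "\<bar>a\<bar> * C + \<bar>b\<bar> * D"])
    fix v assume v: "v \<in> CV"
    have "\<bar>a * f v + b * g v\<bar> \<le> \<bar>a\<bar> * \<bar>f v\<bar> + \<bar>b\<bar> * \<bar>g v\<bar>" by (metis abs_mult abs_triangle_ineq)
    also have "\<dots> \<le> \<bar>a\<bar> * (C * nV v) + \<bar>b\<bar> * (D * nV v)" using C D v by (intro add_mono mult_left_mono) auto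
    finally show "\<bar>a * f v + b * g v\<bar> \<le> (\<bar>a\<bar> * C + \<bar>b\<bar> * D) * nV v" by (simp add: algebra_simps)
  qed (use assms in \<open>simp_all add: vlin_add vlin_scale algebra_simps\<close>)
qed

lemma vlin_plus: "vlin f \<Longrightarrow> vlin g \<Longrightarrow> vlin (\<lambda>v. f v + g v)"
  using vlin_combination[of f g 1 1] by simp

lemma vlin_minus: "vlin f \<Longrightarrow> vlin g \<Longrightarrow> vlin (\<lambda>v. f v - g v)"
  using vlin_combination[of f g 1 "- 1"] by simp

lemma vlin_0: "vlin (\<lambda>_. 0)"
  by (rule vlinI[where C = 0]) simp_all

lemma vlin_cmult: "vlin f \<Longrightarrow> vlin (\<lambda>v. c * f v)"
  using vlin_combination[of f "\<lambda>_. 0" c 0] vlin_0 by simp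

lemma vlin_sum: "finite I \<Longrightarrow> (\<And>i. i \<in> I \<Longrightarrow> vlin (f i)) \<Longrightarrow> vlin (\<lambda>v. \<Sum>i\<in>I. f i v)"
  by (induction I rule: finite_induct) (simp_all add: vlin_0 vlin_plus)

lemma dnorm_le:
  assumes "0 \<le> C" "\<And>v. v \<in> CV \<Longrightarrow> \<bar>f v\<bar> \<le> C * nV v"
  shows "dnorm V f \<le> C"
  unfolding dnorm_def
proof (rule cSup_least)
  show "{\<bar>f v\<bar> |v. v \<in> CV \<and> nV v \<le> 1} \<noteq> {}" using zero_CV nV_zero by (metis (mono_tags, lifting) empty_iff mem_Collect_eq zero_le_one)
  fix r assume "r \<in> {\<bar>f v\<bar> |v. v \<in> CV \<and> nV v \<le> 1}"
  then obtain v where v: "r = \<bar>f v\<bar>" "v \<in> CV" "nV v \<le> 1" by blast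
  have "C * nV v \<le> C * 1" using v assms(1) by (intro mult_left_mono)
  then show "r \<le> C" using assms(2)[OF v(2)] v(1) by simp
qed

lemma dnorm_upper:
  assumes f: "vlin f" and v: "v \<in> CV" "nV v \<le> 1" shows "\<bar>f v\<bar> \<le> dnorm V f"
  unfolding dnorm_def
proof (rule cSup_upper)
  obtain C where C: "\<forall>v\<in>CV. \<bar>f v\<bar> \<le> C * nV v" using f unfolding vlin_def by blast
  show "bdd_above {\<bar>f v\<bar> |v. v \<in> CV \<and> nV v \<le> 1}"
  proof (rule bdd_aboveI)
    fix r assume "r \<in> {\<bar>f v\<bar> |v. v \<in> CV \<and> nV v \<le> 1}"
    then obtain w where w: "r = \<bar>f w\<bar>" "w \<in> CV" "nV w \<le> 1" by blast
    have "C * nV w \<le> \<bar>C\<bar> * nV w" using nV_nonneg[OF w(2)] by (intro mult_right_mono) auto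
    also have "\<dots> \<le> \<bar>C\<bar> * 1" using w(3) by (intro mult_left_mono) auto
    finally show "r \<le> \<bar>C\<bar>" using C w by fastforce
  qed
qed (use v in blast)

lemma dnorm_nonneg: "vlin f \<Longrightarrow> 0 \<le> dnorm V f"
  using dnorm_upper[OF _ zero_CV] vlin_zero by fastforce

lemma dnorm_bound:
  assumes f: "vlin f" and v: "v \<in> CV" shows "\<bar>f v\<bar> \<le> dnorm V f * nV v"
proof (cases "nV v = 0")
  case True
  then show ?thesis using nV_eq_0[OF v] vlin_zero[OF f] by simp
next
  case False
  then have pos: "0 < nV v" using nV_nonneg[OF v] by simp
  define w where "w = vscale V (1 / nV v) v"
  have w: "w \<in> CV" "nV w \<le> 1" unfolding w_def using v pos by (simp_all add: nV_scale)
  have "\<bar>f w\<bar> = \<bar>f v\<bar> / nV v" unfolding w_def vlin_scale[OF f v] using pos by (simp add: abs_mult)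
  with dnorm_upper[OF f w] pos show ?thesis by (simp add: divide_le_eq)
qed

lemma dnorm_plus:
  assumes "vlin f" "vlin g" shows "dnorm V (\<lambda>v. f v + g v) \<le> dnorm V f + dnorm V g"
proof (rule dnorm_le)
  show "0 \<le> dnorm V f + dnorm V g" using dnorm_nonneg assms by (intro add_nonneg_nonneg)
  fix v assume v: "v \<in> CV"
  show "\<bar>f v + g v\<bar> \<le> (dnorm V f + dnorm V g) * nV v"
    using dnorm_bound[OF assms(1) v] dnorm_bound[OF assms(2) v] unfolding distrib_right by linarith
qed

lemma vdual_eqI:
  assumes "f \<in> vdual V" "g \<in> vdual V" "\<And>v. v \<in> CV \<Longrightarrow> f v = g v"
  shows "f = g"
proof
  show "f v = g v" for v
    using assms by (cases "v \<in> CV") (simp_all add: vdual_iff)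
qed

subsection \<open>Elementary properties of vector measures\<close>

lemma lvm_dual: "local_vector_measure V N \<Longrightarrow> A \<in> sets borel \<Longrightarrow> N A \<in> vdual V"
  unfolding local_vector_measure_def by blast

lemma lvm_vlin: "local_vector_measure V N \<Longrightarrow> A \<in> sets borel \<Longrightarrow> vlin (N A)"
  by (rule vdual_vlin[OF lvm_dual])

lemma lvm_not_borel: "local_vector_measure V N \<Longrightarrow> A \<notin> sets borel \<Longrightarrow> N A = (\<lambda>_. 0)"
  unfolding local_vector_measure_def by blast

lemma lvm_sigma: "local_vector_measure V N \<Longrightarrow> range A \<subseteq> sets borel \<Longrightarrow> disjoint_family (A :: nat \<Rightarrow> 'x set)
    \<Longrightarrow> (\<lambda>n. dnorm V (\<lambda>v. (\<Sum>i<n. N (A i) v) - N (\<Union>i. A i) v)) \<longlonglongrightarrow> 0"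
  unfolding local_vector_measure_def by blast

lemma lvm_local: "local_vector_measure V N \<Longrightarrow> v \<in> CV \<Longrightarrow> open A \<Longrightarrow> vnorm_on V A v = 0 \<Longrightarrow> N A v = 0"
  unfolding local_vector_measure_def by blast

lemma lvm_notin: "local_vector_measure V N \<Longrightarrow> v \<notin> CV \<Longrightarrow> N A v = 0"
  by (cases "A \<in> sets borel") (auto dest: lvm_dual lvm_not_borel simp: vdual_iff)

lemma lvm_sums:
  assumes N: "local_vector_measure V N" and A: "range A \<subseteq> sets borel" "disjoint_family (A :: nat \<Rightarrow> 'x set)" and v: "v \<in> CV"
  shows "(\<lambda>i. N (A i) v) sums N (\<Union>i. A i) v"
proof -
  have A': "A i \<in> sets borel" for i using A(1) by blast
  have U: "(\<Union>i. A i) \<in> sets borel" using A' by (intro sets.countable_UN) auto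
  have lin: "vlin (\<lambda>v. (\<Sum>i<n. N (A i) v) - N (\<Union>i. A i) v)" for n
    by (intro vlin_minus vlin_sum lvm_vlin[OF N] A' U) simp
  have "(\<lambda>n. dnorm V (\<lambda>v. (\<Sum>i<n. N (A i) v) - N (\<Union>i. A i) v) * nV v) \<longlonglongrightarrow> 0 * nV v"
    by (intro tendsto_mult tendsto_const lvm_sigma[OF N A])
  then have "(\<lambda>n. dnorm V (\<lambda>v. (\<Sum>i<n. N (A i) v) - N (\<Union>i. A i) v) * nV v) \<longlonglongrightarrow> 0" by simp
  moreover have "norm ((\<Sum>i<n. N (A i) v) - N (\<Union>i. A i) v) \<le> dnorm V (\<lambda>v. (\<Sum>i<n. N (A i) v) - N (\<Union>i. A i) v) * nV v" for n
    using dnorm_bound[OF lin v] by simp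
  ultimately have "(\<lambda>n. (\<Sum>i<n. N (A i) v) - N (\<Union>i. A i) v) \<longlonglongrightarrow> 0"
    by (rule Lim_null_comparison[rotated, OF _ always_eventually, OF _ allI])
  then show ?thesis by (simp add: sums_def LIM_zero_iff)
qed

text \<open>The constant series with terms N {} v converges, so its terms tend to 0.\<close>

lemma lvm_empty:
  assumes N: "local_vector_measure V N" and v: "v \<in> CV" shows "N {} v = 0"
proof -
  have "(\<lambda>i::nat. N {} v) sums N (\<Union>i::nat. {}) v" by (rule lvm_sums[OF N _ _ v]) (auto simp: disjoint_family_on_def)
  then have "(\<lambda>i::nat. N {} v) \<longlonglongrightarrow> 0" by (intro summable_LIMSEQ_zero) (auto simp: sums_iff)
  then show ?thesis by (simp add: LIMSEQ_const_iff)
qed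

lemma lvm_Un:
  assumes N: "local_vector_measure V N" and v: "v \<in> CV" and A: "A \<in> sets borel" and B: "B \<in> sets borel" and "A \<inter> B = {}"
  shows "N (A \<union> B) v = N A v + N B v"
proof -
  define C where "C i = (if i = 0 then A else if i = 1 then B else {})" for i :: nat
  have U: "(\<Union>i. C i) = A \<union> B"
  proof
    show "A \<union> B \<subseteq> (\<Union>i. C i)" using UN_upper[of 0 UNIV C] UN_upper[of 1 UNIV C] by (simp add: C_def)
  qed (auto simp: C_def split: if_splits)
  have "(\<lambda>i. N (C i) v) sums N (\<Union>i. C i) v"
    by (rule lvm_sums[OF N _ _ v]) (use A B assms(5) in \<open>auto simp: C_def disjoint_family_on_def split: if_splits\<close>)
  moreover have "(\<lambda>i. N (C i) v) sums (\<Sum>i\<in>{0, 1}. N (C i) v)"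
    by (rule sums_finite) (auto simp: C_def lvm_empty[OF N v])
  ultimately have "N (\<Union>i. C i) v = (\<Sum>i\<in>{0, 1}. N (C i) v)" by (rule sums_unique2)
  then show ?thesis unfolding U by (simp add: C_def)
qed

lemma lvm_UN:
  assumes N: "local_vector_measure V N" and v: "v \<in> CV" and "finite I" "\<And>i. i \<in> I \<Longrightarrow> A i \<in> sets borel" "disjoint_family_on A I"
  shows "N (\<Union>i\<in>I. A i) v = (\<Sum>i\<in>I. N (A i) v)"
  using assms(3-5)
proof (induction I rule: finite_induct)
  case (insert i I)
  have "A i \<inter> (\<Union>i\<in>I. A i) = {}" using insert.hyps insert.prems(2) by (auto simp: disjoint_family_on_def)
  moreover have "disjoint_family_on A I" using insert.prems(2) by (auto simp: disjoint_family_on_def)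
  moreover have "(\<Union>i\<in>I. A i) \<in> sets borel" using insert.prems(1) insert.hyps by (intro sets.finite_UN) auto
  ultimately show ?case using insert lvm_Un[OF N v, of "A i" "\<Union>i\<in>I. A i"] by simp
qed (simp add: lvm_empty[OF N v])

lemma vnorm_on_bdd: "v \<in> CV \<Longrightarrow> bdd_above {nV (f \<odot> v) | f. supp f \<subseteq> A \<and> norm f \<le> 1}"
proof (rule bdd_aboveI)
  fix r assume v: "v \<in> CV" and "r \<in> {nV (f \<odot> v) | f. supp f \<subseteq> A \<and> norm f \<le> 1}"
  then obtain f where f: "r = nV (f \<odot> v)" "norm f \<le> 1" by blast
  have "nV (f \<odot> v) \<le> norm f * nV v" by (rule nV_smult[OF v])
  also have "\<dots> \<le> 1 * nV v" using f(2) nV_nonneg[OF v] by (rule mult_right_mono)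
  finally show "r \<le> nV v" using f(1) by simp
qed

lemma vnorm_on_0D:
  assumes v: "v \<in> CV" and "vnorm_on V A v = 0" "supp f \<subseteq> A" "norm f \<le> 1"
  shows "f \<odot> v = \<zero>"
proof -
  have "nV (f \<odot> v) \<le> vnorm_on V A v"
    unfolding vnorm_on_def using assms(3,4) by (intro cSup_upper vnorm_on_bdd v) blast
  then show ?thesis using assms(2) nV_nonneg[OF smult_CV[OF v], of f] nV_eq_0[OF smult_CV[OF v], of f] by simp
qed

lemma supp_0: "supp (0 :: 'x \<Rightarrow>\<^sub>C real) = {}"
  by (simp add: supp_def zero_bcontfun.rep_eq)

lemma vnorm_on_0I:
  assumes v: "v \<in> CV" and "\<And>f. supp f \<subseteq> A \<Longrightarrow> norm f \<le> 1 \<Longrightarrow> f \<odot> v = \<zero>"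
  shows "vnorm_on V A v = 0"
proof -
  have "{nV (f \<odot> v) | f. supp f \<subseteq> A \<and> norm f \<le> 1} = {0}"
  proof (intro equalityI subsetI)
    fix r assume "r \<in> {nV (f \<odot> v) | f. supp f \<subseteq> A \<and> norm f \<le> 1}"
    then show "r \<in> {0}" using assms(2) by auto
  next
    fix r :: real assume "r \<in> {0}"
    then have "r = nV (0 \<odot> v)" by (simp add: zero_smult[OF v])
    moreover have "supp (0 :: 'x \<Rightarrow>\<^sub>C real) \<subseteq> A \<and> norm (0 :: 'x \<Rightarrow>\<^sub>C real) \<le> 1" by (simp add: supp_0)
    ultimately show "r \<in> {nV (f \<odot> v) | f. supp f \<subseteq> A \<and> norm f \<le> 1}" by blast
  qed
  then show ?thesis by (simp add: vnorm_on_def)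
qed

text \<open>Locality is postulated for open sets only. Open sets are stable under intersection and
  generate the Borel sets, and sets whose trace on U has value 0 at v form a Dynkin class.\<close>

lemma lvm_local_borel:
  assumes N: "local_vector_measure V N" and v: "v \<in> CV" and U: "open U" "vnorm_on V U v = 0"
    and B: "B \<in> sets borel" "B \<subseteq> U"
  shows "N B v = 0"
proof -
  have Ub: "U \<in> sets borel" using U(1) by simp
  have op: "N (G \<inter> U) v = 0" if "open G" for G
  proof (rule lvm_local[OF N v])
    show "vnorm_on V (G \<inter> U) v = 0" by (rule vnorm_on_0I[OF v]) (rule vnorm_on_0D[OF v U(2)], auto)
  qed (use that U in auto)
  have Bs: "B \<in> sigma_sets UNIV {S :: 'x set. open S}" using B(1) unfolding borel_def by simp
  have "N (B \<inter> U) v = 0"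
  proof (rule sigma_sets_induct_disjoint[OF _ _ Bs, where P = "\<lambda>B. N (B \<inter> U) v = 0"])
    show "Int_stable {S :: 'x set. open S}" by (auto simp: Int_stable_def)
    show "N (A \<inter> U) v = 0" if "A \<in> {S. open S}" for A using op that by simp
    show "N ({} \<inter> U) v = 0" using lvm_empty[OF N v] by simp
    show "N ((UNIV - A) \<inter> U) v = 0" if A: "A \<in> sigma_sets UNIV {S. open S}" "N (A \<inter> U) v = 0" for A
    proof -
      have Ab: "A \<in> sets borel" using A(1) unfolding borel_def by simp
      have eq: "(A \<inter> U) \<union> ((UNIV - A) \<inter> U) = UNIV \<inter> U" by blast
      have "N ((A \<inter> U) \<union> ((UNIV - A) \<inter> U)) v = N (A \<inter> U) v + N ((UNIV - A) \<inter> U) v"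
        by (rule lvm_Un[OF N v]) (use Ab Ub in auto)
      then show ?thesis unfolding eq using A(2) op[of UNIV] by simp
    qed
    show "N ((\<Union>i. A i) \<inter> U) v = 0" if A: "disjoint_family A" "range A \<subseteq> sigma_sets UNIV {S. open S}" "\<And>i. N (A i \<inter> U) v = 0"
      for A :: "nat \<Rightarrow> 'x set"
    proof -
      have Ab: "A i \<in> sets borel" for i using A(2) unfolding borel_def by auto
      have "(\<lambda>i. N (A i \<inter> U) v) sums N (\<Union>i. A i \<inter> U) v"
        by (rule lvm_sums[OF N _ _ v]) (use Ab Ub A(1) in \<open>auto simp: disjoint_family_on_def\<close>)
      then have "(\<lambda>i. 0) sums N (\<Union>i. A i \<inter> U) v" unfolding A(3) .
      then have 0: "N (\<Union>i. A i \<inter> U) v = 0" by (rule sums_unique2[OF _ sums_zero])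
      have eq: "(\<Union>i. A i) \<inter> U = (\<Union>i. A i \<inter> U)" by blast
      show ?thesis unfolding eq by (rule 0)
    qed
  qed simp
  then show ?thesis using B(2) by (simp add: Int_absorb2)
qed

lemma lvm_add:
  assumes N: "local_vector_measure V N" and M: "local_vector_measure V M"
  shows "local_vector_measure V (\<lambda>A v. N A v + M A v)"
  unfolding local_vector_measure_def
proof (intro conjI ballI allI impI)
  fix A :: "'x set"
  show "(\<lambda>v. N A v + M A v) \<in> vdual V" if "A \<in> sets borel"
    unfolding vdual_iff using vlin_plus[OF lvm_vlin[OF N that] lvm_vlin[OF M that]] lvm_notin[OF N] lvm_notin[OF M] by simp
  show "(\<lambda>v. N A v + M A v) = (\<lambda>_. 0)" if "A \<notin> sets borel"
    using lvm_not_borel[OF N that] lvm_not_borel[OF M that] by simp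
next
  fix A :: "nat \<Rightarrow> 'x set" assume A: "range A \<subseteq> sets borel \<and> disjoint_family A"
  have A': "A i \<in> sets borel" for i using A by blast
  have U: "(\<Union>i. A i) \<in> sets borel" using A' by (intro sets.countable_UN) auto
  define f where "f K n v = (\<Sum>i<n. K (A i) v) - K (\<Union>i. A i) v" for K :: "'x set \<Rightarrow> 'v \<Rightarrow> real" and n v
  have lin: "vlin (f K n)" if "local_vector_measure V K" for K n
    unfolding f_def by (intro vlin_minus vlin_sum lvm_vlin[OF that] A' U) simp
  have eq: "f (\<lambda>A v. N A v + M A v) n = (\<lambda>v. f N n v + f M n v)" for n
    by (simp add: f_def fun_eq_iff sum.distrib)
  have "(\<lambda>n. dnorm V (f (\<lambda>A v. N A v + M A v) n)) \<longlonglongrightarrow> 0"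
  proof (rule tendsto_sandwich[OF always_eventually always_eventually tendsto_const])
    show "\<forall>n. 0 \<le> dnorm V (f (\<lambda>A v. N A v + M A v) n)"
      unfolding eq using dnorm_nonneg[OF vlin_plus[OF lin[OF N] lin[OF M]]] by blast
    show "\<forall>n. dnorm V (f (\<lambda>A v. N A v + M A v) n) \<le> dnorm V (f N n) + dnorm V (f M n)"
      unfolding eq using dnorm_plus[OF lin[OF N] lin[OF M]] by blast
    have "(\<lambda>n. dnorm V (f N n) + dnorm V (f M n)) \<longlonglongrightarrow> 0 + 0"
      unfolding f_def using A by (intro tendsto_add lvm_sigma N M) auto
    then show "(\<lambda>n. dnorm V (f N n) + dnorm V (f M n)) \<longlonglongrightarrow> 0" by simp
  qed
  then show "(\<lambda>n. dnorm V (\<lambda>v. (\<Sum>i<n. N (A i) v + M (A i) v) - (N (\<Union>i. A i) v + M (\<Union>i. A i) v))) \<longlonglongrightarrow> 0"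
    unfolding f_def[abs_def] .
next
  fix A v assume "v \<in> CV" "open A \<and> vnorm_on V A v = 0"
  then show "N A v + M A v = 0" using lvm_local[OF N, of v A] lvm_local[OF M, of v A] by simp
qed

text \<open>An unbounded range would split off infinitely many disjoint sets of norm at least one.\<close>

lemma lvm_bounded_range:
  assumes N: "local_vector_measure V N"
  obtains K where "0 \<le> K" "\<And>A. A \<in> sets borel \<Longrightarrow> dnorm V (N A) \<le> K"
proof -
  define bd where "bd A \<longleftrightarrow> (\<exists>K. \<forall>B\<in>sets borel. B \<subseteq> A \<longrightarrow> dnorm V (N B) \<le> K)" for A
  have sub_add: "dnorm V (N (A \<union> B)) \<le> dnorm V (N A) + dnorm V (N B)" if "A \<in> sets borel" "B \<in> sets borel" "A \<inter> B = {}" for A B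
  proof -
    have "N (A \<union> B) = (\<lambda>v. N A v + N B v)"
    proof
      fix v show "N (A \<union> B) v = N A v + N B v"
        by (cases "v \<in> CV") (simp_all add: lvm_Un[OF N _ that] lvm_notin[OF N])
    qed
    then show ?thesis using dnorm_plus[OF lvm_vlin[OF N that(1)] lvm_vlin[OF N that(2)]] by simp
  qed
  have "bd UNIV"
  proof (rule ccontr)
    assume nb: "\<not> bd UNIV"
    \<comment> \<open>A subset B whose value exceeds that of A by more than 1 forces norm at least 1
      on both B and its complement in A. One of the two has unbounded range and is kept; the other
      is split off.\<close>
    have step: "\<exists>A'. (A' \<in> sets borel \<and> \<not> bd A') \<and> A' \<subseteq> A \<and> 1 \<le> dnorm V (N (A - A'))" if A: "A \<in> sets borel" "\<not> bd A" for A
    proof -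
      obtain B where B: "B \<in> sets borel" "B \<subseteq> A" "1 + dnorm V (N A) < dnorm V (N B)"
        using A(2) unfolding bd_def by (auto simp: not_le)
      have AB: "A - B \<in> sets borel" using A B by auto
      have nA: "0 \<le> dnorm V (N A)" by (rule dnorm_nonneg[OF lvm_vlin[OF N A(1)]])
      have "N B = (\<lambda>v. 1 * N A v + (- 1) * N (A - B) v)"
      proof
        fix v
        have "N A v = N B v + N (A - B) v"
        proof (cases "v \<in> CV")
          case True
          have "B \<union> (A - B) = A" using B(2) by blast
          then show ?thesis using lvm_Un[OF N True B(1) AB] by auto
        qed (simp add: lvm_notin[OF N])
        then show "N B v = 1 * N A v + (- 1) * N (A - B) v" by simp
      qed
      then have "dnorm V (N B) \<le> dnorm V (N A) + dnorm V (\<lambda>v. - 1 * N (A - B) v)"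
        using dnorm_plus[OF lvm_vlin[OF N A(1)] vlin_cmult[OF lvm_vlin[OF N AB], of "- 1"]] by simp
      also have "dnorm V (\<lambda>v. - 1 * N (A - B) v) = dnorm V (N (A - B))" by (simp add: dnorm_def)
      finally have 1: "1 \<le> dnorm V (N (A - B))" using B(3) by simp
      show ?thesis
      proof (cases "bd B")
        case False
        then show ?thesis using B 1 by (intro exI[of _ B]) simp
      next
        case True
        have "\<not> bd (A - B)"
        proof
          assume "bd (A - B)"
          then obtain K2 where K2: "\<forall>C\<in>sets borel. C \<subseteq> A - B \<longrightarrow> dnorm V (N C) \<le> K2" unfolding bd_def by blast
          obtain K1 where K1: "\<forall>C\<in>sets borel. C \<subseteq> B \<longrightarrow> dnorm V (N C) \<le> K1" using True unfolding bd_def by blast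
          have "dnorm V (N C) \<le> K1 + K2" if C: "C \<in> sets borel" "C \<subseteq> A" for C
          proof -
            have m: "C \<inter> B \<in> sets borel" "C - B \<in> sets borel" using C(1) B(1) by auto
            have s: "C \<inter> B \<subseteq> B" "C - B \<subseteq> A - B" using C(2) by blast+
            have "(C \<inter> B) \<union> (C - B) = C" "(C \<inter> B) \<inter> (C - B) = {}" by blast+
            then have "dnorm V (N C) \<le> dnorm V (N (C \<inter> B)) + dnorm V (N (C - B))"
              using sub_add[OF m] by simp
            moreover have "dnorm V (N (C \<inter> B)) \<le> K1" using K1 m(1) s(1) by blast
            moreover have "dnorm V (N (C - B)) \<le> K2" using K2 m(2) s(2) by blast
            ultimately show ?thesis by linarith
          qed
          then show False using A(2) unfolding bd_def by blast
        qed
        moreover have eq: "A - (A - B) = B" using B(2) by blast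
        have "1 \<le> dnorm V (N (A - (A - B)))" unfolding eq using B(3) nA by linarith
        ultimately show ?thesis by (intro exI[of _ "A - B"] conjI AB Diff_subset)
      qed
    qed
    have "\<exists>A. \<forall>n::nat. (A n \<in> sets borel \<and> \<not> bd (A n)) \<and> (A (Suc n) \<subseteq> A n \<and> 1 \<le> dnorm V (N (A n - A (Suc n))))"
    proof (rule dependent_nat_choice)
      show "\<exists>A. A \<in> sets borel \<and> \<not> bd A" using nb by (intro exI[of _ UNIV]) simp
    qed (use step in blast)
    then obtain A :: "nat \<Rightarrow> 'x set" where A: "\<forall>n. (A n \<in> sets borel \<and> \<not> bd (A n)) \<and> (A (Suc n) \<subseteq> A n \<and> 1 \<le> dnorm V (N (A n - A (Suc n))))" ..
    define E where "E n = A n - A (Suc n)" for n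
    have E: "E n \<in> sets borel" for n
      unfolding E_def using A[rule_format, of n] A[rule_format, of "Suc n"] by (intro sets.Diff) simp_all
    have dec: "A j \<subseteq> A i" if "i \<le> j" for i j by (rule lift_Suc_antimono_le[OF _ that]) (use A in blast)
    have disj: "disjoint_family E"
      unfolding disjoint_family_on_def
    proof (intro ballI impI)
      have "E i \<inter> E j = {}" if "i < j" for i j using dec[of "Suc i" j] that by (auto simp: E_def)
      then show "E i \<inter> E j = {}" if "i \<noteq> j" for i j using that by (metis Int_commute nat_neq_iff)
    qed
    define f where "f n v = (\<Sum>i<n. N (E i) v) - N (\<Union>i. E i) v" for n v
    have U: "(\<Union>i. E i) \<in> sets borel" using E by (intro sets.countable_UN) auto
    have lin: "vlin (f n)" for n unfolding f_def by (intro vlin_minus vlin_sum lvm_vlin[OF N] E U) simp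
    have lim: "(\<lambda>n. dnorm V (f n)) \<longlonglongrightarrow> 0" unfolding f_def by (rule lvm_sigma[OF N _ disj]) (use E in blast)
    \<comment> \<open>The value on \<open>E n\<close> is the difference of two consecutive
      remainders of the series, which tend to 0 in norm.\<close>
    have "1 \<le> dnorm V (f (Suc n)) + dnorm V (f n)" for n
    proof -
      have "N (E n) = (\<lambda>v. f (Suc n) v + (- 1) * f n v)" by (simp add: f_def fun_eq_iff)
      then have "dnorm V (N (E n)) \<le> dnorm V (f (Suc n)) + dnorm V (\<lambda>v. - 1 * f n v)"
        using dnorm_plus[OF lin vlin_cmult[OF lin], of "Suc n" "- 1" n] by simp
      also have "dnorm V (\<lambda>v. - 1 * f n v) = dnorm V (f n)" by (simp add: dnorm_def)
      finally show ?thesis using A by (simp add: E_def) (meson order_trans)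
    qed
    moreover have "(\<lambda>n. dnorm V (f (Suc n)) + dnorm V (f n)) \<longlonglongrightarrow> 0 + 0"
      by (intro tendsto_add lim LIMSEQ_Suc)
    ultimately have "1 \<le> (0 + 0 :: real)" by (intro LIMSEQ_le_const) blast+
    then show False by simp
  qed
  then obtain K where K: "\<forall>B\<in>sets borel. B \<subseteq> UNIV \<longrightarrow> dnorm V (N B) \<le> K" unfolding bd_def by blast
  show ?thesis
  proof (rule that[of "\<bar>K\<bar>"])
    show "dnorm V (N A) \<le> \<bar>K\<bar>" if "A \<in> sets borel" for A using K that by fastforce
  qed simp
qed

end

lemma half_cancel: "0 < y \<Longrightarrow> x / (2 * y) * y = x / 2" for x y :: real
  by simp

lemma simple_function_approx:
  fixes g :: "'a::topological_space \<Rightarrow> real"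
  assumes g: "g \<in> borel_measurable borel" and C: "\<And>x. \<bar>g x\<bar> \<le> C" and "e > 0"
  obtains s where "simple_function borel s" "\<And>x. \<bar>s x - g x\<bar> \<le> e"
proof -
  obtain J :: "int set" and B c where B: "finite J" "\<And>j. B j \<in> sets borel" "disjoint_family_on B J"
      "(\<Union>j\<in>J. B j) = UNIV" "\<And>j x. x \<in> B j \<Longrightarrow> \<bar>g x - c j\<bar> \<le> e"
    by (rule finite_level_sets[OF g C \<open>e > 0\<close>]) (rule that)
  define s where "s x = (\<Sum>j\<in>J. c j * indicat_real (B j) x)" for x
  have "simple_function borel s"
    unfolding s_def[abs_def] using B(2)
    by (intro simple_function_sum simple_function_mult simple_function_const simple_function_indicator) auto
  moreover have "\<bar>s x - g x\<bar> \<le> e" for x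
    using simple_approx[OF B(1,3,4,5), where x = x] unfolding s_def by (simp add: abs_minus_commute)
  ultimately show ?thesis by (rule that)
qed

context cb_module
begin

section \<open>The Bartle integral\<close>

lemma simple_function_level: "simple_function borel s \<Longrightarrow> s -` {c} \<in> sets borel" for s :: "'x \<Rightarrow> real"
  using simple_functionD(2)[of borel s "{c}"] by simp

lemma simple_function_range: "simple_function borel s \<Longrightarrow> finite (range s)" for s :: "'x \<Rightarrow> real"
  using simple_functionD(1)[of borel s] by simp

text \<open>The integral does not depend on the sets carrying the values: refine the levels of s by
  the sets B j. This permits two simple functions to be compared on a common refinement.\<close>

lemma simple_bartle_family:
  assumes N: "local_vector_measure V N" and v: "v \<in> CV" and A: "A \<in> sets borel" and s: "simple_function borel s"
    and J: "finite J" and B: "\<And>j. j \<in> J \<Longrightarrow> B j \<in> sets borel" and disj: "disjoint_family_on B J"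
    and cover: "(\<Union>j\<in>J. B j) = UNIV" and val: "\<And>j x. j \<in> J \<Longrightarrow> x \<in> B j \<Longrightarrow> s x = c j"
  shows "simple_bartle N s A v = (\<Sum>j\<in>J. c j * N (A \<inter> B j) v)"
proof -
  have fin: "finite (range s)" by (rule simple_function_range[OF s])
  have "simple_bartle N s A v = (\<Sum>r\<in>range s. r * (\<Sum>j\<in>J. N (A \<inter> s -` {r} \<inter> B j) v))"
    unfolding simple_bartle_def
  proof (rule sum.cong[OF refl])
    fix r
    have "N (\<Union>j\<in>J. A \<inter> s -` {r} \<inter> B j) v = (\<Sum>j\<in>J. N (A \<inter> s -` {r} \<inter> B j) v)"
    proof (rule lvm_UN[OF N v J])
      show "A \<inter> s -` {r} \<inter> B j \<in> sets borel" if "j \<in> J" for j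
        by (intro sets.Int A B simple_function_level s that)
      show "disjoint_family_on (\<lambda>j. A \<inter> s -` {r} \<inter> B j) J" using disj by (auto simp: disjoint_family_on_def)
    qed
    moreover have "(\<Union>j\<in>J. A \<inter> s -` {r} \<inter> B j) = A \<inter> s -` {r} \<inter> (\<Union>j\<in>J. B j)" by blast
    ultimately show "r * N (A \<inter> s -` {r}) v = r * (\<Sum>j\<in>J. N (A \<inter> s -` {r} \<inter> B j) v)" unfolding cover by simp
  qed
  also have "\<dots> = (\<Sum>j\<in>J. \<Sum>r\<in>range s. r * N (A \<inter> s -` {r} \<inter> B j) v)"
    unfolding sum_distrib_left by (rule sum.swap)
  also have "\<dots> = (\<Sum>j\<in>J. c j * N (A \<inter> B j) v)"
  proof (rule sum.cong[OF refl])
    fix j assume j: "j \<in> J"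
    have eq: "A \<inter> s -` {r} \<inter> B j = (if r = c j then A \<inter> B j else {})" for r
      using val[OF j] by auto
    have summand: "r * N (A \<inter> s -` {r} \<inter> B j) v = (if r = c j then c j * N (A \<inter> B j) v else 0)" for r
      unfolding eq by (simp add: lvm_empty[OF N v])
    have "(\<Sum>r\<in>range s. r * N (A \<inter> s -` {r} \<inter> B j) v) = (if c j \<in> range s then c j * N (A \<inter> B j) v else 0)"
      unfolding summand by (rule sum.delta[OF fin])
    also have "\<dots> = c j * N (A \<inter> B j) v"
    proof (cases "B j = {}")
      case True
      then show ?thesis using lvm_empty[OF N v] by simp
    next
      case False
      then obtain x where "x \<in> B j" by blast
      then have "c j \<in> range s" using val[OF j] by (metis rangeI)
      then show ?thesis by simp
    qed
    finally show "(\<Sum>r\<in>range s. r * N (A \<inter> s -` {r} \<inter> B j) v) = c j * N (A \<inter> B j) v" .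
  qed
  finally show ?thesis .
qed

text \<open>A semivariation estimate. Coefficients are bounded only on nonempty sets, since in a
  common refinement two levels that never meet may have distant values.\<close>

lemma lvm_sum_bound:
  assumes N: "local_vector_measure V N" and K: "\<And>A. A \<in> sets borel \<Longrightarrow> dnorm V (N A) \<le> K" and "0 \<le> K"
    and v: "v \<in> CV" and J: "finite J" and E: "\<And>j. j \<in> J \<Longrightarrow> E j \<in> sets borel" and disj: "disjoint_family_on E J"
    and a: "\<And>j. j \<in> J \<Longrightarrow> E j \<noteq> {} \<Longrightarrow> \<bar>a j\<bar> \<le> e" and "0 \<le> e"
  shows "\<bar>\<Sum>j\<in>J. a j * N (E j) v\<bar> \<le> e * (2 * K * nV v)"
proof -
  have NK: "\<bar>N A v\<bar> \<le> K * nV v" if "A \<in> sets borel" for A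
  proof -
    have "\<bar>N A v\<bar> \<le> dnorm V (N A) * nV v" by (rule dnorm_bound[OF lvm_vlin[OF N that] v])
    also have "\<dots> \<le> K * nV v" using K[OF that] nV_nonneg[OF v] by (rule mult_right_mono)
    finally show ?thesis .
  qed
  have part: "\<bar>\<Sum>j\<in>I. N (E j) v\<bar> \<le> K * nV v" if "I \<subseteq> J" for I
  proof -
    have I: "finite I" "disjoint_family_on E I"
      using finite_subset[OF that J] disjoint_family_on_mono[OF that disj] .
    have Eb: "E j \<in> sets borel" if "j \<in> I" for j using E \<open>I \<subseteq> J\<close> that by blast
    have "(\<Sum>j\<in>I. N (E j) v) = N (\<Union>j\<in>I. E j) v" by (rule lvm_UN[OF N v I(1) Eb I(2), symmetric])
    moreover have "(\<Union>j\<in>I. E j) \<in> sets borel" using I(1) Eb by (rule sets.finite_UN)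
    ultimately show ?thesis using NK by simp
  qed
  \<comment> \<open>The factor 2: the terms of each sign add up to the value of N on one union, and
    each of these two values is at most K times the norm of v.\<close>
  define P where "P = {j \<in> J. 0 \<le> N (E j) v}"
  have "(\<Sum>j\<in>J. \<bar>N (E j) v\<bar>) = (\<Sum>j\<in>P. \<bar>N (E j) v\<bar>) + (\<Sum>j\<in>J - P. \<bar>N (E j) v\<bar>)"
    using J by (subst add.commute) (rule sum.subset_diff, auto simp: P_def)
  also have "(\<Sum>j\<in>P. \<bar>N (E j) v\<bar>) = (\<Sum>j\<in>P. N (E j) v)" by (rule sum.cong) (auto simp: P_def)
  also have "(\<Sum>j\<in>J - P. \<bar>N (E j) v\<bar>) = - (\<Sum>j\<in>J - P. N (E j) v)"
    unfolding sum_negf[symmetric] by (rule sum.cong) (auto simp: P_def)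
  finally have S: "(\<Sum>j\<in>J. \<bar>N (E j) v\<bar>) \<le> 2 * K * nV v"
    using part[of P] part[of "J - P"] by (auto simp: P_def abs_le_iff)
  have "\<bar>\<Sum>j\<in>J. a j * N (E j) v\<bar> \<le> (\<Sum>j\<in>J. \<bar>a j * N (E j) v\<bar>)" by (rule sum_abs)
  also have "\<dots> \<le> (\<Sum>j\<in>J. e * \<bar>N (E j) v\<bar>)"
  proof (rule sum_mono)
    fix j assume j: "j \<in> J"
    show "\<bar>a j * N (E j) v\<bar> \<le> e * \<bar>N (E j) v\<bar>"
    proof (cases "E j = {}")
      case True
      then show ?thesis by (simp add: lvm_empty[OF N v])
    next
      case False
      then show ?thesis unfolding abs_mult using a[OF j] by (intro mult_right_mono) auto
    qed
  qed
  also have "\<dots> = e * (\<Sum>j\<in>J. \<bar>N (E j) v\<bar>)" by (rule sum_distrib_left[symmetric])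
  also have "\<dots> \<le> e * (2 * K * nV v)" using S \<open>0 \<le> e\<close> by (rule mult_left_mono)
  finally show ?thesis .
qed

lemma simple_bartle_diff:
  assumes N: "local_vector_measure V N" and K: "\<And>A. A \<in> sets borel \<Longrightarrow> dnorm V (N A) \<le> K" "0 \<le> K"
    and v: "v \<in> CV" and A: "A \<in> sets borel" and s: "simple_function borel s" and t: "simple_function borel t"
    and e: "\<And>x. \<bar>s x - t x\<bar> \<le> r" "0 \<le> r"
  shows "\<bar>simple_bartle N s A v - simple_bartle N t A v\<bar> \<le> r * (2 * K * nV v)"
proof -
  define J where "J = range s \<times> range t"
  define B where "B p = s -` {fst p} \<inter> t -` {snd p}" for p
  have J: "finite J" unfolding J_def by (intro finite_cartesian_product simple_function_range s t)
  have B: "B p \<in> sets borel" for p unfolding B_def by (intro sets.Int simple_function_level s t)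
  have disj: "disjoint_family_on B J" by (auto simp: disjoint_family_on_def B_def)
  have cover: "(\<Union>p\<in>J. B p) = UNIV" by (auto simp: J_def B_def)
  have 1: "simple_bartle N s A v = (\<Sum>p\<in>J. fst p * N (A \<inter> B p) v)"
    by (rule simple_bartle_family[OF N v A s J B disj cover]) (simp add: B_def)
  have 2: "simple_bartle N t A v = (\<Sum>p\<in>J. snd p * N (A \<inter> B p) v)"
    by (rule simple_bartle_family[OF N v A t J B disj cover]) (simp add: B_def)
  have "simple_bartle N s A v - simple_bartle N t A v = (\<Sum>p\<in>J. (fst p - snd p) * N (A \<inter> B p) v)"
    unfolding 1 2 by (simp add: sum_subtractf left_diff_distrib)
  also have "\<bar>\<dots>\<bar> \<le> r * (2 * K * nV v)"
  proof (rule lvm_sum_bound[OF N K v J _ _ _ e(2)])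
    show "A \<inter> B p \<in> sets borel" for p by (intro sets.Int A B)
    show "disjoint_family_on (\<lambda>p. A \<inter> B p) J" using disj unfolding disjoint_family_on_def by blast
    show "\<bar>fst p - snd p\<bar> \<le> r" if "A \<inter> B p \<noteq> {}" for p
    proof -
      obtain x where "x \<in> B p" using \<open>A \<inter> B p \<noteq> {}\<close> by blast
      then show ?thesis using e(1)[of x] by (simp add: B_def)
    qed
  qed
  finally show ?thesis .
qed

lemma simple_bartle_dual:
  assumes N: "local_vector_measure V N" and A: "A \<in> sets borel" and s: "simple_function borel s"
  shows "simple_bartle N s A \<in> vdual V"
  unfolding vdual_iff
proof (intro conjI allI impI)
  show "vlin (simple_bartle N s A)"
    unfolding simple_bartle_def
    by (intro vlin_sum simple_function_range s vlin_cmult lvm_vlin[OF N] sets.Int A simple_function_level)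
  show "simple_bartle N s A v = 0" if "v \<notin> CV" for v
    unfolding simple_bartle_def by (simp add: lvm_notin[OF N that])
qed

text \<open>With r as a parameter, a Bartle integral is characterized by a single estimate, linear
  in r, over all simple functions at once.\<close>

definition near :: "('x \<Rightarrow> real) \<Rightarrow> ('x \<Rightarrow> real) \<Rightarrow> real \<Rightarrow> bool" where
  "near s g r \<longleftrightarrow> simple_function borel s \<and> 0 \<le> r \<and> (\<forall>x. \<bar>s x - g x\<bar> \<le> r)"

lemma near_exists:
  assumes g: "g \<in> borel_measurable borel" "\<And>x. \<bar>g x\<bar> \<le> C" and "0 < r"
  obtains s where "near s g r"
proof -
  obtain s where "simple_function borel s" "\<And>x. \<bar>s x - g x\<bar> \<le> r" by (rule simple_function_approx[OF assms]) (rule that)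
  then show ?thesis using \<open>0 < r\<close> by (intro that[of s]) (simp add: near_def)
qed

lemma near_sequence:
  assumes g: "g \<in> borel_measurable borel" "\<And>x. \<bar>g x\<bar> \<le> C"
  obtains t where "\<And>n::nat. near (t n) g (1 / Suc n)"
proof -
  have "\<exists>t. near t g (1 / Suc n)" for n :: nat by (rule near_exists[OF g, of "1 / Suc n"]) auto
  then have "\<forall>n::nat. \<exists>t. near t g (1 / Suc n)" ..
  from choice[OF this] show ?thesis using that by blast
qed

text \<open>The limit is taken along one sequence. Comparing an arbitrary simple function with its
  members and passing to the limit gives the estimate for all simple functions near g.\<close>

lemma bartle_exists:
  fixes g :: "'x \<Rightarrow> real"
  assumes N: "local_vector_measure V N" and K: "\<And>A. A \<in> sets borel \<Longrightarrow> dnorm V (N A) \<le> K" "0 \<le> K"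
    and A: "A \<in> sets borel" and g: "g \<in> borel_measurable borel" "\<And>x. \<bar>g x\<bar> \<le> C"
  obtains f where "f \<in> vdual V"
    "\<And>s r v. near s g r \<Longrightarrow> v \<in> CV \<Longrightarrow> \<bar>simple_bartle N s A v - f v\<bar> \<le> r * (2 * K * nV v)"
proof -
  obtain t where t: "\<And>n::nat. near (t n) g (1 / Suc n)" by (rule near_sequence[OF g]) (rule that)
  have ts: "simple_function borel (t n)" for n using t[of n] by (simp add: near_def)
  define D where "D v = 2 * K * nV v" for v
  have Dn: "0 \<le> D v" if "v \<in> CV" for v unfolding D_def using K(2) nV_nonneg[OF that] by simp
  have comp: "\<bar>simple_bartle N s A v - simple_bartle N (t n) A v\<bar> \<le> (r + 1 / Suc n) * D v"
    if s: "near s g r" and v: "v \<in> CV" for s r v n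
    unfolding D_def
  proof (rule simple_bartle_diff[OF N K v A _ ts])
    fix x
    have "\<bar>s x - g x\<bar> \<le> r" "\<bar>t n x - g x\<bar> \<le> 1 / real (Suc n)"
      using s t[of n] unfolding near_def by blast+
    then show "\<bar>s x - t n x\<bar> \<le> r + 1 / real (Suc n)" by linarith
  qed (use s in \<open>simp_all add: near_def\<close>)
  have "Cauchy (\<lambda>n. simple_bartle N (t n) A v)" if v: "v \<in> CV" for v
  proof (rule metric_CauchyI)
    fix e :: real assume "e > 0"
    have pos: "0 < D v + 1" using Dn[OF v] by simp
    then have "0 < e / (2 * (D v + 1))" using \<open>e > 0\<close> by simp
    then obtain M :: nat where M: "1 / Suc M < e / (2 * (D v + 1))" using nat_approx_posE by blast
    have small: "1 / real (Suc n) \<le> 1 / real (Suc M)" if "n \<ge> M" for n using that by (intro divide_left_mono) auto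
    have "dist (simple_bartle N (t i) A v) (simple_bartle N (t j) A v) < e" if ij: "i \<ge> M" "j \<ge> M" for i j
    proof -
      have "\<bar>simple_bartle N (t i) A v - simple_bartle N (t j) A v\<bar> \<le> (1 / Suc i + 1 / Suc j) * D v"
        by (rule comp[OF t v])
      also have "\<dots> \<le> (1 / Suc M + 1 / Suc M) * (D v + 1)"
        using small[OF ij(1)] small[OF ij(2)] Dn[OF v] by (intro mult_mono add_mono) auto
      also have "\<dots> < (e / (2 * (D v + 1)) + e / (2 * (D v + 1))) * (D v + 1)"
        using M pos by (intro mult_strict_right_mono add_strict_mono)
      also have "\<dots> = e"
        using half_cancel[OF pos, of e] distrib_right[of "e / (2 * (D v + 1))" "e / (2 * (D v + 1))" "D v + 1"] by linarith
      finally show ?thesis by (simp add: dist_real_def)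
    qed
    then show "\<exists>M. \<forall>i\<ge>M. \<forall>j\<ge>M. dist (simple_bartle N (t i) A v) (simple_bartle N (t j) A v) < e" by blast
  qed
  then have conv: "convergent (\<lambda>n. simple_bartle N (t n) A v)" if "v \<in> CV" for v
    using that by (intro Cauchy_convergent)
  define f where "f v = (if v \<in> CV then lim (\<lambda>n. simple_bartle N (t n) A v) else 0)" for v
  have lim: "(\<lambda>n. simple_bartle N (t n) A v) \<longlonglongrightarrow> f v" if "v \<in> CV" for v
    using conv[OF that] that by (simp add: f_def convergent_LIMSEQ_iff)
  have tl: "vlin (simple_bartle N (t n) A)" for n by (rule vdual_vlin[OF simple_bartle_dual[OF N A ts]])
  have est: "\<bar>simple_bartle N s A v - f v\<bar> \<le> r * D v" if s: "near s g r" and v: "v \<in> CV" for s r v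
  proof -
    have 1: "(\<lambda>n. (r + 1 / real (Suc n)) * D v) \<longlonglongrightarrow> (r + 0) * D v"
      by (intro tendsto_intros lim_1_over_n[THEN LIMSEQ_Suc])
    have 2: "(\<lambda>n. \<bar>simple_bartle N s A v - simple_bartle N (t n) A v\<bar>) \<longlonglongrightarrow> \<bar>simple_bartle N s A v - f v\<bar>"
      by (intro tendsto_intros lim[OF v])
    have "\<bar>simple_bartle N s A v - f v\<bar> \<le> (r + 0) * D v"
      by (rule LIMSEQ_le[OF 2 1]) (use comp[OF s v] in blast)
    then show ?thesis by simp
  qed
  have "vlin f"
  proof -
    obtain L where L: "\<forall>v\<in>CV. \<bar>simple_bartle N (t 0) A v\<bar> \<le> L * nV v" using tl[of 0] unfolding vlin_def by blast
    show ?thesis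
    proof (rule vlinI)
      fix v w assume v: "v \<in> CV" and w: "w \<in> CV"
      show "f (v \<oplus> w) = f v + f w"
        by (rule LIMSEQ_unique[OF lim[OF add_CV[OF v w]]])
          (use tendsto_add[OF lim[OF v] lim[OF w]] in \<open>simp add: vlin_add[OF tl v w]\<close>)
    next
      fix c v assume v: "v \<in> CV"
      show "f (vscale V c v) = c * f v"
        by (rule LIMSEQ_unique[OF lim[OF smult_CV[OF v]]])
          (use tendsto_mult[OF tendsto_const lim[OF v], of c] in \<open>simp add: vlin_scale[OF tl v]\<close>)
    next
      fix v assume v: "v \<in> CV"
      have "\<bar>simple_bartle N (t 0) A v - f v\<bar> \<le> 1 / real (Suc 0) * D v" by (rule est[OF t v])
      then show "\<bar>f v\<bar> \<le> (L + 2 * K) * nV v" using L v unfolding D_def by (auto simp: algebra_simps abs_le_iff dest!: bspec)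
    qed
  qed
  then have "f \<in> vdual V" by (simp add: vdual_iff f_def)
  then show ?thesis by (rule that) (use est in \<open>simp add: D_def\<close>)
qed

text \<open>The estimate gives convergence in the dual norm along every uniformly convergent
  sequence of simple functions, so \<phi> satisfies the description in \<open>bartle\<close>; it is
  the only candidate because at least one such sequence exists.\<close>

lemma bartle_eq:
  fixes g :: "'x \<Rightarrow> real"
  assumes N: "local_vector_measure V N" and A: "A \<in> sets borel" and g: "g \<in> borel_measurable borel" "\<And>x. \<bar>g x\<bar> \<le> C"
    and \<phi>: "\<phi> \<in> vdual V" and "0 \<le> K"
    and est: "\<And>s r v. near s g r \<Longrightarrow> v \<in> CV \<Longrightarrow> \<bar>simple_bartle N s A v - \<phi> v\<bar> \<le> r * (K * nV v)"
  shows "bartle V N g A = \<phi>"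
proof -
  define P where "P k \<longleftrightarrow> k \<in> vdual V \<and>
        (\<forall>s. (\<forall>n. simple_function borel (s n)) \<and> uniform_limit UNIV s g sequentially \<longrightarrow>
          (\<lambda>n. dnorm V (\<lambda>v. simple_bartle N (s n) A v - k v)) \<longlonglongrightarrow> 0)" for k
  have sbl: "vlin (simple_bartle N s A)" if "simple_function borel s" for s by (rule vdual_vlin[OF simple_bartle_dual[OF N A that]])
  have "(\<lambda>n. dnorm V (\<lambda>v. simple_bartle N (s n) A v - \<phi> v)) \<longlonglongrightarrow> 0"
    if s: "\<And>n. simple_function borel (s n)" "uniform_limit UNIV s g sequentially" for s
  proof (rule LIMSEQ_I)
    fix e :: real assume "e > 0"
    have pos: "0 < K + 1" using \<open>0 \<le> K\<close> by simp
    define r where "r = e / (2 * (K + 1))"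
    have r: "r > 0" using \<open>e > 0\<close> pos by (simp add: r_def)
    obtain M where M: "\<forall>n\<ge>M. \<forall>x\<in>UNIV. dist (s n x) (g x) < r"
      using s(2) r unfolding uniform_limit_sequentially_iff by blast
    have "norm (dnorm V (\<lambda>v. simple_bartle N (s n) A v - \<phi> v) - 0) < e" if "n \<ge> M" for n
    proof -
      have "near (s n) g r" using M that s(1) r by (auto simp: near_def dist_real_def less_imp_le)
      then have "dnorm V (\<lambda>v. simple_bartle N (s n) A v - \<phi> v) \<le> r * K"
        using r \<open>0 \<le> K\<close> est by (intro dnorm_le) (simp_all add: mult.assoc)
      also have "\<dots> \<le> r * (K + 1)" using r by (intro mult_left_mono) auto
      also have "\<dots> = e / 2" unfolding r_def by (rule half_cancel[OF pos])
      also have "\<dots> < e" using \<open>e > 0\<close> by simp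
      finally show ?thesis using dnorm_nonneg[OF vlin_minus[OF sbl[OF s(1)] vdual_vlin[OF \<phi>]]] by simp
    qed
    then show "\<exists>no. \<forall>n\<ge>no. norm (dnorm V (\<lambda>v. simple_bartle N (s n) A v - \<phi> v) - 0) < e" by blast
  qed
  then have P\<phi>: "P \<phi>" using \<phi> unfolding P_def by blast
  have uniq: "k = \<phi>" if "P k" for k
  proof (rule vdual_eqI[OF _ \<phi>])
    show k: "k \<in> vdual V" using that unfolding P_def by blast
    fix v assume v: "v \<in> CV"
    obtain t where t: "\<And>n::nat. near (t n) g (1 / Suc n)" by (rule near_sequence[OF g]) (rule that)
    have ts: "simple_function borel (t n)" for n using t[of n] by (simp add: near_def)
    have "uniform_limit UNIV t g sequentially"
      unfolding uniform_limit_sequentially_iff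
    proof (intro allI impI)
      fix e :: real assume "e > 0"
      then obtain M :: nat where M: "1 / Suc M < e" using nat_approx_posE by blast
      have "dist (t n x) (g x) < e" if "n \<ge> M" for n x
      proof -
        have "\<bar>t n x - g x\<bar> \<le> 1 / real (Suc n)" using t[of n] unfolding near_def by blast
        also have "\<dots> \<le> 1 / real (Suc M)" using that by (intro divide_left_mono) auto
        finally show ?thesis using M by (simp add: dist_real_def)
      qed
      then show "\<exists>M. \<forall>n\<ge>M. \<forall>x\<in>UNIV. dist (t n x) (g x) < e" by blast
    qed
    then have "(\<lambda>n. dnorm V (\<lambda>v. simple_bartle N (t n) A v - k v)) \<longlonglongrightarrow> 0"
      using that ts unfolding P_def by blast
    then have lim: "(\<lambda>n. dnorm V (\<lambda>v. simple_bartle N (t n) A v - k v) * nV v + 1 / Suc n * (K * nV v)) \<longlonglongrightarrow> 0 * nV v + 0 * (K * nV v)"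
      by (intro tendsto_add tendsto_mult tendsto_const lim_1_over_n[THEN LIMSEQ_Suc])
    have le: "\<bar>k v - \<phi> v\<bar> \<le> dnorm V (\<lambda>v. simple_bartle N (t n) A v - k v) * nV v + 1 / Suc n * (K * nV v)" for n
      using dnorm_bound[OF vlin_minus[OF sbl[OF ts] vdual_vlin[OF k]] v, of n] est[OF t v, of n] by linarith
    have "\<bar>k v - \<phi> v\<bar> \<le> 0 * nV v + 0 * (K * nV v)"
      by (rule LIMSEQ_le_const[OF lim]) (intro exI allI impI le)
    then show "k v = \<phi> v" by simp
  qed
  show ?thesis
    unfolding bartle_def using A the_equality[of P, OF P\<phi> uniq] by (simp add: P_def[abs_def])
qed

lemma bartle_estimate:
  fixes g :: "'x \<Rightarrow> real"
  assumes N: "local_vector_measure V N" and K: "\<And>A. A \<in> sets borel \<Longrightarrow> dnorm V (N A) \<le> K" "0 \<le> K"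
    and A: "A \<in> sets borel" and g: "g \<in> borel_measurable borel" "\<And>x. \<bar>g x\<bar> \<le> C"
  shows "bartle V N g A \<in> vdual V"
    and "near s g r \<Longrightarrow> v \<in> CV \<Longrightarrow> \<bar>simple_bartle N s A v - bartle V N g A v\<bar> \<le> r * (2 * K * nV v)"
proof -
  obtain f where f: "f \<in> vdual V" "\<And>s r v. near s g r \<Longrightarrow> v \<in> CV \<Longrightarrow> \<bar>simple_bartle N s A v - f v\<bar> \<le> r * (2 * K * nV v)"
    by (rule bartle_exists[OF N K A g]) (assumption, rule that)
  have "bartle V N g A = f" by (rule bartle_eq[OF N A g f(1) _ f(2)]) (use K(2) in simp)
  then show "bartle V N g A \<in> vdual V"
    "near s g r \<Longrightarrow> v \<in> CV \<Longrightarrow> \<bar>simple_bartle N s A v - bartle V N g A v\<bar> \<le> r * (2 * K * nV v)"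
    using f by simp_all
qed

lemma bartle_dual:
  fixes g :: "'x \<Rightarrow> real"
  assumes "local_vector_measure V N" "A \<in> sets borel" "g \<in> borel_measurable borel" "\<And>x. \<bar>g x\<bar> \<le> C"
  shows "bartle V N g A \<in> vdual V"
  by (rule lvm_bounded_range[OF assms(1)]) (rule bartle_estimate(1)[OF assms(1) _ _ assms(2-4)])

lemma bartle_not_borel: "A \<notin> sets borel \<Longrightarrow> bartle V N g A = (\<lambda>_. 0)"
  by (simp add: bartle_def)

text \<open>Identifies the value at a single v; the constant M may be anything independent of s and
  r.\<close>

lemma bartle_eqI:
  fixes g :: "'x \<Rightarrow> real"
  assumes N: "local_vector_measure V N" and A: "A \<in> sets borel" and g: "g \<in> borel_measurable borel" "\<And>x. \<bar>g x\<bar> \<le> C"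
    and v: "v \<in> CV" and approx: "\<And>s r. near s g r \<Longrightarrow> \<bar>simple_bartle N s A v - b\<bar> \<le> r * M"
  shows "bartle V N g A v = b"
proof -
  obtain K where K: "0 \<le> K" "\<And>A. A \<in> sets borel \<Longrightarrow> dnorm V (N A) \<le> K" by (rule lvm_bounded_range[OF N]) (rule that)
  show ?thesis
  proof (rule real_eq_of_small)
    fix e :: real assume "e > 0"
    obtain s where s: "near s g e" by (rule near_exists[OF g \<open>e > 0\<close>])
    show "\<bar>bartle V N g A v - b\<bar> \<le> e * (2 * K * nV v + M)"
      using bartle_estimate(2)[OF N K(2,1) A g s v] approx[OF s] unfolding distrib_left[of e] by linarith
  qed
qed

lemma simple_bartle_Un:
  assumes N: "local_vector_measure V N" and v: "v \<in> CV" and s: "simple_function borel s"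
    and A: "A \<in> sets borel" "B \<in> sets borel" "A \<inter> B = {}"
  shows "simple_bartle N s (A \<union> B) v = simple_bartle N s A v + simple_bartle N s B v"
proof -
  have "N ((A \<union> B) \<inter> s -` {c}) v = N (A \<inter> s -` {c}) v + N (B \<inter> s -` {c}) v" for c
  proof -
    have "N ((A \<inter> s -` {c}) \<union> (B \<inter> s -` {c})) v = N (A \<inter> s -` {c}) v + N (B \<inter> s -` {c}) v"
      by (rule lvm_Un[OF N v sets.Int[OF A(1) simple_function_level[OF s]] sets.Int[OF A(2) simple_function_level[OF s]]])
        (use A(3) in blast)
    then show ?thesis by (simp add: Int_Un_distrib2)
  qed
  then show ?thesis by (simp add: simple_bartle_def distrib_left sum.distrib)
qed

lemma bartle_Un:
  fixes g :: "'x \<Rightarrow> real"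
  assumes N: "local_vector_measure V N" and v: "v \<in> CV" and g: "g \<in> borel_measurable borel" "\<And>x. \<bar>g x\<bar> \<le> C"
    and A: "A \<in> sets borel" "B \<in> sets borel" "A \<inter> B = {}"
  shows "bartle V N g (A \<union> B) v = bartle V N g A v + bartle V N g B v"
proof -
  obtain K where K: "0 \<le> K" "\<And>A. A \<in> sets borel \<Longrightarrow> dnorm V (N A) \<le> K" by (rule lvm_bounded_range[OF N]) (rule that)
  show ?thesis
  proof (rule bartle_eqI[OF N sets.Un[OF A(1,2)] g v, where M = "2 * K * nV v + 2 * K * nV v"])
    show "\<bar>simple_bartle N s (A \<union> B) v - (bartle V N g A v + bartle V N g B v)\<bar> \<le> r * (2 * K * nV v + 2 * K * nV v)"
      if s: "near s g r" for s r
    proof -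
      have ss: "simple_function borel s" using s by (simp add: near_def)
      show ?thesis
        using bartle_estimate(2)[OF N K(2,1) A(1) g s v] bartle_estimate(2)[OF N K(2,1) A(2) g s v]
        unfolding simple_bartle_Un[OF N v ss A] distrib_left[of r] by linarith
    qed
  qed
qed

text \<open>For a finitely additive set function the error of a partial sum is minus the value on
  the tail, so countable additivity in norm means that tails have small norm.\<close>

lemma additive_tail:
  fixes M :: "'x set \<Rightarrow> real"
  assumes add: "\<And>A B. A \<in> sets borel \<Longrightarrow> B \<in> sets borel \<Longrightarrow> A \<inter> B = {} \<Longrightarrow> M (A \<union> B) = M A + M B"
    and A: "\<And>i. A i \<in> sets borel" "disjoint_family (A :: nat \<Rightarrow> 'x set)"
  shows "(\<Sum>i<n. M (A i)) - M (\<Union>i. A i) = - M ((\<Union>i. A i) - (\<Union>i<n. A i))"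
proof -
  have U: "(\<Union>i. A i) \<in> sets borel" "(\<Union>i<n. A i) \<in> sets borel" for n
    using A(1) by (auto intro!: sets.countable_UN)
  have e: "M {} = 0" using add[of "{}" "{}"] by simp
  have s: "(\<Sum>i<n. M (A i)) = M (\<Union>i<n. A i)"
  proof (induction n)
    case (Suc n)
    have "A n \<inter> A i = {}" if "i < n" for i using disjoint_family_onD[OF A(2), of n i] that by simp
    then have "A n \<inter> (\<Union>i<n. A i) = {}" by blast
    then show ?case using add[OF A(1) U(2), of n n] Suc by (simp add: lessThan_Suc)
  qed (simp add: e)
  have "(\<Union>i<n. A i) \<union> ((\<Union>i. A i) - (\<Union>i<n. A i)) = (\<Union>i. A i)" by blast
  moreover have "(\<Union>i<n. A i) \<inter> ((\<Union>i. A i) - (\<Union>i<n. A i)) = {}" by blast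
  ultimately show ?thesis using add[OF U(2) sets.Diff[OF U], of n n] s by simp
qed

text \<open>Locality passes to simple functions through \<open>lvm_local_borel\<close>. For
  countable additivity, a simple s within r of g replaces g at a cost of 2 K r on every tail, and on
  each of the finitely many levels of s the tails of N vanish.\<close>

lemma bartle_lvm:
  fixes g :: "'x \<Rightarrow> real"
  assumes N: "local_vector_measure V N" and g: "g \<in> borel_measurable borel" "\<And>x. \<bar>g x\<bar> \<le> C"
  shows "local_vector_measure V (bartle V N g)"
  unfolding local_vector_measure_def
proof (intro conjI ballI allI impI)
  show "bartle V N g A \<in> vdual V" if "A \<in> sets borel" for A by (rule bartle_dual[OF N that g])
  show "bartle V N g A = (\<lambda>_. 0)" if "A \<notin> sets borel" for A by (rule bartle_not_borel[OF that])
  show "bartle V N g A v = 0" if v: "v \<in> CV" and A: "open A \<and> vnorm_on V A v = 0" for A v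
  proof (rule bartle_eqI[OF N _ g v])
    show "A \<in> sets borel" using A by simp
    fix s r assume "near s g r"
    then have s: "simple_function borel s" by (simp add: near_def)
    have "N (A \<inter> s -` {c}) v = 0" for c
      by (rule lvm_local_borel[OF N v, of A]) (use A simple_function_level[OF s, of c] in auto)
    then show "\<bar>simple_bartle N s A v - 0\<bar> \<le> r * 0" by (simp add: simple_bartle_def)
  qed
next
  fix A :: "nat \<Rightarrow> 'x set" assume A: "range A \<subseteq> sets borel \<and> disjoint_family A"
  have A': "A i \<in> sets borel" for i using A by blast
  define T where "T n = (\<Union>i. A i) - (\<Union>i<n. A i)" for n
  have T: "T n \<in> sets borel" for n unfolding T_def using A' by (auto intro!: sets.countable_UN)
  obtain K where K: "0 \<le> K" "\<And>A. A \<in> sets borel \<Longrightarrow> dnorm V (N A) \<le> K" by (rule lvm_bounded_range[OF N]) (rule that)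
  have tail: "(\<lambda>v. (\<Sum>i<n. bartle V N g (A i) v) - bartle V N g (\<Union>i. A i) v) = (\<lambda>v. - bartle V N g (T n) v)" for n
  proof
    fix v
    show "(\<Sum>i<n. bartle V N g (A i) v) - bartle V N g (\<Union>i. A i) v = - bartle V N g (T n) v"
    proof (cases "v \<in> CV")
      case True
      show ?thesis unfolding T_def
        by (rule additive_tail[OF bartle_Un[OF N True g] A' conjunct2[OF A]])
    next
      case False
      have "bartle V N g B v = 0" for B
        using bartle_dual[OF N _ g, of B] bartle_not_borel[of B N g] False by (cases "B \<in> sets borel") (simp_all add: vdual_iff)
      then show ?thesis by simp
    qed
  qed
  have AS: "disjoint_family (\<lambda>i. A i \<inter> S)" for S
    unfolding disjoint_family_on_def using disjoint_family_onD[OF conjunct2[OF A]] by blast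
  have Ntail: "(\<lambda>n. dnorm V (N (T n \<inter> S))) \<longlonglongrightarrow> 0" if S: "S \<in> sets borel" for S
  proof -
    have "(\<lambda>v. (\<Sum>i<n. N (A i \<inter> S) v) - N (\<Union>i. A i \<inter> S) v) = (\<lambda>v. - N (T n \<inter> S) v)" for n
    proof
      fix v
      have eq: "T n \<inter> S = (\<Union>i. A i \<inter> S) - (\<Union>i<n. A i \<inter> S)" by (auto simp: T_def)
      show "(\<Sum>i<n. N (A i \<inter> S) v) - N (\<Union>i. A i \<inter> S) v = - N (T n \<inter> S) v"
      proof (cases "v \<in> CV")
        case True
        show ?thesis unfolding eq
          by (rule additive_tail[OF lvm_Un[OF N True] sets.Int[OF A' S] AS])
      qed (simp add: lvm_notin[OF N])
    qed
    moreover have "(\<lambda>n. dnorm V (\<lambda>v. (\<Sum>i<n. N (A i \<inter> S) v) - N (\<Union>i. A i \<inter> S) v)) \<longlonglongrightarrow> 0"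
      by (rule lvm_sigma[OF N _ AS]) (use A S in auto)
    ultimately show ?thesis by (simp add: dnorm_def)
  qed
  have "(\<lambda>n. dnorm V (bartle V N g (T n))) \<longlonglongrightarrow> 0"
  proof (rule LIMSEQ_I)
    fix e :: real assume "e > 0"
    have pos: "0 < 2 * K + 1" using K(1) by simp
    \<comment> \<open>The replacement of g costs at most e / 2, and the sum over the levels of s is
      below e / 2 for large n.\<close>
    define r where "r = e / (2 * (2 * K + 1))"
    have r: "0 < r" using \<open>e > 0\<close> pos by (simp add: r_def)
    obtain s where ns: "near s g r" by (rule near_exists[OF g r])
    then have s: "simple_function borel s" by (simp add: near_def)
    define S where "S n = (\<Sum>c\<in>range s. \<bar>c\<bar> * dnorm V (N (T n \<inter> s -` {c})))" for n
    have "S \<longlonglongrightarrow> (\<Sum>c\<in>range s. \<bar>c\<bar> * 0)"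
      unfolding S_def by (intro tendsto_sum tendsto_mult tendsto_const Ntail simple_function_level s)
    then have "S \<longlonglongrightarrow> 0" by simp
    from LIMSEQ_D[OF this, of "e / 2"] \<open>e > 0\<close> obtain M where M: "\<forall>n\<ge>M. norm (S n - 0) < e / 2" by auto
    have Sn: "0 \<le> S n" for n unfolding S_def
      by (intro sum_nonneg mult_nonneg_nonneg abs_ge_zero dnorm_nonneg lvm_vlin[OF N] sets.Int T simple_function_level s)
    have "norm (dnorm V (bartle V N g (T n)) - 0) < e" if "n \<ge> M" for n
    proof -
      have "dnorm V (bartle V N g (T n)) \<le> S n + r * (2 * K)"
      proof (rule dnorm_le)
        show "0 \<le> S n + r * (2 * K)" using Sn[of n] r K(1) by (intro add_nonneg_nonneg mult_nonneg_nonneg) auto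
        fix v assume v: "v \<in> CV"
        have "\<bar>simple_bartle N s (T n) v\<bar> \<le> (\<Sum>c\<in>range s. \<bar>c * N (T n \<inter> s -` {c}) v\<bar>)"
          unfolding simple_bartle_def by (rule sum_abs)
        also have "\<dots> \<le> (\<Sum>c\<in>range s. \<bar>c\<bar> * (dnorm V (N (T n \<inter> s -` {c})) * nV v))"
          unfolding abs_mult
          by (intro sum_mono mult_left_mono abs_ge_zero dnorm_bound lvm_vlin[OF N] sets.Int T simple_function_level s v)
        also have "\<dots> = S n * nV v" unfolding S_def by (simp add: sum_distrib_right mult.assoc)
        finally have "\<bar>simple_bartle N s (T n) v\<bar> \<le> S n * nV v" .
        moreover have "\<bar>simple_bartle N s (T n) v - bartle V N g (T n) v\<bar> \<le> r * (2 * K * nV v)"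
          by (rule bartle_estimate(2)[OF N K(2,1) T g ns v])
        ultimately show "\<bar>bartle V N g (T n) v\<bar> \<le> (S n + r * (2 * K)) * nV v"
          unfolding distrib_right mult.assoc by linarith
      qed
      also have "\<dots> < e / 2 + r * (2 * K + 1)" using M that r by (intro add_less_le_mono) (auto simp: abs_less_iff)
      also have "r * (2 * K + 1) = e / 2" unfolding r_def by (rule half_cancel[OF pos])
      finally show ?thesis using dnorm_nonneg[OF vdual_vlin[OF bartle_dual[OF N T g]], of n] by simp
    qed
    then show "\<exists>no. \<forall>n\<ge>no. norm (dnorm V (bartle V N g (T n)) - 0) < e" by blast
  qed
  then show "(\<lambda>n. dnorm V (\<lambda>v. (\<Sum>i<n. bartle V N g (A i) v) - bartle V N g (\<Union>i. A i) v)) \<longlonglongrightarrow> 0"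
    unfolding tail by (simp add: dnorm_def)
qed

end

section \<open>Total variation and integrals of measures given by functionals\<close>

lemma subspace_closure:
  fixes S :: "'a::real_normed_vector set"
  assumes "subspace S" shows "subspace (closure S)"
  unfolding subspace_def
proof (intro conjI ballI allI)
  show "0 \<in> closure S" by (rule subsetD[OF closure_subset subspace_0[OF assms]])
  fix x assume "x \<in> closure S"
  then obtain u where u: "\<And>n. u n \<in> S" "u \<longlonglongrightarrow> x" unfolding closure_sequential by blast
  show "c *\<^sub>R x \<in> closure S" for c
    unfolding closure_sequential
    by (intro exI[of _ "\<lambda>n. c *\<^sub>R u n"] conjI allI subspace_scale[OF assms] u tendsto_intros)
  fix y assume "y \<in> closure S"
  then obtain w where w: "\<And>n. w n \<in> S" "w \<longlonglongrightarrow> y" unfolding closure_sequential by blast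
  show "x + y \<in> closure S"
    unfolding closure_sequential
    by (intro exI[of _ "\<lambda>n. u n + w n"] conjI allI subspace_add[OF assms] u w tendsto_intros)
qed

context cb_module
begin

text \<open>The partition into one block; blocks are nonempty, hence the condition on A.\<close>

lemma dnorm_le_total_variation:
  assumes "A \<in> sets borel" "A \<noteq> {}" shows "ennreal (dnorm V (N A)) \<le> total_variation V N A"
proof -
  have "(\<Sum>B\<in>{A}. ennreal (dnorm V (N B))) \<le> total_variation V N A"
    unfolding total_variation_def using assms by (intro SUP_upper) (auto simp: partition_on_def disjoint_def)
  then show ?thesis by simp
qed

end

context cotangent
begin

lemma nn_integral_pn:
  assumes E: "E \<in> sets borel" shows "(\<integral>\<^sup>+ x\<in>E. ennreal (pn v x) \<partial>m) = ennreal (N1 (cut E v))"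
proof -
  have "(\<integral>\<^sup>+ x\<in>E. ennreal (pn v x) \<partial>m) = (\<integral>\<^sup>+ x. ennreal (indicat_real E x * pn v x) \<partial>m)"
    by (rule nn_integral_cong) (auto simp: indicator_def)
  also have "\<dots> = ennreal (setint E (pn v))"
  proof (rule nn_integral_eq_integral)
    show "integrable m (\<lambda>x. indicat_real E x * pn v x)" by (rule integrable_indicator_mult[OF pn_integrable E])
    show "AE x in m. 0 \<le> indicat_real E x * pn v x" using pn_nonneg[of v] by eventually_elim simp
  qed
  finally show ?thesis unfolding N1_cut[OF E] .
qed

text \<open>If the measure of v is given by a functional on the cuts of u, integrating g moves g
  onto u. Used for abstract couples and for the realization alike.\<close>

lemma bartle_functional:
  fixes V :: "('x, 'v) normed_cb_module" and g :: "'x \<Rightarrow> real"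
  assumes V: "is_normed_cb_module V" and N: "local_vector_measure V N" and v: "v \<in> carrier V"
    and l: "bdf K l" and eq: "\<And>A. A \<in> sets borel \<Longrightarrow> N A v = l (cut A u)"
    and A: "A \<in> sets borel" and g: "g \<in> borel_measurable borel" "\<And>x. \<bar>g x\<bar> \<le> C"
  shows "bartle V N g A v = l (cut A (act g u))"
proof -
  interpret cb_module V by unfold_locales (rule V)
  note lin = bdf_linear[OF l]
  show ?thesis
  proof (rule bartle_eqI[OF N A g v, where M = "\<bar>K\<bar> * N1 u"])
    fix s r assume "near s g r"
    then have s: "simple_function borel s" and e: "\<And>x. \<bar>s x - g x\<bar> \<le> r" by (auto simp: near_def)
    have gL: "g \<in> Linf m" using g by (rule LinfI)
    have fin: "finite (range s)" by (rule simple_function_range[OF s])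
    have lev: "s -` {c} \<in> sets borel" for c by (rule simple_function_level[OF s])
    have sb: "s \<in> borel_measurable borel" by (rule borel_measurable_simple_function[OF s])
    have "\<bar>s x\<bar> \<le> C + r" for x using g(2)[of x] e[of x] by linarith
    then have sL: "s \<in> Linf m" by (rule LinfI[OF sb])
    have "(\<lambda>x. \<Sum>c\<in>range s. c * indicat_real (s -` {c}) x) = s"
    proof
      fix x
      have "(\<Sum>c\<in>range s. c * indicat_real (s -` {c}) x) = (\<Sum>c\<in>range s. if c = s x then c else 0)"
        by (rule sum.cong) (auto simp: indicator_def)
      also have "\<dots> = s x" using fin by simp
      finally show "(\<Sum>c\<in>range s. c * indicat_real (s -` {c}) x) = s x" .
    qed
    then have "act s u = (\<Sum>c\<in>range s. c *\<^sub>R cut (s -` {c}) u)"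
      using act_simple[where J = "range s" and B = "\<lambda>c. s -` {c}" and c = "\<lambda>c. c" and v = u, OF fin lev] by simp
    then have "cut A (act s u) = (\<Sum>c\<in>range s. c *\<^sub>R cut (A \<inter> s -` {c}) u)"
      by (simp add: linear_sum[OF linear_cut[OF A]] linear_scale[OF linear_cut[OF A]] cut_cut[OF A lev])
    then have "l (cut A (act s u)) = simple_bartle N s A v"
      by (simp add: simple_bartle_def linear_sum[OF lin] linear_scale[OF lin] eq[OF sets.Int[OF A lev]])
    then have "\<bar>simple_bartle N s A v - l (cut A (act g u))\<bar> = \<bar>l (cut A (act (\<lambda>x. s x - g x) u))\<bar>"
      by (simp add: act_diff[OF sL gL] linear_diff[OF linear_cut[OF A]] linear_diff[OF lin])
    also have "\<dots> \<le> K * N1 (cut A (act (\<lambda>x. s x - g x) u))" by (rule bdf_le[OF l])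
    also have "\<dots> \<le> \<bar>K\<bar> * N1 (cut A (act (\<lambda>x. s x - g x) u))" by (intro mult_right_mono) auto
    also have "\<dots> \<le> \<bar>K\<bar> * N1 (act (\<lambda>x. s x - g x) u)" by (intro mult_left_mono N1_cut_le A) simp
    also have "\<dots> \<le> \<bar>K\<bar> * (r * N1 u)"
      by (intro mult_left_mono N1_act_le borel_measurable_diff sb g(1) e) simp
    finally show "\<bar>simple_bartle N s A v - l (cut A (act g u))\<bar> \<le> r * (\<bar>K\<bar> * N1 u)"
      by (simp add: mult.left_commute)
  qed
qed

end

section \<open>The functionals on the cotangent module induced by a couple\<close>

locale couple = cotangent m act pn d + cb_module V
  for m :: "'x::polish_space measure" and act :: "('x \<Rightarrow> real) \<Rightarrow> 'c::banach \<Rightarrow> 'c" and pn d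
    and V :: "('x, 'v) normed_cb_module" (structure) +
  fixes D :: "('x \<Rightarrow> real) \<Rightarrow> 'x set \<Rightarrow> 'v \<Rightarrow> real"
  assumes couple: "differential_couple m V D"
begin

lemma D_linear: "linear_into_lvm m V D"
  by (rule couple[unfolded differential_couple_def, THEN conjunct2, THEN conjunct1])

lemma D_lvm: "f \<in> W12 m \<Longrightarrow> local_vector_measure V (D f)"
  using D_linear[unfolded linear_into_lvm_def, THEN conjunct1] by (rule bspec)

lemma D_add: "f \<in> W12 m \<Longrightarrow> g \<in> W12 m \<Longrightarrow> D (\<lambda>x. f x + g x) A v = D f A v + D g A v"
  using D_linear[unfolded linear_into_lvm_def, THEN conjunct2, THEN conjunct2, THEN conjunct1, THEN bspec, THEN bspec, of f g] by simp

lemma D_scale: "f \<in> W12 m \<Longrightarrow> D (\<lambda>x. c * f x) A v = c * D f A v"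
  using D_linear[unfolded linear_into_lvm_def, THEN conjunct2, THEN conjunct2, THEN conjunct2, THEN spec, THEN bspec, of f c] by simp

text \<open>Condition (i) expressed through \<open>pn (d f)\<close>, by uniqueness of the minimal
  relaxed slope.\<close>

lemma D_total_variation:
  assumes f: "f \<in> W12 m" and E: "E \<in> sets borel"
  shows "total_variation V (D f) E = ennreal (N1 (cut E (d f)))"
proof -
  obtain G where G: "minimal_relaxed_slope m f G" "\<And>E. E \<in> sets borel \<Longrightarrow> total_variation V (D f) E = (\<integral>\<^sup>+ x\<in>E. ennreal (G x) \<partial>m)"
    using couple f unfolding differential_couple_def by blast
  have eq: "AE x in m. G x = pn (d f) x"
    by (rule minimal_relaxed_slope_unique[OF W12_L2[OF f] G(1) d_slope[OF f]])
  have "(\<integral>\<^sup>+ x\<in>E. ennreal (G x) \<partial>m) = (\<integral>\<^sup>+ x\<in>E. ennreal (pn (d f) x) \<partial>m)"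
    by (rule nn_integral_cong_AE) (use eq in \<open>eventually_elim, simp\<close>)
  then show ?thesis unfolding G(2)[OF E] nn_integral_pn[OF E] .
qed

lemma D_dnorm_le:
  assumes f: "f \<in> W12 m" and A: "A \<in> sets borel" shows "dnorm V (D f A) \<le> N1 (cut A (d f))"
proof (cases "A = {}")
  case True
  show ?thesis unfolding True by (rule dnorm_le) (simp_all add: lvm_empty[OF D_lvm[OF f]])
next
  case False
  then show ?thesis using dnorm_le_total_variation[OF A, of "D f"] by (simp add: D_total_variation[OF f A])
qed

lemma D_bound:
  assumes f: "f \<in> W12 m" and A: "A \<in> sets borel" and v: "v \<in> CV"
  shows "\<bar>D f A v\<bar> \<le> nV v * N1 (cut A (d f))"
proof -
  have "\<bar>D f A v\<bar> \<le> dnorm V (D f A) * nV v" by (rule dnorm_bound[OF lvm_vlin[OF D_lvm[OF f] A] v])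
  also have "\<dots> \<le> N1 (cut A (d f)) * nV v" using D_dnorm_le[OF f A] nV_nonneg[OF v] by (rule mult_right_mono)
  finally show ?thesis by (simp add: mult.commute)
qed

definition admissible :: "('x set \<times> ('x \<Rightarrow> real)) list \<Rightarrow> bool" where
  "admissible xs \<longleftrightarrow> set xs \<subseteq> sets borel \<times> W12 m"

text \<open>A list of pairs (A, f) stands for the sum of the cut differentials, here restricted to
  B; \<open>Dsum\<close> is the value that the functional of v has to take on it. Lists are used
  since a vector has many such presentations.\<close>

definition csum :: "('x set \<times> ('x \<Rightarrow> real)) list \<Rightarrow> 'x set \<Rightarrow> 'c" where
  "csum xs B = (\<Sum>(A, f)\<leftarrow>xs. cut (A \<inter> B) (d f))"

definition Dsum :: "('x set \<times> ('x \<Rightarrow> real)) list \<Rightarrow> 'x set \<Rightarrow> 'v \<Rightarrow> real" where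
  "Dsum xs B v = (\<Sum>(A, f)\<leftarrow>xs. D f (A \<inter> B) v)"

lemma csum_simps [simp]:
  "csum [] B = 0" "csum ((A, f) # xs) B = cut (A \<inter> B) (d f) + csum xs B" "csum (xs @ ys) B = csum xs B + csum ys B"
  by (simp_all add: csum_def)

lemma Dsum_simps [simp]:
  "Dsum [] B v = 0" "Dsum ((A, f) # xs) B v = D f (A \<inter> B) v + Dsum xs B v" "Dsum (xs @ ys) B v = Dsum xs B v + Dsum ys B v"
  by (simp_all add: Dsum_def)

lemma admissible_simps [simp]:
  "admissible []" "admissible ((A, f) # xs) \<longleftrightarrow> A \<in> sets borel \<and> f \<in> W12 m \<and> admissible xs"
  "admissible (xs @ ys) \<longleftrightarrow> admissible xs \<and> admissible ys"
  by (auto simp: admissible_def)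

lemma cut_csum: "admissible xs \<Longrightarrow> B \<in> sets borel \<Longrightarrow> C \<in> sets borel \<Longrightarrow> cut C (csum xs B) = csum xs (B \<inter> C)"
proof (induction xs)
  case (Cons p xs)
  obtain A f where p: "p = (A, f)" by (cases p)
  have "C \<inter> (A \<inter> B) = A \<inter> (B \<inter> C)" by blast
  then have "cut C (cut (A \<inter> B) (d f)) = cut (A \<inter> (B \<inter> C)) (d f)"
    using cut_cut[of C "A \<inter> B" "d f"] Cons.prems unfolding p by (simp add: sets.Int)
  then show ?case using Cons unfolding p by (simp add: linear_add[OF linear_cut])
qed (simp add: linear_0[OF linear_cut])

lemma Dsum_split:
  assumes v: "v \<in> CV" and "admissible xs" "B \<in> sets borel" "C \<in> sets borel"
  shows "Dsum xs B v = Dsum xs (B \<inter> C) v + Dsum xs (B - C) v"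
  using assms(2)
proof (induction xs)
  case (Cons p xs)
  obtain A f where p: "p = (A, f)" by (cases p)
  have f: "f \<in> W12 m" and A: "A \<in> sets borel" using Cons.prems unfolding p by auto
  have "D f ((A \<inter> (B \<inter> C)) \<union> (A \<inter> (B - C))) v = D f (A \<inter> (B \<inter> C)) v + D f (A \<inter> (B - C)) v"
    by (rule lvm_Un[OF D_lvm[OF f] v]) (use A assms(3,4) in auto)
  moreover have "(A \<inter> (B \<inter> C)) \<union> (A \<inter> (B - C)) = A \<inter> B" by blast
  ultimately show ?case using Cons unfolding p by simp
qed simp

lemma D_split:
  assumes f: "f \<in> W12 m" and v: "v \<in> CV" and "B \<in> sets borel" "C \<in> sets borel"
  shows "D f B v = D f (B \<inter> C) v + D f (B - C) v"
  using Dsum_split[OF v _ assms(3,4), of "[(UNIV, f)]"] f by simp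

text \<open>On B inside A the head of the list merges with f into the differential of f + g; on B
  outside A it disappears. Both pieces have the original form with a shorter list.\<close>

lemma csum_step:
  assumes A: "A \<in> sets borel" and g: "g \<in> W12 m" and xs: "admissible xs" and B: "B \<in> sets borel" and f: "f \<in> W12 m"
  defines "h \<equiv> cut B (d f) + csum ((A, g) # xs) B"
  shows "cut (B \<inter> A) h = cut (B \<inter> A) (d (\<lambda>x. f x + g x)) + csum xs (B \<inter> A)"
    and "cut (B - A) h = cut (B - A) (d f) + csum xs (B - A)"
    and "cut B h = h"
proof -
  have s: "B \<inter> A \<inter> B = B \<inter> A" "B \<inter> A \<inter> (A \<inter> B) = B \<inter> A" "B \<inter> (B \<inter> A) = B \<inter> A"
    "(B - A) \<inter> B = B - A" "(B - A) \<inter> (A \<inter> B) = {}" "B \<inter> (B - A) = B - A" "B \<inter> (A \<inter> B) = A \<inter> B" by blast+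
  show "cut (B \<inter> A) h = cut (B \<inter> A) (d (\<lambda>x. f x + g x)) + csum xs (B \<inter> A)"
    "cut (B - A) h = cut (B - A) (d f) + csum xs (B - A)" "cut B h = h"
    unfolding h_def csum_simps using A B xs
    by (simp_all add: linear_add[OF linear_cut] cut_cut cut_csum s d_add[OF f g])
qed

text \<open>Splitting \<open>B\<close> along the first set of the list turns its term into a contribution to the single function \<open>f\<close>.\<close>

lemma Dsum_bound:
  assumes v: "v \<in> CV"
  shows "admissible xs \<Longrightarrow> B \<in> sets borel \<Longrightarrow> f \<in> W12 m
    \<Longrightarrow> \<bar>D f B v + Dsum xs B v\<bar> \<le> nV v * N1 (cut B (d f) + csum xs B)"
proof (induction xs arbitrary: B f)
  case Nil
  then show ?case using D_bound[OF _ _ v] by simp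
next
  case (Cons p xs)
  obtain A g where p: "p = (A, g)" by (cases p)
  have A: "A \<in> sets borel" and g: "g \<in> W12 m" and xs: "admissible xs" using Cons.prems(1) unfolding p by auto
  note B = Cons.prems(2) and f = Cons.prems(3)
  define h where "h = cut B (d f) + csum (p # xs) B"
  have BA: "B \<inter> A \<in> sets borel" "B - A \<in> sets borel" using A B by auto
  have fg: "(\<lambda>x. f x + g x) \<in> W12 m" by (rule W12_add[OF f g])
  note 1 = csum_step(1)[OF A g xs B f, folded p, folded h_def]
    and 2 = csum_step(2)[OF A g xs B f, folded p, folded h_def]
    and 3 = csum_step(3)[OF A g xs B f, folded p, folded h_def]
  have "B \<inter> A \<union> (B - A) = B" "B \<inter> A \<inter> (B - A) = {}" by blast+
  then have 4: "N1 h = N1 (cut (B \<inter> A) h) + N1 (cut (B - A) h)"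
    using N1_cut_split[OF BA, of h] 3 by simp
  have "D f B v + Dsum (p # xs) B v = (D (\<lambda>x. f x + g x) (B \<inter> A) v + Dsum xs (B \<inter> A) v) + (D f (B - A) v + Dsum xs (B - A) v)"
    unfolding p Dsum_simps Dsum_split[OF v xs B A] D_split[OF f v B A] D_add[OF f g] by (simp add: Int_commute)
  also have "\<bar>\<dots>\<bar> \<le> nV v * N1 (cut (B \<inter> A) h) + nV v * N1 (cut (B - A) h)"
    using Cons.IH[OF xs BA(1) fg] Cons.IH[OF xs BA(2) f] unfolding 1 2 by linarith
  also have "\<dots> = nV v * N1 h" unfolding 4 by (rule distrib_left[symmetric])
  finally show ?case unfolding h_def .
qed

lemma Dsum_UNIV_bound:
  assumes v: "v \<in> CV" and xs: "admissible xs" shows "\<bar>Dsum xs UNIV v\<bar> \<le> nV v * N1 (csum xs UNIV)"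
proof -
  \<comment> \<open>The zero function starts the recursion of \<open>Dsum_bound\<close>.\<close>
  have "d (\<lambda>x. 0) = 0" using d_scale[OF W12_zero, of 0] by simp
  moreover have "D (\<lambda>x. 0) UNIV v = 0" using D_scale[OF W12_zero, of 0 UNIV v] by simp
  ultimately show ?thesis using Dsum_bound[OF v xs, of UNIV "\<lambda>_. 0"] W12_zero by simp
qed

lemma csum_scale:
  assumes "admissible xs"
  obtains ys where "admissible ys" "csum ys UNIV = c *\<^sub>R csum xs UNIV" "\<And>v. Dsum ys UNIV v = c * Dsum xs UNIV v"
proof -
  define ys where "ys = map (\<lambda>(A, f). (A, \<lambda>x. c * f x)) xs"
  have "admissible ys \<and> csum ys UNIV = c *\<^sub>R csum xs UNIV \<and> (\<forall>v. Dsum ys UNIV v = c * Dsum xs UNIV v)"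
    using assms unfolding ys_def
  proof (induction xs)
    case (Cons p xs)
    obtain A f where p: "p = (A, f)" by (cases p)
    show ?case using Cons unfolding p
      by (simp add: W12_scale d_scale D_scale linear_scale[OF linear_cut] scaleR_add_right distrib_left)
  qed simp
  then show ?thesis using that by blast
qed

lemma subspace_csum: "subspace {csum xs UNIV | xs. admissible xs}"
  unfolding subspace_def
proof (intro conjI ballI allI)
  show "0 \<in> {csum xs UNIV | xs. admissible xs}" by (intro CollectI exI[of _ "[]"]) simp
  fix x assume "x \<in> {csum xs UNIV | xs. admissible xs}"
  then obtain xs where xs: "x = csum xs UNIV" "admissible xs" by blast
  show "c *\<^sub>R x \<in> {csum xs UNIV | xs. admissible xs}" for c
  proof -
    obtain ys where "admissible ys" "csum ys UNIV = c *\<^sub>R csum xs UNIV" by (rule csum_scale[OF xs(2)])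
    then show ?thesis using xs(1) by force
  qed
  fix y assume "y \<in> {csum xs UNIV | xs. admissible xs}"
  then obtain ys where ys: "y = csum ys UNIV" "admissible ys" by blast
  show "x + y \<in> {csum xs UNIV | xs. admissible xs}"
    using xs ys by (intro CollectI exI[of _ "xs @ ys"]) simp
qed

lemma csum_dense: "v \<in> closure {csum xs UNIV | xs. admissible xs}"
proof (rule cut_d_dense)
  show "subspace (closure {csum xs UNIV |xs. admissible xs})" by (rule subspace_closure[OF subspace_csum])
  show "cut A (d f) \<in> closure {csum xs UNIV |xs. admissible xs}" if "A \<in> sets borel" "f \<in> W12 m" for A f
    by (rule subsetD[OF closure_subset]) (use that in \<open>auto intro!: exI[of _ "[(A, f)]"]\<close>)
qed simp

text \<open>Different presentations of one vector might give different values; their graph R is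
  still a subspace, and the domination of \<open>Dsum_UNIV_bound\<close> makes it single-valued and
  extendable.\<close>

lemma ell_exists:
  assumes v: "v \<in> CV"
  obtains l where "bdf (nV v) l" "\<And>A f. A \<in> sets borel \<Longrightarrow> f \<in> W12 m \<Longrightarrow> l (cut A (d f)) = D f A v"
proof -
  define R where "R = {(csum xs UNIV, Dsum xs UNIV v) | xs. admissible xs}"
  have R: "subspace R"
    unfolding subspace_def
  proof (intro conjI ballI allI)
    show "0 \<in> R" unfolding R_def by (intro CollectI exI[of _ "[]"]) (simp add: zero_prod_def)
    fix x assume "x \<in> R"
    then obtain xs where xs: "x = (csum xs UNIV, Dsum xs UNIV v)" "admissible xs" unfolding R_def by blast
    show "c *\<^sub>R x \<in> R" for c
    proof -
      obtain ys where ys: "admissible ys" "csum ys UNIV = c *\<^sub>R csum xs UNIV" "\<And>v. Dsum ys UNIV v = c * Dsum xs UNIV v"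
        by (rule csum_scale[OF xs(2)]) (rule that)
      show ?thesis unfolding R_def by (intro CollectI exI[of _ ys]) (simp add: xs(1) ys)
    qed
    fix y assume "y \<in> R"
    then obtain ys where ys: "y = (csum ys UNIV, Dsum ys UNIV v)" "admissible ys" unfolding R_def by blast
    show "x + y \<in> R" using xs ys unfolding R_def by (intro CollectI exI[of _ "xs @ ys"]) simp
  qed
  have dom: "r \<le> nV v * N1 x" if "(x, r) \<in> R" for x r
  proof -
    obtain xs where "x = csum xs UNIV" "r = Dsum xs UNIV v" "admissible xs" using \<open>(x, r) \<in> R\<close> unfolding R_def by blast
    then show ?thesis using Dsum_UNIV_bound[OF v] by (simp add: abs_le_iff)
  qed
  have sub: "nV v * N1 (x + y) \<le> nV v * N1 x + nV v * N1 y" for x y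
    using mult_left_mono[OF N1_triangle nV_nonneg[OF v], of x y] by (simp add: distrib_left)
  obtain l where l: "linear l" "\<And>x. l x \<le> nV v * N1 x" "\<And>x r. (x, r) \<in> R \<Longrightarrow> l x = r"
  proof (rule hahn_banach_graph[of "\<lambda>x. nV v * N1 x" R, OF sub _ R])
    show "nV v * N1 (c *\<^sub>R x) = c * (nV v * N1 x)" if "0 \<le> c" for c x using that by (simp add: N1_scale)
    show "r \<le> nV v * N1 x" if "(x, r) \<in> R" for x r by (rule dom[OF that])
    show thesis if "linear l" "\<And>x. l x \<le> nV v * N1 x" "\<And>x r. (x, r) \<in> R \<Longrightarrow> l x = r" for l
      by (rule \<open>\<And>l. linear l \<Longrightarrow> (\<And>x. l x \<le> nV v * N1 x) \<Longrightarrow> (\<And>x r. (x, r) \<in> R \<Longrightarrow> l x = r) \<Longrightarrow> thesis\<close>[OF that])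
  qed
  have "\<bar>l x\<bar> \<le> nV v * N1 x" for x
    using l(2)[of x] l(2)[of "- x"] linear_neg[OF l(1), of x] by simp
  then have "bdf (nV v) l" using l(1) by (simp add: bdf_def)
  moreover have "l (cut A (d f)) = D f A v" if "A \<in> sets borel" "f \<in> W12 m" for A f
    by (rule l(3)) (use that in \<open>auto simp: R_def intro!: exI[of _ "[(A, f)]"]\<close>)
  ultimately show ?thesis by (rule that)
qed

text \<open>The choice is harmless: by \<open>bdf_eqI\<close> there is only one such
  functional.\<close>

definition ell :: "'v \<Rightarrow> 'c \<Rightarrow> real" where
  "ell v = (SOME l. bdf (nV v) l \<and> (\<forall>A\<in>sets borel. \<forall>f\<in>W12 m. l (cut A (d f)) = D f A v))"

lemma ell:
  assumes v: "v \<in> CV"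
  shows ell_bdf: "bdf (nV v) (ell v)"
    and ell_cut: "\<And>A f. A \<in> sets borel \<Longrightarrow> f \<in> W12 m \<Longrightarrow> ell v (cut A (d f)) = D f A v"
proof -
  have "\<exists>l. bdf (nV v) l \<and> (\<forall>A\<in>sets borel. \<forall>f\<in>W12 m. l (cut A (d f)) = D f A v)"
    by (rule ell_exists[OF v]) blast
  from someI_ex[OF this, folded ell_def]
  show "bdf (nV v) (ell v)" "\<And>A f. A \<in> sets borel \<Longrightarrow> f \<in> W12 m \<Longrightarrow> ell v (cut A (d f)) = D f A v" by blast+
qed

lemma ell_linear: "v \<in> CV \<Longrightarrow> linear (ell v)"
  by (rule bdf_linear[OF ell_bdf])

lemma ell_le: "v \<in> CV \<Longrightarrow> \<bar>ell v u\<bar> \<le> nV v * N1 u"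
  by (rule bdf_le[OF ell_bdf])

lemma ell_eqI:
  assumes "v \<in> CV" "bdf C l" "\<And>A f. A \<in> sets borel \<Longrightarrow> f \<in> W12 m \<Longrightarrow> l (cut A (d f)) = D f A v"
  shows "ell v = l"
  by (rule bdf_eqI[OF ell_bdf[OF assms(1)] assms(2)]) (simp add: ell_cut[OF assms(1)] assms(3))

lemma ell_add:
  assumes v: "v \<in> CV" "w \<in> CV" shows "ell (v \<oplus> w) = (\<lambda>u. ell v u + ell w u)"
  by (rule ell_eqI[OF add_CV[OF v] bdf_add[OF ell_bdf ell_bdf, OF v]])
    (simp add: ell_cut v vlin_add[OF lvm_vlin[OF D_lvm] v])

lemma ell_scale:
  assumes v: "v \<in> CV" shows "ell (vscale V c v) = (\<lambda>u. c * ell v u)"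
proof (rule ell_eqI[OF smult_CV[OF v]])
  show "bdf (\<bar>c\<bar> * nV v) (\<lambda>u. c * ell v u)"
    unfolding bdf_def
  proof (intro conjI allI)
    show "linear (\<lambda>u. c * ell v u)" using linear_compose_scale_right[OF ell_linear[OF v], of c] by simp
    show "\<bar>c * ell v u\<bar> \<le> \<bar>c\<bar> * nV v * N1 u" for u
      unfolding abs_mult mult.assoc using ell_le[OF v] by (intro mult_left_mono) auto
  qed
qed (simp add: ell_cut v vlin_scale[OF lvm_vlin[OF D_lvm] v])

lemma clamp_bcontfun:
  "\<exists>h :: 'x \<Rightarrow>\<^sub>C real. \<forall>x. apply_bcontfun h x = max (- e) (min e (apply_bcontfun g x - c))"
proof -
  have "(\<lambda>x. max (- e) (min e (apply_bcontfun g x - c))) \<in> bcontfun"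
  proof (rule bcontfun_normI)
    show "continuous_on UNIV (\<lambda>x. max (- e) (min e (apply_bcontfun g x - c)))"
      by (intro continuous_intros continuous_on_apply_bcontfun continuous_on_id)
    show "norm (max (- e) (min e (apply_bcontfun g x - c))) \<le> \<bar>e\<bar>" for x by (auto simp: max_def min_def)
  qed
  then show ?thesis using Bcontfun_inverse by metis
qed

text \<open>Where \<open>|g - c| < e\<close> the module elements \<open>g v\<close> and \<open>c v\<close> differ, up to locality, by the product
  of \<open>v\<close> with a function bounded by \<open>e\<close>.\<close>

lemma D_smult_approx:
  assumes f: "f \<in> W12 m" and v: "v \<in> CV" and B: "B \<in> sets borel" and "0 < e"
    and g: "\<And>x. x \<in> B \<Longrightarrow> \<bar>apply_bcontfun g x - c\<bar> < e"
  shows "\<bar>D f B (g \<odot> v) - c * D f B v\<bar> \<le> e * (nV v * N1 (cut B (d f)))"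
proof -
  obtain h :: "'x \<Rightarrow>\<^sub>C real" where h: "\<And>x. apply_bcontfun h x = max (- e) (min e (apply_bcontfun g x - c))"
    using clamp_bcontfun by blast
  define k where "k = g - const_bcontfun c - h"
  have k: "apply_bcontfun k x = apply_bcontfun g x - c - apply_bcontfun h x" for x
    unfolding k_def by (simp add: minus_bcontfun.rep_eq const_bcontfun.rep_eq)
  have "g = const_bcontfun c + (k + h)" unfolding k_def by simp
  then have gv: "g \<odot> v = vscale V c v \<oplus> (k \<odot> v \<oplus> h \<odot> v)"
    by (metis smult_plus[OF v])
  define U where "U = {x. \<bar>apply_bcontfun g x - c\<bar> < e}"
  have U: "open U" unfolding U_def
    by (intro open_Collect_less continuous_intros continuous_on_apply_bcontfun continuous_on_id)
  \<comment> \<open>On U the truncation h coincides with g - c, so k vanishes there and every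
    function supported in U annihilates k v. Locality then removes k v from all Borel subsets of
    U.\<close>
  have "vnorm_on V U (k \<odot> v) = 0"
  proof (rule vnorm_on_0I[OF smult_CV[OF v]])
    fix p :: "'x \<Rightarrow>\<^sub>C real" assume p: "supp p \<subseteq> U"
    have "cb_mult p k = 0"
    proof (rule bcontfun_eqI)
      fix x
      have "apply_bcontfun k x = 0" if "apply_bcontfun p x \<noteq> 0"
      proof -
        have "x \<in> supp p" unfolding supp_def using that by (intro subsetD[OF closure_subset]) simp
        then show ?thesis using p unfolding k h U_def by (auto simp: max_def min_def abs_less_iff)
      qed
      then show "apply_bcontfun (cb_mult p k) x = apply_bcontfun 0 x" by (cases "apply_bcontfun p x = 0") (simp_all add: zero_bcontfun.rep_eq)
    qed
    then show "p \<odot> (k \<odot> v) = \<zero>" using smult_mult[OF v, of p k] by (simp add: zero_smult[OF v])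
  qed
  then have k0: "D f B (k \<odot> v) = 0"
    by (rule lvm_local_borel[OF D_lvm[OF f] smult_CV[OF v] U _ B]) (use g in \<open>auto simp: U_def\<close>)
  have "D f B (g \<odot> v) = c * D f B v + (D f B (k \<odot> v) + D f B (h \<odot> v))"
    unfolding gv using lvm_vlin[OF D_lvm[OF f] B] v by (simp add: vlin_add vlin_scale)
  then have "\<bar>D f B (g \<odot> v) - c * D f B v\<bar> = \<bar>D f B (h \<odot> v)\<bar>" using k0 by simp
  also have "\<dots> \<le> nV (h \<odot> v) * N1 (cut B (d f))" by (rule D_bound[OF f B smult_CV[OF v]])
  also have "\<dots> \<le> (e * nV v) * N1 (cut B (d f))"
  proof (rule mult_right_mono)
    have "norm h \<le> e" using \<open>0 < e\<close> by (intro norm_bound) (auto simp: h max_def min_def)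
    have "nV (h \<odot> v) \<le> norm h * nV v" by (rule nV_smult[OF v])
    also have "\<dots> \<le> e * nV v" using \<open>norm h \<le> e\<close> nV_nonneg[OF v] by (rule mult_right_mono)
    finally show "nV (h \<odot> v) \<le> e * nV v" .
  qed simp
  finally show ?thesis by (simp add: mult.assoc)
qed

text \<open>On a level set of g both sides are within e times \<open>N1\<close> of c j times the
  value at v: the left one by domination, the right one by locality. The errors add up over the
  level sets because \<open>N1\<close> is additive over disjoint cuts.\<close>

lemma ell_smult:
  assumes v: "v \<in> CV" shows "ell (g \<odot> v) u = ell v (act (apply_bcontfun g) u)"
proof -
  have gL: "apply_bcontfun g \<in> Linf m" by simp
  have "ell (g \<odot> v) = (\<lambda>u. ell v (act (apply_bcontfun g) u))"
  proof (rule ell_eqI[OF smult_CV[OF v]])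
    show "bdf (norm g * nV v) (\<lambda>u. ell v (act (apply_bcontfun g) u))"
      unfolding bdf_def
    proof (intro conjI allI)
      show "linear (\<lambda>u. ell v (act (apply_bcontfun g) u))"
        using linear_compose[OF linear_act[OF gL] ell_linear[OF v]] by (simp add: o_def)
      fix u
      have "\<bar>ell v (act (apply_bcontfun g) u)\<bar> \<le> nV v * N1 (act (apply_bcontfun g) u)" by (rule ell_le[OF v])
      also have "\<dots> \<le> nV v * (norm g * N1 u)"
        by (intro mult_left_mono nV_nonneg[OF v] N1_act_le bcontfun_borel bcontfun_abs_le)
      finally show "\<bar>ell v (act (apply_bcontfun g) u)\<bar> \<le> norm g * nV v * N1 u" by (simp add: mult_ac)
    qed
    fix A :: "'x set" and f assume A: "A \<in> sets borel" and f: "f \<in> W12 m"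
    show "ell v (act (apply_bcontfun g) (cut A (d f))) = D f A (g \<odot> v)"
    proof (rule real_eq_of_small)
      fix e :: real assume "e > 0"
      \<comment> \<open>\<open>finite_level_sets\<close> yields a weak inequality and
        \<open>D_smult_approx\<close> asks for a strict one, hence levels of width e / 2.\<close>
      then have e2: "e / 2 > 0" "e / 2 < e" by auto
      obtain J :: "int set" and B c where J: "finite J" "\<And>j. B j \<in> sets borel" "disjoint_family_on B J"
          "(\<Union>j\<in>J. B j) = UNIV" "\<And>j x. x \<in> B j \<Longrightarrow> \<bar>apply_bcontfun g x - c j\<bar> \<le> e / 2"
        by (rule finite_level_sets[OF bcontfun_borel bcontfun_abs_le e2(1), of g]) (rule that)
      have AB: "A \<inter> B j \<in> sets borel" for j by (intro sets.Int A J(2))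
      have dAB: "disjoint_family_on (\<lambda>j. A \<inter> B j) J" using J(3) unfolding disjoint_family_on_def by blast
      have UAB: "(\<Union>j\<in>J. A \<inter> B j) = A" using J(4) by blast
      define h where "h j = cut (A \<inter> B j) (d f)" for j
      have eq1: "D f A (g \<odot> v) = (\<Sum>j\<in>J. D f (A \<inter> B j) (g \<odot> v))"
        using lvm_UN[OF D_lvm[OF f] smult_CV[OF v] J(1) AB dAB, of g] unfolding UAB .
      have "cut A (d f) = (\<Sum>j\<in>J. h j)" unfolding h_def using cut_UN[OF J(1) AB dAB, of "d f"] unfolding UAB .
      then have eq2: "ell v (act (apply_bcontfun g) (cut A (d f))) = (\<Sum>j\<in>J. ell v (act (apply_bcontfun g) (h j)))"
        by (simp add: linear_sum[OF linear_act[OF gL]] linear_sum[OF ell_linear[OF v]])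
      have eq3: "(\<Sum>j\<in>J. N1 (h j)) = N1 (cut A (d f))"
        using N1_cut_UN[OF J(1) AB dAB, of "d f"] unfolding UAB h_def by simp
      have each: "\<bar>ell v (act (apply_bcontfun g) (h j)) - D f (A \<inter> B j) (g \<odot> v)\<bar> \<le> 2 * (e * (nV v * N1 (h j)))" for j
      proof -
        have 1: "\<bar>D f (A \<inter> B j) (g \<odot> v) - c j * D f (A \<inter> B j) v\<bar> \<le> e * (nV v * N1 (h j))"
          unfolding h_def
          by (rule D_smult_approx[OF f v AB \<open>e > 0\<close>]) (use J(5) e2(2) in fastforce)
        \<comment> \<open>g - c j is small only on the j-th level set; multiplying by its indicator
          makes it small everywhere without changing the action on \<open>h j\<close>.\<close>
        define q :: "'x \<Rightarrow> real" where "q x = (apply_bcontfun g x - c j) * indicat_real (A \<inter> B j) x" for x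
        have qL: "(\<lambda>x. apply_bcontfun g x - c j) \<in> Linf m" by simp
        have qb: "q \<in> borel_measurable borel" unfolding q_def[abs_def]
          using AB by (intro borel_measurable_times borel_measurable_diff bcontfun_borel) auto
        have "act q (h j) = act (\<lambda>x. apply_bcontfun g x - c j) (cut (A \<inter> B j) (h j))"
          unfolding q_def[abs_def] cut_def by (rule act_times[OF qL]) (rule Linf_indicator[OF AB])
        also have "cut (A \<inter> B j) (h j) = h j" unfolding h_def using AB by (simp add: cut_cut)
        also have "act (\<lambda>x. apply_bcontfun g x - c j) (h j) = act (apply_bcontfun g) (h j) - c j *\<^sub>R h j"
          by (simp add: act_diff act_const)
        finally have q: "act q (h j) = act (apply_bcontfun g) (h j) - c j *\<^sub>R h j" .
        have qe: "\<bar>q x\<bar> \<le> e" for x using J(5)[of x j] \<open>e > 0\<close> by (auto simp: q_def indicator_def)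
        have "\<bar>ell v (act q (h j))\<bar> \<le> nV v * N1 (act q (h j))" by (rule ell_le[OF v])
        also have "\<dots> \<le> nV v * (e * N1 (h j))" by (intro mult_left_mono nV_nonneg[OF v] N1_act_le qb qe)
        finally have 2: "\<bar>ell v (act (apply_bcontfun g) (h j)) - c j * ell v (h j)\<bar> \<le> e * (nV v * N1 (h j))"
          unfolding q by (simp add: linear_diff[OF ell_linear[OF v]] linear_scale[OF ell_linear[OF v]] mult_ac)
        have 3: "ell v (h j) = D f (A \<inter> B j) v" unfolding h_def by (rule ell_cut[OF v AB f])
        show ?thesis using 1 2 unfolding 3 by argo
      qed
      have "\<bar>ell v (act (apply_bcontfun g) (cut A (d f))) - D f A (g \<odot> v)\<bar>
          \<le> (\<Sum>j\<in>J. \<bar>ell v (act (apply_bcontfun g) (h j)) - D f (A \<inter> B j) (g \<odot> v)\<bar>)"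
        unfolding eq1 eq2 sum_subtractf[symmetric] by (rule sum_abs)
      also have "\<dots> \<le> (\<Sum>j\<in>J. 2 * (e * (nV v * N1 (h j))))" by (rule sum_mono[OF each])
      also have "\<dots> = e * (2 * (nV v * N1 (cut A (d f))))"
        unfolding eq3[symmetric] sum_distrib_left by (rule sum.cong) auto
      finally show "\<bar>ell v (act (apply_bcontfun g) (cut A (d f))) - D f A (g \<odot> v)\<bar> \<le> e * (2 * (nV v * N1 (cut A (d f))))" .
    qed
  qed
  then show ?thesis by simp
qed

end

section \<open>Norm attainment: \<open>N1\<close> as a supremum over the unit ball of V\<close>

context cb_module
begin

text \<open>The axiom on disjoint supports for two summands, the only form in which the lower bound
  of \<open>N1\<close> uses it.\<close>

lemma nV_disjoint_sum:
  assumes v: "v \<in> CV" "w \<in> CV" "nV v \<le> 1" "nV w \<le> 1" and f: "norm f \<le> 1" "norm g \<le> 1" "supp f \<inter> supp g = {}"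
  shows "nV (f \<odot> v \<oplus> g \<odot> w) \<le> 1"
proof -
  interpret Module.module Cb V by (rule module_V)
  define F where "F i = (if i = 0 then f else g)" for i :: nat
  define U where "U i = (if i = 0 then v else w)" for i :: nat
  have two: "{..<2} = {0, 1 :: nat}" by auto
  have "finsum V (\<lambda>i. F i \<odot> U i) {..<2} = f \<odot> v \<oplus> g \<odot> w"
    unfolding two by (subst M.finsum_insert) (auto simp: F_def U_def v M.finsum_insert M.r_zero)
  moreover have "nV (finsum V (\<lambda>i. F i \<odot> U i) {..<2}) \<le> (MAX i\<in>{..<2}. norm (F i)) * (MAX i\<in>{..<2}. nV (U i))"
    by (rule nV_finsum) (use v f in \<open>auto simp: U_def F_def disjoint_family_on_def\<close>)
  moreover have "(MAX i\<in>{..<2}. norm (F i)) \<le> 1" "(MAX i\<in>{..<2}. nV (U i)) \<le> 1"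
    unfolding two using v f by (auto simp: F_def U_def)
  moreover have "0 \<le> (MAX i\<in>{..<2}. nV (U i))"
    unfolding two using nV_nonneg[OF v(1)] by (auto simp: U_def le_max_iff_disj)
  ultimately show ?thesis using mult_mono[of "MAX i\<in>{..<2}. norm (F i)" 1 "MAX i\<in>{..<2}. nV (U i)" 1] by simp
qed

end

context couple
begin

lemma ell_bartle:
  fixes g :: "'x \<Rightarrow> real"
  assumes f: "f \<in> W12 m" and A: "A \<in> sets borel" and g: "g \<in> borel_measurable borel" "\<And>x. \<bar>g x\<bar> \<le> C" and v: "v \<in> CV"
  shows "bartle V (D f) g A v = ell v (cut A (act g (d f)))"
  by (rule bartle_functional[OF normed D_lvm[OF f] v ell_bdf[OF v] _ A g]) (simp add: ell_cut[OF v _ f])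

text \<open>Measures in the generated module act through a vector u of the cotangent module, a
  C_b-combination of differentials; (ii) thereby becomes a statement about the functionals
  \<open>ell v\<close>.\<close>

lemma generated_ell:
  assumes "N \<in> generated_module m V D"
  obtains u where "\<And>A v. A \<in> sets borel \<Longrightarrow> v \<in> CV \<Longrightarrow> N A v = ell v (cut A u)"
proof -
  obtain n and g :: "nat \<Rightarrow> 'x \<Rightarrow>\<^sub>C real" and f where f: "\<forall>i<n. f i \<in> W12 m"
    and N: "N = (\<lambda>A v. \<Sum>i<n. bartle V (D (f i)) (apply_bcontfun (g i)) A v)"
    using assms unfolding generated_module_def by blast
  have "N A v = ell v (cut A (\<Sum>i<n. act (apply_bcontfun (g i)) (d (f i))))" if A: "A \<in> sets borel" and v: "v \<in> CV" for A v
  proof -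
    have "bartle V (D (f i)) (apply_bcontfun (g i)) A v = ell v (cut A (act (apply_bcontfun (g i)) (d (f i))))" if "i < n" for i
      by (rule ell_bartle[OF _ A bcontfun_borel bcontfun_abs_le v]) (use f that in blast)
    then show ?thesis unfolding N by (simp add: linear_sum[OF linear_cut[OF A]] linear_sum[OF ell_linear[OF v]])
  qed
  then show ?thesis by (rule that)
qed

text \<open>The seminorm dual to the unit ball of V. It lies below \<open>N1\<close> by
  construction; the aim is equality.\<close>

definition ell_sup :: "'c \<Rightarrow> real" where
  "ell_sup u = (SUP v\<in>{v \<in> CV. nV v \<le> 1}. ell v u)"

lemma unit_ball_nonempty: "{v \<in> CV. nV v \<le> 1} \<noteq> {}"
  using zero_CV nV_zero by fastforce

lemma ell_unit_le: "v \<in> CV \<Longrightarrow> nV v \<le> 1 \<Longrightarrow> ell v u \<le> N1 u"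
proof -
  assume v: "v \<in> CV" "nV v \<le> 1"
  have "nV v * N1 u \<le> 1 * N1 u" using v(2) by (rule mult_right_mono) simp
  then show ?thesis using ell_le[OF v(1), of u] by simp
qed

lemma ell_bdd: "bdd_above ((\<lambda>v. ell v u) ` {v \<in> CV. nV v \<le> 1})"
  by (rule bdd_aboveI[of _ "N1 u"]) (auto intro: ell_unit_le)

lemma ell_le_sup: "v \<in> CV \<Longrightarrow> nV v \<le> 1 \<Longrightarrow> ell v u \<le> ell_sup u"
  unfolding ell_sup_def by (rule cSUP_upper[OF _ ell_bdd]) simp

lemma ell_sup_least: "(\<And>v. v \<in> CV \<Longrightarrow> nV v \<le> 1 \<Longrightarrow> ell v u \<le> C) \<Longrightarrow> ell_sup u \<le> C"
  unfolding ell_sup_def by (rule cSUP_least[OF unit_ball_nonempty]) simp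

lemma ell_sup_approx:
  assumes "e > 0" obtains v where "v \<in> CV" "nV v \<le> 1" "ell_sup u - e < ell v u"
proof -
  have "ell_sup u - e < (SUP v\<in>{v \<in> CV. nV v \<le> 1}. ell v u)" unfolding ell_sup_def using assms by simp
  then obtain v where "v \<in> {v \<in> CV. nV v \<le> 1}" "ell_sup u - e < ell v u"
    unfolding less_cSUP_iff[OF unit_ball_nonempty ell_bdd] by blast
  then show ?thesis by (intro that[of v]) auto
qed

lemma ell_zero: "ell \<zero> u = 0"
  using ell_le[OF zero_CV, of u] by simp

lemma abs_ell_le_sup:
  assumes v: "v \<in> CV" shows "\<bar>ell v u\<bar> \<le> ell_sup u * nV v"
proof (cases "nV v = 0")
  case True
  then show ?thesis using ell_le[OF v, of u] by simp
next
  case False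
  then have pos: "0 < nV v" using nV_nonneg[OF v] by simp
  have le: "c * ell v u \<le> ell_sup u" if "\<bar>c\<bar> = 1 / nV v" for c
  proof -
    have "nV (vscale V c v) \<le> 1" unfolding nV_scale[OF v] that using pos by simp
    from ell_le_sup[OF smult_CV[OF v] this, of u] show ?thesis by (simp add: ell_scale[OF v])
  qed
  have "ell v u / nV v \<le> ell_sup u" "(- ell v u) / nV v \<le> ell_sup u"
    using le[of "1 / nV v"] le[of "- 1 / nV v"] pos by simp_all
  then show ?thesis unfolding pos_divide_le_eq[OF pos] by (simp add: abs_le_iff)
qed

lemma ell_sup_nonneg: "0 \<le> ell_sup u"
  using ell_le_sup[OF zero_CV, of u] by (simp add: ell_zero)

lemma ell_sup_triangle: "ell_sup (u + h) \<le> ell_sup u + N1 h"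
proof (rule ell_sup_least)
  fix v assume v: "v \<in> CV" "nV v \<le> 1"
  show "ell v (u + h) \<le> ell_sup u + N1 h"
    unfolding linear_add[OF ell_linear[OF v(1)]] by (intro add_mono ell_le_sup ell_unit_le v)
qed

text \<open>Take nearly optimal v for the cut to A and w for the cut to the complement, and multiply
  them by cutoffs with disjoint supports, close to 1 on A and on the complement. Their sum stays in
  the unit ball and nearly attains both suprema.\<close>

lemma ell_sup_split:
  assumes A: "A \<in> sets borel"
  shows "ell_sup (cut A y) + ell_sup (cut (- A) y) \<le> ell_sup y"
proof (rule field_le_epsilon)
  fix e :: real assume "e > 0"
  \<comment> \<open>The choices of v and w lose e / 8 each, the two cutoffs 2 e / 8 each.\<close>
  then have e8: "e / 8 > 0" by simp
  have A': "- A \<in> sets borel" using A by (rule borel_comp)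
  obtain v where v: "v \<in> CV" "nV v \<le> 1" "ell_sup (cut A y) - e / 8 < ell v (cut A y)" by (rule ell_sup_approx[OF e8])
  obtain w where w: "w \<in> CV" "nV w \<le> 1" "ell_sup (cut (- A) y) - e / 8 < ell w (cut (- A) y)" by (rule ell_sup_approx[OF e8])
  obtain K where K: "compact K" "K \<subseteq> A" "K \<in> sets borel" "N1 (cut (A - K) y) < e / 8"
    by (rule compact_approx_N1[OF A e8])
  obtain L where L: "compact L" "L \<subseteq> - A" "L \<in> sets borel" "N1 (cut (- A - L) y) < e / 8"
    by (rule compact_approx_N1[OF A' e8])
  have "K \<inter> L = {}" using K(2) L(2) by blast
  then obtain f :: "'x \<Rightarrow>\<^sub>C real" where f: "\<And>x. 0 \<le> apply_bcontfun f x" "\<And>x. apply_bcontfun f x \<le> 1" "norm f \<le> 1"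
      "\<And>x. x \<in> K \<Longrightarrow> apply_bcontfun f x = 1" "supp f \<inter> L = {}" "\<And>x. x \<in> L \<Longrightarrow> apply_bcontfun f x = 0"
    by (rule bump_between[OF K(1) compact_imp_closed[OF L(1)]]) (rule that)
  \<comment> \<open>The second cutoff is separated from the whole support of the first, which
    contains K; so the supports are disjoint and g vanishes on K.\<close>
  have "closed (supp f)" "L \<inter> supp f = {}" using f(5) by (auto simp: supp_def)
  then obtain g :: "'x \<Rightarrow>\<^sub>C real" where g: "\<And>x. 0 \<le> apply_bcontfun g x" "\<And>x. apply_bcontfun g x \<le> 1" "norm g \<le> 1"
      "\<And>x. x \<in> L \<Longrightarrow> apply_bcontfun g x = 1" "supp g \<inter> supp f = {}" "\<And>x. x \<in> supp f \<Longrightarrow> apply_bcontfun g x = 0"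
    by (rule bump_between[OF L(1)]) (rule that)
  have gK: "apply_bcontfun g x = 0" if "x \<in> K" for x
    using f(4)[OF that] by (intro g(6)) (auto simp: supp_def intro!: subsetD[OF closure_subset])
  have 1: "N1 (cut A y - act (apply_bcontfun f) y) \<le> N1 (cut (A - K) y) + N1 (cut (- A - L) y)"
    by (rule N1_cut_minus_act[OF A K(3,2) L(3,2) f(1,2,4,6)])
  have 2: "N1 (cut (- A) y - act (apply_bcontfun g) y) \<le> N1 (cut (- A - L) y) + N1 (cut (- (- A) - K) y)"
    by (rule N1_cut_minus_act[OF A' L(3,2) K(3) _ g(1,2,4) gK]) (use K(2) in simp_all)
  have 3: "ell v (cut A y) - ell v (act (apply_bcontfun f) y) \<le> N1 (cut A y - act (apply_bcontfun f) y)"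
    using ell_unit_le[OF v(1,2), of "cut A y - act (apply_bcontfun f) y"] by (simp add: linear_diff[OF ell_linear[OF v(1)]])
  have 4: "ell w (cut (- A) y) - ell w (act (apply_bcontfun g) y) \<le> N1 (cut (- A) y - act (apply_bcontfun g) y)"
    using ell_unit_le[OF w(1,2), of "cut (- A) y - act (apply_bcontfun g) y"] by (simp add: linear_diff[OF ell_linear[OF w(1)]])
  define u where "u = f \<odot> v \<oplus> g \<odot> w"
  have u: "u \<in> CV" "nV u \<le> 1"
    unfolding u_def using v w nV_disjoint_sum[OF v(1) w(1) v(2) w(2) f(3) g(3)] g(5) by (simp_all add: Int_commute)
  have 5: "ell v (act (apply_bcontfun f) y) + ell w (act (apply_bcontfun g) y) \<le> ell_sup y"
    using ell_le_sup[OF u, of y] unfolding u_def by (simp add: ell_add v(1) w(1) ell_smult)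
  have "- (- A) - K = A - K" by blast
  then show "ell_sup (cut A y) + ell_sup (cut (- A) y) \<le> ell_sup y + e"
    using 1 2 3 4 5 v(3) w(3) K(4) L(4) \<open>e > 0\<close> by simp
qed

lemma ell_sup_UN:
  assumes "finite P" "P \<subseteq> sets borel" "disjoint P"
  shows "(\<Sum>B\<in>P. ell_sup (cut B u)) \<le> ell_sup (cut (\<Union>P) u)"
  using assms
proof (induction P rule: finite_induct)
  case (insert B P)
  have B: "B \<in> sets borel" and U: "\<Union>P \<in> sets borel" using insert.prems(1) insert.hyps(1) by (auto intro: sets.finite_Union)
  have dis: "B \<inter> \<Union>P = {}" using insert.prems(2) insert.hyps(2) by (auto simp: disjoint_def)
  have s: "B \<inter> (B \<union> \<Union>P) = B" "- B \<inter> (B \<union> \<Union>P) = \<Union>P" using dis by blast+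
  have "disjoint P" using insert.prems(2) by (auto simp: disjoint_def)
  then have "(\<Sum>C\<in>insert B P. ell_sup (cut C u)) \<le> ell_sup (cut B u) + ell_sup (cut (\<Union>P) u)"
    using insert by simp
  also have "\<dots> \<le> ell_sup (cut (B \<union> \<Union>P) u)"
    using ell_sup_split[OF B, of "cut (B \<union> \<Union>P) u"] unfolding cut_cut[OF B sets.Un[OF B U]] cut_cut[OF borel_comp[OF B] sets.Un[OF B U]] s .
  finally show ?case by simp
qed (simp add: ell_sup_nonneg)

text \<open>Each term of a partition sum in the total variation of D f is at most
  \<open>ell_sup\<close> of the corresponding cut, and superadditivity collects the terms. This is
  the lower estimate contained in (i).\<close>

lemma ell_sup_cut_d:
  assumes f: "f \<in> W12 m" and A: "A \<in> sets borel"
  shows "N1 (cut A (d f)) \<le> ell_sup (cut A (d f))"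
proof -
  have dn: "dnorm V (D f B) \<le> ell_sup (cut B (d f))" if B: "B \<in> sets borel" for B
  proof (rule dnorm_le[OF ell_sup_nonneg])
    show "\<bar>D f B v\<bar> \<le> ell_sup (cut B (d f)) * nV v" if "v \<in> CV" for v
      using abs_ell_le_sup[OF that, of "cut B (d f)"] unfolding ell_cut[OF that B f] .
  qed
  have "ennreal (N1 (cut A (d f))) \<le> ennreal (ell_sup (cut A (d f)))"
    unfolding D_total_variation[OF f A, symmetric] total_variation_def
  proof (rule SUP_least)
    fix P assume "P \<in> {P. finite P \<and> partition_on A P \<and> P \<subseteq> sets borel}"
    then have P: "finite P" "P \<subseteq> sets borel" "disjoint P" "\<Union>P = A" by (auto simp: partition_on_def)
    have "(\<Sum>B\<in>P. ennreal (dnorm V (D f B))) \<le> (\<Sum>B\<in>P. ennreal (ell_sup (cut B (d f))))"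
      by (intro sum_mono ennreal_leI dn) (use P(2) in blast)
    also have "\<dots> = ennreal (\<Sum>B\<in>P. ell_sup (cut B (d f)))" by (rule sum_ennreal) (rule ell_sup_nonneg)
    also have "\<dots> \<le> ennreal (ell_sup (cut A (d f)))"
      using ell_sup_UN[OF P(1-3), of "d f"] unfolding P(4) by (rule ennreal_leI)
    finally show "(\<Sum>B\<in>P. ennreal (dnorm V (D f B))) \<le> ennreal (ell_sup (cut A (d f)))" .
  qed
  then show ?thesis by (simp add: ell_sup_nonneg)
qed

text \<open>Same recursion as in \<open>Dsum_bound\<close>, with the additivity of \<open>N1\<close>
  on one side and the superadditivity of \<open>ell_sup\<close> on the other.\<close>

lemma ell_sup_csum:
  "admissible xs \<Longrightarrow> B \<in> sets borel \<Longrightarrow> f \<in> W12 m \<Longrightarrow> N1 (cut B (d f) + csum xs B) \<le> ell_sup (cut B (d f) + csum xs B)"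
proof (induction xs arbitrary: B f)
  case Nil
  then show ?case by (simp add: ell_sup_cut_d)
next
  case (Cons p xs)
  obtain A g where p: "p = (A, g)" by (cases p)
  have A: "A \<in> sets borel" and g: "g \<in> W12 m" and xs: "admissible xs" using Cons.prems(1) unfolding p by auto
  note B = Cons.prems(2) and f = Cons.prems(3)
  define h where "h = cut B (d f) + csum (p # xs) B"
  have BA: "B \<inter> A \<in> sets borel" "B - A \<in> sets borel" using A B by auto
  note 1 = csum_step(1)[OF A g xs B f, folded p, folded h_def]
    and 2 = csum_step(2)[OF A g xs B f, folded p, folded h_def]
    and 3 = csum_step(3)[OF A g xs B f, folded p, folded h_def]
  have "B \<inter> A \<union> (B - A) = B" "B \<inter> A \<inter> (B - A) = {}" by blast+
  then have "N1 h = N1 (cut (B \<inter> A) h) + N1 (cut (B - A) h)"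
    using N1_cut_split[OF BA, of h] 3 by simp
  also have "\<dots> \<le> ell_sup (cut (B \<inter> A) h) + ell_sup (cut (B - A) h)"
    unfolding 1 2 by (intro add_mono Cons.IH xs BA W12_add f g)
  also have "\<dots> = ell_sup (cut A h) + ell_sup (cut (- A) h)"
  proof -
    have "cut A h = cut (A \<inter> B) h" "cut (- A) h = cut (- A \<inter> B) h"
      using cut_cut[OF A B, of h] cut_cut[OF borel_comp[OF A] B, of h] unfolding 3 by simp_all
    moreover have "A \<inter> B = B \<inter> A" "- A \<inter> B = B - A" by blast+
    ultimately show ?thesis by simp
  qed
  also have "\<dots> \<le> ell_sup h" by (rule ell_sup_split[OF A])
  finally show ?case unfolding h_def .
qed

lemma N1_le_ell_sup: "N1 u \<le> ell_sup u"
proof (rule field_le_epsilon)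
  fix e :: real assume "e > 0"
  then have e2: "e / 2 > 0" by simp
  obtain h where h: "h \<in> {csum xs UNIV | xs. admissible xs}" and 1: "N1 (u - h) < e / 2"
    by (rule N1_closure_approx[OF csum_dense e2])
  then obtain xs where xs: "admissible xs" "h = csum xs UNIV" by blast
  have "d (\<lambda>x. 0) = 0" using d_scale[OF W12_zero, of 0] by simp
  then have 2: "N1 h \<le> ell_sup h"
    using ell_sup_csum[OF xs(1) _ W12_zero, of UNIV] unfolding xs(2) by simp
  have "ell_sup h \<le> ell_sup u + N1 (h - u)" using ell_sup_triangle[of u "h - u"] by simp
  moreover have "N1 u \<le> N1 h + N1 (u - h)" using N1_triangle[of h "u - h"] by simp
  moreover have "N1 (h - u) = N1 (u - h)" by (rule N1_diff_commute)
  ultimately show "N1 u \<le> ell_sup u + e" using 1 2 by linarith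
qed

lemma N1_le_of_ell: "(\<And>v. v \<in> CV \<Longrightarrow> ell v u \<le> C * nV v) \<Longrightarrow> 0 \<le> C \<Longrightarrow> N1 u \<le> C"
proof (rule order_trans[OF N1_le_ell_sup], rule ell_sup_least)
  fix v assume le: "\<And>v. v \<in> CV \<Longrightarrow> ell v u \<le> C * nV v" "0 \<le> C" and v: "v \<in> CV" "nV v \<le> 1"
  have "C * nV v \<le> C * 1" using v(2) le(2) by (rule mult_left_mono)
  then show "ell v u \<le> C" using le(1)[OF v(1)] by simp
qed

text \<open>A generated measure of total variation at most 1 acts by a vector u, and its value on
  the whole space has dual norm at most 1; hence u has \<open>N1\<close> at most 1 by
  \<open>N1_le_of_ell\<close>, and the measure at v is at most C. Condition (ii) expresses the norm
  of v by such values.\<close>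

lemma nV_le_of_bdf:
  assumes v: "v \<in> CV" and C: "bdf C (ell v)" "0 \<le> C" shows "nV v \<le> C"
proof -
  have eq: "nV v = (SUP N \<in> {N \<in> generated_module m V D. total_variation V N UNIV \<le> 1}. N UNIV v)"
    using couple[unfolded differential_couple_def, THEN conjunct2, THEN conjunct2, THEN conjunct2, THEN conjunct1] v by (rule bspec)
  show ?thesis
    unfolding eq
  proof (rule cSUP_least)
    have z: "(\<lambda>A v. 0) \<in> generated_module m V D"
      unfolding generated_module_def by (intro CollectI exI[of _ 0]) simp
    have "dnorm V (\<lambda>v. 0) = 0" using dnorm_le[of 0 "\<lambda>v. 0"] dnorm_nonneg[OF vlin_0] by simp
    then have "total_variation V (\<lambda>A v. 0) UNIV \<le> 1" unfolding total_variation_def by (intro SUP_least) simp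
    with z show "{N \<in> generated_module m V D. total_variation V N UNIV \<le> 1} \<noteq> {}" by blast
    fix N assume N: "N \<in> {N \<in> generated_module m V D. total_variation V N UNIV \<le> 1}"
    obtain u where u: "\<And>A v. A \<in> sets borel \<Longrightarrow> v \<in> CV \<Longrightarrow> N A v = ell v (cut A u)"
      using generated_ell[of N] N by blast
    have NU: "N UNIV w = ell w u" if "w \<in> CV" for w using u[OF _ that, of UNIV] by simp
    have lin: "vlin (N UNIV)"
      by (rule vlinI[where C = "N1 u"]) (simp_all add: NU ell_add ell_scale ell_le mult.commute)
    have "ennreal (dnorm V (N UNIV)) \<le> total_variation V N UNIV" by (rule dnorm_le_total_variation) simp_all
    also have "\<dots> \<le> 1" using N by simp
    finally have dn: "dnorm V (N UNIV) \<le> 1" by simp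
    have "N1 u \<le> 1"
    proof (rule N1_le_of_ell)
      show "ell w u \<le> 1 * nV w" if w: "w \<in> CV" for w
      proof -
        have "dnorm V (N UNIV) * nV w \<le> 1 * nV w" using dn nV_nonneg[OF w] by (rule mult_right_mono)
        then show ?thesis using dnorm_bound[OF lin w] NU[OF w] by linarith
      qed
    qed simp
    then have "C * N1 u \<le> C * 1" using C(2) by (rule mult_left_mono)
    then show "N UNIV v \<le> C" using bdf_le[OF C(1), of u] NU[OF v] by linarith
  qed
qed

lemma ell_inj:
  assumes v: "v \<in> CV" "w \<in> CV" and eq: "ell v = ell w" shows "v = w"
proof (rule eq_of_add_minus[OF v])
  have u: "v \<oplus> vscale V (- 1) w \<in> CV" using v by simp
  have "ell (v \<oplus> vscale V (- 1) w) = (\<lambda>y. 0)" using v by (simp add: ell_add ell_scale eq)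
  then have "bdf 0 (ell (v \<oplus> vscale V (- 1) w))" using ell_linear[OF u] by (simp add: bdf_def)
  then have "nV (v \<oplus> vscale V (- 1) w) \<le> 0" by (rule nV_le_of_bdf[OF u]) simp
  then show "v \<oplus> vscale V (- 1) w = \<zero>" using nV_nonneg[OF u] nV_eq_0[OF u] by simp
qed

end

section \<open>Surjectivity onto the dominated functionals\<close>

context couple
begin

definition ellb :: "'v \<Rightarrow> 'c \<Rightarrow>\<^sub>L real" where
  "ellb v = Blinfun (ell v)"

lemma ellb_apply: "v \<in> CV \<Longrightarrow> blinfun_apply (ellb v) = ell v"
  unfolding ellb_def by (rule bounded_linear_Blinfun_apply) (rule bdf_bounded_linear[OF ell_bdf])

lemma ellb_add: "v \<in> CV \<Longrightarrow> w \<in> CV \<Longrightarrow> ellb (v \<oplus> w) = ellb v + ellb w"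
  by (rule blinfun_eqI) (simp add: ellb_apply ell_add plus_blinfun.rep_eq)

lemma ellb_scale: "v \<in> CV \<Longrightarrow> ellb (vscale V c v) = c *\<^sub>R ellb v"
  by (rule blinfun_eqI) (simp add: ellb_apply ell_scale scaleR_blinfun.rep_eq)

text \<open>Infimal convolution of the norm of V with n times the dual norm. A bound by C for all n
  provides elements of V with norm at most C + 1 whose functionals are within (C + 1) / n of
  x.\<close>

definition inf_conv :: "real \<Rightarrow> ('c \<Rightarrow>\<^sub>L real) \<Rightarrow> real" where
  "inf_conv n x = (INF v\<in>CV. nV v + n * norm (x - ellb v))"

lemma CV_nonempty: "CV \<noteq> {}"
  using zero_CV by blast

lemma inf_conv_bdd: "0 \<le> n \<Longrightarrow> bdd_below ((\<lambda>v. nV v + n * norm (x - ellb v)) ` CV)"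
  by (rule bdd_belowI[of _ 0]) (auto simp: nV_nonneg)

lemma inf_conv_le: "0 \<le> n \<Longrightarrow> v \<in> CV \<Longrightarrow> inf_conv n x \<le> nV v + n * norm (x - ellb v)"
  unfolding inf_conv_def by (rule cINF_lower[OF inf_conv_bdd])

lemma inf_conv_ge: "(\<And>v. v \<in> CV \<Longrightarrow> C \<le> nV v + n * norm (x - ellb v)) \<Longrightarrow> C \<le> inf_conv n x"
  unfolding inf_conv_def by (rule cINF_greatest[OF CV_nonempty])

lemma inf_conv_approx:
  assumes "0 \<le> n" "inf_conv n x < C"
  obtains v where "v \<in> CV" "nV v + n * norm (x - ellb v) < C"
proof -
  obtain v where "v \<in> CV" "nV v + n * norm (x - ellb v) < C"
    using assms(2) unfolding inf_conv_def cINF_less_iff[OF CV_nonempty inf_conv_bdd[OF assms(1)]] by blast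
  then show ?thesis by (rule that)
qed

lemma inf_conv_add:
  assumes n: "0 \<le> n" shows "inf_conv n (x + y) \<le> inf_conv n x + inf_conv n y"
proof (rule field_le_epsilon)
  fix e :: real assume "e > 0"
  then have lt: "inf_conv n x < inf_conv n x + e / 2" "inf_conv n y < inf_conv n y + e / 2" by auto
  obtain v where v: "v \<in> CV" "nV v + n * norm (x - ellb v) < inf_conv n x + e / 2" by (rule inf_conv_approx[OF n lt(1)])
  obtain w where w: "w \<in> CV" "nV w + n * norm (y - ellb w) < inf_conv n y + e / 2" by (rule inf_conv_approx[OF n lt(2)])
  have "inf_conv n (x + y) \<le> nV (v \<oplus> w) + n * norm (x + y - ellb (v \<oplus> w))"
    by (rule inf_conv_le[OF n add_CV[OF v(1) w(1)]])
  also have "x + y - ellb (v \<oplus> w) = (x - ellb v) + (y - ellb w)" by (simp add: ellb_add[OF v(1) w(1)])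
  also have "nV (v \<oplus> w) + n * norm ((x - ellb v) + (y - ellb w))
      \<le> (nV v + nV w) + n * (norm (x - ellb v) + norm (y - ellb w))"
    by (intro add_mono nV_add v(1) w(1) mult_left_mono norm_triangle_ineq n)
  also have "\<dots> = (nV v + n * norm (x - ellb v)) + (nV w + n * norm (y - ellb w))" by (simp add: algebra_simps)
  finally show "inf_conv n (x + y) \<le> inf_conv n x + inf_conv n y + e" using v(2) w(2) by linarith
qed

lemma inf_conv_scale_le:
  assumes n: "0 \<le> n" and c: "0 < c" shows "inf_conv n (c *\<^sub>R x) \<le> c * inf_conv n x"
proof -
  have "inf_conv n (c *\<^sub>R x) / c \<le> inf_conv n x"
  proof (rule inf_conv_ge)
    fix v assume v: "v \<in> CV"
    have "inf_conv n (c *\<^sub>R x) \<le> nV (vscale V c v) + n * norm (c *\<^sub>R x - ellb (vscale V c v))"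
      by (rule inf_conv_le[OF n smult_CV[OF v]])
    also have "\<dots> = c * (nV v + n * norm (x - ellb v))"
      using c by (simp add: nV_scale[OF v] ellb_scale[OF v] algebra_simps flip: scaleR_diff_right)
    finally show "inf_conv n (c *\<^sub>R x) / c \<le> nV v + n * norm (x - ellb v)" using c by (simp add: divide_le_eq mult.commute)
  qed
  then show ?thesis using c by (simp add: divide_le_eq mult.commute)
qed

lemma ellb_zero: "ellb \<zero> = 0"
  by (rule blinfun_eqI) (simp add: ellb_apply ell_zero zero_blinfun.rep_eq)

lemma inf_conv_le_norm: "0 \<le> n \<Longrightarrow> inf_conv n x \<le> n * norm x"
  using inf_conv_le[OF _ zero_CV, of n x] by (simp add: ellb_zero)

lemma inf_conv_nonneg: "0 \<le> n \<Longrightarrow> 0 \<le> inf_conv n x"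
  by (rule inf_conv_ge) (simp add: nV_nonneg)

lemma inf_conv_scale:
  assumes n: "0 \<le> n" and c: "0 \<le> c" shows "inf_conv n (c *\<^sub>R x) = c * inf_conv n x"
proof (cases "c = 0")
  case True
  then show ?thesis using inf_conv_le_norm[OF n, of 0] inf_conv_nonneg[OF n, of 0] by simp
next
  case False
  then have c: "0 < c" using assms(2) by simp
  have "inf_conv n ((1 / c) *\<^sub>R (c *\<^sub>R x)) \<le> 1 / c * inf_conv n (c *\<^sub>R x)" by (rule inf_conv_scale_le[OF n]) (use c in simp)
  then have "c * inf_conv n x \<le> inf_conv n (c *\<^sub>R x)" using c by (simp add: le_divide_eq mult.commute)
  with inf_conv_scale_le[OF n c, of x] show ?thesis by simp
qed

text \<open>By reflexivity a linear functional dominated by \<open>inf_conv n\<close> is the evaluation at some \<open>u\<close>,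
  and \<open>N1 u \<le> 1\<close> because \<open>\<ell>\<^sub>v(u) \<le> \<parallel>v\<parallel>\<close> for all \<open>v\<close>.\<close>

lemma inf_conv_bdf:
  assumes refl: "reflexive_space TYPE('c)" and n: "0 \<le> n" and l: "bdf C l" "0 \<le> C"
  shows "inf_conv n (Blinfun l) \<le> C"
proof -
  define x where "x = Blinfun l"
  have xl: "blinfun_apply x = l" unfolding x_def by (rule bounded_linear_Blinfun_apply[OF bdf_bounded_linear[OF l(1)]])
  obtain F where F: "linear F" "\<And>y. F y \<le> inf_conv n y" "F x = inf_conv n x"
    by (rule hahn_banach_point[of "inf_conv n" x, OF inf_conv_add[OF n] inf_conv_scale[OF n] inf_conv_nonneg[OF n]]) (assumption, rule that)
  \<comment> \<open>Taking the zero element of V in the infimum bounds the gauge by n times the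
    norm, so F is continuous on the dual and reflexivity applies to it.\<close>
  have "\<bar>F y\<bar> \<le> norm y * n" for y
    using F(2)[of y] F(2)[of "- y"] inf_conv_le_norm[OF n, of y] inf_conv_le_norm[OF n, of "- y"] linear_neg[OF F(1), of y]
    by (simp add: abs_le_iff mult.commute)
  then have "bounded_linear F"
    using F(1) by (intro bounded_linear_intro[where K = n]) (simp_all add: linear_add linear_scale)
  then have FB: "blinfun_apply (Blinfun F) = F" by (rule bounded_linear_Blinfun_apply)
  obtain u where u: "\<And>f. F f = blinfun_apply f u"
    using refl[unfolded reflexive_space_def, THEN spec, of "Blinfun F"] unfolding FB by blast
  have "N1 u \<le> 1"
  proof (rule N1_le_of_ell)
    show "ell v u \<le> 1 * nV v" if v: "v \<in> CV" for v
      using u[of "ellb v"] F(2)[of "ellb v"] inf_conv_le[OF n v, of "ellb v"] by (simp add: ellb_apply[OF v])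
  qed simp
  then have "C * N1 u \<le> C * 1" using l(2) by (rule mult_left_mono)
  moreover have "inf_conv n x = l u" using u[of x] F(3) xl by simp
  ultimately show ?thesis unfolding x_def[symmetric] using bdf_le[OF l(1), of u] by linarith
qed

lemma couple_closed:
  assumes "\<And>k. v k \<in> CV" "\<And>k. nV (v k) \<le> C" "\<And>A f. A \<in> sets borel \<Longrightarrow> f \<in> W12 m \<Longrightarrow> convergent (\<lambda>k. D f A (v k))"
  obtains w where "w \<in> CV" "\<And>A f. A \<in> sets borel \<Longrightarrow> f \<in> W12 m \<Longrightarrow> (\<lambda>k. D f A (v k)) \<longlonglongrightarrow> D f A w"
proof -
  have "(\<forall>k. v k \<in> CV) \<and> (\<exists>C. \<forall>k. nV (v k) \<le> C) \<and> (\<forall>A\<in>sets borel. \<forall>f\<in>W12 m. convergent (\<lambda>k. D f A (v k)))"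
    using assms by blast
  with couple[unfolded differential_couple_def, THEN conjunct2, THEN conjunct2, THEN conjunct2, THEN conjunct2, THEN spec, of v]
  obtain w where "w \<in> CV" "\<forall>A\<in>sets borel. \<forall>f\<in>W12 m. (\<lambda>k. D f A (v k)) \<longlonglongrightarrow> D f A w" by blast
  then show ?thesis by (intro that[of w]) blast+
qed

lemma ell_surj:
  assumes refl: "reflexive_space TYPE('c)" and l: "bdf C l"
  obtains v where "v \<in> CV" "ell v = l"
proof -
  define C' where "C' = \<bar>C\<bar>"
  have l': "bdf C' l" "0 \<le> C'" unfolding C'_def using bdf_mono[OF l, of "\<bar>C\<bar>"] by simp_all
  define x where "x = Blinfun l"
  have xl: "blinfun_apply x = l" unfolding x_def by (rule bounded_linear_Blinfun_apply[OF bdf_bounded_linear[OF l]])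
  \<comment> \<open>The strict bound C' + 1 allows an actual v below the infimum; this one
    inequality yields both the uniform norm bound and the rate 1 / Suc k.\<close>
  have "\<exists>v. v \<in> CV \<and> nV v + real (Suc k) * norm (x - ellb v) < C' + 1" for k
  proof -
    have "inf_conv (real (Suc k)) x < C' + 1" using inf_conv_bdf[OF refl _ l', of "real (Suc k)"] unfolding x_def by simp
    then show ?thesis by (rule inf_conv_approx[rotated]) auto
  qed
  then have "\<forall>k. \<exists>v. v \<in> CV \<and> nV v + real (Suc k) * norm (x - ellb v) < C' + 1" ..
  from choice[OF this] obtain v where v: "\<forall>k. v k \<in> CV \<and> nV (v k) + real (Suc k) * norm (x - ellb (v k)) < C' + 1" ..
  have vC: "v k \<in> CV" for k using v by blast
  have n1: "nV (v k) \<le> C' + 1" for k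
  proof -
    have "nV (v k) + real (Suc k) * norm (x - ellb (v k)) < C' + 1" using v by blast
    moreover have "0 \<le> real (Suc k) * norm (x - ellb (v k))" by (intro mult_nonneg_nonneg) auto
    ultimately show ?thesis by linarith
  qed
  have n2: "norm (x - ellb (v k)) \<le> (C' + 1) / real (Suc k)" for k
  proof -
    have "nV (v k) + real (Suc k) * norm (x - ellb (v k)) < C' + 1" using v by blast
    then have "norm (x - ellb (v k)) * real (Suc k) \<le> C' + 1" using nV_nonneg[OF vC, of k] by (simp add: mult.commute)
    then show ?thesis by (subst pos_le_divide_eq) simp_all
  qed
  have lim: "(\<lambda>k. D f A (v k)) \<longlonglongrightarrow> l (cut A (d f))" if A: "A \<in> sets borel" and f: "f \<in> W12 m" for A f
  proof -
    have "(\<lambda>k. (C' + 1) * (1 / real (Suc k)) * norm (cut A (d f))) \<longlonglongrightarrow> (C' + 1) * 0 * norm (cut A (d f))"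
      by (intro tendsto_intros lim_1_over_n[THEN LIMSEQ_Suc])
    then have z: "(\<lambda>k. (C' + 1) * (1 / real (Suc k)) * norm (cut A (d f))) \<longlonglongrightarrow> 0" by simp
    have "norm (D f A (v k) - l (cut A (d f))) \<le> (C' + 1) * (1 / real (Suc k)) * norm (cut A (d f))" for k
    proof -
      have "D f A (v k) - l (cut A (d f)) = - blinfun_apply (x - ellb (v k)) (cut A (d f))"
        by (simp add: minus_blinfun.rep_eq xl ellb_apply[OF vC] ell_cut[OF vC A f])
      then have "norm (D f A (v k) - l (cut A (d f))) \<le> norm (x - ellb (v k)) * norm (cut A (d f))"
        using norm_blinfun[of "x - ellb (v k)" "cut A (d f)"] by simp
      also have "\<dots> \<le> (C' + 1) / real (Suc k) * norm (cut A (d f))" using n2 by (rule mult_right_mono) simp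
      finally show ?thesis by simp
    qed
    then have "(\<lambda>k. D f A (v k) - l (cut A (d f))) \<longlonglongrightarrow> 0"
      by (rule Lim_null_comparison[OF always_eventually z, OF allI])
    then show ?thesis by (simp add: LIM_zero_iff)
  qed
  obtain w where w: "w \<in> CV" "\<And>A f. A \<in> sets borel \<Longrightarrow> f \<in> W12 m \<Longrightarrow> (\<lambda>k. D f A (v k)) \<longlonglongrightarrow> D f A w"
  proof (rule couple_closed[of v, OF vC n1])
    show "convergent (\<lambda>k. D f A (v k))" if "A \<in> sets borel" "f \<in> W12 m" for A f
      using lim[OF that] by (rule convergentI)
    fix w assume a: "w \<in> CV" and b: "\<And>A f. A \<in> sets borel \<Longrightarrow> f \<in> W12 m \<Longrightarrow> (\<lambda>k. D f A (v k)) \<longlonglongrightarrow> D f A w"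
    show thesis by (rule that[OF a b])
  qed
  have "ell w = l"
    by (rule ell_eqI[OF w(1) l]) (rule LIMSEQ_unique[OF lim w(2)])
  with w(1) show ?thesis by (rule that)
qed

end

section \<open>Transport along an isometry and uniqueness\<close>

text \<open>The inverse is a parameter, so that the locale can be reversed and the construction of
  the transported measures inverted.\<close>

locale cb_iso = V: cb_module V + W: cb_module W
  for V :: "('x::polish_space, 'v) normed_cb_module" and W :: "('x, 'w) normed_cb_module" +
  fixes \<Psi> :: "'v \<Rightarrow> 'w" and \<Theta> :: "'w \<Rightarrow> 'v"
  assumes fwd: "v \<in> carrier V \<Longrightarrow> \<Psi> v \<in> carrier W" and bwd: "w \<in> carrier W \<Longrightarrow> \<Theta> w \<in> carrier V"
    and bwd_fwd: "v \<in> carrier V \<Longrightarrow> \<Theta> (\<Psi> v) = v" and fwd_bwd: "w \<in> carrier W \<Longrightarrow> \<Psi> (\<Theta> w) = w"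
    and fwd_add: "v \<in> carrier V \<Longrightarrow> v' \<in> carrier V \<Longrightarrow> \<Psi> (v \<oplus>\<^bsub>V\<^esub> v') = \<Psi> v \<oplus>\<^bsub>W\<^esub> \<Psi> v'"
    and fwd_smult: "v \<in> carrier V \<Longrightarrow> \<Psi> (f \<odot>\<^bsub>V\<^esub> v) = f \<odot>\<^bsub>W\<^esub> \<Psi> v"
    and fwd_norm: "v \<in> carrier V \<Longrightarrow> vnorm W (\<Psi> v) = vnorm V v"
begin

lemma bwd_add: "w \<in> carrier W \<Longrightarrow> w' \<in> carrier W \<Longrightarrow> \<Theta> (w \<oplus>\<^bsub>W\<^esub> w') = \<Theta> w \<oplus>\<^bsub>V\<^esub> \<Theta> w'"
  using fwd_add[OF bwd bwd, of w w'] bwd_fwd[OF V.add_CV[OF bwd bwd], of w w'] by (simp add: fwd_bwd)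

lemma bwd_smult: "w \<in> carrier W \<Longrightarrow> \<Theta> (f \<odot>\<^bsub>W\<^esub> w) = f \<odot>\<^bsub>V\<^esub> \<Theta> w"
  using fwd_smult[OF bwd, of w f] bwd_fwd[OF V.smult_CV[OF bwd], of w f] by (simp add: fwd_bwd)

lemma bwd_norm: "w \<in> carrier W \<Longrightarrow> vnorm V (\<Theta> w) = vnorm W w"
  using fwd_norm[OF bwd, of w] by (simp add: fwd_bwd)

lemma cb_iso_sym: "cb_iso W V \<Theta> \<Psi>"
proof
  show "w \<in> carrier W \<Longrightarrow> w' \<in> carrier W \<Longrightarrow> \<Theta> (w \<oplus>\<^bsub>W\<^esub> w') = \<Theta> w \<oplus>\<^bsub>V\<^esub> \<Theta> w'" for w w' by (rule bwd_add)
  show "w \<in> carrier W \<Longrightarrow> \<Theta> (f \<odot>\<^bsub>W\<^esub> w) = f \<odot>\<^bsub>V\<^esub> \<Theta> w" for f w by (rule bwd_smult)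
  show "w \<in> carrier W \<Longrightarrow> vnorm V (\<Theta> w) = vnorm W w" for w by (rule bwd_norm)
qed (simp_all add: fwd bwd bwd_fwd fwd_bwd)

lemma cb_isometry_restrict: "cb_isometry V W (restrict \<Psi> (carrier V))"
  unfolding cb_isometry_def
proof (intro conjI ballI allI)
  show "bij_betw (restrict \<Psi> (carrier V)) (carrier V) (carrier W)"
    by (rule bij_betwI[where g = \<Theta>]) (auto simp: fwd bwd bwd_fwd fwd_bwd)
qed (simp_all add: fwd_add fwd_smult fwd_norm)

text \<open>The compatibility of the pairings leaves no choice: the value of the transported measure
  at \<Psi> v is that of N at v.\<close>

definition push :: "('x set \<Rightarrow> 'v \<Rightarrow> real) \<Rightarrow> 'x set \<Rightarrow> 'w \<Rightarrow> real" where
  "push N A w = (if w \<in> carrier W then N A (\<Theta> w) else 0)"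

lemma dnorm_transport:
  assumes "\<And>w. w \<in> carrier W \<Longrightarrow> g w = f (\<Theta> w)" shows "dnorm W g = dnorm V f"
proof -
  have "{\<bar>g w\<bar> | w. w \<in> carrier W \<and> vnorm W w \<le> 1} = {\<bar>f v\<bar> | v. v \<in> carrier V \<and> vnorm V v \<le> 1}"
  proof (intro equalityI subsetI)
    fix r assume "r \<in> {\<bar>g w\<bar> | w. w \<in> carrier W \<and> vnorm W w \<le> 1}"
    then obtain w where w: "r = \<bar>g w\<bar>" "w \<in> carrier W" "vnorm W w \<le> 1" by blast
    then show "r \<in> {\<bar>f v\<bar> | v. v \<in> carrier V \<and> vnorm V v \<le> 1}"
      by (intro CollectI exI[of _ "\<Theta> w"]) (simp add: assms bwd bwd_norm)
  next
    fix r assume "r \<in> {\<bar>f v\<bar> | v. v \<in> carrier V \<and> vnorm V v \<le> 1}"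
    then obtain v where v: "r = \<bar>f v\<bar>" "v \<in> carrier V" "vnorm V v \<le> 1" by blast
    then show "r \<in> {\<bar>g w\<bar> | w. w \<in> carrier W \<and> vnorm W w \<le> 1}"
      by (intro CollectI exI[of _ "\<Psi> v"]) (simp add: assms[OF fwd] bwd_fwd fwd fwd_norm)
  qed
  then show ?thesis by (simp add: dnorm_def)
qed

lemma vdual_transport:
  assumes f: "f \<in> vdual V" shows "(\<lambda>w. if w \<in> carrier W then f (\<Theta> w) else 0) \<in> vdual W"
proof -
  note lin = V.vdual_vlin[OF f]
  show ?thesis
    unfolding W.vdual_iff
    by (intro conjI W.vlinI[where C = "dnorm V f"])
      (use V.dnorm_bound[OF lin bwd] in \<open>auto simp: bwd_add bwd_smult bwd V.vlin_add[OF lin] V.vlin_scale[OF lin] bwd_norm\<close>)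
qed

lemma vnorm_on_transport: "w \<in> carrier W \<Longrightarrow> vnorm_on V A (\<Theta> w) = vnorm_on W A w"
  unfolding vnorm_on_def by (simp add: bwd_norm flip: bwd_smult)

lemma push_lvm:
  assumes N: "local_vector_measure V N" shows "local_vector_measure W (push N)"
  unfolding local_vector_measure_def
proof (intro conjI ballI allI impI)
  show "push N A \<in> vdual W" if "A \<in> sets borel" for A
    using vdual_transport[OF V.lvm_dual[OF N that]] by (simp add: push_def[abs_def])
  show "push N A = (\<lambda>_. 0)" if "A \<notin> sets borel" for A
    by (simp add: push_def V.lvm_not_borel[OF N that] fun_eq_iff)
  show "push N A w = 0" if "w \<in> carrier W" "open A \<and> vnorm_on W A w = 0" for A w
    using that V.lvm_local[OF N bwd[OF that(1)], of A] by (simp add: push_def vnorm_on_transport)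
next
  fix A :: "nat \<Rightarrow> 'x set" assume A: "range A \<subseteq> sets borel \<and> disjoint_family A"
  have "dnorm W (\<lambda>w. (\<Sum>i<n. push N (A i) w) - push N (\<Union>i. A i) w) = dnorm V (\<lambda>v. (\<Sum>i<n. N (A i) v) - N (\<Union>i. A i) v)" for n
    by (rule dnorm_transport) (simp add: push_def)
  then show "(\<lambda>n. dnorm W (\<lambda>w. (\<Sum>i<n. push N (A i) w) - push N (\<Union>i. A i) w)) \<longlonglongrightarrow> 0"
    using V.lvm_sigma[OF N, of A] A by simp
qed

lemma push_total_variation: "total_variation W (push N) E = total_variation V N E"
proof -
  have "dnorm W (push N A) = dnorm V (N A)" for A by (rule dnorm_transport) (simp add: push_def)
  then show ?thesis by (simp add: total_variation_def)
qed

text \<open>The transported integral satisfies the estimate against nearby simple functions that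
  characterizes Bartle integrals in \<open>bartle_eq\<close>.\<close>

lemma push_bartle:
  fixes g :: "'x \<Rightarrow> real"
  assumes N: "local_vector_measure V N" and g: "g \<in> borel_measurable borel" "\<And>x. \<bar>g x\<bar> \<le> C"
  shows "push (bartle V N g) = bartle W (push N) g"
proof
  fix A
  show "push (bartle V N g) A = bartle W (push N) g A"
  proof (cases "A \<in> sets borel")
    case False
    then show ?thesis by (simp add: push_def bartle_def fun_eq_iff)
  next
    case A: True
    obtain K where K: "0 \<le> K" "\<And>A. A \<in> sets borel \<Longrightarrow> dnorm V (N A) \<le> K" by (rule V.lvm_bounded_range[OF N]) (rule that)
    have "bartle W (push N) g A = (\<lambda>w. if w \<in> carrier W then bartle V N g A (\<Theta> w) else 0)"
    proof (rule W.bartle_eq[OF push_lvm[OF N] A g vdual_transport[OF V.bartle_dual[OF N A g]]])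
      fix s r w assume "W.near s g r" and w: "w \<in> carrier W"
      then have "V.near s g r" by (simp add: V.near_def W.near_def)
      from V.bartle_estimate(2)[OF N K(2,1) A g this bwd[OF w]]
      show "\<bar>simple_bartle (push N) s A w - (if w \<in> carrier W then bartle V N g A (\<Theta> w) else 0)\<bar> \<le> r * (2 * K * vnorm W w)"
        using w by (simp add: simple_bartle_def push_def bwd_norm)
    qed (use K(1) in simp)
    then show ?thesis by (simp add: push_def[abs_def])
  qed
qed

text \<open>The \<open>push\<close> of the reversed isomorphism is the inverse. Sums and products by
  functions stay in the carrier, so the restriction does not interfere.\<close>

lemma lvm_isometry: "cb_isometry (lvm_space V) (lvm_space W) (restrict push (carrier (lvm_space V)))"
  unfolding cb_isometry_def
proof (intro conjI ballI allI)
  interpret S: cb_iso W V \<Theta> \<Psi> by (rule cb_iso_sym)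
  have sp: "S.push (push N) = N" if "local_vector_measure V N" for N
    using V.lvm_notin[OF that] by (auto simp: fun_eq_iff push_def S.push_def fwd bwd_fwd)
  have ps: "push (S.push N) = N" if "local_vector_measure W N" for N
    using W.lvm_notin[OF that] by (auto simp: fun_eq_iff push_def S.push_def bwd fwd_bwd)
  show "bij_betw (restrict push (carrier (lvm_space V))) (carrier (lvm_space V)) (carrier (lvm_space W))"
    by (rule bij_betwI[where g = S.push]) (auto simp: lvm_space_def push_lvm S.push_lvm sp ps)
  show "restrict push (carrier (lvm_space V)) \<in> extensional (carrier (lvm_space V))" by simp
  fix N assume N: "N \<in> carrier (lvm_space V)"
  then have N': "local_vector_measure V N" by (simp add: lvm_space_def)
  show "vnorm (lvm_space W) (restrict push (carrier (lvm_space V)) N) = vnorm (lvm_space V) N"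
    using N' by (simp add: lvm_space_def push_total_variation)
  show "restrict push (carrier (lvm_space V)) (g \<odot>\<^bsub>lvm_space V\<^esub> N) = g \<odot>\<^bsub>lvm_space W\<^esub> restrict push (carrier (lvm_space V)) N" for g
  proof -
    note gb = bcontfun_borel[of g]
    have "local_vector_measure V (bartle V N (apply_bcontfun g))" by (rule V.bartle_lvm[OF N' gb bcontfun_abs_le])
    then show ?thesis using N' push_bartle[OF N' gb bcontfun_abs_le] by (simp add: lvm_space_def)
  qed
  fix M assume M: "M \<in> carrier (lvm_space V)"
  then have M': "local_vector_measure V M" by (simp add: lvm_space_def)
  have "push (\<lambda>A v. N A v + M A v) = (\<lambda>A w. push N A w + push M A w)" by (simp add: fun_eq_iff push_def)
  then show "restrict push (carrier (lvm_space V)) (N \<oplus>\<^bsub>lvm_space V\<^esub> M)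
      = restrict push (carrier (lvm_space V)) N \<oplus>\<^bsub>lvm_space W\<^esub> restrict push (carrier (lvm_space V)) M"
    using N' M' V.lvm_add[OF N' M'] by (simp add: lvm_space_def)
qed

end

text \<open>Elements of the two modules are compared through their functionals, which live on the
  same cotangent module. Surjectivity defines \<Psi>, injectivity makes it a bijection linear over
  C_b, and the norm as least dominating constant makes it an isometry.\<close>

lemma (in cotangent) couple_unique:
  fixes V :: "('x, 'v) normed_cb_module" and W :: "('x, 'w) normed_cb_module"
  assumes refl: "reflexive_space TYPE('c)" and V: "differential_couple m V D" and W: "differential_couple m W E"
  shows "\<exists>!(\<Phi>, \<Psi>). cb_isometry (lvm_space V) (lvm_space W) \<Phi> \<and> cb_isometry V W \<Psi>
            \<and> (\<forall>f\<in>W12 m. \<Phi> (D f) = E f)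
            \<and> (\<forall>v\<in>carrier V. \<forall>N\<in>carrier (lvm_space V). \<forall>A\<in>sets borel. \<Phi> N A (\<Psi> v) = N A v)" (is "\<exists>!(\<Phi>, \<Psi>). ?P \<Phi> \<Psi>")
proof -
  interpret V: couple m act pn d V D
  proof unfold_locales
    show "is_normed_cb_module V" by (rule V[unfolded differential_couple_def, THEN conjunct1])
  qed (rule V)
  interpret W: couple m act pn d W E
  proof unfold_locales
    show "is_normed_cb_module W" by (rule W[unfolded differential_couple_def, THEN conjunct1])
  qed (rule W)
  have "\<exists>w. v \<in> carrier V \<longrightarrow> w \<in> carrier W \<and> W.ell w = V.ell v" for v
    by (cases "v \<in> carrier V") (auto intro: W.ell_surj[OF refl V.ell_bdf])
  then have "\<forall>v. \<exists>w. v \<in> carrier V \<longrightarrow> w \<in> carrier W \<and> W.ell w = V.ell v" ..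
  from choice[OF this] obtain \<Psi> where \<Psi>': "\<forall>v. v \<in> carrier V \<longrightarrow> \<Psi> v \<in> carrier W \<and> W.ell (\<Psi> v) = V.ell v" ..
  then have \<Psi>: "\<Psi> v \<in> carrier W" "W.ell (\<Psi> v) = V.ell v" if "v \<in> carrier V" for v using that by blast+
  have "\<exists>v. w \<in> carrier W \<longrightarrow> v \<in> carrier V \<and> V.ell v = W.ell w" for w
    by (cases "w \<in> carrier W") (auto intro: V.ell_surj[OF refl W.ell_bdf])
  then have "\<forall>w. \<exists>v. w \<in> carrier W \<longrightarrow> v \<in> carrier V \<and> V.ell v = W.ell w" ..
  from choice[OF this] obtain \<Theta> where \<Theta>': "\<forall>w. w \<in> carrier W \<longrightarrow> \<Theta> w \<in> carrier V \<and> V.ell (\<Theta> w) = W.ell w" ..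
  then have \<Theta>: "\<Theta> w \<in> carrier V" "V.ell (\<Theta> w) = W.ell w" if "w \<in> carrier W" for w using that by blast+
  interpret iso: cb_iso V W \<Psi> \<Theta>
  proof
    show "\<Psi> v \<in> carrier W" if "v \<in> carrier V" for v by (rule \<Psi>[OF that])
    show "\<Theta> w \<in> carrier V" if "w \<in> carrier W" for w by (rule \<Theta>[OF that])
    show "\<Theta> (\<Psi> v) = v" if "v \<in> carrier V" for v
      by (rule V.ell_inj) (simp_all add: \<Psi> \<Theta> that)
    show "\<Psi> (\<Theta> w) = w" if "w \<in> carrier W" for w
      by (rule W.ell_inj) (simp_all add: \<Psi> \<Theta> that)
    show "\<Psi> (v \<oplus>\<^bsub>V\<^esub> v') = \<Psi> v \<oplus>\<^bsub>W\<^esub> \<Psi> v'" if "v \<in> carrier V" "v' \<in> carrier V" for v v'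
      by (rule W.ell_inj) (simp_all add: \<Psi> that V.ell_add W.ell_add)
    show "\<Psi> (f \<odot>\<^bsub>V\<^esub> v) = f \<odot>\<^bsub>W\<^esub> \<Psi> v" if "v \<in> carrier V" for f v
      by (rule W.ell_inj) (simp_all add: \<Psi> that V.ell_smult W.ell_smult fun_eq_iff)
    show "vnorm W (\<Psi> v) = vnorm V v" if v: "v \<in> carrier V" for v
    proof (rule antisym)
      show "vnorm W (\<Psi> v) \<le> vnorm V v"
        by (rule W.nV_le_of_bdf[OF \<Psi>(1)[OF v]]) (simp_all add: \<Psi>(2)[OF v] V.ell_bdf v V.nV_nonneg)
      show "vnorm V v \<le> vnorm W (\<Psi> v)"
        using W.ell_bdf[OF \<Psi>(1)[OF v]] unfolding \<Psi>(2)[OF v]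
        by (rule V.nV_le_of_bdf[OF v _ W.nV_nonneg[OF \<Psi>(1)[OF v]]])
    qed
  qed
  define \<Phi> where "\<Phi> = restrict iso.push (carrier (lvm_space V))"
  define \<Psi>0 where "\<Psi>0 = restrict \<Psi> (carrier V)"
  have lvmV: "N \<in> carrier (lvm_space V) \<longleftrightarrow> local_vector_measure V N" for N by (simp add: lvm_space_def)
  have lvmW: "N \<in> carrier (lvm_space W) \<longleftrightarrow> local_vector_measure W N" for N by (simp add: lvm_space_def)
  have ev: "\<Phi> N A (\<Psi>0 v) = N A v" if "v \<in> carrier V" "N \<in> carrier (lvm_space V)" for v N A
    using that by (simp add: \<Phi>_def \<Psi>0_def iso.push_def \<Psi> iso.bwd_fwd)
  have DE: "\<Phi> (D f) = E f" if f: "f \<in> W12 m" for f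
  proof (intro ext)
    fix A w
    have mem: "D f \<in> carrier (lvm_space V)" unfolding lvmV by (rule V.D_lvm[OF f])
    show "\<Phi> (D f) A w = E f A w"
    proof (cases "w \<in> carrier W \<and> A \<in> sets borel")
      case True
      then have w: "w \<in> carrier W" and A: "A \<in> sets borel" by auto
      have "\<Phi> (D f) A w = D f A (\<Theta> w)" using mem w by (simp add: \<Phi>_def iso.push_def)
      also have "\<dots> = V.ell (\<Theta> w) (cut A (d f))" by (rule V.ell_cut[OF \<Theta>(1)[OF w] A f, symmetric])
      also have "\<dots> = E f A w" unfolding \<Theta>(2)[OF w] by (rule W.ell_cut[OF w A f])
      finally show ?thesis .
    next
      case False
      then show ?thesis
        using mem W.lvm_notin[OF W.D_lvm[OF f], of w A] W.lvm_not_borel[OF W.D_lvm[OF f], of A] V.lvm_not_borel[OF V.D_lvm[OF f], of A]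
        by (auto simp: \<Phi>_def iso.push_def)
    qed
  qed
  show ?thesis
  proof (rule ex1I[of _ "(\<Phi>, \<Psi>0)"])
    show "case (\<Phi>, \<Psi>0) of (\<Phi>, \<Psi>) \<Rightarrow> ?P \<Phi> \<Psi>"
      unfolding prod.case
    proof (intro conjI ballI)
      show "cb_isometry (lvm_space V) (lvm_space W) \<Phi>" unfolding \<Phi>_def by (rule iso.lvm_isometry)
      show "cb_isometry V W \<Psi>0" unfolding \<Psi>0_def by (rule iso.cb_isometry_restrict)
    qed (rule DE ev, assumption+)+
    fix p assume p: "case p of (\<Phi>, \<Psi>) \<Rightarrow> ?P \<Phi> \<Psi>"
    obtain \<Phi>' \<Psi>' where pair: "p = (\<Phi>', \<Psi>')" by (cases p)
    have \<Phi>': "\<Phi>' \<in> extensional (carrier (lvm_space V))" "bij_betw \<Phi>' (carrier (lvm_space V)) (carrier (lvm_space W))"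
      and \<Psi>': "\<Psi>' \<in> extensional (carrier V)" "bij_betw \<Psi>' (carrier V) (carrier W)"
      and DE': "\<And>f. f \<in> W12 m \<Longrightarrow> \<Phi>' (D f) = E f"
      and ev': "\<And>v N A. v \<in> carrier V \<Longrightarrow> N \<in> carrier (lvm_space V) \<Longrightarrow> A \<in> sets borel \<Longrightarrow> \<Phi>' N A (\<Psi>' v) = N A v"
      using p unfolding pair prod.case cb_isometry_def by blast+
    \<comment> \<open>Compatibility with D f and E f makes \<open>\<Psi>' v\<close> and v induce the
      same functional. Once \<Psi> is fixed, its surjectivity determines every measure
      \<open>\<Phi>' N\<close> pointwise.\<close>
    have \<Psi>eq: "\<Psi>' = \<Psi>0"
    proof (rule extensionalityI[OF \<Psi>'(1)])
      show "\<Psi>0 \<in> extensional (carrier V)" by (simp add: \<Psi>0_def)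
      fix v assume v: "v \<in> carrier V"
      have w: "\<Psi>' v \<in> carrier W" using bij_betwE[OF \<Psi>'(2)] v by blast
      have "W.ell (\<Psi>' v) = V.ell v"
      proof (rule W.ell_eqI[OF w V.ell_bdf[OF v]])
        fix A :: "'x set" and f assume A: "A \<in> sets borel" and f: "f \<in> W12 m"
        have "D f \<in> carrier (lvm_space V)" unfolding lvmV by (rule V.D_lvm[OF f])
        from ev'[OF v this A] show "V.ell v (cut A (d f)) = E f A (\<Psi>' v)"
          unfolding DE'[OF f] V.ell_cut[OF v A f] by simp
      qed
      then have "W.ell (\<Psi>' v) = W.ell (\<Psi> v)" by (simp add: \<Psi>(2)[OF v])
      then have "\<Psi>' v = \<Psi> v" by (rule W.ell_inj[OF w \<Psi>(1)[OF v]])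
      then show "\<Psi>' v = \<Psi>0 v" using v by (simp add: \<Psi>0_def)
    qed
    have "\<Phi>' = \<Phi>"
    proof (rule extensionalityI[OF \<Phi>'(1)])
      show "\<Phi> \<in> extensional (carrier (lvm_space V))" by (simp add: \<Phi>_def)
      fix N assume N: "N \<in> carrier (lvm_space V)"
      have N': "local_vector_measure W (\<Phi>' N)" using bij_betwE[OF \<Phi>'(2)] N unfolding lvmW by blast
      have M': "local_vector_measure W (\<Phi> N)"
        using N iso.push_lvm[of N] by (simp add: \<Phi>_def lvmV)
      show "\<Phi>' N = \<Phi> N"
      proof (intro ext)
        fix A w
        show "\<Phi>' N A w = \<Phi> N A w"
        proof (cases "w \<in> carrier W \<and> A \<in> sets borel")
          case True
          then have w: "w \<in> carrier W" and A: "A \<in> sets borel" by auto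
          have "\<Psi>0 (\<Theta> w) = w" using w by (simp add: \<Psi>0_def \<Theta> iso.fwd_bwd)
          then show ?thesis
            using ev'[OF \<Theta>(1)[OF w] N A] ev[OF \<Theta>(1)[OF w] N, of A] unfolding \<Psi>eq by simp
        next
          case False
          then show ?thesis
            using W.lvm_notin[OF N', of w A] W.lvm_not_borel[OF N', of A] W.lvm_notin[OF M', of w A] W.lvm_not_borel[OF M', of A] by auto
        qed
      qed
    qed
    then show "p = (\<Phi>, \<Psi>0)" by (simp add: pair \<Psi>eq)
  qed
qed

section \<open>The realization by bounded vector fields\<close>

context cotangent
begin

interpretation VF: cb_module TM
  by unfold_locales (rule normed_module_TM)

declare TM_simps(4) [simp del]

text \<open>\<open>D_tangent\<close> with an arbitrary vector u in place of the differential, so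
  that products by functions and sums of such measures are again of this form.\<close>

definition pairing_measure :: "'c \<Rightarrow> 'x set \<Rightarrow> ('c \<Rightarrow> ('x \<Rightarrow> real) set) \<Rightarrow> real" where
  "pairing_measure u A T = (if A \<in> sets borel \<and> T \<in> carrier TM then J T (cut A u) else 0)"

lemma D_tangent_eq: "D_tangent m act pn d f = pairing_measure (d f)"
  by (intro ext) (simp add: D_tangent_def pairing_measure_def J_cut TM_L2T set_lebesgue_integral_def ev_def)

lemma pairing_measure_eq: "A \<in> sets borel \<Longrightarrow> T \<in> carrier TM \<Longrightarrow> pairing_measure u A T = J T (cut A u)"
  by (simp add: pairing_measure_def)

lemma act_const_bcontfun: "act (apply_bcontfun (const_bcontfun c)) u = c *\<^sub>R u"
proof -
  have "apply_bcontfun (const_bcontfun c :: 'x \<Rightarrow>\<^sub>C real) = (\<lambda>_. c)" by (rule ext) (simp add: const_bcontfun.rep_eq)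
  then show ?thesis by (simp only: act_const)
qed

lemma pairing_measure_vlin: "VF.vlin (pairing_measure u A)"
proof (cases "A \<in> sets borel")
  case True
  show ?thesis
  proof (rule VF.vlinI[where C = "N1 (cut A u)"])
    show "pairing_measure u A (S \<oplus>\<^bsub>TM\<^esub> T) = pairing_measure u A S + pairing_measure u A T"
      if "S \<in> carrier TM" "T \<in> carrier TM" for S T
      using VF.add_CV[OF that] by (simp add: pairing_measure_eq[OF True] that J_TM_add)
    show "pairing_measure u A (vscale TM c T) = c * pairing_measure u A T" if "T \<in> carrier TM" for c T
    proof -
      have "pairing_measure u A (vscale TM c T) = J (vscale TM c T) (cut A u)"
        by (rule pairing_measure_eq[OF True VF.smult_CV[OF that]])
      also have "\<dots> = J T (act (apply_bcontfun (const_bcontfun c)) (cut A u))"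
        unfolding TM_simps(3) by (rule J_TM_smult[OF that])
      also have "\<dots> = c * J T (cut A u)" unfolding act_const_bcontfun by (simp add: linear_scale[OF linear_J[OF that]])
      finally show ?thesis by (simp add: pairing_measure_eq[OF True that])
    qed
    show "\<bar>pairing_measure u A T\<bar> \<le> N1 (cut A u) * vnorm TM T" if "T \<in> carrier TM" for T
      using J_le[OF that, of "cut A u"] by (simp add: pairing_measure_eq[OF True that] mult.commute)
  qed
next
  case False
  then have "pairing_measure u A = (\<lambda>_. 0)" by (simp add: pairing_measure_def fun_eq_iff)
  then show ?thesis by (simp add: VF.vlin_0)
qed

text \<open>A norming functional for the cut vector is represented by a field in the unit ball, so
  the dual norm is attained.\<close>

lemma dnorm_pairing_measure:
  assumes A: "A \<in> sets borel" shows "dnorm TM (pairing_measure u A) = N1 (cut A u)"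
proof (rule antisym)
  show "dnorm TM (pairing_measure u A) \<le> N1 (cut A u)"
  proof (rule VF.dnorm_le)
    show "\<bar>pairing_measure u A T\<bar> \<le> N1 (cut A u) * vnorm TM T" if "T \<in> carrier TM" for T
      using J_le[OF that, of "cut A u"] by (simp add: pairing_measure_eq[OF A that] mult.commute)
  qed simp
  obtain l where l: "bdf 1 l" "l (cut A u) = N1 (cut A u)" by (rule bdf_norming)
  obtain T where T: "T \<in> carrier TM" "J T = l" "vnorm TM T \<le> 1" by (rule bdf_representation[OF l(1)]) auto
  show "N1 (cut A u) \<le> dnorm TM (pairing_measure u A)"
    using VF.dnorm_upper[OF pairing_measure_vlin T(1,3), of u A] unfolding pairing_measure_eq[OF A T(1)] T(2) l(2) by simp
qed

text \<open>By additivity of \<open>N1\<close> every partition of E gives the same sum, so one block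
  suffices for the lower bound; the empty set has no such partition but value 0.\<close>

lemma total_variation_pairing_measure:
  assumes E: "E \<in> sets borel" shows "total_variation TM (pairing_measure u) E = ennreal (N1 (cut E u))"
proof (rule antisym)
  show "total_variation TM (pairing_measure u) E \<le> ennreal (N1 (cut E u))"
    unfolding total_variation_def
  proof (rule SUP_least)
    fix P assume "P \<in> {P. finite P \<and> partition_on E P \<and> P \<subseteq> sets borel}"
    then have P: "finite P" "P \<subseteq> sets borel" "disjoint P" "\<Union>P = E" by (auto simp: partition_on_def)
    have "(\<Sum>A\<in>P. ennreal (dnorm TM (pairing_measure u A))) = (\<Sum>A\<in>P. ennreal (N1 (cut A u)))"
      by (rule sum.cong) (use P(2) in \<open>auto simp: dnorm_pairing_measure\<close>)
    also have "\<dots> = ennreal (\<Sum>A\<in>P. N1 (cut A u))" by (rule sum_ennreal) simp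
    also have "(\<Sum>A\<in>P. N1 (cut A u)) = N1 (cut (\<Union>A\<in>P. A) u)"
      by (rule N1_cut_UN[symmetric]) (use P in \<open>auto simp: disjoint_family_on_def disjoint_def\<close>)
    finally show "(\<Sum>A\<in>P. ennreal (dnorm TM (pairing_measure u A))) \<le> ennreal (N1 (cut E u))" using P(4) by simp
  qed
  show "ennreal (N1 (cut E u)) \<le> total_variation TM (pairing_measure u) E"
  proof (cases "E = {}")
    case False
    then show ?thesis using VF.dnorm_le_total_variation[OF E, of "pairing_measure u"] by (simp add: dnorm_pairing_measure[OF E])
  qed simp
qed

text \<open>A cutoff f supported in U annihilates T, and f u approximates the cut of u to U when f
  is 1 on a large compact subset.\<close>

lemma pairing_measure_local:
  assumes U: "open U" and T: "T \<in> carrier TM" and z: "vnorm_on TM U T = 0"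
  shows "pairing_measure u U T = 0"
proof -
  have Ub: "U \<in> sets borel" using U by simp
  have "J T (cut U u) = 0"
  proof (rule real_eq_of_small)
    fix e :: real assume "e > 0"
    obtain K where K: "compact K" "K \<subseteq> U" "K \<in> sets borel" "N1 (cut (U - K) u) < e"
      by (rule compact_approx_N1[OF Ub \<open>e > 0\<close>])
    have "closed (- U)" "K \<inter> - U = {}" using U K(2) by auto
    then obtain f :: "'x \<Rightarrow>\<^sub>C real" where f: "\<And>x. 0 \<le> apply_bcontfun f x" "\<And>x. apply_bcontfun f x \<le> 1" "norm f \<le> 1"
      "\<And>x. x \<in> K \<Longrightarrow> apply_bcontfun f x = 1" "supp f \<inter> - U = {}" "\<And>x. x \<in> - U \<Longrightarrow> apply_bcontfun f x = 0"
      by (rule bump_between[OF K(1)]) (rule that)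
    have sU: "supp f \<subseteq> U" using f(5) by blast
    have "f \<odot>\<^bsub>TM\<^esub> T = \<zero>\<^bsub>TM\<^esub>" by (rule VF.vnorm_on_0D[OF T z sU f(3)])
    then have "J T (act (apply_bcontfun f) u) = J (tan_zero m) u"
      using J_TM_smult[OF T, of f u] by simp
    then have 0: "J T (act (apply_bcontfun f) u) = 0" by (simp add: J_tan_zero)
    have "\<bar>J T (cut U u) - 0\<bar> = \<bar>J T (cut U u - act (apply_bcontfun f) u)\<bar>"
      by (simp add: linear_diff[OF linear_J[OF T]] 0)
    also have "\<dots> \<le> vnorm TM T * N1 (cut U u - act (apply_bcontfun f) u)" by (rule J_le[OF T])
    \<comment> \<open>The cutoff vanishes on the whole complement of U, so the second error term is
      a cut to the empty set.\<close>
    also have "\<dots> \<le> vnorm TM T * (N1 (cut (U - K) u) + N1 (cut (- U - (- U)) u))"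
      by (intro mult_left_mono N1_cut_minus_act Ub K borel_comp f(1,2,4,6) VF.nV_nonneg[OF T]) simp_all
    also have "\<dots> \<le> vnorm TM T * e" using K(4) by (intro mult_left_mono VF.nV_nonneg[OF T]) simp
    finally show "\<bar>J T (cut U u) - 0\<bar> \<le> e * vnorm TM T" by (simp add: mult.commute)
  qed
  then show ?thesis by (simp add: pairing_measure_def)
qed

lemma pairing_measure_lvm: "local_vector_measure TM (pairing_measure u)"
  unfolding local_vector_measure_def
proof (intro conjI ballI allI impI)
  show "pairing_measure u A \<in> vdual TM" for A
    unfolding VF.vdual_iff using pairing_measure_vlin by (simp add: pairing_measure_def)
  show "pairing_measure u A = (\<lambda>_. 0)" if "A \<notin> sets borel" for A
    using that by (simp add: pairing_measure_def fun_eq_iff)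
  show "pairing_measure u A T = 0" if "T \<in> carrier TM" "open A \<and> vnorm_on TM A T = 0" for A T
    using pairing_measure_local that by blast
next
  fix A :: "nat \<Rightarrow> 'x set" assume A: "range A \<subseteq> sets borel \<and> disjoint_family A"
  have A': "A i \<in> sets borel" for i using A by blast
  define R where "R n = (\<Union>i. A i) - (\<Union>i<n. A i)" for n
  have R: "R n \<in> sets borel" for n unfolding R_def using A' by (auto intro!: sets.countable_UN)
  have tail: "(\<lambda>T. (\<Sum>i<n. pairing_measure u (A i) T) - pairing_measure u (\<Union>i. A i) T) = (\<lambda>T. - pairing_measure u (R n) T)" for n
  proof
    fix T
    have add: "pairing_measure u (B \<union> C) T = pairing_measure u B T + pairing_measure u C T"
      if "B \<in> sets borel" "C \<in> sets borel" "B \<inter> C = {}" for B C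
      using that sets.Un[OF that(1,2)]
      by (cases "T \<in> carrier TM") (simp_all add: pairing_measure_def cut_Un linear_add[OF linear_J])
    show "(\<Sum>i<n. pairing_measure u (A i) T) - pairing_measure u (\<Union>i. A i) T = - pairing_measure u (R n) T"
      unfolding R_def by (rule VF.additive_tail[OF add A' conjunct2[OF A]])
  qed
  have "dnorm TM (\<lambda>T. - pairing_measure u (R n) T) = N1 (cut (R n) u)" for n
    using dnorm_pairing_measure[OF R, of u n] by (simp add: dnorm_def)
  then show "(\<lambda>n. dnorm TM (\<lambda>T. (\<Sum>i<n. pairing_measure u (A i) T) - pairing_measure u (\<Union>i. A i) T)) \<longlonglongrightarrow> 0"
    unfolding tail using N1_cut_tail[OF conjunct1[OF A], of u] by (simp add: R_def)
qed

lemma bartle_pairing_measure: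
  fixes g :: "'x \<Rightarrow>\<^sub>C real"
  shows "bartle TM (pairing_measure u) (apply_bcontfun g) = pairing_measure (act (apply_bcontfun g) u)"
proof (intro ext)
  fix A T
  show "bartle TM (pairing_measure u) (apply_bcontfun g) A T = pairing_measure (act (apply_bcontfun g) u) A T"
  proof (cases "A \<in> sets borel \<and> T \<in> carrier TM")
    case True
    then have A: "A \<in> sets borel" and T: "T \<in> carrier TM" by auto
    show ?thesis unfolding pairing_measure_eq[OF A T]
      by (rule bartle_functional[OF normed_module_TM pairing_measure_lvm T J_bdf_vnorm[OF T] _ A bcontfun_borel bcontfun_abs_le])
        (simp add: pairing_measure_eq T)
  next
    case False
    then show ?thesis
      using VF.lvm_notin[OF VF.bartle_lvm[OF pairing_measure_lvm bcontfun_borel bcontfun_abs_le], of T u g A]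
      by (auto simp: pairing_measure_def bartle_def)
  qed
qed

lemma generated_tangent:
  "generated_module m TM (D_tangent m act pn d) = pairing_measure ` cb_comb"
proof -
  have sum: "(\<lambda>A v. \<Sum>i<n. pairing_measure (h i) A v) = pairing_measure (\<Sum>i<n. h i)" for n :: nat and h
    by (auto simp: fun_eq_iff pairing_measure_def linear_sum[OF linear_cut] linear_sum[OF linear_J])
  show ?thesis
    unfolding generated_module_def cb_comb_def D_tangent_eq bartle_pairing_measure sum by blast
qed

text \<open>Homogeneity extends the bound from the \<open>N1\<close>-unit ball to all of
  \<open>cb_comb\<close>; there vectors with \<open>N1\<close> equal to 0 are covered by the a
  priori bound of \<open>J_le\<close>. Density in \<open>N1\<close> does the rest, using the same a
  priori bound.\<close>

lemma J_le_on_cb_comb: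
  assumes T: "T \<in> carrier TM" and le: "\<And>u. u \<in> cb_comb \<Longrightarrow> N1 u \<le> 1 \<Longrightarrow> J T u \<le> C" and "0 \<le> C"
  shows "bdf C (J T)"
proof -
  note lin = linear_J[OF T]
  have cb: "\<bar>J T u\<bar> \<le> C * N1 u" if u: "u \<in> cb_comb" for u
  proof (cases "N1 u = 0")
    case True
    then show ?thesis using J_le[OF T, of u] by simp
  next
    case False
    then have pos: "0 < N1 u" using N1_nonneg[of u] by linarith
    have c: "c * J T u \<le> C" if "\<bar>c\<bar> = 1 / N1 u" for c
    proof -
      have "N1 (c *\<^sub>R u) \<le> 1" unfolding N1_scale that using pos by simp
      from le[OF subspace_scale[OF subspace_cb_comb u] this] show ?thesis by (simp add: linear_scale[OF lin])
    qed
    have "J T u / N1 u \<le> C" "(- J T u) / N1 u \<le> C" using c[of "1 / N1 u"] c[of "- 1 / N1 u"] pos by simp_all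
    then show ?thesis unfolding pos_divide_le_eq[OF pos] by (simp add: abs_le_iff)
  qed
  have "\<bar>J T u\<bar> \<le> C * N1 u" for u
  proof (rule field_le_epsilon)
    fix e :: real assume "e > 0"
    define k where "k = vnorm TM T + C + 1"
    have k: "k > 0" unfolding k_def using VF.nV_nonneg[OF T] \<open>0 \<le> C\<close> by linarith
    then have "e / k > 0" using \<open>e > 0\<close> by simp
    then obtain w where w: "w \<in> cb_comb" "N1 (u - w) < e / k" by (rule cb_comb_dense)
    have "J T u = J T w + J T (u - w)" by (simp add: linear_diff[OF lin])
    then have "\<bar>J T u\<bar> \<le> C * N1 w + vnorm TM T * N1 (u - w)" using cb[OF w(1)] J_le[OF T, of "u - w"] by linarith
    also have "C * N1 w \<le> C * (N1 u + N1 (u - w))"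
      using N1_triangle[of u "w - u"] N1_diff_commute[of w u] \<open>0 \<le> C\<close> by (intro mult_left_mono) simp_all
    finally have "\<bar>J T u\<bar> \<le> C * N1 u + (vnorm TM T + C) * N1 (u - w)" by (simp add: algebra_simps)
    also have "(vnorm TM T + C) * N1 (u - w) \<le> k * N1 (u - w)" unfolding k_def by (intro mult_right_mono) simp_all
    also have "k * N1 (u - w) \<le> e" using w(2) k by (simp add: pos_less_divide_eq mult.commute less_imp_le)
    finally show "\<bar>J T u\<bar> \<le> C * N1 u + e" by simp
  qed
  then show ?thesis using lin by (simp add: bdf_def)
qed

text \<open>Condition (ii) for the realization: the competitors are the pairings with vectors of
  \<open>cb_comb\<close> in the \<open>N1\<close>-unit ball, and their supremum dominates
  \<open>J T\<close>.\<close>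

lemma vnorm_tangent_eq_SUP:
  assumes T: "T \<in> carrier TM"
  shows "vnorm TM T = (SUP N \<in> {N \<in> generated_module m TM (D_tangent m act pn d). total_variation TM N UNIV \<le> 1}. N UNIV T)"
proof -
  define S where "S = {u \<in> cb_comb. N1 u \<le> 1}"
  have "{N \<in> generated_module m TM (D_tangent m act pn d). total_variation TM N UNIV \<le> 1} = pairing_measure ` S"
    unfolding generated_tangent S_def by (auto simp: total_variation_pairing_measure)
  then have "(SUP N \<in> {N \<in> generated_module m TM (D_tangent m act pn d). total_variation TM N UNIV \<le> 1}. N UNIV T)
      = (SUP u\<in>S. J T u)"
    by (simp add: image_image pairing_measure_eq[OF _ T])
  moreover have "vnorm TM T = (SUP u\<in>S. J T u)"
  proof (rule antisym)
    have le: "J T u \<le> vnorm TM T" if "u \<in> S" for u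
    proof -
      have "vnorm TM T * N1 u \<le> vnorm TM T * 1" using that by (intro mult_left_mono VF.nV_nonneg[OF T]) (simp add: S_def)
      then show ?thesis using J_le[OF T, of u] by linarith
    qed
    have S0: "0 \<in> S" unfolding S_def using subspace_0[OF subspace_cb_comb] by simp
    have bdd: "bdd_above (J T ` S)" using le by (intro bdd_aboveI[of _ "vnorm TM T"]) blast
    show "(SUP u\<in>S. J T u) \<le> vnorm TM T" using S0 le by (intro cSUP_least) blast+
    have up: "J T u \<le> (SUP u\<in>S. J T u)" if "u \<in> S" for u using that bdd by (rule cSUP_upper)
    have nn: "0 \<le> (SUP u\<in>S. J T u)" using up[OF S0] linear_0[OF linear_J[OF T]] by simp
    have "bdf (SUP u\<in>S. J T u) (J T)"
      by (rule J_le_on_cb_comb[OF T _ nn]) (rule up, simp add: S_def)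
    then show "vnorm TM T \<le> (SUP u\<in>S. J T u)" by (rule vnorm_le_of_bdf(2)[OF TM_L2T[OF T] _ nn])
  qed
  ultimately show ?thesis by simp
qed

text \<open>Under the uniform bound C \<open>N1\<close>, the vectors on which the functionals
  converge form a closed subspace, hence everything. The limit obeys the same bound and is
  represented by a field.\<close>

lemma tangent_closed:
  assumes T: "\<And>k::nat. T k \<in> carrier TM" and C: "\<And>k. vnorm TM (T k) \<le> C"
    and conv: "\<And>A f. A \<in> sets borel \<Longrightarrow> f \<in> W12 m \<Longrightarrow> convergent (\<lambda>k. J (T k) (cut A (d f)))"
  obtains S where "S \<in> carrier TM" "\<And>u. (\<lambda>k. J (T k) u) \<longlonglongrightarrow> J S u"
proof -
  note lin = linear_J[OF T]
  have C0: "0 \<le> C" using VF.nV_nonneg[OF T, of 0] C[of 0] by linarith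
  have bd: "\<bar>J (T k) u\<bar> \<le> C * N1 u" for k u
    using J_le[OF T, of k u] mult_right_mono[OF C[of k] N1_nonneg[of u]] by linarith
  define Q where "Q = {u. convergent (\<lambda>k. J (T k) u)}"
  have "u \<in> Q" for u
  proof (rule cut_d_dense)
    show "subspace Q"
      unfolding subspace_def Q_def
      by (auto simp: linear_0[OF lin] linear_add[OF lin] linear_scale[OF lin] convergent_const
          intro!: convergent_add convergent_mult)
    have "u \<in> Q" if cl: "u \<in> closure Q" for u
      unfolding Q_def mem_Collect_eq
    proof (rule Cauchy_convergent, rule metric_CauchyI)
      fix e :: real assume "e > 0"
      have e3: "e / (3 * (C + 1)) > 0" using \<open>e > 0\<close> C0 by simp
      obtain h where h: "h \<in> Q" "N1 (u - h) < e / (3 * (C + 1))" by (rule N1_closure_approx[OF cl e3])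
      have near: "\<bar>J (T n) u - J (T n) h\<bar> < e / 3" for n
      proof -
        have "\<bar>J (T n) u - J (T n) h\<bar> = \<bar>J (T n) (u - h)\<bar>" by (simp add: linear_diff[OF lin])
        also have "\<dots> \<le> C * N1 (u - h)" by (rule bd)
        also have "\<dots> \<le> (C + 1) * N1 (u - h)" by (intro mult_right_mono) simp_all
        also have "\<dots> < e / 3" using h(2) C0 by (simp add: pos_less_divide_eq algebra_simps)
        finally show ?thesis .
      qed
      have "Cauchy (\<lambda>k. J (T k) h)" using h(1) unfolding Q_def by (simp add: convergent_Cauchy)
      then obtain M where M: "\<forall>i\<ge>M. \<forall>j\<ge>M. dist (J (T i) h) (J (T j) h) < e / 3"
        using metric_CauchyD[of _ "e / 3"] \<open>e > 0\<close> by (metis divide_pos_pos zero_less_numeral)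
      have "dist (J (T i) u) (J (T j) u) < e" if "i \<ge> M" "j \<ge> M" for i j
      proof -
        have "\<bar>J (T i) h - J (T j) h\<bar> < e / 3" using M that by (simp add: dist_real_def)
        then show ?thesis using near[of i] near[of j] unfolding dist_real_def by linarith
      qed
      then show "\<exists>M. \<forall>i\<ge>M. \<forall>j\<ge>M. dist (J (T i) u) (J (T j) u) < e" by blast
    qed
    then show "closed Q" by (metis closure_subset closure_closed closed_closure subsetI subset_antisym)
    show "cut A (d f) \<in> Q" if "A \<in> sets borel" "f \<in> W12 m" for A f using conv[OF that] by (simp add: Q_def)
  qed
  then have lim: "(\<lambda>k. J (T k) u) \<longlonglongrightarrow> lim (\<lambda>k. J (T k) u)" for u unfolding Q_def by (simp add: convergent_LIMSEQ_iff)
  define l where "l u = lim (\<lambda>k. J (T k) u)" for u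
  note lim = lim[folded l_def]
  have "bdf C l"
    unfolding bdf_def
  proof (intro conjI allI)
    show "linear l"
    proof (rule linearI)
      show "l (u + h) = l u + l h" for u h
        using LIMSEQ_unique[OF lim[of "u + h"]] tendsto_add[OF lim[of u] lim[of h]] by (simp add: linear_add[OF lin])
      show "l (c *\<^sub>R u) = c *\<^sub>R l u" for c u
        using LIMSEQ_unique[OF lim[of "c *\<^sub>R u"]] tendsto_mult[OF tendsto_const lim[of u], of c] by (simp add: linear_scale[OF lin])
    qed
    show "\<bar>l u\<bar> \<le> C * N1 u" for u
      using tendsto_rabs[OF lim[of u]] by (rule LIMSEQ_le_const2) (use bd in blast)
  qed
  then obtain S where S: "S \<in> carrier TM" "J S = l" by (rule bdf_representation[OF _ C0])
  show ?thesis by (rule that[OF S(1)]) (simp add: S(2) lim)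
qed

theorem tangent_couple: "differential_couple m TM (D_tangent m act pn d)"
  unfolding differential_couple_def
proof (intro conjI)
  show "is_normed_cb_module TM" by (rule normed_module_TM)
  show "linear_into_lvm m TM (D_tangent m act pn d)"
    unfolding linear_into_lvm_def D_tangent_eq
  proof (intro conjI ballI allI impI)
    show "local_vector_measure TM (pairing_measure (d f))" for f by (rule pairing_measure_lvm)
    show "pairing_measure (d f) = pairing_measure (d g)" if "f \<in> W12 m" "g \<in> W12 m" "AE x in m. f x = g x" for f g
      using d_cong[OF that] by simp
    show "pairing_measure (d (\<lambda>x. f x + g x)) = (\<lambda>A v. pairing_measure (d f) A v + pairing_measure (d g) A v)"
      if "f \<in> W12 m" "g \<in> W12 m" for f g
      unfolding d_add[OF that] by (auto simp: fun_eq_iff pairing_measure_def linear_add[OF linear_cut] linear_add[OF linear_J])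
    show "pairing_measure (d (\<lambda>x. c * f x)) = (\<lambda>A v. c * pairing_measure (d f) A v)" if "f \<in> W12 m" for c f
      unfolding d_scale[OF that] by (auto simp: fun_eq_iff pairing_measure_def linear_scale[OF linear_cut] linear_scale[OF linear_J])
  qed
  show "\<forall>f\<in>W12 m. \<exists>G. minimal_relaxed_slope m f G \<and>
      (\<forall>E\<in>sets borel. total_variation TM (D_tangent m act pn d f) E = (\<integral>\<^sup>+ x\<in>E. ennreal (G x) \<partial>m))"
  proof
    fix f assume f: "f \<in> W12 m"
    show "\<exists>G. minimal_relaxed_slope m f G \<and>
      (\<forall>E\<in>sets borel. total_variation TM (D_tangent m act pn d f) E = (\<integral>\<^sup>+ x\<in>E. ennreal (G x) \<partial>m))"
      by (intro exI[of _ "pn (d f)"] conjI ballI d_slope[OF f]) (simp add: D_tangent_eq total_variation_pairing_measure nn_integral_pn)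
  qed
  show "\<forall>v\<in>carrier TM. vnorm TM v =
      (SUP N \<in> {N \<in> generated_module m TM (D_tangent m act pn d). total_variation TM N UNIV \<le> 1}. N UNIV v)"
    using vnorm_tangent_eq_SUP by blast
  show "\<forall>v :: nat \<Rightarrow> 'c \<Rightarrow> ('x \<Rightarrow> real) set. (\<forall>k. v k \<in> carrier TM) \<and> (\<exists>C. \<forall>k. vnorm TM (v k) \<le> C)
          \<and> (\<forall>A\<in>sets borel. \<forall>f\<in>W12 m. convergent (\<lambda>k. D_tangent m act pn d f A (v k)))
        \<longrightarrow> (\<exists>w\<in>carrier TM. \<forall>A\<in>sets borel. \<forall>f\<in>W12 m.
              (\<lambda>k. D_tangent m act pn d f A (v k)) \<longlonglongrightarrow> D_tangent m act pn d f A w)"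
  proof (intro allI impI)
    fix v :: "nat \<Rightarrow> 'c \<Rightarrow> ('x \<Rightarrow> real) set"
    assume v: "(\<forall>k. v k \<in> carrier TM) \<and> (\<exists>C. \<forall>k. vnorm TM (v k) \<le> C)
          \<and> (\<forall>A\<in>sets borel. \<forall>f\<in>W12 m. convergent (\<lambda>k. D_tangent m act pn d f A (v k)))"
    then obtain C where C: "\<And>k. vnorm TM (v k) \<le> C" by blast
    have vC: "v k \<in> carrier TM" for k using v by blast
    have conv: "convergent (\<lambda>k. J (v k) (cut A (d f)))" if "A \<in> sets borel" "f \<in> W12 m" for A f
      using v[THEN conjunct2, THEN conjunct2, THEN bspec, OF that(1), THEN bspec, OF that(2)]
      by (simp add: D_tangent_eq pairing_measure_eq[OF that(1) vC])
    obtain S where S: "S \<in> carrier TM" "\<And>u. (\<lambda>k. J (v k) u) \<longlonglongrightarrow> J S u"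
    proof (rule tangent_closed[of v, OF vC C])
      show "convergent (\<lambda>k. J (v k) (cut A (d f)))" if "A \<in> sets borel" "f \<in> W12 m" for A f by (rule conv[OF that])
    qed (rule that)
    show "\<exists>w\<in>carrier TM. \<forall>A\<in>sets borel. \<forall>f\<in>W12 m.
              (\<lambda>k. D_tangent m act pn d f A (v k)) \<longlonglongrightarrow> D_tangent m act pn d f A w"
      by (intro bexI[OF _ S(1)] ballI) (simp add: D_tangent_eq pairing_measure_eq vC S)
  qed
qed

end

text \<open>The existence claim is typed by the realization that witnesses it, while uniqueness
  compares couples over arbitrary types. The last two conjuncts say that \<open>LinfT\<close>, with
  its pointwise norm, is the set of elements of the L^0 completion whose pointwise norm is
  bounded.\<close>

theorem theorem1p43:
  fixes m :: "'x::polish_space measure"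
    and act :: "('x \<Rightarrow> real) \<Rightarrow> 'c::banach \<Rightarrow> 'c"
    and pn :: "'c \<Rightarrow> 'x \<Rightarrow> real"
    and d :: "('x \<Rightarrow> real) \<Rightarrow> 'c"
  assumes "metric_measure_space m"
    and "emeasure m UNIV < \<infinity>"
    and "cotangent_module m act pn d"
    and "reflexive_space TYPE('c)"
  shows "(\<exists>(V :: ('x, 'c \<Rightarrow> ('x \<Rightarrow> real) set) normed_cb_module) D. differential_couple m V D)
    \<and> (\<forall>(V :: ('x, 'v) normed_cb_module) D (W :: ('x, 'w) normed_cb_module) E.
         differential_couple m V D \<and> differential_couple m W E \<longrightarrow>
         (\<exists>!(\<Phi>, \<Psi>). cb_isometry (lvm_space V) (lvm_space W) \<Phi> \<and> cb_isometry V W \<Psi>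
            \<and> (\<forall>f\<in>W12 m. \<Phi> (D f) = E f)
            \<and> (\<forall>v\<in>carrier V. \<forall>N\<in>carrier (lvm_space V). \<forall>A\<in>sets borel. \<Phi> N A (\<Psi> v) = N A v)))
    \<and> differential_couple m (LinfT m act pn) (D_tangent m act pn d)
    \<and> bij_betw (L0_embed m act pn) (carrier (LinfT m act pn))
        {\<xi> \<in> L0T m act pn. \<exists>h\<in>Linf m. is_L0_pnorm m pn \<xi> h}
    \<and> (\<forall>T \<in> carrier (LinfT m act pn). \<forall>h.
         is_L0_pnorm m pn (L0_embed m act pn T) h \<longleftrightarrow> is_dual_pnorm m pn T h)"
proof -
  have sets: "sets m = sets borel" using assms(1) by (simp add: metric_measure_space_def)
  have space: "space m = UNIV" using sets_eq_imp_space_eq[OF sets] by simp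
  interpret finite_measure m by (rule finite_measureI) (use assms(2) space in simp)
  interpret cotangent m act pn d by unfold_locales (rule sets assms(3))+
  show ?thesis
    by (intro conjI exI allI impI ballI tangent_couple bij_betw_L0_embed is_L0_pnorm_embed TM_L2T couple_unique[OF assms(4)])
      (rule tangent_couple | assumption | elim conjE)+
qed

end
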